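(* Fix the domain $[0,1]^d$, let $p\ge1$, let $\mathsf{dist}$ be the normalized $\ell_p$ metric, and let $\epsilon,\delta\in(0,1)$. Then there is a $(\mathcal{CV}_\delta,\mathcal B_\delta,\epsilon/16)$-diameter-guarded $\epsilon$-tester for uniformity of distributions on $[0,1]^d$ under $\mathsf{EMD}_{\mathsf{dist}}$ using at most $m(\epsilon)=2^{O(d)}\cdot\widetilde O(\epsilon^{-\max\{2,\frac d2\}})$ samples and $q(\epsilon)=2^{O(d)}\cdot\widetilde O\!\left(\epsilon^{-\max\{2,\frac d2\}}\log^2(1/\delta)\right)$ queries; and there is a $(\mathcal{CV}_\delta,\mathcal B_\delta,\epsilon/16)$-diameter-guarded $\epsilon$-tester for equivalence of distributions under $\mathsf{EMD}_{\mathsf{dist}}$ using at most $m(\epsilon)=2^{O(d)}\cdot\widetilde O(\epsilon^{-\max\{2,\frac{2d}{3}\}})$ samples and $q(\epsilon)=O\!\left(\frac1\epsilon\cdot d^3\log^2(\frac d\delta)\log(\frac d\epsilon)\right)$ queries. Here $\widetilde O(\cdot)$ hides polylogarithmic factors in $1/\epsilon$.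
   Context: Input distributions on $[0,1]^d$ are assumed absolutely continuous with respect to Lebesgue measure. The normalized $\ell_p$ metric on $[0,1]^d$ is $\mathsf{dist}(x,y)=\|x-y\|_p/d^{1/p}$; $\mathsf{EMD}_{\mathsf{dist}}(\mu,\nu)=\inf_\pi\mathbb{E}_{(x,y)\sim\pi}[\mathsf{dist}(x,y)]$ over couplings $\pi$. A clustering is a pair $(\Gamma,\mathsf{rep})$ with $\Gamma=\{\Gamma_1,\dots,\Gamma_k\}$ a partition into finitely many cells and $\mathsf{rep}(i)\in\Gamma_i$; $\gamma(x)$ is the index of the cell containing $x$. The clustered-sample oracle for $\mu$ returns independent samples $\mathsf{rep}(\gamma(x))$, $x\sim\mu$; the label oracle on query $x$ returns $\mathsf{rep}(\gamma(x))$. $\mathbb B(x,\delta)$ is the Euclidean ball of radius $\delta$ about $x$. $\mathcal{CV}_\delta$ is the class of clusterings of $[0,1]^d$ such that each cell $\Gamma_i$ with representative $r_i$ is Lebesgue measurable, satisfies $S\subseteq\Gamma_i\subseteq\overline S$ for some open convex set $S$, and contains $\mathbb B(r_i,\delta)$. A Lebesgue measurable set $B$ is an axis-aligned box if $\mathrm{int}\,B'\subseteq B\subseteq B'$ for some closed box $B'=\{x: a_i\le x_i\le b_i\}$; $\mathcal B_\delta$ is the subclass of $\mathcal{CV}_\delta$ whose cells are axis-aligned boxes. Let $c=\frac1{384\ln 24}$. An algorithm is a $(\mathcal U,\mathcal G,\Delta)$-diameter-guarded $\epsilon$-tester for uniformity if it outputs ACCEPT, REJECT or CLUSTER-REJECT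 and, for every input $((\Gamma,\mathsf{rep}),\mu)$ with $(\Gamma,\mathsf{rep})\in\mathcal U$: (1) if $(\Gamma,\mathsf{rep})\in\mathcal G$ and $\Pr_{x\sim\mu}[\mathrm{diam}_{\mathsf{dist}}(\Gamma_{\gamma(x)})>\Delta]\le c\epsilon$, it outputs CLUSTER-REJECT with probability at most $1/6$; (2) if $\mu$ is uniform on $[0,1]^d$ it outputs ACCEPT or CLUSTER-REJECT with probability at least $5/6$; (3) if $\mathsf{EMD}_{\mathsf{dist}}(\mu,\text{uniform})>\epsilon$ it outputs REJECT or CLUSTER-REJECT with probability at least $5/6$. For equivalence testing there are two unknown distributions $\mu,\nu$ accessed via their own clustered-sample oracles under the same clustering; (1) applies when $(\Gamma,\mathsf{rep})\in\mathcal G$ and both $\mu,\nu$ satisfy the diameter condition, (2) when $\mu=\nu$, (3) when $\mathsf{EMD}_{\mathsf{dist}}(\mu,\nu)>\epsilon$.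
   Formalization: In the equivalence query bound the factor log(d/ε) is read as 1 + ln(d/ε), since for d = 1 and ε close to 1 the literal bound would allow no queries and the claim would fail; for d/ε ≥ 2 the two agree up to a constant. *)

theory Defs
  imports "HOL-Probability.Probability"
begin

text \<open>
  The dimension \<open>d\<close> has to be an ordinary variable, because the constants hidden in the
  complexity bounds must not depend on it. A point of \<open>\<real>\<^sup>d\<close> is therefore an extensional function on
  \<open>{..<d}\<close>, as in the space of the product measure \<^const>\<open>PiM\<close>.
\<close>

type_synonym point = "nat \<Rightarrow> real"

definition cube :: "nat \<Rightarrow> point set" where
  "cube d = {..<d} \<rightarrow>\<^sub>E {0..1}"

definition lebesgue_d :: "nat \<Rightarrow> point measure" where
  "lebesgue_d d = completion (\<Pi>\<^sub>M i\<in>{..<d}. lborel)"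

text \<open>Lebesgue measure on the unit cube is already normalized.\<close>

definition uniform_cube :: "nat \<Rightarrow> point measure" where
  "uniform_cube d = restrict_space (lebesgue_d d) (cube d)"

text \<open>
  Since cells are Lebesgue measurable and not necessarily Borel, distributions live on the Lebesgue
  \<open>\<sigma>\<close>-algebra; an absolutely continuous Borel distribution extends to it uniquely.
\<close>

definition input_distribution :: "nat \<Rightarrow> point measure \<Rightarrow> bool" where
  "input_distribution d \<mu> \<longleftrightarrow>
     prob_space \<mu> \<and> sets \<mu> = sets (uniform_cube d) \<and> absolutely_continuous (uniform_cube d) \<mu>"

definition lp_dist :: "nat \<Rightarrow> real \<Rightarrow> point \<Rightarrow> point \<Rightarrow> real" where
  "lp_dist d p x y = (\<Sum>i<d. \<bar>x i - y i\<bar> powr p) powr (1 / p) / real d powr (1 / p)"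

definition lp_diam :: "nat \<Rightarrow> real \<Rightarrow> point set \<Rightarrow> real" where
  "lp_diam d p A = (SUP (x, y)\<in>A \<times> A. lp_dist d p x y)"

definition couplings :: "'a measure \<Rightarrow> 'b measure \<Rightarrow> ('a \<times> 'b) measure set" where
  "couplings \<mu> \<nu> =
     {\<pi>. sets \<pi> = sets (\<mu> \<Otimes>\<^sub>M \<nu>) \<and> distr \<pi> \<mu> fst = \<mu> \<and> distr \<pi> \<nu> snd = \<nu>}"

definition EMD :: "nat \<Rightarrow> real \<Rightarrow> point measure \<Rightarrow> point measure \<Rightarrow> real" where
  "EMD d p \<mu> \<nu> = (INF \<pi>\<in>couplings \<mu> \<nu>. (\<integral>(x, y). lp_dist d p x y \<partial>\<pi>))"

section \<open>Clusterings\<close>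

text \<open>Only the values of \<open>cell\<close> and \<open>rep\<close> at indices below \<open>num_cells\<close> are meaningful.\<close>

record clustering =
  num_cells :: nat
  cell :: "nat \<Rightarrow> point set"
  rep :: "nat \<Rightarrow> point"

definition is_clustering :: "nat \<Rightarrow> clustering \<Rightarrow> bool" where
  "is_clustering d K \<longleftrightarrow>
     disjoint_family_on (cell K) {..<num_cells K} \<and>
     (\<Union>i<num_cells K. cell K i) = cube d \<and>
     (\<forall>i<num_cells K. rep K i \<in> cell K i)"

definition cell_index :: "clustering \<Rightarrow> point \<Rightarrow> nat" where
  "cell_index K x = (THE i. i < num_cells K \<and> x \<in> cell K i)"

definition label :: "clustering \<Rightarrow> point \<Rightarrow> point" where
  "label K x = rep K (cell_index K x)"

abbreviation euclidean_top :: "nat \<Rightarrow> point topology" where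
  "euclidean_top d \<equiv> product_topology (\<lambda>_. euclideanreal) {..<d}"

text \<open>The library predicate \<^const>\<open>convex\<close> needs a vector space type, which \<^typ>\<open>point\<close> is not.\<close>

definition convex_d :: "nat \<Rightarrow> point set \<Rightarrow> bool" where
  "convex_d d S \<longleftrightarrow>
     (\<forall>x\<in>S. \<forall>y\<in>S. \<forall>u\<in>{0..1}. (\<lambda>i\<in>{..<d}. (1 - u) * x i + u * y i) \<in> S)"

definition eucl_ball :: "nat \<Rightarrow> point \<Rightarrow> real \<Rightarrow> point set" where
  "eucl_ball d x r = {y \<in> topspace (euclidean_top d). L2_set (\<lambda>i. x i - y i) {..<d} < r}"

definition CV :: "nat \<Rightarrow> real \<Rightarrow> clustering set" where
  "CV d \<delta> = {K. is_clustering d K \<and>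
     (\<forall>i<num_cells K.
        cell K i \<in> sets (lebesgue_d d) \<and>
        (\<exists>S. openin (euclidean_top d) S \<and> convex_d d S \<and>
             S \<subseteq> cell K i \<and> cell K i \<subseteq> euclidean_top d closure_of S) \<and>
        eucl_ball d (rep K i) \<delta> \<subseteq> cell K i)}"

definition closed_box :: "nat \<Rightarrow> point \<Rightarrow> point \<Rightarrow> point set" where
  "closed_box d a b = (\<Pi>\<^sub>E i\<in>{..<d}. {a i..b i})"

definition axis_aligned_box :: "nat \<Rightarrow> point set \<Rightarrow> bool" where
  "axis_aligned_box d B \<longleftrightarrow>
     B \<in> sets (lebesgue_d d) \<and>
     (\<exists>a b. euclidean_top d interior_of closed_box d a b \<subseteq> B \<and> B \<subseteq> closed_box d a b)"

definition Boxes :: "nat \<Rightarrow> real \<Rightarrow> clustering set" where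
  "Boxes d \<delta> = {K \<in> CV d \<delta>. \<forall>i<num_cells K. axis_aligned_box d (cell K i)}"

section \<open>Algorithms with oracle access\<close>

datatype verdict = Accept | Reject | ClusterReject

text \<open>
  A deterministic adaptive strategy is a decision tree. The type \<^typ>\<open>'s\<close> indexes the unknown
  distributions: \<open>Draw s f\<close> asks for a clustered sample of the \<open>s\<close>-th distribution and
  \<open>Query x f\<close> asks the label oracle about \<open>x\<close>; both continue with \<open>f\<close> applied to the answer.
\<close>

datatype 's strategy =
    Output verdict
  | Draw 's "point \<Rightarrow> 's strategy"
  | Query point "point \<Rightarrow> 's strategy"

text \<open>
  A randomized algorithm chooses its strategy from a seed, an infinite sequence of independent
  uniform elements of \<open>[0,1]\<close>.
\<close>

type_synonym 's algorithm = "(nat \<Rightarrow> real) \<Rightarrow> 's strategy"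

definition seed_space :: "(nat \<Rightarrow> real) measure" where
  "seed_space = (\<Pi>\<^sub>M i\<in>UNIV. uniform_measure lborel {0..1})"

text \<open>
  \<open>uses_at_most d m q t\<close>: whatever answers in the cube the oracles give, \<open>t\<close> draws at most \<open>m\<close>
  samples (of all distributions together) and makes at most \<open>q\<close> queries, all at points of the cube.
\<close>

inductive uses_at_most :: "nat \<Rightarrow> nat \<Rightarrow> nat \<Rightarrow> 's strategy \<Rightarrow> bool" for d where
  "uses_at_most d m q (Output v)"
| "(\<And>r. r \<in> cube d \<Longrightarrow> uses_at_most d m q (f r)) \<Longrightarrow> uses_at_most d (Suc m) q (Draw s f)"
| "x \<in> cube d \<Longrightarrow> (\<And>r. r \<in> cube d \<Longrightarrow> uses_at_most d m q (f r)) \<Longrightarrow>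
     uses_at_most d m (Suc q) (Query x f)"

text \<open>
  The argument \<open>xs (s, n)\<close> is the point underlying the sample drawn from source \<open>s\<close> when \<open>n\<close>
  samples have been drawn before; as \<open>n\<close> counts the draws from all sources, no entry of \<open>xs\<close> is
  used twice. The strategy sees only the label of the point.
\<close>

primrec run :: "clustering \<Rightarrow> ('s \<times> nat \<Rightarrow> point) \<Rightarrow> 's strategy \<Rightarrow> nat \<Rightarrow> verdict" where
  "run K xs (Output v) n = v"
| "run K xs (Draw s f) n = run K xs (f (label K (xs (s, n)))) (Suc n)"
| "run K xs (Query x f) n = run K xs (f (label K x)) n"

text \<open>
  The completion matters because cells need not be Borel: it is what makes the label of, say, a
  uniformly distributed query point a random variable.
\<close>

definition run_space ::
  "('s \<Rightarrow> point measure) \<Rightarrow> ((nat \<Rightarrow> real) \<times> ('s \<times> nat \<Rightarrow> point)) measure" where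
  "run_space src = completion (seed_space \<Otimes>\<^sub>M (\<Pi>\<^sub>M sn\<in>UNIV. src (fst sn)))"

definition outcome ::
  "'s algorithm \<Rightarrow> clustering \<Rightarrow> (nat \<Rightarrow> real) \<times> ('s \<times> nat \<Rightarrow> point) \<Rightarrow> verdict" where
  "outcome T K = (\<lambda>(\<omega>, xs). run K xs (T \<omega>) 0)"

definition outcome_prob ::
  "'s algorithm \<Rightarrow> clustering \<Rightarrow> ('s \<Rightarrow> point measure) \<Rightarrow> verdict set \<Rightarrow> real" where
  "outcome_prob T K src V =
     measure (run_space src) {z \<in> space (run_space src). outcome T K z \<in> V}"

section \<open>Diameter-guarded testers\<close>

definition guard_const :: real where
  "guard_const = 1 / (384 * ln 24)"

definition diameter_condition ::
  "nat \<Rightarrow> real \<Rightarrow> real \<Rightarrow> real \<Rightarrow> clustering \<Rightarrow> point measure \<Rightarrow> bool" where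
  "diameter_condition d p \<epsilon> \<Delta> K \<mu> \<longleftrightarrow>
     measure \<mu> {x \<in> space \<mu>. lp_diam d p (cell K (cell_index K x)) > \<Delta>} \<le> guard_const * \<epsilon>"

text \<open>
  The measurability clauses make the output a random variable on every input; without them, an
  upper bound on \<^const>\<open>outcome_prob\<close> could hold vacuously for a non-measurable event.
\<close>

definition uniformity_tester ::
  "nat \<Rightarrow> real \<Rightarrow> real \<Rightarrow> clustering set \<Rightarrow> clustering set \<Rightarrow> real \<Rightarrow> unit algorithm \<Rightarrow> bool" where
  "uniformity_tester d p \<epsilon> U G \<Delta> T \<longleftrightarrow>
     (\<forall>K\<in>U. \<forall>\<mu>. input_distribution d \<mu> \<longrightarrow>
        (let src = (\<lambda>_. \<mu>) in
           outcome T K \<in> run_space src \<rightarrow>\<^sub>M count_space UNIV \<and>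
           (K \<in> G \<and> diameter_condition d p \<epsilon> \<Delta> K \<mu> \<longrightarrow>
              outcome_prob T K src {ClusterReject} \<le> 1 / 6) \<and>
           (\<mu> = uniform_cube d \<longrightarrow>
              outcome_prob T K src {Accept, ClusterReject} \<ge> 5 / 6) \<and>
           (EMD d p \<mu> (uniform_cube d) > \<epsilon> \<longrightarrow>
              outcome_prob T K src {Reject, ClusterReject} \<ge> 5 / 6)))"

definition equivalence_tester ::
  "nat \<Rightarrow> real \<Rightarrow> real \<Rightarrow> clustering set \<Rightarrow> clustering set \<Rightarrow> real \<Rightarrow> bool algorithm \<Rightarrow> bool" where
  "equivalence_tester d p \<epsilon> U G \<Delta> T \<longleftrightarrow>
     (\<forall>K\<in>U. \<forall>\<mu> \<nu>. input_distribution d \<mu> \<longrightarrow> input_distribution d \<nu> \<longrightarrow>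
        (let src = (\<lambda>s. if s then \<mu> else \<nu>) in
           outcome T K \<in> run_space src \<rightarrow>\<^sub>M count_space UNIV \<and>
           (K \<in> G \<and> diameter_condition d p \<epsilon> \<Delta> K \<mu> \<and> diameter_condition d p \<epsilon> \<Delta> K \<nu> \<longrightarrow>
              outcome_prob T K src {ClusterReject} \<le> 1 / 6) \<and>
           (\<mu> = \<nu> \<longrightarrow>
              outcome_prob T K src {Accept, ClusterReject} \<ge> 5 / 6) \<and>
           (EMD d p \<mu> \<nu> > \<epsilon> \<longrightarrow>
              outcome_prob T K src {Reject, ClusterReject} \<ge> 5 / 6)))"

text \<open>
  Polylogarithmic factors. The summand 1 keeps a logarithm bounded away from 0 when its argument
  tends to 1; for arguments at least 2 it changes only the constant.
\<close>

definition log1 :: "real \<Rightarrow> real" where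
  "log1 x = 1 + ln x"

end

theory Submission
  imports Defs
begin

text \<open>
  A cell is probed by bisecting along the \<open>2 * d\<close> axis directions from its representative and then
  asking whether certain combinations of the recorded end points (for uniformity also all corners
  of the recorded box) lie in the cell; boxes pass. By convexity and the inscribed ball, the extent
  of a cell that passes is, up to a small error, the recorded one, even if it is not a box. Probing
  \<open>O(1 / \<epsilon>)\<close> sampled cells certifies that, except for mass \<open>O(\<epsilon>)\<close>, cells have diameter about
  \<open>\<epsilon> / 16\<close>; otherwise the answer is CLUSTER-REJECT.

  It remains to compare discrete distributions on the dyadic grids of the cube. Greedy transport
  along the dyadic tree bounds the EMD by the sum over the levels \<open>l \<le> L\<close>, where \<open>2 ^ L\<close> is about
  \<open>1 / \<epsilon>\<close>, of \<open>2 powr -l\<close> times the total variation distance of level \<open>l\<close>, so a large EMD shows at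
  some level. On each level a quadratic statistic, the inner product of the difference vectors of
  two independent samples, estimates the squared Euclidean distance. For equivalence, the bin of
  a sample is that of its representative, and the bins are first flattened with weights taken from
  an auxiliary sample, which gives the exponent \<open>2 * d / 3\<close>. For uniformity, each sample is spread
  uniformly over its probed box, so that the uniform distribution is reproduced up to the volume
  error of the probe; this gives the exponent \<open>d / 2\<close>.
\<close>

section \<open>Convex cells and boxes\<close>

text \<open>Guarantees (2) and (3) concern arbitrary convex cells, (1) only boxes: a check must be
  passed by every box and, once passed, must bound any convex cell. Pairs of axis end points suffice
  for extents, since \<open>eliminate_coordinates\<close> loses only a factor 1 +
  d/\<open>\<delta>'\<close>; this is why bisection to precision about \<delta>^2/d is enough.
  Volumes need the 2^d corners. Both strategies ignore the seed and see only labels of independent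
  points, so beyond \<open>outcome_deterministic\<close> all probability is about finitely supported
  laws. The budget: bad cells of mass \<epsilon>/20 escape 40/\<epsilon> probes with probability at
  most e^-2 \<le> 1/6, while \<open>guard_const\<close> keeps 41/\<epsilon> probes of boxes quiet.
  The EMD is then at most 2 (2 \<epsilon>/16 + \<epsilon>/20), plus \<epsilon>/8 for the finest grid
  and \<epsilon>/4 for the levels. The null case must survive a union bound over all levels; the far
  case has to succeed on one level only. For \<delta> > 1/2 the class \<open>CV\<close> is empty,
  which settles the range where ln (1/\<delta>) tends to 0.\<close>

lemma openin_cube_nbhd:
  assumes "openin (euclidean_top d) S" "x \<in> S"
  obtains e where "e > 0"
    "\<And>y. y \<in> topspace (euclidean_top d) \<Longrightarrow> (\<And>i. i < d \<Longrightarrow> \<bar>y i - x i\<bar> < e) \<Longrightarrow> y \<in> S"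
proof -
  have "\<exists>U. (\<forall>i\<in>{..<d}. open (U i)) \<and> x \<in> Pi\<^sub>E {..<d} U \<and> Pi\<^sub>E {..<d} U \<subseteq> S"
    using assms(1)[unfolded openin_product_topology_alt, rule_format, OF assms(2)]
    by (auto simp: open_openin[symmetric])
  then obtain U where U: "\<And>i. i < d \<Longrightarrow> open (U i)" "x \<in> Pi\<^sub>E {..<d} U" "Pi\<^sub>E {..<d} U \<subseteq> S"
    by (metis lessThan_iff)
  have "\<exists>e>0. \<forall>z. \<bar>z - x i\<bar> < e \<longrightarrow> z \<in> U i" if "i < d" for i
    using U(1)[OF that] U(2) that unfolding open_dist
    by (metis PiE_mem dist_real_def lessThan_iff)
  then obtain e where e: "\<And>i. i < d \<Longrightarrow> e i > (0::real)"
      "\<And>i z. i < d \<Longrightarrow> \<bar>z - x i\<bar> < e i \<Longrightarrow> z \<in> U i" by metis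
  \<comment> \<open>The extra 1 keeps the minimum over a nonempty set when
    \<open>d = 0\<close>.\<close>
  define e0 where "e0 = Min (insert 1 (e ` {..<d}))"
  have "e0 > 0" unfolding e0_def using e by (subst Min_gr_iff) auto
  moreover have "y \<in> S" if y: "y \<in> topspace (euclidean_top d)"
    "\<And>i. i < d \<Longrightarrow> \<bar>y i - x i\<bar> < e0" for y
  proof -
    have "e0 \<le> e i" if "i < d" for i unfolding e0_def using that by (intro Min_le) auto
    then have "y i \<in> U i" if "i < d" for i
      using that y(2)[OF that] e(2)[OF that] by fastforce
    with y(1) have "y \<in> Pi\<^sub>E {..<d} U" by (auto simp: PiE_iff)
    with U(3) show ?thesis by blast
  qed
  ultimately show ?thesis using that by blast
qed

lemma closure_of_approx:
  assumes "x \<in> euclidean_top d closure_of S" "e > 0"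
  obtains y where "y \<in> S" "\<And>i. i < d \<Longrightarrow> \<bar>y i - x i\<bar> < e"
proof -
  have "x \<in> topspace (euclidean_top d)" using assms(1) by (simp add: in_closure_of)
  define T where "T = (\<Pi>\<^sub>E i\<in>{..<d}. ball (x i) e)"
  have "openin (euclidean_top d) T" unfolding T_def
    by (subst openin_PiE) (auto simp: open_openin[symmetric])
  moreover have "x \<in> T" using \<open>x \<in> topspace (euclidean_top d)\<close> assms(2)
    by (auto simp: T_def PiE_iff)
  ultimately obtain y where "y \<in> S" "y \<in> T" using assms(1) by (meson in_closure_of)
  then show ?thesis using that
    by (auto simp: T_def PiE_iff dist_real_def abs_minus_commute)
qed

text \<open>Replace the far end \<open>z\<close> by a nearby \<open>z'\<close> in \<open>S\<close>
  and let openness at \<open>a\<close> absorb the error: only the end point in the closure can leave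
  \<open>S\<close>.\<close>

lemma convex_d_segment:
  assumes op: "openin (euclidean_top d) S" and cv: "convex_d d S"
    and a: "a \<in> S" and z: "z \<in> euclidean_top d closure_of S" and u: "0 \<le> u" "u < 1"
  shows "(\<lambda>i\<in>{..<d}. (1 - u) * a i + u * z i) \<in> S"
proof -
  obtain e where e: "e > 0"
    "\<And>y. y \<in> topspace (euclidean_top d) \<Longrightarrow> (\<And>i. i < d \<Longrightarrow> \<bar>y i - a i\<bar> < e) \<Longrightarrow> y \<in> S"
    using openin_cube_nbhd[OF op a] by blast
  obtain z' where z': "z' \<in> S" "\<And>i. i < d \<Longrightarrow> \<bar>z' i - z i\<bar> < e * (1 - u)"
    using closure_of_approx[OF z, of "e * (1 - u)"] e(1) u by auto
  \<comment> \<open>Chosen so that (1 - u) a' + u z' = (1 - u) a + u z.\<close>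
  define a' where "a' = (\<lambda>i\<in>{..<d}. a i + u * (z i - z' i) / (1 - u))"
  have "a' \<in> S"
  proof (rule e(2))
    show "a' \<in> topspace (euclidean_top d)" by (auto simp: a'_def)
    fix i assume i: "i < d"
    have "\<bar>a' i - a i\<bar> = u / (1 - u) * \<bar>z' i - z i\<bar>" using i u
      by (simp add: a'_def abs_mult abs_minus_commute)
    also have "\<dots> \<le> 1 / (1 - u) * \<bar>z' i - z i\<bar>" using u
      by (intro mult_right_mono divide_right_mono) auto
    also have "\<dots> < e" using z'(2)[OF i] u by (simp add: field_simps)
    finally show "\<bar>a' i - a i\<bar> < e" .
  qed
  with z'(1) cv u have "(\<lambda>i\<in>{..<d}. (1 - u) * a' i + u * z' i) \<in> S"
    unfolding convex_d_def by auto
  also have "(\<lambda>i\<in>{..<d}. (1 - u) * a' i + u * z' i) = (\<lambda>i\<in>{..<d}. (1 - u) * a i + u * z i)"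
  proof (intro restrict_ext)
    fix i assume "i \<in> {..<d}"
    then have "(1 - u) * a' i = (1 - u) * a i + u * (z i - z' i)"
      using u by (simp add: a'_def distrib_left)
    then show "(1 - u) * a' i + u * z' i = (1 - u) * a i + u * z i" by (simp add: algebra_simps)
  qed
  finally show ?thesis .
qed

definition axis_move :: "point \<Rightarrow> nat \<Rightarrow> real \<Rightarrow> point" where
  "axis_move r i t = r(i := r i + t)"

definition sgn_of :: "bool \<Rightarrow> real" where
  "sgn_of b = (if b then 1 else - 1)"

lemma sgn_of_simps [simp]: "sgn_of True = 1" "sgn_of False = -1" "sgn_of b * sgn_of b = 1" "\<bar>sgn_of b\<bar> = 1"
  by (auto simp: sgn_of_def)

text \<open>\<open>S\<close> is the open convex core of the cell \<open>G\<close>. Which boundary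
  points belong to \<open>G\<close> is arbitrary, so arguments pass through \<open>S\<close> and its
  closure.\<close>

locale convex_cell =
  fixes d :: nat and \<delta> :: real and G S :: "point set" and r :: point
  assumes d: "d \<ge> 1" and \<delta>: "0 < \<delta>" and op: "openin (euclidean_top d) S" and cv: "convex_d d S"
    and SG: "S \<subseteq> G" and Gcl: "G \<subseteq> euclidean_top d closure_of S" and rG: "r \<in> G"
    and ball: "eucl_ball d r \<delta> \<subseteq> G" and Gcube: "G \<subseteq> cube d"
begin

lemma r_ext: "r \<in> extensional {..<d}"
  using rG Gcube by (auto simp: cube_def PiE_iff)

lemma ball_axis: "i < d \<Longrightarrow> \<bar>t\<bar> < \<delta> \<Longrightarrow> axis_move r i t \<in> G"
proof -
  assume i: "i < d" and t: "\<bar>t\<bar> < \<delta>"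
  have "L2_set (\<lambda>j. r j - axis_move r i t j) {..<d} = \<bar>t\<bar>"
  proof -
    have "(\<Sum>j<d. (r j - axis_move r i t j)\<^sup>2) = (\<Sum>j\<in>{i}. (r j - axis_move r i t j)\<^sup>2)"
      using i by (intro sum.mono_neutral_right) (auto simp: axis_move_def)
    then show ?thesis by (simp add: L2_set_def axis_move_def)
  qed
  then have "axis_move r i t \<in> eucl_ball d r \<delta>"
    using t r_ext i by (auto simp: eucl_ball_def axis_move_def PiE_iff extensional_def)
  with ball show ?thesis by blast
qed

text \<open>The Euclidean norm is at most the sum of the absolute coordinates, so the ball contains
  a cube of half-side \<delta>/d, for which coordinatewise estimates suffice.\<close>

lemma ball_box:
  assumes y: "y \<in> topspace (euclidean_top d)" "\<And>i. i < d \<Longrightarrow> \<bar>y i - r i\<bar> < \<delta> / d"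
  shows "y \<in> G"
proof -
  have "L2_set (\<lambda>i. r i - y i) {..<d} \<le> (\<Sum>i<d. \<bar>r i - y i\<bar>)"
    by (rule L2_set_le_sum_abs)
  also have "\<dots> < (\<Sum>i<d. \<delta> / d)"
    using d y(2) by (intro sum_strict_mono) (auto simp: abs_minus_commute lessThan_empty_iff not_le)
  also have "\<dots> = \<delta>" using d by simp
  finally show ?thesis using ball y(1) by (auto simp: eucl_ball_def)
qed

text \<open>Push \<open>r\<close> slightly away from a point \<open>u\<close> of \<open>S\<close>:
  the result \<open>z\<close> is still in the inscribed ball, hence in the closure of
  \<open>S\<close>, and \<open>r\<close> lies strictly between \<open>u\<close> and
  \<open>z\<close>.\<close>

lemma r_in_S: "r \<in> S"
proof -
  obtain u where u: "u \<in> S" using closure_of_approx[OF subsetD[OF Gcl rG], of 1] by auto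
  have ucube: "u \<in> cube d" using u SG Gcube by auto
  have rcube: "r \<in> cube d" using rG Gcube by auto
  \<comment> \<open>Coordinates in the cube differ by at most 1, so this step keeps \<open>z\<close>
    within \<delta>/d of \<open>r\<close> in every coordinate.\<close>
  define \<tau> where "\<tau> = \<delta> / (2 * d)"
  have \<tau>: "\<tau> > 0" using \<delta> d by (simp add: \<tau>_def)
  define z where "z = (\<lambda>i\<in>{..<d}. r i + \<tau> * (r i - u i))"
  have "z \<in> G"
  proof (rule ball_box)
    fix i assume i: "i < d"
    have "u i \<in> {0..1}" "r i \<in> {0..1}" using i ucube rcube by (auto simp: cube_def PiE_iff)
    then have "\<bar>r i - u i\<bar> \<le> 1" by auto
    then have "\<bar>z i - r i\<bar> \<le> \<tau>" using i \<tau> by (simp add: z_def abs_mult)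
    also have "\<tau> < \<delta> / d" using d \<delta> by (simp add: \<tau>_def field_simps)
    finally show "\<bar>z i - r i\<bar> < \<delta> / d" .
  qed (auto simp: z_def)
  then have "z \<in> euclidean_top d closure_of S" using Gcl by auto
  from convex_d_segment[OF op cv u this, of "1 / (1 + \<tau>)"]
  have "(\<lambda>i\<in>{..<d}. (1 - 1 / (1 + \<tau>)) * u i + 1 / (1 + \<tau>) * z i) \<in> S" using \<tau> by simp
  also have "(\<lambda>i\<in>{..<d}. (1 - 1 / (1 + \<tau>)) * u i + 1 / (1 + \<tau>) * z i) = (\<lambda>i\<in>{..<d}. r i)"
  proof (intro restrict_ext)
    fix i assume "i \<in> {..<d}"
    then show "(1 - 1 / (1 + \<tau>)) * u i + 1 / (1 + \<tau>) * z i = r i"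
      using \<tau> by (simp add: z_def divide_simps) (simp add: algebra_simps)
  qed
  also have "\<dots> = r" using r_ext by (simp add: extensional_restrict)
  finally show ?thesis .
qed

text \<open>
  The displacements from \<open>r\<close> all of whose proper fractions stay in \<open>S\<close>. It is a convex set, and
  working in it avoids treating the boundary of the cell.
\<close>

definition star :: "point set" where
  "star = {y. \<forall>h. 0 \<le> h \<longrightarrow> h < 1 \<longrightarrow> (\<lambda>i\<in>{..<d}. r i + h * y i) \<in> S}"

lemma star_cong: "y \<in> star \<Longrightarrow> (\<And>i. i < d \<Longrightarrow> z i = y i) \<Longrightarrow> z \<in> star"
  by (auto simp: star_def cong: restrict_cong)

lemma star_diff: "x \<in> G \<Longrightarrow> (\<lambda>i. x i - r i) \<in> star"
proof -
  assume "x \<in> G"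
  then have x: "x \<in> euclidean_top d closure_of S" using Gcl by auto
  have "(\<lambda>i\<in>{..<d}. r i + h * (x i - r i)) = (\<lambda>i\<in>{..<d}. (1 - h) * r i + h * x i)" for h
    by (auto simp: algebra_simps)
  then show ?thesis using convex_d_segment[OF op cv r_in_S x] by (simp add: star_def)
qed

lemma star_convex:
  assumes y: "y \<in> star" and z: "z \<in> star" and u: "0 \<le> u" "u \<le> 1"
  shows "(\<lambda>i. (1 - u) * y i + u * z i) \<in> star"
  unfolding star_def
proof (intro CollectI allI impI)
  fix h :: real assume h: "0 \<le> h" "h < 1"
  have Y: "(\<lambda>i\<in>{..<d}. r i + h * y i) \<in> S" (is "?Y \<in> S") and Z: "(\<lambda>i\<in>{..<d}. r i + h * z i) \<in> S" (is "?Z \<in> S")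
    using y z h unfolding star_def by blast+
  have "(\<lambda>i\<in>{..<d}. (1 - u) * ?Y i + u * ?Z i) \<in> S"
    by (rule cv[unfolded convex_d_def, THEN bspec, OF Y, THEN bspec, OF Z, THEN bspec]) (use u in auto)
  also have "(\<lambda>i\<in>{..<d}. (1 - u) * ?Y i + u * ?Z i)
     = (\<lambda>i\<in>{..<d}. r i + h * ((1 - u) * y i + u * z i))"
    by (intro restrict_ext) (simp add: algebra_simps)
  finally show "(\<lambda>i\<in>{..<d}. r i + h * ((1 - u) * y i + u * z i)) \<in> S" .
qed

text \<open>\<open>star_convex\<close> with unnormalized weights, the form in which points are
  combined when coordinates are eliminated.\<close>

lemma star_weighted:
  assumes "y \<in> star" "z \<in> star" "0 < a" "0 \<le> b"
  shows "(\<lambda>i. (a * y i + b * z i) / (a + b)) \<in> star"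
proof (rule star_cong[OF star_convex[of y z "b / (a + b)"]])
  fix i
  have "1 - b / (a + b) = a / (a + b)" using assms(3,4) by (simp add: field_simps)
  then show "(a * y i + b * z i) / (a + b) = (1 - b / (a + b)) * y i + b / (a + b) * z i"
    by (simp add: add_divide_distrib)
qed (use assms in auto)

lemma star_in_S: "y \<in> star \<Longrightarrow> 0 \<le> h \<Longrightarrow> h < 1 \<Longrightarrow> (\<lambda>i\<in>{..<d}. r i + h * y i) \<in> S"
  by (simp add: star_def)

end

text \<open>The sum of two recorded axis displacements. For \<open>i = j\<close> the first one alone
  remains, so the axis end points themselves are among these points.\<close>

definition pair_point :: "nat \<Rightarrow> point \<Rightarrow> (nat \<Rightarrow> bool \<Rightarrow> real) \<Rightarrow> nat \<Rightarrow> bool \<Rightarrow> nat \<Rightarrow> bool \<Rightarrow> point" where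
  "pair_point d r e i \<sigma> j \<tau> = (\<lambda>k\<in>{..<d}. r k +
     (if k = i then sgn_of \<sigma> * e i \<sigma> else if k = j then sgn_of \<tau> * e j \<tau> else 0))"

text \<open>The certificate left by a successful probe, freed from bisection: \<open>w\<close>
  bounds how much too short an axis end point is recorded, and \<open>\<delta>'\<close> controls the
  loss in \<open>eliminate_coordinates\<close>.\<close>

locale probed_cell = convex_cell +
  fixes e :: "nat \<Rightarrow> bool \<Rightarrow> real" and \<delta>' w :: real
  assumes \<delta>': "0 < \<delta>'" and e_ge: "\<And>i \<sigma>. i < d \<Longrightarrow> \<delta>' \<le> e i \<sigma>"
    and pairs: "\<And>i \<sigma> j \<tau>. i < d \<Longrightarrow> j < d \<Longrightarrow> pair_point d r e i \<sigma> j \<tau> \<in> G"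
    and w: "0 < w"
    and outside: "\<And>i \<sigma>. i < d \<Longrightarrow> axis_move r i (sgn_of \<sigma> * (e i \<sigma> + w)) \<notin> G"
begin

lemma pair_star:
  assumes "i < d" "j < d"
  shows "(\<lambda>k. if k = i then sgn_of \<sigma> * e i \<sigma> else if k = j then sgn_of \<tau> * e j \<tau> else 0) \<in> star"
  using star_diff[OF pairs[OF assms]] by (rule star_cong) (simp add: pair_point_def)

text \<open>Otherwise the certified outside point would be a proper fraction of \<open>y\<close> and
  thus in \<open>S\<close>.\<close>

lemma axis_star:
  assumes i: "i < d" and y: "y \<in> star" "\<And>k. k < d \<Longrightarrow> k \<noteq> i \<Longrightarrow> y k = 0"
  shows "sgn_of \<sigma> * y i \<le> e i \<sigma> + w"
proof (rule ccontr)
  assume "\<not> ?thesis"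
  then have less: "e i \<sigma> + w < sgn_of \<sigma> * y i" by simp
  have pos: "0 < e i \<sigma> + w" using e_ge[OF i, of \<sigma>] \<delta>' w by simp
  define h where "h = (e i \<sigma> + w) / (sgn_of \<sigma> * y i)"
  have h: "0 \<le> h" "h < 1" "h * (sgn_of \<sigma> * y i) = e i \<sigma> + w" using pos less by (auto simp: h_def)
  have "sgn_of \<sigma> * (e i \<sigma> + w) = sgn_of \<sigma> * (h * (sgn_of \<sigma> * y i))" using h(3) by simp
  also have "\<dots> = h * y i" by (cases \<sigma>) auto
  finally have hy: "sgn_of \<sigma> * (e i \<sigma> + w) = h * y i" .
  have "axis_move r i (sgn_of \<sigma> * (e i \<sigma> + w)) = (\<lambda>k\<in>{..<d}. r k + h * y k)"
    unfolding hy using r_ext y(2) i by (auto simp: axis_move_def extensional_def)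
  also have "\<dots> \<in> G" using star_in_S[OF y(1) h(1,2)] SG by blast
  finally show False using outside[OF i] by blast
qed

text \<open>
  Combining a point with the points \<open>pair_point\<close> removes its coordinates other than \<open>i\<close> one by one,
  at the price of shrinking the excess in direction \<open>i\<close> by the factor \<open>N\<close>.
\<close>

lemma eliminate_coordinates:
  assumes i: "i < d" and y: "y \<in> star" "\<And>j. j < d \<Longrightarrow> \<bar>y j\<bar> \<le> 1" and k: "k \<le> d"
  shows "\<exists>N\<ge>1. N \<le> 1 + k / \<delta>' \<and>
    (\<lambda>j. if j = i then sgn_of \<sigma> * e i \<sigma> + (y i - sgn_of \<sigma> * e i \<sigma>) / N else if j < k then 0 else y j / N) \<in> star"
  using k
proof (induction k)
  case 0
  show ?case using y(1) by (intro exI[of _ 1]) (auto intro: star_cong)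
next
  case (Suc k)
  then obtain N where N: "N \<ge> 1" "N \<le> 1 + k / \<delta>'" and st:
    "(\<lambda>j. if j = i then sgn_of \<sigma> * e i \<sigma> + (y i - sgn_of \<sigma> * e i \<sigma>) / N else if j < k then 0 else y j / N) \<in> star"
    by auto
  have kd: "k < d" using Suc by simp
  show ?case
  proof (cases "k = i")
    case True
    have "N \<le> 1 + Suc k / \<delta>'" using N(2) \<delta>' by (simp add: field_simps)
    then show ?thesis using N(1)
      by (intro exI[of _ N]) (auto intro!: star_cong[OF st] simp: True less_Suc_eq)
  next
    case False
    \<comment> \<open>The sign opposite to that of \<open>y k\<close>: the pair point then cancels
      coordinate \<open>k\<close>, while its own coordinate \<open>i\<close> stays at the recorded
      end point.\<close>
    define \<tau> where "\<tau> = (y k < 0)"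
    define t where "t = \<bar>y k\<bar> / e k \<tau>"
    have ek: "\<delta>' \<le> e k \<tau>" "0 < e k \<tau>" using e_ge[OF kd, of \<tau>] \<delta>' by auto
    have t: "0 \<le> t" "t * e k \<tau> = \<bar>y k\<bar>" using ek by (auto simp: t_def)
    \<comment> \<open>Each eliminated coordinate adds at most 1/\<open>\<delta>'\<close> to the
      factor, which gives the linear bound on \<open>N\<close>.\<close>
    have "t \<le> 1 / \<delta>'" unfolding t_def using ek \<delta>' y(2)[OF kd] by (intro frac_le) auto
    then have "N + t \<le> 1 + Suc k / \<delta>'" using N(2) by (simp add: add_divide_distrib)
    moreover have "(\<lambda>j. if j = i then sgn_of \<sigma> * e i \<sigma> + (y i - sgn_of \<sigma> * e i \<sigma>) / (N + t)
        else if j < Suc k then 0 else y j / (N + t)) \<in> star"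
    proof (rule star_cong[OF star_weighted[OF st pair_star[OF i kd, of \<sigma> \<tau>], of N t]])
      fix j
      have Nt: "N + t > 0" "N > 0" using N(1) t by auto
      have "sgn_of \<tau> * \<bar>y k\<bar> = - y k" by (auto simp: \<tau>_def sgn_of_def)
      then have *: "y k + t * (sgn_of \<tau> * e k \<tau>) = 0"
        unfolding mult.left_commute[of t] t(2) by simp
      have **: "(N * (c + (y i - c) / N) + t * c) / (N + t) = c + (y i - c) / (N + t)" for c
      proof -
        have "N * (c + (y i - c) / N) + t * c = (N + t) * c + (y i - c)"
          using Nt by (simp add: distrib_left distrib_right)
        then show ?thesis using Nt by (simp add: add_divide_distrib)
      qed
      show "(if j = i then sgn_of \<sigma> * e i \<sigma> + (y i - sgn_of \<sigma> * e i \<sigma>) / (N + t)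
        else if j < Suc k then 0 else y j / (N + t)) =
        (N * (if j = i then sgn_of \<sigma> * e i \<sigma> + (y i - sgn_of \<sigma> * e i \<sigma>) / N else if j < k then 0 else y j / N) +
         t * (if j = i then sgn_of \<sigma> * e i \<sigma> else if j = k then sgn_of \<tau> * e k \<tau> else 0)) / (N + t)"
      proof (cases "j = i")
        case True
        then show ?thesis by (simp add: **)
      next
        case False
        then show ?thesis using \<open>k \<noteq> i\<close> Nt * by (cases j k rule: linorder_cases) auto
      qed
    qed (use N t in auto)
    ultimately show ?thesis using N(1) t(1) by (intro exI[of _ "N + t"]) auto
  qed
qed

text \<open>Once all other coordinates are eliminated, the point lies on axis \<open>i\<close> with
  its excess divided by \<open>N\<close>; there \<open>axis_star\<close> bounds the excess by
  \<open>w\<close>.\<close>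

lemma cell_extent:
  assumes x: "x \<in> G" and i: "i < d"
  shows "sgn_of \<sigma> * (x i - r i) \<le> e i \<sigma> + w * (1 + d / \<delta>')"
proof -
  define y where "y j = x j - r j" for j
  have "\<bar>y j\<bar> \<le> 1" if "j < d" for j
  proof -
    have "x j \<in> {0..1}" "r j \<in> {0..1}" using x rG Gcube that by (auto simp: cube_def PiE_iff)
    then show ?thesis by (auto simp: y_def)
  qed
  moreover have "y \<in> star" using star_diff[OF x] by (simp add: y_def[abs_def])
  ultimately obtain N where N: "N \<ge> 1" "N \<le> 1 + d / \<delta>'" and st:
    "(\<lambda>j. if j = i then sgn_of \<sigma> * e i \<sigma> + (y i - sgn_of \<sigma> * e i \<sigma>) / N else if j < d then 0 else y j / N) \<in> star"
    using eliminate_coordinates[OF i, of y d \<sigma>] by auto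
  have "sgn_of \<sigma> * (sgn_of \<sigma> * e i \<sigma> + (y i - sgn_of \<sigma> * e i \<sigma>) / N) \<le> e i \<sigma> + w"
    using axis_star[OF i st, of \<sigma>] by simp
  then have "(sgn_of \<sigma> * y i - e i \<sigma>) / N \<le> w"
    by (cases \<sigma>) (auto simp: minus_divide_left)
  then have "sgn_of \<sigma> * y i - e i \<sigma> \<le> w * N" using N(1) by (simp add: divide_le_eq)
  also have "\<dots> \<le> w * (1 + d / \<delta>')" using N w by (intro mult_left_mono) auto
  finally show ?thesis by (simp add: y_def)
qed

text \<open>A box is the convex hull of its corners. The induction frees one coordinate at a time:
  \<open>n\<close> coordinates are arbitrary, the others still sit at a corner.\<close>

lemma box_star:
  assumes corners: "\<And>c. (\<lambda>k\<in>{..<d}. r k + sgn_of (c k) * e k (c k)) \<in> G"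
    and y: "\<And>k. k < d \<Longrightarrow> - e k False \<le> y k \<and> y k \<le> e k True"
  shows "y \<in> star"
proof -
  have "(\<lambda>k. if k < n then y k else sgn_of (c k) * e k (c k)) \<in> star" if "n \<le> d" for n c
    using that
  proof (induction n arbitrary: c)
    case 0
    show ?case using star_diff[OF corners[of c]] by (rule star_cong) simp
  next
    case (Suc n)
    have pos: "0 < e n True" "0 < e n False" using e_ge[of n] Suc.prems \<delta>' by (force dest: less_le_trans)+
    define u where "u = (y n + e n False) / (e n True + e n False)"
    have yn: "- e n False \<le> y n" "y n \<le> e n True" using y[of n] Suc.prems by auto
    have u: "0 \<le> u" "u \<le> 1" using pos yn by (auto simp: u_def divide_le_eq)
    have "(e n True + e n False) * u = y n + e n False" using pos by (simp add: u_def)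
    then have un: "(1 - u) * (- e n False) + u * e n True = y n" by (simp add: algebra_simps)
    from Suc have "n \<le> d" by simp
    from star_convex[OF Suc.IH[OF this, of "c(n := False)"] Suc.IH[OF this, of "c(n := True)"] u]
    show ?case
    proof (rule star_cong)
      fix k assume "k < d"
      show "(if k < Suc n then y k else sgn_of (c k) * e k (c k)) =
        (1 - u) * (if k < n then y k else sgn_of ((c(n := False)) k) * e k ((c(n := False)) k)) +
        u * (if k < n then y k else sgn_of ((c(n := True)) k) * e k ((c(n := True)) k))"
        using un by (cases k n rule: linorder_cases) (auto simp: algebra_simps)
    qed
  qed
  from this[of d] show ?thesis by (rule star_cong) auto
qed

end

text \<open>Boundary points of a box need not belong to it, hence the strict inequalities.\<close>

lemma interior_of_box_in_cell:
  assumes box: "euclidean_top d interior_of closed_box d a b \<subseteq> B"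
    and x: "x \<in> extensional {..<d}" "\<And>i. i < d \<Longrightarrow> a i < x i \<and> x i < b i"
  shows "x \<in> B"
proof -
  have "openin (euclidean_top d) (\<Pi>\<^sub>E i\<in>{..<d}. {a i<..<b i})"
    by (subst openin_PiE) (auto simp: open_openin[symmetric])
  moreover have "(\<Pi>\<^sub>E i\<in>{..<d}. {a i<..<b i}) \<subseteq> closed_box d a b"
    unfolding closed_box_def by (intro PiE_mono) auto
  ultimately have "(\<Pi>\<^sub>E i\<in>{..<d}. {a i<..<b i}) \<subseteq> B" using box by (meson interior_of_maximal subset_trans)
  moreover have "x \<in> (\<Pi>\<^sub>E i\<in>{..<d}. {a i<..<b i})" using x by (auto simp: PiE_iff)
  ultimately show ?thesis by blast
qed

section \<open>Membership queries and the law of the verdict\<close>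

text \<open>All that a probe asks is membership in one fixed cell. Keeping this yes/no language
  apart from label queries lets the geometry ignore labels.\<close>

datatype 'a qtree = Answer 'a | Ask point "bool \<Rightarrow> 'a qtree"

primrec eval_q :: "(point \<Rightarrow> bool) \<Rightarrow> 'a qtree \<Rightarrow> 'a" where
  "eval_q P (Answer a) = a"
| "eval_q P (Ask x f) = eval_q P (f (P x))"

primrec bind_q :: "'a qtree \<Rightarrow> ('a \<Rightarrow> 'b qtree) \<Rightarrow> 'b qtree" where
  "bind_q (Answer a) g = g a"
| "bind_q (Ask x f) g = Ask x (\<lambda>b. bind_q (f b) g)"

primrec asks :: "'a qtree \<Rightarrow> nat \<Rightarrow> bool" where
  "asks (Answer a) n = True"
| "asks (Ask x f) n = (\<exists>m. n = Suc m \<and> (\<forall>b. asks (f b) m))"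

primrec collect_q :: "('b \<Rightarrow> 'a qtree) \<Rightarrow> 'b list \<Rightarrow> 'a list qtree" where
  "collect_q f [] = Answer []"
| "collect_q f (x # xs) = bind_q (f x) (\<lambda>a. bind_q (collect_q f xs) (\<lambda>as. Answer (a # as)))"

lemma eval_bind_q [simp]: "eval_q P (bind_q t g) = eval_q P (g (eval_q P t))"
  by (induction t) auto

lemma eval_collect_q [simp]: "eval_q P (collect_q f xs) = map (\<lambda>x. eval_q P (f x)) xs"
  by (induction xs) auto

lemma asks_mono: "asks t m \<Longrightarrow> m \<le> n \<Longrightarrow> asks t n"
proof (induction t arbitrary: m n)
  case (Ask x f)
  then obtain k where "m = Suc k" "\<forall>b. asks (f b) k" by auto
  moreover with Ask.prems obtain l where "n = Suc l" "k \<le> l" by (cases n) auto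
  ultimately show ?case using Ask.IH[OF rangeI] by auto
qed simp

lemma asks_bind_q: "asks t m \<Longrightarrow> (\<And>a. asks (g a) n) \<Longrightarrow> asks (bind_q t g) (m + n)"
proof (induction t arbitrary: m)
  case (Answer a)
  show ?case using asks_mono[OF Answer(2)[of a], of "m + n"] by simp
next
  case (Ask x f)
  then show ?case by auto
qed

lemma asks_collect_q: "(\<And>x. asks (f x) n) \<Longrightarrow> asks (collect_q f xs) (length xs * n)"
proof (induction xs)
  case (Cons x xs)
  have "asks (bind_q (collect_q f xs) (\<lambda>as. Answer (a # as))) (length xs * n + 0)" for a
    using Cons by (intro asks_bind_q) auto
  then have "asks (collect_q f (x # xs)) (n + length xs * n)"
    using Cons.prems by (simp add: asks_bind_q)
  then show ?case by simp
qed simp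

text \<open>
  Membership in the cell represented by \<open>r\<close> is decided by comparing labels with \<open>r\<close>; points outside
  the cube must not be passed to the label oracle.
\<close>

primrec compile_q :: "nat \<Rightarrow> point \<Rightarrow> 'a qtree \<Rightarrow> ('a \<Rightarrow> 's strategy) \<Rightarrow> 's strategy" where
  "compile_q d r (Answer a) k = k a"
| "compile_q d r (Ask x f) k =
     (if x \<in> cube d then Query x (\<lambda>y. compile_q d r (f (y = r)) k) else compile_q d r (f False) k)"

primrec probes :: "nat \<Rightarrow> (point \<Rightarrow> 'a qtree) \<Rightarrow> point list \<Rightarrow> ('a list \<Rightarrow> 's strategy) \<Rightarrow> 's strategy" where
  "probes d g [] k = k []"
| "probes d g (r # rs) k = compile_q d r (g r) (\<lambda>a. probes d g rs (\<lambda>as. k (a # as)))"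

text \<open>\<open>dr\<close> is one drawing step in continuation-passing form, either a single
  sample or a pair with one sample from each source.\<close>

primrec draws :: "(('z \<Rightarrow> 's strategy) \<Rightarrow> 's strategy) \<Rightarrow> nat \<Rightarrow> ('z list \<Rightarrow> 's strategy) \<Rightarrow> 's strategy" where
  "draws dr 0 k = k []"
| "draws dr (Suc n) k = dr (\<lambda>z. draws dr n (\<lambda>zs. k (z # zs)))"

lemma uses_at_most_mono:
  "uses_at_most d m q t \<Longrightarrow> m \<le> m' \<Longrightarrow> q \<le> q' \<Longrightarrow> uses_at_most d m' q' t"
proof (induction arbitrary: m' q' rule: uses_at_most.induct)
  case (1 m q v)
  show ?case by (rule uses_at_most.intros)
next
  case (2 m q f s)
  then obtain m'' where "m' = Suc m''" "m \<le> m''" by (cases m') auto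
  with 2 show ?case by (auto intro: uses_at_most.intros)
next
  case (3 x m q f)
  then obtain q'' where "q' = Suc q''" "q \<le> q''" by (cases q') auto
  with 3 show ?case by (auto intro: uses_at_most.intros)
qed

lemma uses_compile_q:
  "asks t n \<Longrightarrow> (\<And>a. uses_at_most d m q (k a)) \<Longrightarrow> uses_at_most d m (n + q) (compile_q d r t k)"
proof (induction t arbitrary: n)
  case (Answer a)
  show ?case using uses_at_most_mono[OF Answer(2)[of a], of m "n + q"] by simp
next
  case (Ask x f)
  then obtain l where l: "n = Suc l" "\<And>b. asks (f b) l" by auto
  have "uses_at_most d m (l + q) (compile_q d r (f b) k)" for b using Ask l by auto
  then show ?case using l(1) uses_at_most_mono[of d m "l + q" _ m "n + q"]
    by (auto intro: uses_at_most.intros)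
qed

lemma uses_probes:
  "(\<And>r. asks (g r) n) \<Longrightarrow> (\<And>as. uses_at_most d m q (k as)) \<Longrightarrow>
    uses_at_most d m (length rs * n + q) (probes d g rs k)"
proof (induction rs arbitrary: k)
  case (Cons r rs)
  have "uses_at_most d m (n + (length rs * n + q)) (probes d g (r # rs) k)"
    unfolding probes.simps by (rule uses_compile_q) (use Cons in auto)
  then show ?case by (simp add: add.assoc)
qed simp

lemma uses_draws:
  assumes dr: "\<And>m q k. (\<And>z. z \<in> Z \<Longrightarrow> uses_at_most d m q (k z)) \<Longrightarrow> uses_at_most d (c + m) q (dr k)"
  assumes "\<And>zs. set zs \<subseteq> Z \<Longrightarrow> length zs = n \<Longrightarrow> uses_at_most d m q (k zs)"
  shows "uses_at_most d (n * c + m) q (draws dr n k)"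
  using assms(2)
proof (induction n arbitrary: k)
  case (Suc n)
  have "uses_at_most d (c + (n * c + m)) q (draws dr (Suc n) k)"
    unfolding draws.simps by (rule dr, rule Suc.IH, rule Suc.prems) auto
  then show ?case by (simp add: add.assoc)
qed simp

text \<open>\<open>embed_pmf\<close> has this mass function once the cell masses are known to sum to
  1, which holds inside \<open>clustered_source\<close>.\<close>

definition cell_pmf :: "clustering \<Rightarrow> point measure \<Rightarrow> nat pmf" where
  "cell_pmf K \<mu> = embed_pmf (\<lambda>i. if i < num_cells K then measure \<mu> (cell K i) else 0)"

definition label_pmf :: "clustering \<Rightarrow> point measure \<Rightarrow> point pmf" where
  "label_pmf K \<mu> = map_pmf (rep K) (cell_pmf K \<mu>)"

text \<open>The discrete model of a run: every draw is a fresh independent label, every query is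
  answered deterministically by \<open>K\<close>.\<close>

primrec verdict_pmf :: "clustering \<Rightarrow> ('s \<Rightarrow> point pmf) \<Rightarrow> 's strategy \<Rightarrow> verdict pmf" where
  "verdict_pmf K P (Output v) = return_pmf v"
| "verdict_pmf K P (Draw s f) = bind_pmf (P s) (\<lambda>r. verdict_pmf K P (f r))"
| "verdict_pmf K P (Query x f) = verdict_pmf K P (f (label K x))"

lemma verdict_draws:
  assumes "\<And>k. verdict_pmf K P (dr k) = bind_pmf D (\<lambda>z. verdict_pmf K P (k z))"
  shows "verdict_pmf K P (draws dr n k) = bind_pmf (replicate_pmf n D) (\<lambda>zs. verdict_pmf K P (k zs))"
  by (induction n arbitrary: k) (simp_all add: assms bind_return_pmf bind_assoc_pmf)

lemma is_clustering_cell_index: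
  assumes "is_clustering d K" "i < num_cells K" "x \<in> cell K i"
  shows "cell_index K x = i"
  unfolding cell_index_def using assms
  by (intro the_equality) (auto simp: is_clustering_def disjoint_family_on_def)

text \<open>Disjoint cells have distinct representatives, so a label identifies its cell.\<close>

lemma label_eq_rep_iff:
  assumes K: "is_clustering d K" and i: "i < num_cells K" and x: "x \<in> cube d"
  shows "label K x = rep K i \<longleftrightarrow> x \<in> cell K i"
proof -
  obtain j where j: "j < num_cells K" "x \<in> cell K j" using K x by (auto simp: is_clustering_def)
  have rj: "rep K j \<in> cell K j" "rep K i \<in> cell K i" using K i j by (auto simp: is_clustering_def)
  have "label K x = rep K j" using is_clustering_cell_index[OF K j] by (simp add: label_def)
  moreover have "i = j" if "rep K j = rep K i"
    using is_clustering_cell_index[OF K j(1) rj(1)] is_clustering_cell_index[OF K i rj(2)] that by metis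
  moreover have "i = j" if "x \<in> cell K i"
    using is_clustering_cell_index[OF K j] is_clustering_cell_index[OF K i that] by metis
  ultimately show ?thesis using j by metis
qed

lemma verdict_compile_q:
  assumes K: "is_clustering d K" and i: "i < num_cells K"
  shows "verdict_pmf K P (compile_q d (rep K i) t k) = verdict_pmf K P (k (eval_q (\<lambda>x. x \<in> cell K i) t))"
proof (induction t)
  case (Ask x f)
  show ?case
  proof (cases "x \<in> cube d")
    case True
    then show ?thesis using Ask label_eq_rep_iff[OF K i True] by simp
  next
    case False
    \<comment> \<open>Cells lie in the cube, so the answer False substituted outside it is
      correct.\<close>
    then have "x \<notin> cell K i" using K i by (auto simp: is_clustering_def)
    with False show ?thesis using Ask by simp
  qed
qed simp

locale clustered_source =
  fixes d :: nat and K :: clustering and \<mu> :: "point measure"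
  assumes K: "is_clustering d K" and mu: "prob_space \<mu>" and space: "space \<mu> = cube d"
    and cells: "\<And>i. i < num_cells K \<Longrightarrow> cell K i \<in> sets \<mu>"
begin

sublocale prob_space \<mu> by (rule mu)

lemma sum_cells: "A \<in> sets \<mu> \<Longrightarrow> (\<Sum>i<num_cells K. measure \<mu> (A \<inter> cell K i)) = measure \<mu> A"
proof -
  assume A: "A \<in> sets \<mu>"
  have "measure \<mu> (\<Union>i<num_cells K. A \<inter> cell K i) = (\<Sum>i<num_cells K. measure \<mu> (A \<inter> cell K i))"
    using A cells K
    by (intro finite_measure_finite_Union) (auto simp: is_clustering_def disjoint_family_on_def)
  also have "(\<Union>i<num_cells K. A \<inter> cell K i) = A"
    using K sets.sets_into_space[OF A] by (auto simp: is_clustering_def space)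
  finally show ?thesis by simp
qed

lemma sum_cells_1: "(\<Sum>i<num_cells K. measure \<mu> (cell K i)) = 1"
proof -
  have "cube d \<inter> cell K i = cell K i" if "i < num_cells K" for i
    using cells[OF that] sets.sets_into_space space by blast
  then show ?thesis using sum_cells[OF sets.top] prob_space by (simp add: space)
qed

lemma pmf_cell_pmf: "pmf (cell_pmf K \<mu>) i = (if i < num_cells K then measure \<mu> (cell K i) else 0)"
  unfolding cell_pmf_def
proof (rule pmf_embed_pmf)
  have "(\<integral>\<^sup>+x. ennreal (if x < num_cells K then measure \<mu> (cell K x) else 0) \<partial>count_space UNIV) =
    (\<Sum>x<num_cells K. ennreal (if x < num_cells K then measure \<mu> (cell K x) else 0))"
    by (intro nn_integral_count_space') auto
  also have "\<dots> = ennreal (\<Sum>x<num_cells K. measure \<mu> (cell K x))" by (simp flip: sum_ennreal)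
  finally show "(\<integral>\<^sup>+x. ennreal (if x < num_cells K then measure \<mu> (cell K x) else 0) \<partial>count_space UNIV) = 1"
    by (simp add: sum_cells_1)
qed simp

lemma set_cell_pmf: "set_pmf (cell_pmf K \<mu>) \<subseteq> {..<num_cells K}"
  by (auto simp: set_pmf_iff pmf_cell_pmf split: if_splits)

lemma finite_cell_pmf: "finite (set_pmf (cell_pmf K \<mu>))"
  using set_cell_pmf finite_subset by blast

lemma finite_label_pmf: "finite (set_pmf (label_pmf K \<mu>))"
  using finite_cell_pmf by (simp add: label_pmf_def)

lemma expectation_cell_pmf:
  fixes g :: "nat \<Rightarrow> real"
  shows "measure_pmf.expectation (cell_pmf K \<mu>) g = (\<Sum>i<num_cells K. measure \<mu> (cell K i) * g i)"
proof -
  have "measure_pmf.expectation (cell_pmf K \<mu>) g = (\<Sum>i<num_cells K. g i * pmf (cell_pmf K \<mu>) i)"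
    using set_cell_pmf by (intro integral_measure_pmf_real) auto
  then show ?thesis by (simp add: pmf_cell_pmf mult.commute)
qed

lemma expectation_label_pmf:
  fixes g :: "point \<Rightarrow> real"
  shows "measure_pmf.expectation (label_pmf K \<mu>) g = (\<Sum>i<num_cells K. measure \<mu> (cell K i) * g (rep K i))"
  by (simp add: label_pmf_def expectation_cell_pmf)

lemma prob_bind_label_pmf:
  "measure_pmf.prob (bind_pmf (label_pmf K \<mu>) g) V =
    (\<Sum>i<num_cells K. measure \<mu> (cell K i) * measure_pmf.prob (g (rep K i)) V)"
  using expectation_label_pmf[of "\<lambda>x. measure_pmf.prob (g x) V"]
  by (simp add: measure_pmf_bind measure_measure_pmf_not_zero
      measure_pmf.measure_bind[where N = "count_space UNIV"] measure_pmf_in_subprob_algebra)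

end

text \<open>The induction must remember where earlier samples fell, hence the cylinder over the
  coordinates \<open>J\<close>. A draw splits the event by the cell of coordinate
  \<open>(s, n)\<close>, which is fresh because \<open>J\<close> only holds indices below
  \<open>n\<close>; the masses then multiply. Measurability is proved along with the value, since
  additivity over the cells needs it.\<close>

lemma measure_run_cylinder:
  fixes src :: "'s \<Rightarrow> point measure" and K :: clustering
  assumes src: "\<And>s. clustered_source d K (src s)"
  defines "M \<equiv> (\<Pi>\<^sub>M sn\<in>UNIV. src (fst sn) :: ('s \<times> nat \<Rightarrow> point) measure)"
  assumes J: "finite J" "J \<subseteq> {sn. snd sn < n}" and A: "\<And>j. j \<in> J \<Longrightarrow> A j \<in> sets (src (fst j))"
  shows "{xs \<in> space M. (\<forall>j\<in>J. xs j \<in> A j) \<and> run K xs t n \<in> V} \<in> sets M \<and>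
    measure M {xs \<in> space M. (\<forall>j\<in>J. xs j \<in> A j) \<and> run K xs t n \<in> V} =
    (\<Prod>j\<in>J. measure (src (fst j)) (A j)) *
      measure_pmf.prob (verdict_pmf K (\<lambda>s. label_pmf K (src s)) t) V"
  using J A
proof (induction t arbitrary: n J A)
  case (Output v)
  interpret product_prob_space "\<lambda>sn. src (fst sn)" "UNIV :: ('s \<times> nat) set"
    using src by (intro product_prob_spaceI) (simp add: clustered_source_def)
  have *: "{xs \<in> space M. \<forall>j\<in>J. xs j \<in> A j} = prod_emb UNIV (\<lambda>sn. src (fst sn)) J (Pi\<^sub>E J A)"
    using Output by (auto simp: prod_emb_def M_def space_PiM Pi_iff)
  have "measure M {xs \<in> space M. \<forall>j\<in>J. xs j \<in> A j} = (\<Prod>j\<in>J. measure (src (fst j)) (A j))"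
    unfolding * unfolding M_def using Output by (intro measure_PiM_emb) auto
  moreover have "{xs \<in> space M. \<forall>j\<in>J. xs j \<in> A j} \<in> sets M"
    unfolding * unfolding M_def using Output by (intro sets_PiM_I) auto
  ultimately show ?case by (cases "v \<in> V") auto
next
  case (Query x f)
  then show ?case by simp
next
  case (Draw s f)
  interpret S: clustered_source d K "src s" by (rule src)
  interpret product_prob_space "\<lambda>sn. src (fst sn)" "UNIV :: ('s \<times> nat) set"
    using src by (intro product_prob_spaceI) (simp add: clustered_source_def)
  \<comment> \<open>The cylinder extended by the event that the new point lies in cell
    \<open>i\<close>, on which the label is known to be \<open>rep K i\<close>.\<close>
  define A' where "A' i = A((s, n) := cell K i)" for i
  define B where "B i = {xs \<in> space M. (\<forall>j\<in>insert (s, n) J. xs j \<in> A' i j) \<and> run K xs (f (rep K i)) (Suc n) \<in> V}" for i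
  have notin: "(s, n) \<notin> J" using Draw.prems by auto
  have B: "B i \<in> sets M" "measure M (B i) = (\<Prod>j\<in>J. measure (src (fst j)) (A j)) * (measure (src s) (cell K i) *
      measure_pmf.prob (verdict_pmf K (\<lambda>s. label_pmf K (src s)) (f (rep K i))) V)" if i: "i < num_cells K" for i
  proof -
    have "insert (s, n) J \<subseteq> {sn. snd sn < Suc n}" using Draw.prems by auto
    moreover have "A' i j \<in> sets (src (fst j))" if "j \<in> insert (s, n) J" for j
      using that Draw.prems(3)[of j] S.cells[OF i] by (cases "j = (s, n)") (simp_all add: A'_def)
    ultimately have "B i \<in> sets M \<and> measure M (B i) = (\<Prod>j\<in>insert (s, n) J. measure (src (fst j)) (A' i j)) *
      measure_pmf.prob (verdict_pmf K (\<lambda>s. label_pmf K (src s)) (f (rep K i))) V"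
      unfolding B_def using Draw.prems by (intro Draw.IH) auto
    moreover have "(\<Prod>j\<in>insert (s, n) J. measure (src (fst j)) (A' i j)) =
      measure (src s) (cell K i) * (\<Prod>j\<in>J. measure (src (fst j)) (A j))"
      using notin Draw.prems by (auto simp: A'_def intro!: prod.cong)
    ultimately show "B i \<in> sets M" "measure M (B i) = (\<Prod>j\<in>J. measure (src (fst j)) (A j)) * (measure (src s) (cell K i) *
      measure_pmf.prob (verdict_pmf K (\<lambda>s. label_pmf K (src s)) (f (rep K i))) V)" by auto
  qed
  have eq: "{xs \<in> space M. (\<forall>j\<in>J. xs j \<in> A j) \<and> run K xs (Draw s f) n \<in> V} = (\<Union>i<num_cells K. B i)"
    (is "?L = ?R")
  proof (rule set_eqI)
    fix xs
    show "xs \<in> ?L \<longleftrightarrow> xs \<in> ?R"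
    proof (cases "xs \<in> space M")
      case True
      then have "xs (s, n) \<in> space (src (fst (s, n)))" unfolding M_def space_PiM by (rule PiE_mem) simp
      then have "xs (s, n) \<in> cube d" using S.space by simp
      then obtain i where i: "i < num_cells K" "xs (s, n) \<in> cell K i"
        using S.K by (auto simp: is_clustering_def)
      have lab: "label K (xs (s, n)) = rep K i"
        using is_clustering_cell_index[OF S.K i] by (simp add: label_def)
      have "xs \<in> B k \<longleftrightarrow> k = i \<and> (\<forall>j\<in>J. xs j \<in> A j) \<and> run K xs (f (rep K i)) (Suc n) \<in> V" if "k < num_cells K" for k
      proof (cases "k = i")
        case k: True
        have "(\<forall>j\<in>J. xs j \<in> A' i j) \<longleftrightarrow> (\<forall>j\<in>J. xs j \<in> A j)"
          using notin by (auto simp: A'_def)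
        then show ?thesis using True i k by (auto simp: B_def A'_def)
      next
        case False
        then have "xs (s, n) \<notin> cell K k"
          using is_clustering_cell_index[OF S.K] that i by metis
        then show ?thesis using False by (simp add: B_def A'_def)
      qed
      then have "xs \<in> ?R \<longleftrightarrow> (\<forall>j\<in>J. xs j \<in> A j) \<and> run K xs (f (rep K i)) (Suc n) \<in> V" using i by auto
      then show ?thesis using True by (simp add: lab)
    next
      case False
      then show ?thesis by (auto simp: B_def)
    qed
  qed
  have disj: "disjoint_family_on B {..<num_cells K}"
  proof (unfold disjoint_family_on_def, intro ballI impI)
    fix i j assume ij: "i \<in> {..<num_cells K}" "j \<in> {..<num_cells K}" "i \<noteq> j"
    then have "cell K i \<inter> cell K j = {}" using S.K by (auto simp: is_clustering_def disjoint_family_on_def)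
    then show "B i \<inter> B j = {}" by (auto simp: B_def A'_def)
  qed
  have "measure M (\<Union>i<num_cells K. B i) = (\<Sum>i<num_cells K. measure M (B i))"
    using B(1) disj unfolding M_def by (intro P.finite_measure_finite_Union) auto
  moreover have "(\<Union>i<num_cells K. B i) \<in> sets M" using B(1) by auto
  ultimately show ?case unfolding eq
    by (simp add: B(2) S.prob_bind_label_pmf sum_distrib_left)
qed

text \<open>For a strategy that ignores the seed, each verdict event is the full seed space times
  the event of \<open>measure_run_cylinder\<close> with \<open>J = {}\<close>, hence measurable even
  before completion.\<close>

theorem outcome_deterministic:
  fixes src :: "'s \<Rightarrow> point measure"
  assumes src: "\<And>s. clustered_source d K (src s)"
  shows "outcome (\<lambda>_. t) K \<in> run_space src \<rightarrow>\<^sub>M count_space UNIV" (is ?meas)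
    and "outcome_prob (\<lambda>_. t) K src V = measure_pmf.prob (verdict_pmf K (\<lambda>s. label_pmf K (src s)) t) V" (is ?prob)
proof -
  define M where "M = (\<Pi>\<^sub>M sn\<in>UNIV. src (fst sn) :: ('s \<times> nat \<Rightarrow> point) measure)"
  have seed: "prob_space seed_space" unfolding seed_space_def
    by (intro prob_space_PiM prob_space_uniform_measure) auto
  have M: "prob_space M" unfolding M_def
    using src by (intro prob_space_PiM) (simp add: clustered_source_def)
  interpret pt: prob_space M by (rule M)
  interpret seed: prob_space seed_space by (rule seed)
  interpret PS: pair_prob_space seed_space M ..
  define E where "E V = {xs \<in> space M. run K xs t 0 \<in> V}" for V
  have E: "E V \<in> sets M" "measure M (E V) = measure_pmf.prob (verdict_pmf K (\<lambda>s. label_pmf K (src s)) t) V" for V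
    using measure_run_cylinder[where src = src and d = d and K = K, OF src, where J = "{}" and n = 0 and A = "\<lambda>_. {}" and t = t and V = V] by (auto simp: M_def E_def)
  have eq: "{z \<in> space (run_space src). outcome (\<lambda>_. t) K z \<in> V} = space seed_space \<times> E V" for V
    by (auto simp: run_space_def outcome_def space_pair_measure E_def M_def)
  have meas: "space seed_space \<times> E V \<in> sets (seed_space \<Otimes>\<^sub>M M)" for V using E(1) by auto
  have "outcome (\<lambda>_. t) K -` {v} \<inter> space (run_space src) \<in> sets (run_space src)" for v
  proof -
    have "outcome (\<lambda>_. t) K -` {v} \<inter> space (run_space src) = {z \<in> space (run_space src). outcome (\<lambda>_. t) K z \<in> {v}}" by auto
    then show ?thesis unfolding eq using meas[of "{v}"] by (auto simp: run_space_def M_def)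
  qed
  moreover have "finite (UNIV :: verdict set)"
    by (rule finite_subset[of _ "{Accept, Reject, ClusterReject}"]) (auto intro: verdict.exhaust)
  ultimately show ?meas by (simp add: measurable_count_space_eq2)
  have "measure (run_space src) (space seed_space \<times> E V) = measure (seed_space \<Otimes>\<^sub>M M) (space seed_space \<times> E V)"
    using meas[of V] by (simp add: run_space_def M_def)
  also have "\<dots> = measure seed_space (space seed_space) * measure M (E V)"
    using E(1)[of V] by (simp add: measure_def pt.emeasure_pair_measure_Times enn2real_mult)
  finally show ?prob unfolding outcome_prob_def eq using E(2) seed.prob_space by simp
qed

section \<open>Transport along trees\<close>

text \<open>The push-forward along \<open>\<phi>\<close> of the mass \<open>p\<close> on
  \<open>A\<close>.\<close>

definition fiber_sum :: "'c set \<Rightarrow> ('c \<Rightarrow> 'b) \<Rightarrow> ('c \<Rightarrow> real) \<Rightarrow> 'b \<Rightarrow> real" where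
  "fiber_sum A \<phi> p b = (\<Sum>c | c \<in> A \<and> \<phi> c = b. p c)"

lemma sum_fiber_sum: "finite A \<Longrightarrow> (\<Sum>b\<in>\<phi> ` A. fiber_sum A \<phi> p b) = sum p A"
  unfolding fiber_sum_def by (rule sum.image_gen[symmetric])

lemma fiber_sum_nonneg: "(\<And>c. c \<in> A \<Longrightarrow> 0 \<le> p c) \<Longrightarrow> 0 \<le> fiber_sum A \<phi> p b"
  unfolding fiber_sum_def by (intro sum_nonneg) auto

text \<open>Within each fibre, mass is matched in proportion to \<open>p c * q c'\<close>, scaled so
  that the smaller of the two fibre masses is used up. What remains of \<open>p\<close> is the
  surplus that is passed on to the next coarser level.\<close>

lemma match_fibers:
  fixes p q :: "'c \<Rightarrow> real" and \<phi> :: "'c \<Rightarrow> 'b"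
  assumes fin: "finite A" and p: "\<forall>c\<in>A. 0 \<le> p c" and q: "\<forall>c\<in>A. 0 \<le> q c"
  shows "\<exists>g. (\<forall>c\<in>A. \<forall>c'\<in>A. 0 \<le> g c c') \<and> (\<forall>c c'. \<phi> c \<noteq> \<phi> c' \<longrightarrow> g c c' = 0) \<and>
    (\<forall>c\<in>A. (\<Sum>c'\<in>A. g c c') \<le> p c) \<and> (\<forall>c'\<in>A. (\<Sum>c\<in>A. g c c') \<le> q c') \<and>
    (\<forall>b. fiber_sum A \<phi> (\<lambda>c. p c - (\<Sum>c'\<in>A. g c c')) b =
      fiber_sum A \<phi> p b - min (fiber_sum A \<phi> p b) (fiber_sum A \<phi> q b))"
proof -
  define P Q where "P = fiber_sum A \<phi> p" and "Q = fiber_sum A \<phi> q"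
  have PQ: "0 \<le> P b" "0 \<le> Q b" for b unfolding P_def Q_def using p q by (auto intro: fiber_sum_nonneg)
  \<comment> \<open>If a fibre has no mass on one side, division by zero makes this 0, which is the
    right value.\<close>
  define s where "s b = min (P b) (Q b) / (P b * Q b)" for b
  define g where "g c c' = (if \<phi> c = \<phi> c' then p c * q c' * s (\<phi> c) else 0)" for c c'
  have s0: "0 \<le> s b" for b using PQ by (simp add: s_def)
  have sQ: "s b * Q b \<le> 1" "s b * P b \<le> 1" "P b * (s b * Q b) = min (P b) (Q b)" for b
    using PQ[of b] by (auto simp: s_def min_def divide_simps)
  have g1: "(\<Sum>c'\<in>A. g c c') = p c * (s (\<phi> c) * Q (\<phi> c))" for c
  proof -
    have "(\<Sum>c'\<in>A. g c c') = (\<Sum>c' | c' \<in> A \<and> \<phi> c' = \<phi> c. p c * s (\<phi> c) * q c')"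
      using fin by (subst sum.inter_filter[OF fin]) (auto simp: g_def intro!: sum.cong)
    then show ?thesis by (simp add: Q_def fiber_sum_def sum_distrib_left mult_ac)
  qed
  have g2: "(\<Sum>c\<in>A. g c c') = q c' * (s (\<phi> c') * P (\<phi> c'))" for c'
  proof -
    have "(\<Sum>c\<in>A. g c c') = (\<Sum>c | c \<in> A \<and> \<phi> c = \<phi> c'. q c' * s (\<phi> c') * p c)"
      using fin by (subst sum.inter_filter[OF fin]) (auto simp: g_def intro!: sum.cong)
    then show ?thesis by (simp add: P_def fiber_sum_def sum_distrib_left mult_ac)
  qed
  show ?thesis
  proof (intro exI[of _ g] conjI ballI allI impI)
    fix b
    have "fiber_sum A \<phi> (\<lambda>c. p c - (\<Sum>c'\<in>A. g c c')) b = (\<Sum>c | c \<in> A \<and> \<phi> c = b. p c - p c * (s b * Q b))"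
      unfolding fiber_sum_def by (intro sum.cong) (auto simp: g1)
    also have "\<dots> = P b - P b * (s b * Q b)"
      by (simp add: P_def fiber_sum_def sum_subtractf sum_distrib_right)
    finally show "fiber_sum A \<phi> (\<lambda>c. p c - (\<Sum>c'\<in>A. g c c')) b =
      fiber_sum A \<phi> p b - min (fiber_sum A \<phi> p b) (fiber_sum A \<phi> q b)"
      unfolding sQ(3) by (simp only: P_def Q_def)
  next
    fix c assume "c \<in> A"
    then show "(\<Sum>c'\<in>A. g c c') \<le> p c" unfolding g1 using p sQ by (intro mult_left_le) auto
  next
    fix c assume "c \<in> A"
    then show "(\<Sum>c'\<in>A. g c' c) \<le> q c" unfolding g2 using q sQ by (intro mult_left_le) auto
  next
    fix c c' assume "c \<in> A" "c' \<in> A"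
    then show "0 \<le> g c c'" using p q s0 by (simp add: g_def)
  next
    fix c c' assume "\<phi> c \<noteq> \<phi> c'"
    then show "g c c' = 0" by (simp add: g_def)
  qed
qed

text \<open>
  Greedy transport along a tree: mass is matched within the clusters of level \<open>L\<close>, and the
  remaining surplus is passed on to level \<open>L - 1\<close>.
\<close>

lemma tree_coupling:
  fixes p q :: "'c \<Rightarrow> real" and anc :: "nat \<Rightarrow> 'c \<Rightarrow> 'b" and D :: "'c \<Rightarrow> 'c \<Rightarrow> real"
  assumes fin: "finite A" and p: "\<forall>c\<in>A. 0 \<le> p c" and q: "\<forall>c\<in>A. 0 \<le> q c"
    and total: "sum p A = sum q A"
    and root: "\<And>c c'. c \<in> A \<Longrightarrow> c' \<in> A \<Longrightarrow> anc 0 c = anc 0 c'"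
    and refines: "\<And>l l' c c'. l' \<le> l \<Longrightarrow> l \<le> L \<Longrightarrow> anc l c = anc l c' \<Longrightarrow> anc l' c = anc l' c'"
    and D: "\<And>l c c'. l \<le> L \<Longrightarrow> c \<in> A \<Longrightarrow> c' \<in> A \<Longrightarrow> anc l c = anc l c' \<Longrightarrow> D c c' \<le> (1 / 2) ^ l"
  shows "\<exists>g. (\<forall>c\<in>A. \<forall>c'\<in>A. 0 \<le> g c c') \<and> (\<forall>c\<in>A. (\<Sum>c'\<in>A. g c c') = p c) \<and>
    (\<forall>c'\<in>A. (\<Sum>c\<in>A. g c c') = q c') \<and>
    (\<Sum>c\<in>A. \<Sum>c'\<in>A. g c c' * D c c') \<le> (1 / 2) ^ L * sum p A +
      (\<Sum>l=1..L. (1 / 2) ^ l * (\<Sum>b\<in>anc l ` A. \<bar>fiber_sum A (anc l) p b - fiber_sum A (anc l) q b\<bar>))"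
  using p q total refines D
proof (induction L arbitrary: p q)
  case 0
  obtain g where g0: "\<forall>c\<in>A. \<forall>c'\<in>A. 0 \<le> g c c'" "\<forall>c c'. anc 0 c \<noteq> anc 0 c' \<longrightarrow> g c c' = 0"
    "\<forall>c\<in>A. (\<Sum>c'\<in>A. g c c') \<le> p c" "\<forall>c'\<in>A. (\<Sum>c\<in>A. g c c') \<le> q c'"
    "\<forall>b. fiber_sum A (anc 0) (\<lambda>c. p c - (\<Sum>c'\<in>A. g c c')) b =
      fiber_sum A (anc 0) p b - min (fiber_sum A (anc 0) p b) (fiber_sum A (anc 0) q b)"
    using match_fibers[where p = p and q = q and \<phi> = "anc 0", OF fin 0(1,2)] by (elim exE conjE) (rule that)
  note g = g0[rule_format]
  \<comment> \<open>At the root there is a single fibre and both totals agree, so nothing is left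
    over.\<close>
  have one: "fiber_sum A (anc 0) f (anc 0 c) = sum f A" if "c \<in> A" for f c
    unfolding fiber_sum_def using root[OF _ that] by (intro sum.cong) auto
  have "(\<Sum>c\<in>A. p c - (\<Sum>c'\<in>A. g c c')) = 0"
  proof (cases "A = {}")
    case False
    then obtain c where c: "c \<in> A" by auto
    from g(5)[of "anc 0 c"] show ?thesis unfolding one[OF c] using 0(3) by simp
  qed simp
  then have z: "(\<Sum>c\<in>A. p c - (\<Sum>c'\<in>A. g c c')) = 0" "(\<Sum>c'\<in>A. q c' - (\<Sum>c\<in>A. g c c')) = 0"
    using 0(3) sum.swap[of "\<lambda>c c'. g c' c" A A] by (simp_all add: sum_subtractf)
  have gp: "(\<Sum>c'\<in>A. g c c') = p c" if "c \<in> A" for c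
    using z(1) g(3) that fin by (subst (asm) sum_nonneg_eq_0_iff) auto
  have gq: "(\<Sum>c\<in>A. g c c') = q c'" if "c' \<in> A" for c'
    using z(2) g(4) that fin by (subst (asm) sum_nonneg_eq_0_iff) auto
  have "(\<Sum>c\<in>A. \<Sum>c'\<in>A. g c c' * D c c') \<le> (\<Sum>c\<in>A. \<Sum>c'\<in>A. g c c' * 1)"
  proof (intro sum_mono mult_left_mono)
    fix c c' assume c: "c \<in> A" "c' \<in> A"
    show "D c c' \<le> 1" using 0(5)[of 0 c c', OF _ c root[OF c]] by simp
  qed (rule g(1))
  also have "\<dots> = sum p A" by (simp add: gp)
  finally show ?case using g(1) gp gq by (intro exI[of _ g]) auto
next
  case (Suc L)
  let ?\<phi> = "anc (Suc L)"
  obtain g where g0: "\<forall>c\<in>A. \<forall>c'\<in>A. 0 \<le> g c c'" "\<forall>c c'. ?\<phi> c \<noteq> ?\<phi> c' \<longrightarrow> g c c' = 0"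
    "\<forall>c\<in>A. (\<Sum>c'\<in>A. g c c') \<le> p c" "\<forall>c'\<in>A. (\<Sum>c\<in>A. g c c') \<le> q c'"
    "\<forall>b. fiber_sum A (?\<phi>) (\<lambda>c. p c - (\<Sum>c'\<in>A. g c c')) b =
      fiber_sum A (?\<phi>) p b - min (fiber_sum A (?\<phi>) p b) (fiber_sum A (?\<phi>) q b)"
    using match_fibers[where p = p and q = q and \<phi> = ?\<phi>, OF fin Suc.prems(1,2)] by (elim exE conjE) (rule that)
  note g = g0[rule_format]
  define p' q' where "p' c = p c - (\<Sum>c'\<in>A. g c c')" and "q' c' = q c' - (\<Sum>c\<in>A. g c c')" for c c'
  have p': "\<forall>c\<in>A. 0 \<le> p' c" and q': "\<forall>c\<in>A. 0 \<le> q' c"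
    using g0(3,4) by (simp_all add: p'_def q'_def)
  have total': "sum p' A = sum q' A" using Suc.prems(3) sum.swap[of "\<lambda>c c'. g c' c" A A]
    by (simp add: p'_def q'_def sum_subtractf)
  \<comment> \<open>\<open>g\<close> moves mass only inside fibres of the finer level, hence inside
    fibres of every coarser one; the differences in the induction hypothesis are therefore still
    those of \<open>p\<close> and \<open>q\<close>.\<close>
  have diff: "fiber_sum A (anc l) p' b - fiber_sum A (anc l) q' b = fiber_sum A (anc l) p b - fiber_sum A (anc l) q b"
    if l: "l \<le> L" for l b
  proof -
    let ?F = "{c. c \<in> A \<and> anc l c = b}"
    have F: "?F \<subseteq> A" "finite ?F" using fin by auto
    have z: "g c c' = 0" if "c \<in> ?F \<and> c' \<notin> ?F \<or> c \<notin> ?F \<and> c' \<in> ?F" "c \<in> A" "c' \<in> A" for c c'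
      using that Suc.prems(4)[of l "Suc L" c c'] l by (intro g(2)) auto
    have "(\<Sum>c\<in>?F. \<Sum>c'\<in>A. g c c') = (\<Sum>c\<in>?F. \<Sum>c'\<in>?F. g c c')"
      using z F by (intro sum.cong sum.mono_neutral_right fin) auto
    moreover have "(\<Sum>c'\<in>?F. \<Sum>c\<in>A. g c c') = (\<Sum>c'\<in>?F. \<Sum>c\<in>?F. g c c')"
      using z F by (intro sum.cong sum.mono_neutral_right fin) auto
    ultimately have "(\<Sum>c\<in>?F. \<Sum>c'\<in>A. g c c') = (\<Sum>c'\<in>?F. \<Sum>c\<in>A. g c c')"
      by (subst (asm) (2) sum.swap) simp
    then show ?thesis by (simp add: fiber_sum_def p'_def q'_def sum_subtractf)
  qed
  \<comment> \<open>With equal totals the surplus is half the L1 distance. This half turns the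
    factor (1/2)^L of the induction hypothesis into the coefficient of level
    \<open>Suc L\<close>.\<close>
  have sp': "sum p' A = 1 / 2 * (\<Sum>b\<in>?\<phi> ` A. \<bar>fiber_sum A ?\<phi> p b - fiber_sum A ?\<phi> q b\<bar>)"
  proof -
    have "(\<Sum>b\<in>?\<phi> ` A. \<bar>fiber_sum A ?\<phi> p b - fiber_sum A ?\<phi> q b\<bar>) =
      (\<Sum>b\<in>?\<phi> ` A. 2 * fiber_sum A ?\<phi> p' b - (fiber_sum A ?\<phi> p b - fiber_sum A ?\<phi> q b))"
      unfolding p'_def g(5) by (intro sum.cong) auto
    also have "\<dots> = 2 * sum p' A"
      using Suc.prems(3) by (simp add: sum_subtractf sum_fiber_sum[OF fin] flip: sum_distrib_left)
    finally show ?thesis by simp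
  qed
  obtain h where h: "\<forall>c\<in>A. \<forall>c'\<in>A. 0 \<le> h c c'" "\<forall>c\<in>A. (\<Sum>c'\<in>A. h c c') = p' c"
    "\<forall>c'\<in>A. (\<Sum>c\<in>A. h c c') = q' c'"
    "(\<Sum>c\<in>A. \<Sum>c'\<in>A. h c c' * D c c') \<le> (1 / 2) ^ L * sum p' A +
      (\<Sum>l=1..L. (1 / 2) ^ l * (\<Sum>b\<in>anc l ` A. \<bar>fiber_sum A (anc l) p' b - fiber_sum A (anc l) q' b\<bar>))"
  proof -
    have "\<exists>h. (\<forall>c\<in>A. \<forall>c'\<in>A. 0 \<le> h c c') \<and> (\<forall>c\<in>A. (\<Sum>c'\<in>A. h c c') = p' c) \<and>
      (\<forall>c'\<in>A. (\<Sum>c\<in>A. h c c') = q' c') \<and>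
      (\<Sum>c\<in>A. \<Sum>c'\<in>A. h c c' * D c c') \<le> (1 / 2) ^ L * sum p' A +
      (\<Sum>l=1..L. (1 / 2) ^ l * (\<Sum>b\<in>anc l ` A. \<bar>fiber_sum A (anc l) p' b - fiber_sum A (anc l) q' b\<bar>))"
    proof (rule Suc.IH[OF p' q' total'])
      show "anc l' c = anc l' c'" if "l' \<le> l" "l \<le> L" "anc l c = anc l c'" for l l' c c'
        using Suc.prems(4)[of l' l c c'] that by simp
      show "D c c' \<le> (1 / 2) ^ l" if "l \<le> L" "c \<in> A" "c' \<in> A" "anc l c = anc l c'" for l c c'
        using Suc.prems(5)[of l c c'] that by simp
    qed
    then show ?thesis by (elim exE conjE) (rule that)
  qed
  have "(\<Sum>c\<in>A. \<Sum>c'\<in>A. g c c' * D c c') \<le> (\<Sum>c\<in>A. \<Sum>c'\<in>A. g c c' * (1 / 2) ^ Suc L)"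
  proof (intro sum_mono)
    fix c c' assume "c \<in> A" "c' \<in> A"
    then show "g c c' * D c c' \<le> g c c' * (1 / 2) ^ Suc L"
      using g(1,2)[of c c'] Suc.prems(5)[of "Suc L" c c']
      by (cases "?\<phi> c = ?\<phi> c'") (auto intro: mult_left_mono simp del: power_Suc)
  qed
  also have "\<dots> = (1 / 2) ^ Suc L * (\<Sum>c\<in>A. \<Sum>c'\<in>A. g c c')"
    by (simp add: sum_distrib_left sum_distrib_right mult_ac)
  also have "\<dots> \<le> (1 / 2) ^ Suc L * sum p A"
    using g(3) by (intro mult_left_mono sum_mono) auto
  finally have gD: "(\<Sum>c\<in>A. \<Sum>c'\<in>A. g c c' * D c c') \<le> (1 / 2) ^ Suc L * sum p A" .
  have hD: "(\<Sum>c\<in>A. \<Sum>c'\<in>A. h c c' * D c c') \<le>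
    (1 / 2) ^ Suc L * (\<Sum>b\<in>?\<phi> ` A. \<bar>fiber_sum A ?\<phi> p b - fiber_sum A ?\<phi> q b\<bar>) +
    (\<Sum>l=1..L. (1 / 2) ^ l * (\<Sum>b\<in>anc l ` A. \<bar>fiber_sum A (anc l) p b - fiber_sum A (anc l) q b\<bar>))"
    using h(4) by (simp add: sp' diff)
  show ?case
  proof (intro exI[of _ "\<lambda>c c'. g c c' + h c c'"] conjI ballI)
    show "(\<Sum>c\<in>A. \<Sum>c'\<in>A. (g c c' + h c c') * D c c') \<le> (1 / 2) ^ Suc L * sum p A +
      (\<Sum>l=1..Suc L. (1 / 2) ^ l * (\<Sum>b\<in>anc l ` A. \<bar>fiber_sum A (anc l) p b - fiber_sum A (anc l) q b\<bar>))"
      using gD hD by (simp add: distrib_right sum.distrib)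
  qed (use g h in \<open>auto simp: sum.distrib p'_def q'_def\<close>)
qed

text \<open>
  A matching \<open>w\<close> of the cells of two partitions is realized by the density \<open>w i j / (\<mu> (A i) * \<nu> (B j))\<close>
  on \<open>A i \<times> B j\<close>; the summand vanishes if one of the cells is a null set.
\<close>

lemma EMD_le_matching:
  fixes A :: "'i \<Rightarrow> point set" and B :: "'j \<Rightarrow> point set"
  assumes mu: "prob_space \<mu>" and nu: "prob_space \<nu>" and fin: "finite I" "finite J"
    and A: "\<And>i. i \<in> I \<Longrightarrow> A i \<in> sets \<mu>" "disjoint_family_on A I" "(\<Union>i\<in>I. A i) = space \<mu>"
    and B: "\<And>j. j \<in> J \<Longrightarrow> B j \<in> sets \<nu>" "disjoint_family_on B J" "(\<Union>j\<in>J. B j) = space \<nu>"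
    and w: "\<And>i j. i \<in> I \<Longrightarrow> j \<in> J \<Longrightarrow> 0 \<le> w i j"
    and wA: "\<And>i. i \<in> I \<Longrightarrow> (\<Sum>j\<in>J. w i j) = measure \<mu> (A i)"
    and wB: "\<And>j. j \<in> J \<Longrightarrow> (\<Sum>i\<in>I. w i j) = measure \<nu> (B j)"
    and k: "\<And>i j x y. i \<in> I \<Longrightarrow> j \<in> J \<Longrightarrow> x \<in> A i \<Longrightarrow> y \<in> B j \<Longrightarrow> w i j * lp_dist d p x y \<le> k i j"
    and k0: "\<And>i j. i \<in> I \<Longrightarrow> j \<in> J \<Longrightarrow> 0 \<le> k i j"
  shows "EMD d p \<mu> \<nu> \<le> (\<Sum>i\<in>I. \<Sum>j\<in>J. k i j)"
proof -
  interpret mu: prob_space \<mu> by fact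
  interpret nu: prob_space \<nu> by fact
  interpret pair_prob_space \<mu> \<nu> ..
  define a b where "a i = measure \<mu> (A i)" and "b j = measure \<nu> (B j)" for i j
  define f where "f c = (\<lambda>z :: point \<times> point. \<Sum>i\<in>I. \<Sum>j\<in>J. ennreal (c i j / (a i * b j)) * indicator (A i \<times> B j) z)" for c
  have ab: "0 \<le> a i" "0 \<le> b j" for i j by (auto simp: a_def b_def)
  have rect: "A i \<times> B j \<in> sets (\<mu> \<Otimes>\<^sub>M \<nu>)" if "i \<in> I" "j \<in> J" for i j using that A B by auto
  have f_meas [measurable]: "f c \<in> borel_measurable (\<mu> \<Otimes>\<^sub>M \<nu>)" for c
    unfolding f_def using rect
    by (intro borel_measurable_sum borel_measurable_times_ennreal borel_measurable_const borel_measurable_indicator) auto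
  have f_int: "(\<integral>\<^sup>+z. f c z * indicator (X \<times> Y) z \<partial>(\<mu> \<Otimes>\<^sub>M \<nu>)) =
      (\<Sum>i\<in>I. \<Sum>j\<in>J. ennreal (c i j / (a i * b j) * (measure \<mu> (A i \<inter> X) * measure \<nu> (B j \<inter> Y))))"
    if X: "X \<in> sets \<mu>" and Y: "Y \<in> sets \<nu>" and c: "\<And>i j. i \<in> I \<Longrightarrow> j \<in> J \<Longrightarrow> 0 \<le> c i j" for c X Y
  proof -
    have "f c z * indicator (X \<times> Y) z =
        (\<Sum>i\<in>I. \<Sum>j\<in>J. ennreal (c i j / (a i * b j)) * indicator ((A i \<inter> X) \<times> (B j \<inter> Y)) z)" for z
      unfolding f_def sum_distrib_right by (intro sum.cong refl) (auto simp: indicator_def)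
    then have "(\<integral>\<^sup>+z. f c z * indicator (X \<times> Y) z \<partial>(\<mu> \<Otimes>\<^sub>M \<nu>)) =
       (\<integral>\<^sup>+z. (\<Sum>i\<in>I. \<Sum>j\<in>J. ennreal (c i j / (a i * b j)) * indicator ((A i \<inter> X) \<times> (B j \<inter> Y)) z) \<partial>(\<mu> \<Otimes>\<^sub>M \<nu>))"
      by simp
    also have "\<dots> = (\<Sum>i\<in>I. \<Sum>j\<in>J. \<integral>\<^sup>+z. ennreal (c i j / (a i * b j)) * indicator ((A i \<inter> X) \<times> (B j \<inter> Y)) z \<partial>(\<mu> \<Otimes>\<^sub>M \<nu>))"
      using A B X Y by (subst nn_integral_sum, force, intro sum.cong refl, subst nn_integral_sum) auto
    also have "\<dots> = (\<Sum>i\<in>I. \<Sum>j\<in>J. ennreal (c i j / (a i * b j)) * emeasure (\<mu> \<Otimes>\<^sub>M \<nu>) ((A i \<inter> X) \<times> (B j \<inter> Y)))"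
      using A B X Y by (intro sum.cong refl nn_integral_cmult_indicator) auto
    also have "\<dots> = (\<Sum>i\<in>I. \<Sum>j\<in>J. ennreal (c i j / (a i * b j) * (measure \<mu> (A i \<inter> X) * measure \<nu> (B j \<inter> Y))))"
    proof (intro sum.cong refl)
      fix i j assume ij: "i \<in> I" "j \<in> J"
      have "emeasure (\<mu> \<Otimes>\<^sub>M \<nu>) ((A i \<inter> X) \<times> (B j \<inter> Y)) = emeasure \<mu> (A i \<inter> X) * emeasure \<nu> (B j \<inter> Y)"
        using A(1)[OF ij(1)] B(1)[OF ij(2)] X Y by (intro nu.emeasure_pair_measure_Times) auto
      moreover have "0 \<le> c i j / (a i * b j)" using c[OF ij] ab by simp
      ultimately show "ennreal (c i j / (a i * b j)) * emeasure (\<mu> \<Otimes>\<^sub>M \<nu>) ((A i \<inter> X) \<times> (B j \<inter> Y)) =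
        ennreal (c i j / (a i * b j) * (measure \<mu> (A i \<inter> X) * measure \<nu> (B j \<inter> Y)))"
        by (simp only: mu.emeasure_eq_measure nu.emeasure_eq_measure ennreal_mult measure_nonneg mult_nonneg_nonneg)
    qed
    finally show ?thesis .
  qed
  define \<pi> where "\<pi> = density (\<mu> \<Otimes>\<^sub>M \<nu>) (f w)"
  \<comment> \<open>A null cell receives no weight, so the value 0 of a division by zero in the
    density is right.\<close>
  have w0: "w i j = 0" if "i \<in> I" "j \<in> J" "a i = 0 \<or> b j = 0" for i j
  proof -
    have "(\<Sum>j\<in>J. w i j) = 0 \<or> (\<Sum>i\<in>I. w i j) = 0" using that wA wB by (simp add: a_def b_def)
    then show ?thesis using that w fin by (subst (asm) (1 2) sum_nonneg_eq_0_iff) auto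
  qed
  have pi_rect: "emeasure \<pi> (X \<times> Y) =
      ennreal (\<Sum>i\<in>I. \<Sum>j\<in>J. w i j / (a i * b j) * (measure \<mu> (A i \<inter> X) * measure \<nu> (B j \<inter> Y)))"
    if X: "X \<in> sets \<mu>" and Y: "Y \<in> sets \<nu>" for X Y
  proof -
    have "emeasure \<pi> (X \<times> Y) = (\<integral>\<^sup>+z. f w z * indicator (X \<times> Y) z \<partial>(\<mu> \<Otimes>\<^sub>M \<nu>))"
      unfolding \<pi>_def using X Y by (subst emeasure_density) auto
    then show ?thesis using f_int[OF X Y, of w] w ab
      by (simp add: sum_nonneg)
  qed
  have Asub: "A i \<inter> space \<mu> = A i" if "i \<in> I" for i using A(3) that by auto
  have Bsub: "B j \<inter> space \<nu> = B j" if "j \<in> J" for j using B(3) that by auto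
  have distr_fst: "distr \<pi> \<mu> fst = \<mu>"
  proof (rule measure_eqI)
    fix X assume "X \<in> sets (distr \<pi> \<mu> fst)"
    then have X: "X \<in> sets \<mu>" by simp
    have eq: "fst -` X \<inter> space \<pi> = X \<times> space \<nu>"
      using sets.sets_into_space[OF X] by (auto simp: \<pi>_def space_pair_measure)
    have "(\<Sum>j\<in>J. w i j / (a i * b j) * (measure \<mu> (A i \<inter> X) * measure \<nu> (B j \<inter> space \<nu>))) = measure \<mu> (A i \<inter> X)"
      if i: "i \<in> I" for i
    proof -
      have "(\<Sum>j\<in>J. w i j / (a i * b j) * (measure \<mu> (A i \<inter> X) * measure \<nu> (B j \<inter> space \<nu>))) =
         (\<Sum>j\<in>J. w i j * (measure \<mu> (A i \<inter> X) / a i))"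
        using w0[OF i] by (intro sum.cong refl) (auto simp: Bsub b_def[symmetric])
      also have "\<dots> = a i * (measure \<mu> (A i \<inter> X) / a i)" by (simp only: wA[OF i] a_def flip: sum_distrib_right)
      also have "\<dots> = measure \<mu> (A i \<inter> X)"
        using mu.finite_measure_mono[of "A i \<inter> X" "A i"] A(1)[OF i]
        by (cases "a i = 0") (auto simp: a_def measure_le_0_iff)
      finally show ?thesis .
    qed
    then have "emeasure \<pi> (X \<times> space \<nu>) = ennreal (\<Sum>i\<in>I. measure \<mu> (A i \<inter> X))"
      using pi_rect[OF X sets.top] by simp
    also have "(\<Sum>i\<in>I. measure \<mu> (A i \<inter> X)) = measure \<mu> (\<Union>i\<in>I. A i \<inter> X)"
      using A X fin by (intro mu.finite_measure_finite_Union[symmetric]) (auto simp: disjoint_family_on_def)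
    also have "(\<Union>i\<in>I. A i \<inter> X) = X" using A(3) sets.sets_into_space[OF X] by auto
    finally show "emeasure (distr \<pi> \<mu> fst) X = emeasure \<mu> X"
      using X by (subst emeasure_distr) (auto simp: eq mu.emeasure_eq_measure, simp add: \<pi>_def)
  qed simp
  have distr_snd: "distr \<pi> \<nu> snd = \<nu>"
  proof (rule measure_eqI)
    fix Y assume "Y \<in> sets (distr \<pi> \<nu> snd)"
    then have Y: "Y \<in> sets \<nu>" by simp
    have eq: "snd -` Y \<inter> space \<pi> = space \<mu> \<times> Y"
      using sets.sets_into_space[OF Y] by (auto simp: \<pi>_def space_pair_measure)
    have "(\<Sum>i\<in>I. w i j / (a i * b j) * (measure \<mu> (A i \<inter> space \<mu>) * measure \<nu> (B j \<inter> Y))) = measure \<nu> (B j \<inter> Y)"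
      if j: "j \<in> J" for j
    proof -
      have "(\<Sum>i\<in>I. w i j / (a i * b j) * (measure \<mu> (A i \<inter> space \<mu>) * measure \<nu> (B j \<inter> Y))) =
         (\<Sum>i\<in>I. w i j * (measure \<nu> (B j \<inter> Y) / b j))"
        using w0[OF _ j] by (intro sum.cong refl) (auto simp: Asub a_def[symmetric])
      also have "\<dots> = b j * (measure \<nu> (B j \<inter> Y) / b j)" by (simp only: wB[OF j] b_def flip: sum_distrib_right)
      also have "\<dots> = measure \<nu> (B j \<inter> Y)"
        using nu.finite_measure_mono[of "B j \<inter> Y" "B j"] B(1)[OF j]
        by (cases "b j = 0") (auto simp: b_def measure_le_0_iff)
      finally show ?thesis .
    qed
    then have "emeasure \<pi> (space \<mu> \<times> Y) = ennreal (\<Sum>j\<in>J. measure \<nu> (B j \<inter> Y))"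
      using pi_rect[OF sets.top Y] by (subst (asm) sum.swap) simp
    also have "(\<Sum>j\<in>J. measure \<nu> (B j \<inter> Y)) = measure \<nu> (\<Union>j\<in>J. B j \<inter> Y)"
      using B Y fin by (intro nu.finite_measure_finite_Union[symmetric]) (auto simp: disjoint_family_on_def)
    also have "(\<Union>j\<in>J. B j \<inter> Y) = Y" using B(3) sets.sets_into_space[OF Y] by auto
    finally show "emeasure (distr \<pi> \<nu> snd) Y = emeasure \<nu> Y"
      using Y by (subst emeasure_distr) (auto simp: eq nu.emeasure_eq_measure, simp add: \<pi>_def)
  qed simp
  have coupling: "\<pi> \<in> couplings \<mu> \<nu>"
    using distr_fst distr_snd by (simp add: couplings_def) (simp add: \<pi>_def)
  have lp0: "0 \<le> lp_dist d p x y" for x y by (simp add: lp_dist_def)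
  let ?h = "\<lambda>(x, y). lp_dist d p x y"
  have "(\<integral>z. ?h z \<partial>\<pi>) \<le> (\<Sum>i\<in>I. \<Sum>j\<in>J. k i j)"
  proof (cases "integrable \<pi> ?h")
    \<comment> \<open>The distance may fail to be measurable for the sets of \<mu> and \<nu>. A
      non-integrable integrand has integral 0, which satisfies the bound.\<close>
    case False
    then show ?thesis using k0 by (simp add: not_integrable_integral_eq sum_nonneg)
  next
    case True
    then have meas: "?h \<in> borel_measurable (\<mu> \<Otimes>\<^sub>M \<nu>)"
      using borel_measurable_integrable[OF True] by (simp add: \<pi>_def)
    have "ennreal (\<integral>z. ?h z \<partial>\<pi>) = (\<integral>\<^sup>+z. ennreal (?h z) \<partial>\<pi>)"
      using True lp0 by (intro nn_integral_eq_integral[symmetric]) auto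
    also have "\<dots> = (\<integral>\<^sup>+z. f w z * ennreal (?h z) \<partial>(\<mu> \<Otimes>\<^sub>M \<nu>))"
      unfolding \<pi>_def using meas by (intro nn_integral_density) auto
    also have "\<dots> \<le> (\<integral>\<^sup>+z. f k z * indicator (space \<mu> \<times> space \<nu>) z \<partial>(\<mu> \<Otimes>\<^sub>M \<nu>))"
    proof (rule nn_integral_mono)
      fix z assume "z \<in> space (\<mu> \<Otimes>\<^sub>M \<nu>)"
      then have z: "z \<in> space \<mu> \<times> space \<nu>" by (simp add: space_pair_measure)
      have "ennreal (w i j / (a i * b j)) * indicator (A i \<times> B j) z * ennreal (?h z)
         \<le> ennreal (k i j / (a i * b j)) * indicator (A i \<times> B j) z" if ij: "i \<in> I" "j \<in> J" for i j
      proof (cases "z \<in> A i \<times> B j")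
        case True
        then have "w i j * ?h z / (a i * b j) \<le> k i j / (a i * b j)"
          using k[OF ij] ab by (intro divide_right_mono) auto
        moreover have "ennreal (w i j / (a i * b j)) * ennreal (?h z) = ennreal (w i j * ?h z / (a i * b j))"
          using w[OF ij] ab lp0 by (subst ennreal_mult[symmetric]) (auto split: prod.split)
        ultimately show ?thesis using True by (simp add: ennreal_leI)
      qed simp
      then show "f w z * ennreal (?h z) \<le> f k z * indicator (space \<mu> \<times> space \<nu>) z"
        using z unfolding f_def sum_distrib_right by (intro sum_mono) simp
    qed
    also have "\<dots> = ennreal (\<Sum>i\<in>I. \<Sum>j\<in>J. k i j / (a i * b j) * (a i * b j))"
      using f_int[OF sets.top sets.top, of k] k0 ab
      by (simp add: Asub Bsub a_def[symmetric] b_def[symmetric] sum_nonneg cong: sum.cong)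
    also have "\<dots> \<le> ennreal (\<Sum>i\<in>I. \<Sum>j\<in>J. k i j)"
      using k0 ab by (intro ennreal_leI sum_mono) auto
    finally show ?thesis using k0 by (simp add: sum_nonneg)
  qed
  moreover have "EMD d p \<mu> \<nu> \<le> (\<integral>z. ?h z \<partial>\<pi>)"
    unfolding EMD_def
  proof (rule cINF_lower[OF _ coupling])
    show "bdd_below ((\<lambda>\<pi>. \<integral>(x, y). lp_dist d p x y \<partial>\<pi>) ` couplings \<mu> \<nu>)"
      using lp0 by (intro bdd_belowI2[of _ 0] integral_nonneg_AE) auto
  qed
  ultimately show ?thesis by simp
qed

section \<open>The normalized l_p distance\<close>

lemma powr_convex_nonneg:
  fixes u v p t :: real
  assumes p: "1 \<le> p" and uv: "0 \<le> u" "0 \<le> v" and t: "0 \<le> t" "t \<le> 1"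
  shows "(t * u + (1 - t) * v) powr p \<le> t * u powr p + (1 - t) * v powr p"
proof -
  \<comment> \<open>If one argument is 0, convexity reduces to t^p \<le> t on [0,1].\<close>
  have *: "(t * u) powr p \<le> t * u powr p" if "0 \<le> t" "t \<le> 1" "0 \<le> u" for t u :: real
  proof -
    have "t powr p \<le> t powr 1" if "0 < t" using p that \<open>t \<le> 1\<close> by (intro powr_mono') auto
    then have "t powr p \<le> t" using \<open>0 \<le> t\<close> by (cases "t = 0") auto
    then show ?thesis using that by (simp add: powr_mult mult_right_mono)
  qed
  consider "u = 0" | "v = 0" | "0 < u" "0 < v" using uv by fastforce
  then show ?thesis
  proof cases
    case 1
    then show ?thesis using *[of "1 - t" v] t uv by simp
  next
    case 2
    then show ?thesis using *[of t u] t uv by simp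
  next
    case 3
    have "((1 - (1 - t)) * u + (1 - t) * v) powr p \<le> (1 - (1 - t)) * u powr p + (1 - t) * v powr p"
      using convex_onD[OF powr_convex[OF p], of "1 - t" u v] t 3 by simp
    then show ?thesis by simp
  qed
qed

text \<open>Divide by the sum of the two norms: each coordinate is then dominated by a convex
  combination, with weights \<open>t\<close> and \<open>1 - t\<close>, of the normalized
  coordinates, and by convexity of x^p the powers sum to at most 1.\<close>

lemma Minkowski_sum:
  fixes a b :: "'a \<Rightarrow> real"
  assumes p: "1 \<le> p" and fin: "finite I"
  shows "(\<Sum>i\<in>I. \<bar>a i + b i\<bar> powr p) powr (1 / p) \<le>
    (\<Sum>i\<in>I. \<bar>a i\<bar> powr p) powr (1 / p) + (\<Sum>i\<in>I. \<bar>b i\<bar> powr p) powr (1 / p)"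
proof -
  define N where "N a = (\<Sum>i\<in>I. \<bar>a i\<bar> powr p) powr (1 / p)" for a :: "'a \<Rightarrow> real"
  have N0: "0 \<le> N a" for a by (simp add: N_def)
  have sum0: "0 \<le> (\<Sum>i\<in>I. \<bar>a i\<bar> powr p)" for a :: "'a \<Rightarrow> real" by (intro sum_nonneg) auto
  have Np: "N a powr p = (\<Sum>i\<in>I. \<bar>a i\<bar> powr p)" for a
    unfolding N_def using sum0[of a] p by (simp add: powr_powr)
  have zero: "\<forall>i\<in>I. a i = 0" if "N a = 0" for a
  proof -
    have "(\<Sum>i\<in>I. \<bar>a i\<bar> powr p) = 0" using Np[of a] that p by simp
    then show ?thesis using fin by (subst (asm) sum_nonneg_eq_0_iff) auto
  qed
  have "N (\<lambda>i. a i + b i) \<le> N a + N b"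
  proof (cases "N a = 0 \<or> N b = 0")
    case True
    then show ?thesis
    proof
      assume "N a = 0"
      then have "N (\<lambda>i. a i + b i) = N b" unfolding N_def using zero[OF \<open>N a = 0\<close>] by simp
      then show ?thesis using N0 by simp
    next
      assume "N b = 0"
      then have "N (\<lambda>i. a i + b i) = N a" unfolding N_def using zero[OF \<open>N b = 0\<close>] by simp
      then show ?thesis using N0 by simp
    qed
  next
    case False
    then have pos: "0 < N a" "0 < N b" using N0[of a] N0[of b] by auto
    define t where "t = N a / (N a + N b)"
    have t: "0 \<le> t" "t \<le> 1" using pos by (auto simp: t_def)
    have t': "1 - t = N b / (N a + N b)" using pos by (simp add: t_def field_simps)
    have "(\<Sum>i\<in>I. \<bar>a i + b i\<bar> powr p) = (N a + N b) powr p * (\<Sum>i\<in>I. (\<bar>a i + b i\<bar> / (N a + N b)) powr p)"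
      using pos by (simp add: sum_distrib_left powr_divide)
    also have "\<dots> \<le> (N a + N b) powr p *
        (\<Sum>i\<in>I. t * (\<bar>a i\<bar> / N a) powr p + (1 - t) * (\<bar>b i\<bar> / N b) powr p)"
    proof (intro mult_left_mono sum_mono)
      fix i
      have "\<bar>a i + b i\<bar> / (N a + N b) \<le> (\<bar>a i\<bar> + \<bar>b i\<bar>) / (N a + N b)"
        using pos by (intro divide_right_mono) auto
      also have "\<dots> = t * (\<bar>a i\<bar> / N a) + (1 - t) * (\<bar>b i\<bar> / N b)"
        unfolding t' using pos by (simp add: t_def add_divide_distrib)
      finally have "(\<bar>a i + b i\<bar> / (N a + N b)) powr p \<le> (t * (\<bar>a i\<bar> / N a) + (1 - t) * (\<bar>b i\<bar> / N b)) powr p"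
        using p pos by (intro powr_mono2) auto
      also have "\<dots> \<le> t * (\<bar>a i\<bar> / N a) powr p + (1 - t) * (\<bar>b i\<bar> / N b) powr p"
        using p t pos by (intro powr_convex_nonneg) auto
      finally show "(\<bar>a i + b i\<bar> / (N a + N b)) powr p \<le> t * (\<bar>a i\<bar> / N a) powr p + (1 - t) * (\<bar>b i\<bar> / N b) powr p" .
    qed simp
    also have "(\<Sum>i\<in>I. t * (\<bar>a i\<bar> / N a) powr p + (1 - t) * (\<bar>b i\<bar> / N b) powr p) = 1"
    proof -
      have "(\<Sum>i\<in>I. t * (\<bar>a i\<bar> / N a) powr p) = t * ((\<Sum>i\<in>I. \<bar>a i\<bar> powr p) / N a powr p)"
        using pos by (simp add: powr_divide flip: sum_distrib_left sum_divide_distrib)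
      moreover have "(\<Sum>i\<in>I. (1 - t) * (\<bar>b i\<bar> / N b) powr p) = (1 - t) * ((\<Sum>i\<in>I. \<bar>b i\<bar> powr p) / N b powr p)"
        using pos by (simp add: powr_divide flip: sum_distrib_left sum_divide_distrib)
      ultimately show ?thesis using pos by (simp add: sum.distrib Np[symmetric])
    qed
    finally have "(\<Sum>i\<in>I. \<bar>a i + b i\<bar> powr p) powr (1 / p) \<le> ((N a + N b) powr p) powr (1 / p)"
      using sum0[of "\<lambda>i. a i + b i"] p by (intro powr_mono2) auto
    also have "\<dots> = N a + N b" using pos p by (simp add: powr_powr)
    finally show ?thesis by (simp add: N_def)
  qed
  then show ?thesis by (simp add: N_def)
qed

lemma lp_dist_commute: "lp_dist d p x y = lp_dist d p y x"
  by (simp add: lp_dist_def abs_minus_commute)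

lemma lp_dist_triangle:
  assumes "1 \<le> p"
  shows "lp_dist d p x z \<le> lp_dist d p x y + lp_dist d p y z"
proof -
  have "(\<Sum>i<d. \<bar>x i - z i\<bar> powr p) powr (1 / p) \<le>
    (\<Sum>i<d. \<bar>x i - y i\<bar> powr p) powr (1 / p) + (\<Sum>i<d. \<bar>y i - z i\<bar> powr p) powr (1 / p)"
    using Minkowski_sum[OF assms, of "{..<d}" "\<lambda>i. x i - y i" "\<lambda>i. y i - z i"] by simp
  from divide_right_mono[OF this, of "real d powr (1 / p)"] show ?thesis
    by (simp add: lp_dist_def add_divide_distrib)
qed

lemma lp_dist_scale_mono:
  assumes p: "1 \<le> p" and c: "0 \<le> c" and le: "\<And>i. i < d \<Longrightarrow> \<bar>x i - y i\<bar> \<le> c * \<bar>x' i - y' i\<bar>"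
  shows "lp_dist d p x y \<le> c * lp_dist d p x' y'"
proof -
  have "(\<Sum>i<d. \<bar>x i - y i\<bar> powr p) \<le> (\<Sum>i<d. (c * \<bar>x' i - y' i\<bar>) powr p)"
    using p le by (intro sum_mono powr_mono2) auto
  also have "\<dots> = c powr p * (\<Sum>i<d. \<bar>x' i - y' i\<bar> powr p)"
    using c by (simp add: powr_mult sum_distrib_left)
  finally have "(\<Sum>i<d. \<bar>x i - y i\<bar> powr p) powr (1 / p) \<le> (c powr p * (\<Sum>i<d. \<bar>x' i - y' i\<bar> powr p)) powr (1 / p)"
    using p by (intro powr_mono2 sum_nonneg) auto
  also have "\<dots> = c * (\<Sum>i<d. \<bar>x' i - y' i\<bar> powr p) powr (1 / p)"
    using p c by (simp add: powr_mult powr_powr sum_nonneg)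
  finally show ?thesis
    using divide_right_mono[of _ _ "real d powr (1 / p)"] by (fastforce simp: lp_dist_def)
qed

lemma lp_dist_const:
  assumes "1 \<le> p" "1 \<le> d" "0 \<le> M"
  shows "lp_dist d p (\<lambda>_. M) (\<lambda>_. 0) = M"
  using assms by (simp add: lp_dist_def powr_mult powr_powr)

lemma lp_dist_le_const:
  assumes "1 \<le> p" "1 \<le> d" "0 \<le> M" "\<And>i. i < d \<Longrightarrow> \<bar>x i - y i\<bar> \<le> M"
  shows "lp_dist d p x y \<le> M"
  using lp_dist_scale_mono[of p 1 d x y "\<lambda>_. M" "\<lambda>_. 0"] assms lp_dist_const[of p d M] by simp

lemma lp_dist_cube_le_1:
  assumes "1 \<le> p" "1 \<le> d" "x \<in> cube d" "y \<in> cube d"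
  shows "lp_dist d p x y \<le> 1"
proof (rule lp_dist_le_const)
  fix i assume "i < d"
  then have "x i \<in> {0..1}" "y i \<in> {0..1}" using assms by (auto simp: cube_def PiE_iff)
  then show "\<bar>x i - y i\<bar> \<le> 1" by auto
qed (use assms in auto)

lemma sum_swap_inner:
  "(\<Sum>k\<in>K. \<Sum>c\<in>C. \<Sum>c'\<in>C'. f k c c') = (\<Sum>c\<in>C. \<Sum>c'\<in>C'. \<Sum>k\<in>K. f k c c')"
  by (subst sum.swap, intro sum.cong refl sum.swap)

text \<open>
  \<open>v i\<close> and \<open>v' j\<close> spread the mass of a cell over the leaves of a tree. Cells are then matched
  through the leaves, \<open>\<rho>\<close> and \<open>\<rho>'\<close> being the cost of reaching a leaf.
\<close>

lemma EMD_le_tree: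
  fixes A :: "'i \<Rightarrow> point set" and B :: "'j \<Rightarrow> point set" and anc :: "nat \<Rightarrow> 'c \<Rightarrow> 'b"
  assumes mu: "prob_space \<mu>" and nu: "prob_space \<nu>" and fin: "finite I" "finite J" "finite C"
    and A: "\<And>i. i \<in> I \<Longrightarrow> A i \<in> sets \<mu>" "disjoint_family_on A I" "(\<Union>i\<in>I. A i) = space \<mu>"
    and B: "\<And>j. j \<in> J \<Longrightarrow> B j \<in> sets \<nu>" "disjoint_family_on B J" "(\<Union>j\<in>J. B j) = space \<nu>"
    and v: "\<And>i c. i \<in> I \<Longrightarrow> c \<in> C \<Longrightarrow> 0 \<le> v i c" "\<And>i. i \<in> I \<Longrightarrow> (\<Sum>c\<in>C. v i c) = 1"
    and v': "\<And>j c. j \<in> J \<Longrightarrow> c \<in> C \<Longrightarrow> 0 \<le> v' j c" "\<And>j. j \<in> J \<Longrightarrow> (\<Sum>c\<in>C. v' j c) = 1"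
    and root: "\<And>c c'. c \<in> C \<Longrightarrow> c' \<in> C \<Longrightarrow> anc 0 c = anc 0 c'"
    and refines: "\<And>l l' c c'. l' \<le> l \<Longrightarrow> l \<le> L \<Longrightarrow> anc l c = anc l c' \<Longrightarrow> anc l' c = anc l' c'"
    and D: "\<And>l c c'. l \<le> L \<Longrightarrow> c \<in> C \<Longrightarrow> c' \<in> C \<Longrightarrow> anc l c = anc l c' \<Longrightarrow> D c c' \<le> (1 / 2) ^ l"
    and D0: "\<And>c c'. 0 \<le> D c c'" and \<rho>: "\<And>i. i \<in> I \<Longrightarrow> 0 \<le> \<rho> i" "\<And>j. j \<in> J \<Longrightarrow> 0 \<le> \<rho>' j"
    and dist: "\<And>i j x y c c'. i \<in> I \<Longrightarrow> j \<in> J \<Longrightarrow> x \<in> A i \<Longrightarrow> y \<in> B j \<Longrightarrow> c \<in> C \<Longrightarrow> c' \<in> C \<Longrightarrow>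
      0 < v i c \<Longrightarrow> 0 < v' j c' \<Longrightarrow> lp_dist d p x y \<le> \<rho> i + \<rho>' j + D c c'"
  defines "P \<equiv> \<lambda>c. \<Sum>i\<in>I. measure \<mu> (A i) * v i c"
    and "Q \<equiv> \<lambda>c. \<Sum>j\<in>J. measure \<nu> (B j) * v' j c"
  shows "EMD d p \<mu> \<nu> \<le> (\<Sum>i\<in>I. measure \<mu> (A i) * \<rho> i) + (\<Sum>j\<in>J. measure \<nu> (B j) * \<rho>' j) + (1 / 2) ^ L +
    (\<Sum>l=1..L. (1 / 2) ^ l * (\<Sum>b\<in>anc l ` C. \<bar>fiber_sum C (anc l) P b - fiber_sum C (anc l) Q b\<bar>))"
proof -
  interpret mu: prob_space \<mu> by fact
  interpret nu: prob_space \<nu> by fact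
  define a b where "a i = measure \<mu> (A i)" and "b j = measure \<nu> (B j)" for i j
  have ab: "0 \<le> a i" "0 \<le> b j" for i j by (auto simp: a_def b_def)
  have suma: "sum a I = 1" unfolding a_def
    using mu.finite_measure_finite_Union[of I A] A fin mu.prob_space by (auto simp: image_subset_iff)
  have sumb: "sum b J = 1" unfolding b_def
    using nu.finite_measure_finite_Union[of J B] B fin nu.prob_space by (auto simp: image_subset_iff)
  have sumP: "sum P C = 1" unfolding P_def
    using suma v(2) by (subst sum.swap) (simp add: a_def flip: sum_distrib_left)
  have sumQ: "sum Q C = 1" unfolding Q_def
    using sumb v'(2) by (subst sum.swap) (simp add: b_def flip: sum_distrib_left)
  have P0: "\<forall>c\<in>C. 0 \<le> P c" unfolding P_def using v(1) by (intro ballI sum_nonneg mult_nonneg_nonneg) auto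
  have Q0: "\<forall>c\<in>C. 0 \<le> Q c" unfolding Q_def using v'(1) by (intro ballI sum_nonneg mult_nonneg_nonneg) auto
  have "\<exists>g. (\<forall>c\<in>C. \<forall>c'\<in>C. 0 \<le> g c c') \<and> (\<forall>c\<in>C. (\<Sum>c'\<in>C. g c c') = P c) \<and>
    (\<forall>c'\<in>C. (\<Sum>c\<in>C. g c c') = Q c') \<and>
    (\<Sum>c\<in>C. \<Sum>c'\<in>C. g c c' * D c c') \<le> (1 / 2) ^ L * sum P C +
      (\<Sum>l=1..L. (1 / 2) ^ l * (\<Sum>b\<in>anc l ` C. \<bar>fiber_sum C (anc l) P b - fiber_sum C (anc l) Q b\<bar>))"
  proof (rule tree_coupling[OF fin(3) P0 Q0])
    show "sum P C = sum Q C" using sumP sumQ by simp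
  qed (fact root refines D)+
  then obtain g where g0: "\<forall>c\<in>C. \<forall>c'\<in>C. 0 \<le> g c c'" "\<forall>c\<in>C. (\<Sum>c'\<in>C. g c c') = P c"
    "\<forall>c'\<in>C. (\<Sum>c\<in>C. g c c') = Q c'"
    "(\<Sum>c\<in>C. \<Sum>c'\<in>C. g c c' * D c c') \<le> (1 / 2) ^ L * sum P C +
      (\<Sum>l=1..L. (1 / 2) ^ l * (\<Sum>b\<in>anc l ` C. \<bar>fiber_sum C (anc l) P b - fiber_sum C (anc l) Q b\<bar>))"
    by (elim exE conjE) (rule that)
  note g = g0[rule_format]
  \<comment> \<open>The fraction of the mass at leaf \<open>c\<close> that belongs to cell
    \<open>i\<close>, respectively cell \<open>j\<close>. At a leaf without mass it is 0, and
    \<open>g\<close> vanishes there as well.\<close>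
  define \<alpha> \<beta> where "\<alpha> i c = a i * v i c / P c" and "\<beta> j c = b j * v' j c / Q c" for i j c
  have \<alpha>0: "0 \<le> \<alpha> i c" if "i \<in> I" "c \<in> C" for i c using that ab v(1) P0 by (simp add: \<alpha>_def)
  have \<beta>0: "0 \<le> \<beta> j c" if "j \<in> J" "c \<in> C" for j c using that ab v'(1) Q0 by (simp add: \<beta>_def)
  have gP: "(\<Sum>i\<in>I. \<alpha> i c) * g c c' = g c c'" if "c \<in> C" "c' \<in> C" for c c'
  proof (cases "P c = 0")
    case True
    then have "g c c' = 0" using g(1,2) that fin(3) sum_nonneg_eq_0_iff[of C "g c"] by auto
    then show ?thesis by simp
  next
    case False
    then have "(\<Sum>i\<in>I. \<alpha> i c) = 1" by (simp add: \<alpha>_def P_def a_def flip: sum_divide_distrib)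
    then show ?thesis by simp
  qed
  have gQ: "g c c' * (\<Sum>j\<in>J. \<beta> j c') = g c c'" if "c \<in> C" "c' \<in> C" for c c'
  proof (cases "Q c' = 0")
    case True
    then have "g c c' = 0" using g(1,3) that fin(3) sum_nonneg_eq_0_iff[of C "\<lambda>c. g c c'"] by auto
    then show ?thesis by simp
  next
    case False
    then have "(\<Sum>j\<in>J. \<beta> j c') = 1" by (simp add: \<beta>_def Q_def b_def flip: sum_divide_distrib)
    then show ?thesis by simp
  qed
  have \<alpha>P: "\<alpha> i c * P c = a i * v i c" if "i \<in> I" "c \<in> C" for i c
  proof (cases "P c = 0")
    case True
    then have "a i * v i c = 0"
      using that fin(1) v(1) ab sum_nonneg_eq_0_iff[of I "\<lambda>i. a i * v i c"] by (auto simp: P_def a_def)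
    then show ?thesis using True by simp
  qed (simp add: \<alpha>_def)
  have \<beta>Q: "\<beta> j c * Q c = b j * v' j c" if "j \<in> J" "c \<in> C" for j c
  proof (cases "Q c = 0")
    case True
    then have "b j * v' j c = 0"
      using that fin(2) v'(1) ab sum_nonneg_eq_0_iff[of J "\<lambda>j. b j * v' j c"] by (auto simp: Q_def b_def)
    then show ?thesis using True by simp
  qed (simp add: \<beta>_def)
  \<comment> \<open>Three transports glued at the leaves: cell \<open>i\<close> to leaf
    \<open>c\<close>, leaf \<open>c\<close> to leaf \<open>c'\<close>, leaf \<open>c'\<close> to
    cell \<open>j\<close>. Summing out the leaves and one cell index gives back the masses of the
    cells.\<close>
  define W where "W i j c c' = \<alpha> i c * g c c' * \<beta> j c'" for i j c c'
  have W0: "0 \<le> W i j c c'" if "i \<in> I" "j \<in> J" "c \<in> C" "c' \<in> C" for i j c c'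
    using that \<alpha>0 \<beta>0 g(1) by (simp add: W_def)
  define k where "k i j = (\<Sum>c\<in>C. \<Sum>c'\<in>C. W i j c c' * (\<rho> i + \<rho>' j + D c c'))" for i j
  define w where "w i j = (\<Sum>c\<in>C. \<Sum>c'\<in>C. W i j c c')" for i j
  have w1: "(\<Sum>j\<in>J. w i j) = a i" if i: "i \<in> I" for i
  proof -
    have "(\<Sum>j\<in>J. w i j) = (\<Sum>c\<in>C. \<Sum>c'\<in>C. \<Sum>j\<in>J. W i j c c')"
      unfolding w_def by (subst sum.swap, intro sum.cong refl sum.swap)
    also have "\<dots> = (\<Sum>c\<in>C. \<Sum>c'\<in>C. \<alpha> i c * g c c')"
      using gQ by (intro sum.cong refl) (simp add: W_def mult.assoc flip: sum_distrib_left)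
    also have "\<dots> = (\<Sum>c\<in>C. \<alpha> i c * P c)" using g(2) by (intro sum.cong refl) (simp flip: sum_distrib_left)
    also have "\<dots> = a i" using \<alpha>P[OF i] v(2)[OF i] by (simp flip: sum_distrib_left)
    finally show ?thesis .
  qed
  have w2: "(\<Sum>i\<in>I. w i j) = b j" if j: "j \<in> J" for j
  proof -
    have "(\<Sum>i\<in>I. w i j) = (\<Sum>c\<in>C. \<Sum>c'\<in>C. \<Sum>i\<in>I. W i j c c')"
      unfolding w_def by (subst sum.swap, intro sum.cong refl sum.swap)
    also have "\<dots> = (\<Sum>c\<in>C. \<Sum>c'\<in>C. g c c' * \<beta> j c')"
      using gP by (intro sum.cong refl) (simp add: W_def flip: sum_distrib_right)
    also have "\<dots> = (\<Sum>c'\<in>C. \<beta> j c' * Q c')" using g(3)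
      by (subst sum.swap, intro sum.cong refl) (simp add: mult.commute flip: sum_distrib_left)
    also have "\<dots> = b j" using \<beta>Q[OF j] v'(2)[OF j] by (simp flip: sum_distrib_left)
    finally show ?thesis .
  qed
  have "EMD d p \<mu> \<nu> \<le> (\<Sum>i\<in>I. \<Sum>j\<in>J. k i j)"
  proof (rule EMD_le_matching[OF mu nu fin(1,2) A B])
    fix i j assume ij: "i \<in> I" "j \<in> J"
    show "0 \<le> w i j" unfolding w_def using W0[OF ij] by (intro sum_nonneg) auto
    show "0 \<le> k i j" unfolding k_def using W0[OF ij] \<rho>(1)[OF ij(1)] \<rho>(2)[OF ij(2)] D0 by (intro sum_nonneg) auto
    fix x y assume xy: "x \<in> A i" "y \<in> B j"
    have "W i j c c' * lp_dist d p x y \<le> W i j c c' * (\<rho> i + \<rho>' j + D c c')" if c: "c \<in> C" "c' \<in> C" for c c'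
    \<comment> \<open>The distance premise speaks only of leaves that a cell really reaches;
      elsewhere the weight is 0.\<close>
    proof (cases "v i c = 0 \<or> v' j c' = 0")
      case True
      then have "W i j c c' = 0" by (auto simp: W_def \<alpha>_def \<beta>_def)
      then show ?thesis by simp
    next
      case False
      then have "0 < v i c" "0 < v' j c'" using v(1)[OF ij(1) c(1)] v'(1)[OF ij(2) c(2)] by auto
      then show ?thesis using dist[OF ij xy c] W0[OF ij c] by (intro mult_left_mono)
    qed
    then show "w i j * lp_dist d p x y \<le> k i j"
      unfolding w_def k_def sum_distrib_right by (intro sum_mono) auto
  qed (use w1 w2 in \<open>auto simp: a_def b_def\<close>)
  also have "\<dots> = (\<Sum>i\<in>I. \<Sum>j\<in>J. w i j * \<rho> i) + (\<Sum>i\<in>I. \<Sum>j\<in>J. w i j * \<rho>' j) +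
      (\<Sum>i\<in>I. \<Sum>j\<in>J. \<Sum>c\<in>C. \<Sum>c'\<in>C. W i j c c' * D c c')"
    by (simp add: k_def w_def distrib_left sum.distrib sum_distrib_right)
  also have "(\<Sum>i\<in>I. \<Sum>j\<in>J. w i j * \<rho> i) = (\<Sum>i\<in>I. a i * \<rho> i)"
    using w1 by (intro sum.cong refl) (simp flip: sum_distrib_right)
  also have "(\<Sum>i\<in>I. \<Sum>j\<in>J. w i j * \<rho>' j) = (\<Sum>j\<in>J. b j * \<rho>' j)"
    using w2 by (subst sum.swap, intro sum.cong refl) (simp flip: sum_distrib_right)
  also have "(\<Sum>i\<in>I. \<Sum>j\<in>J. \<Sum>c\<in>C. \<Sum>c'\<in>C. W i j c c' * D c c') = (\<Sum>c\<in>C. \<Sum>c'\<in>C. g c c' * D c c')"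
  proof -
    have "(\<Sum>i\<in>I. \<Sum>j\<in>J. \<Sum>c\<in>C. \<Sum>c'\<in>C. W i j c c' * D c c') =
      (\<Sum>c\<in>C. \<Sum>c'\<in>C. \<Sum>i\<in>I. \<Sum>j\<in>J. W i j c c' * D c c')"
    proof -
      show ?thesis unfolding sum_swap_inner[of _ C C J] by (rule sum_swap_inner)
    qed
    also have "\<dots> = (\<Sum>c\<in>C. \<Sum>c'\<in>C. g c c' * D c c')"
    proof (intro sum.cong refl)
      fix c c' assume c: "c \<in> C" "c' \<in> C"
      have "(\<Sum>i\<in>I. \<Sum>j\<in>J. W i j c c' * D c c') = (\<Sum>i\<in>I. \<alpha> i c * (g c c' * (\<Sum>j\<in>J. \<beta> j c')) * D c c')"
        by (intro sum.cong refl) (simp add: W_def sum_distrib_left sum_distrib_right mult_ac)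
      also have "\<dots> = (\<Sum>i\<in>I. \<alpha> i c) * g c c' * D c c'" by (simp add: gQ[OF c] sum_distrib_right)
      finally show "(\<Sum>i\<in>I. \<Sum>j\<in>J. W i j c c' * D c c') = g c c' * D c c'"
        by (simp only: gP[OF c])
    qed
    finally show ?thesis .
  qed
  also have "(\<Sum>c\<in>C. \<Sum>c'\<in>C. g c c' * D c c') \<le> (1 / 2) ^ L +
    (\<Sum>l=1..L. (1 / 2) ^ l * (\<Sum>b\<in>anc l ` C. \<bar>fiber_sum C (anc l) P b - fiber_sum C (anc l) Q b\<bar>))"
    using g(4) by (simp add: sumP)
  finally show ?thesis by (simp add: a_def b_def)
qed

section \<open>Quadratic statistics of independent samples\<close>

abbreviation E_pmf :: "'a pmf \<Rightarrow> ('a \<Rightarrow> real) \<Rightarrow> real" where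
  "E_pmf p f \<equiv> measure_pmf.expectation p f"

text \<open>Supports are finite throughout, so every function is integrable and expectations commute
  with finite sums.\<close>

lemma E_bind_pmf:
  fixes h :: "'b \<Rightarrow> real"
  assumes "finite (set_pmf p)" "\<And>x. x \<in> set_pmf p \<Longrightarrow> finite (set_pmf (f x))"
  shows "E_pmf (bind_pmf p f) h = E_pmf p (\<lambda>x. E_pmf (f x) h)"
  using assms by (subst pmf_expectation_bind[of "set_pmf p"]) (auto simp: integral_measure_pmf[of "set_pmf p"])

lemma E_pair_pmf:
  fixes h :: "'a \<times> 'b \<Rightarrow> real"
  assumes "finite (set_pmf p)" "finite (set_pmf q)"
  shows "E_pmf (pair_pmf p q) h = E_pmf p (\<lambda>x. E_pmf q (\<lambda>y. h (x, y)))"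
  unfolding pair_pmf_def using assms by (simp add: E_bind_pmf)

lemma E_add:
  fixes f g :: "'a \<Rightarrow> real"
  assumes "finite (set_pmf p)" shows "E_pmf p (\<lambda>x. f x + g x) = E_pmf p f + E_pmf p g"
  using assms by (intro Bochner_Integration.integral_add integrable_measure_pmf_finite)

lemma E_sum:
  fixes f :: "'i \<Rightarrow> 'a \<Rightarrow> real"
  assumes "finite (set_pmf p)" shows "E_pmf p (\<lambda>x. \<Sum>i\<in>I. f i x) = (\<Sum>i\<in>I. E_pmf p (f i))"
  using assms by (intro Bochner_Integration.integral_sum integrable_measure_pmf_finite)

lemma E_mono:
  fixes f g :: "'a \<Rightarrow> real"
  assumes "finite (set_pmf p)" "\<And>x. x \<in> set_pmf p \<Longrightarrow> f x \<le> g x" shows "E_pmf p f \<le> E_pmf p g"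
  using assms by (intro integral_mono_AE integrable_measure_pmf_finite) (auto simp: AE_measure_pmf_iff)

lemma E_cong:
  fixes f g :: "'a \<Rightarrow> real"
  assumes "\<And>x. x \<in> set_pmf p \<Longrightarrow> f x = g x" shows "E_pmf p f = E_pmf p g"
  using assms by (intro Bochner_Integration.integral_cong_AE) (auto simp: AE_measure_pmf_iff)

lemma E_E_mult: "E_pmf p (\<lambda>x. E_pmf q (\<lambda>y. k * (g x * h y))) = k * (E_pmf p g * E_pmf q h)"
  for g :: "'a \<Rightarrow> real" and h :: "'b \<Rightarrow> real"
  by simp

lemma finite_set_replicate_pmf: "finite (set_pmf p) \<Longrightarrow> finite (set_pmf (replicate_pmf n p))"
proof -
  assume "finite (set_pmf p)"
  then have "finite {xs. set xs \<subseteq> set_pmf p \<and> length xs = n}" by (rule finite_lists_length_eq)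
  then show ?thesis by (rule finite_subset[rotated]) (auto simp: set_replicate_pmf)
qed

lemma finite_set_pair_pmf: "finite (set_pmf p) \<Longrightarrow> finite (set_pmf q) \<Longrightarrow> finite (set_pmf (pair_pmf p q))"
  by simp

lemma E_replicate_Suc:
  fixes h :: "'a list \<Rightarrow> real"
  assumes "finite (set_pmf p)"
  shows "E_pmf (replicate_pmf (Suc n) p) h = E_pmf p (\<lambda>x. E_pmf (replicate_pmf n p) (\<lambda>xs. h (x # xs)))"
  using assms by (simp add: E_bind_pmf finite_set_replicate_pmf)

lemma prob_bind_pmf:
  "measure_pmf.prob (bind_pmf p f) V = E_pmf p (\<lambda>x. measure_pmf.prob (f x) V)"
  by (simp add: measure_pmf_bind measure_pmf.measure_bind[where N = "count_space UNIV"] measure_pmf_in_subprob_algebra)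

text \<open>Condition on the first stage and charge a bad first outcome with probability 1.\<close>

lemma prob_bind_pmf_le:
  assumes fin: "finite (set_pmf p)" and b: "0 \<le> b"
    and f: "\<And>x. x \<in> set_pmf p \<Longrightarrow> x \<notin> Bad \<Longrightarrow> measure_pmf.prob (f x) V \<le> b"
  shows "measure_pmf.prob (bind_pmf p f) V \<le> measure_pmf.prob p Bad + b"
proof -
  have "E_pmf p (\<lambda>x. measure_pmf.prob (f x) V) \<le> E_pmf p (\<lambda>x. indicator Bad x + b)"
    using f b by (intro E_mono[OF fin]) (auto simp: indicator_def intro: order_trans[OF measure_pmf.prob_le_1])
  also have "\<dots> = measure_pmf.prob p Bad + b" by (subst E_add[OF fin]) simp
  finally show ?thesis by (simp add: prob_bind_pmf)
qed

lemma Markov_pmf: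
  fixes u :: "'a \<Rightarrow> real"
  assumes "finite (set_pmf p)" "\<And>x. 0 \<le> u x" "0 < c"
  shows "measure_pmf.prob p {x. c \<le> u x} \<le> E_pmf p u / c"
proof -
  have "measure (measure_pmf p) {x \<in> space (measure_pmf p). c \<le> u x} \<le> (\<integral>x. u x \<partial>measure_pmf p) / c"
    using assms by (intro integral_Markov_inequality_measure[of _ _ UNIV] integrable_measure_pmf_finite) auto
  then show ?thesis by simp
qed

lemma count_binomial_pmf:
  "map_pmf (\<lambda>zs. length (filter P zs)) (replicate_pmf n D) = binomial_pmf n (measure_pmf.prob D {z. P z})"
proof (induction n)
  case 0
  then show ?case by (simp add: binomial_pmf_0)
next
  case (Suc n)
  let ?p = "measure_pmf.prob D {z. P z}"
  have p: "?p \<in> {0..1}" by simp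
  have "map_pmf P D = bernoulli_pmf ?p"
  proof (rule pmf_eqI)
    fix b
    have "pmf (map_pmf P D) b = measure_pmf.prob D (P -` {b})" by (simp add: pmf_map)
    also have "P -` {b} = (if b then {z. P z} else - {z. P z})" by auto
    also have "measure_pmf.prob D (if b then {z. P z} else - {z. P z}) = pmf (bernoulli_pmf ?p) b"
      using p measure_pmf.prob_compl[of "{z. P z}" D] by (cases b) (auto simp: Compl_eq_Diff_UNIV)
    finally show "pmf (map_pmf P D) b = pmf (bernoulli_pmf ?p) b" .
  qed
  then have "binomial_pmf (Suc n) ?p = bind_pmf (map_pmf P D)
      (\<lambda>b. bind_pmf (map_pmf (\<lambda>zs. length (filter P zs)) (replicate_pmf n D)) (\<lambda>k. return_pmf ((if b then 1 else 0) + k)))"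
    using Suc by (simp add: binomial_pmf_Suc[OF p])
  then show ?case
    by (simp add: map_pmf_def bind_assoc_pmf bind_return_pmf cong: if_cong)
      (intro bind_pmf_cong refl, auto)
qed

text \<open>The count is binomial, and C(n,k)/(k+1) = C(n+1,k+1)/(n+1) turns the sum into a part of
  the binomial expansion of exponent n+1. This is what bounds the norm after flattening.\<close>

lemma expectation_inverse_count:
  fixes P :: "'a \<Rightarrow> bool" and D :: "'a pmf"
  defines "p \<equiv> measure_pmf.prob D {z. P z}"
  shows "p * E_pmf (replicate_pmf n D) (\<lambda>zs. 1 / (1 + real (length (filter P zs)))) \<le> 1 / (n + 1)"
proof -
  have p: "p \<in> {0..1}" by (simp add: p_def)
  have "E_pmf (replicate_pmf n D) (\<lambda>zs. 1 / (1 + real (length (filter P zs)))) = E_pmf (binomial_pmf n p) (\<lambda>k. 1 / (1 + real k))"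
    unfolding p_def count_binomial_pmf[symmetric] by simp
  also have "\<dots> = (\<Sum>k\<le>n. real (n choose k) * p ^ k * (1 - p) ^ (n - k) * (1 / (1 + real k)))"
    by (subst expectation_binomial_pmf'[OF p]) simp
  finally have "p * E_pmf (replicate_pmf n D) (\<lambda>zs. 1 / (1 + real (length (filter P zs)))) =
    (\<Sum>k\<le>n. real (n choose k) / (1 + real k) * p ^ Suc k * (1 - p) ^ (n - k))"
    by (simp add: sum_distrib_left mult_ac)
  also have "\<dots> = (\<Sum>k\<le>n. (real (Suc n choose Suc k) * p ^ Suc k * (1 - p) ^ (Suc n - Suc k)) / (n + 1))"
  proof (intro sum.cong refl)
    fix k
    have "real (Suc k) * real (Suc n choose Suc k) = real (Suc n) * real (n choose k)"
      using Suc_times_binomial[of k n] by (metis of_nat_mult)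
    then have "real (n choose k) / (1 + real k) = real (Suc n choose Suc k) / (n + 1)"
      by (simp add: field_simps)
    then show "real (n choose k) / (1 + real k) * p ^ Suc k * (1 - p) ^ (n - k) =
       (real (Suc n choose Suc k) * p ^ Suc k * (1 - p) ^ (Suc n - Suc k)) / (n + 1)" by simp
  qed
  also have "\<dots> = (\<Sum>k\<le>n. real (Suc n choose Suc k) * p ^ Suc k * (1 - p) ^ (Suc n - Suc k)) / (n + 1)"
    by (simp add: sum_divide_distrib)
  also have "(\<Sum>k\<le>n. real (Suc n choose Suc k) * p ^ Suc k * (1 - p) ^ (Suc n - Suc k)) \<le>
     (\<Sum>k\<le>Suc n. real (Suc n choose k) * p ^ k * (1 - p) ^ (Suc n - k))"
    using p by (subst sum.atMost_Suc_shift) auto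
  also have "\<dots> = 1" using binomial_ring[of p "1 - p" "Suc n"] by simp
  finally show ?thesis by (simp add: divide_right_mono add.commute)
qed

definition vec_sum :: "('z \<Rightarrow> 'c \<Rightarrow> real) \<Rightarrow> 'z list \<Rightarrow> 'c \<Rightarrow> real" where
  "vec_sum f zs c = (\<Sum>z\<leftarrow>zs. f z c)"

text \<open>Two independent lists replace the sum over distinct pairs of one list: no diagonal terms
  arise, and the mean is exactly m^2 \<kappa>.\<close>

definition ustat :: "('c \<Rightarrow> real) \<Rightarrow> 'c set \<Rightarrow> ('z \<Rightarrow> 'c \<Rightarrow> real) \<Rightarrow> 'z list \<Rightarrow> 'z list \<Rightarrow> real" where
  "ustat w C f zs zs' = (\<Sum>c\<in>C. w c * (vec_sum f zs c * vec_sum f zs' c))"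

locale sampled_vectors =
  fixes Z :: "'z pmf" and f :: "'z \<Rightarrow> 'c \<Rightarrow> real" and C :: "'c set" and w :: "'c \<Rightarrow> real"
  assumes fZ: "finite (set_pmf Z)" and fC: "finite C" and w0: "\<And>c. 0 \<le> w c"
begin

text \<open>Mean vector, uncentred second-moment matrix, squared weighted norm of the mean, and
  squared weighted Hilbert-Schmidt norm of the matrix.\<close>

definition \<theta> :: "'c \<Rightarrow> real" where "\<theta> c = E_pmf Z (\<lambda>z. f z c)"
definition Q :: "'c \<Rightarrow> 'c \<Rightarrow> real" where "Q c c' = E_pmf Z (\<lambda>z. f z c * f z c')"
definition \<kappa> :: real where "\<kappa> = (\<Sum>c\<in>C. w c * (\<theta> c)\<^sup>2)"
definition H2 :: real where "H2 = (\<Sum>c\<in>C. \<Sum>c'\<in>C. w c * w c' * (Q c c')\<^sup>2)"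

lemma kappa_nonneg: "0 \<le> \<kappa>" unfolding \<kappa>_def using w0 by (intro sum_nonneg) auto
lemma H2_nonneg: "0 \<le> H2" unfolding H2_def using w0 by (intro sum_nonneg) auto

lemma mean_vec_sum: "E_pmf (replicate_pmf n Z) (\<lambda>zs. vec_sum f zs c) = n * \<theta> c"
proof (induction n)
  case (Suc n)
  have "E_pmf (replicate_pmf (Suc n) Z) (\<lambda>zs. vec_sum f zs c) =
      E_pmf Z (\<lambda>z. E_pmf (replicate_pmf n Z) (\<lambda>zs. f z c + vec_sum f zs c))"
    by (subst E_replicate_Suc[OF fZ]) (simp add: vec_sum_def)
  also have "\<dots> = E_pmf Z (\<lambda>z. f z c + n * \<theta> c)"
    by (simp add: E_add[OF finite_set_replicate_pmf[OF fZ]] Suc)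
  also have "\<dots> = \<theta> c + n * \<theta> c" by (simp add: E_add[OF fZ] \<theta>_def)
  finally show ?case by (simp add: algebra_simps)
qed (simp add: vec_sum_def)

lemma second_moment_vec_sum:
  "E_pmf (replicate_pmf n Z) (\<lambda>zs. vec_sum f zs c * vec_sum f zs c') =
     n * Q c c' + n * (real n - 1) * (\<theta> c * \<theta> c')"
proof (induction n)
  case (Suc n)
  note fR = finite_set_replicate_pmf[OF fZ]
  have "E_pmf (replicate_pmf (Suc n) Z) (\<lambda>zs. vec_sum f zs c * vec_sum f zs c') =
      E_pmf Z (\<lambda>z. E_pmf (replicate_pmf n Z) (\<lambda>zs. f z c * f z c' +
        (f z c * vec_sum f zs c' + (vec_sum f zs c * f z c' + vec_sum f zs c * vec_sum f zs c'))))"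
    by (subst E_replicate_Suc[OF fZ]) (simp add: vec_sum_def algebra_simps)
  also have "\<dots> = E_pmf Z (\<lambda>z. f z c * f z c' + (f z c * (n * \<theta> c') + ((n * \<theta> c) * f z c' +
      (n * Q c c' + n * (real n - 1) * (\<theta> c * \<theta> c')))))"
    by (simp add: E_add[OF fR] Suc mean_vec_sum)
  also have "\<dots> = Q c c' + (\<theta> c * (n * \<theta> c') + ((n * \<theta> c) * \<theta> c' + (n * Q c c' + n * (real n - 1) * (\<theta> c * \<theta> c'))))"
    by (simp add: E_add[OF fZ] \<theta>_def Q_def)
  finally show ?case by (simp add: algebra_simps)
qed (simp add: vec_sum_def)

definition samples :: "nat \<Rightarrow> ('z list \<times> 'z list) pmf" where
  "samples m = pair_pmf (replicate_pmf m Z) (replicate_pmf m Z)"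

lemma finite_samples: "finite (set_pmf (samples m))"
  unfolding samples_def by (intro finite_set_pair_pmf finite_set_replicate_pmf fZ)

lemma mean_ustat: "E_pmf (samples m) (\<lambda>(zs, zs'). ustat w C f zs zs') = (real m)\<^sup>2 * \<kappa>"
proof -
  note fR = finite_set_replicate_pmf[OF fZ]
  have "E_pmf (samples m) (\<lambda>(zs, zs'). ustat w C f zs zs') =
     (\<Sum>c\<in>C. w c * (E_pmf (replicate_pmf m Z) (\<lambda>zs. vec_sum f zs c) * E_pmf (replicate_pmf m Z) (\<lambda>zs. vec_sum f zs c)))"
    by (simp add: samples_def E_pair_pmf[OF fR fR] ustat_def E_sum[OF fR])
  also have "\<dots> = (real m)\<^sup>2 * \<kappa>"
    by (simp add: mean_vec_sum \<kappa>_def sum_distrib_left power2_eq_square mult_ac)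
  finally show ?thesis .
qed

text \<open>Cauchy-Schwarz over index pairs between the matrix \<open>Q\<close> and the rank-one
  matrix built from \<theta>, whose weighted Hilbert-Schmidt norm is \<kappa>.\<close>

lemma quadratic_form_le: "(\<Sum>c\<in>C. \<Sum>c'\<in>C. w c * w c' * (Q c c' * (\<theta> c * \<theta> c'))) \<le> sqrt H2 * \<kappa>"
proof -
  let ?I = "C \<times> C"
  define a where "a = (\<lambda>(c, c'). sqrt (w c * w c') * Q c c')"
  define b where "b = (\<lambda>(c, c'). sqrt (w c * w c') * (\<theta> c * \<theta> c'))"
  have sq: "x * (q * t) = sqrt x * q * (sqrt x * t)" if "0 \<le> x" for x q t :: real
  proof -
    have "sqrt x * q * (sqrt x * t) = (sqrt x * sqrt x) * (q * t)" by (simp only: mult_ac)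
    then show ?thesis using that by simp
  qed
  have "(\<Sum>c\<in>C. \<Sum>c'\<in>C. w c * w c' * (Q c c' * (\<theta> c * \<theta> c'))) = (\<Sum>z\<in>?I. a z * b z)"
    unfolding sum.cartesian_product
  proof (intro sum.cong refl)
    fix z
    show "(case z of (c, c') \<Rightarrow> w c * w c' * (Q c c' * (\<theta> c * \<theta> c'))) = a z * b z"
      using sq[of "w (fst z) * w (snd z)"] w0 by (simp add: a_def b_def case_prod_unfold)
  qed
  also have "\<dots> \<le> L2_set a ?I * L2_set b ?I"
    using L2_set_mult_ineq[of a b ?I] by (rule order_trans[rotated]) (auto intro!: sum_mono simp: abs_mult[symmetric])
  also have "L2_set a ?I = sqrt H2"
    unfolding L2_set_def H2_def sum.cartesian_product using w0
    by (intro arg_cong[of _ _ sqrt] sum.cong refl) (auto simp: a_def power_mult_distrib)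
  also have "L2_set b ?I = sqrt (\<kappa>\<^sup>2)"
    unfolding L2_set_def \<kappa>_def power2_eq_square[of "sum _ _"] sum_product sum.cartesian_product using w0
    by (intro arg_cong[of _ _ sqrt] sum.cong refl) (auto simp: b_def power_mult_distrib)
  also have "sqrt (\<kappa>\<^sup>2) = \<kappa>" using kappa_nonneg by simp
  finally show ?thesis .
qed

text \<open>By independence of the two lists, the second moment is the weighted sum of the squared
  entries of m Q plus m (m-1) times the rank-one matrix of \<theta>. Expanding gives
  \<open>H2\<close>, a cross term bounded by \<open>quadratic_form_le\<close>, and a term that the
  squared mean absorbs.\<close>

lemma variance_ustat:
  "E_pmf (samples m) (\<lambda>(zs, zs'). (ustat w C f zs zs' - (real m)\<^sup>2 * \<kappa>)\<^sup>2) \<le>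
     (real m)\<^sup>2 * H2 + 2 * real m ^ 3 * (sqrt H2 * \<kappa>)"
proof (cases "m = 0")
  case True
  then show ?thesis by (simp add: samples_def ustat_def vec_sum_def E_pair_pmf)
next
  case False
  note fR = finite_set_replicate_pmf[OF fZ, of m]
  let ?R = "replicate_pmf m Z"
  define M where "M c c' = E_pmf ?R (\<lambda>zs. vec_sum f zs c * vec_sum f zs c')" for c c'
  have "E_pmf (samples m) (\<lambda>(zs, zs'). (ustat w C f zs zs')\<^sup>2) =
      E_pmf ?R (\<lambda>zs. E_pmf ?R (\<lambda>zs'. \<Sum>c\<in>C. \<Sum>c'\<in>C. w c * w c' *
        ((vec_sum f zs c * vec_sum f zs c') * (vec_sum f zs' c * vec_sum f zs' c'))))"
    by (simp add: samples_def E_pair_pmf[OF fR fR] ustat_def power2_eq_square sum_product mult_ac)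
  also have "\<dots> = (\<Sum>c\<in>C. \<Sum>c'\<in>C. w c * w c' * (M c c')\<^sup>2)"
    by (simp only: E_sum[OF fR] E_E_mult M_def power2_eq_square)
  finally have second: "E_pmf (samples m) (\<lambda>(zs, zs'). (ustat w C f zs zs')\<^sup>2) = (\<Sum>c\<in>C. \<Sum>c'\<in>C. w c * w c' * (M c c')\<^sup>2)" .
  define S where "S = (\<Sum>c\<in>C. \<Sum>c'\<in>C. w c * w c' * (Q c c' * (\<theta> c * \<theta> c')))"
  have k2: "(\<Sum>c\<in>C. \<Sum>c'\<in>C. w c * w c' * (\<theta> c * \<theta> c')\<^sup>2) = \<kappa>\<^sup>2"
    unfolding \<kappa>_def power2_eq_square[of "sum _ _"] sum_product by (simp add: power_mult_distrib mult_ac)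
  define n where "n = real m * (real m - 1)"
  have n: "0 \<le> n" "n \<le> (real m)\<^sup>2" using False by (auto simp: n_def power2_eq_square)
  have "(\<Sum>c\<in>C. \<Sum>c'\<in>C. w c * w c' * (M c c')\<^sup>2) =
    (\<Sum>c\<in>C. \<Sum>c'\<in>C. (real m)\<^sup>2 * (w c * w c' * (Q c c')\<^sup>2) + 2 * real m * n * (w c * w c' * (Q c c' * (\<theta> c * \<theta> c')))
       + n\<^sup>2 * (w c * w c' * (\<theta> c * \<theta> c')\<^sup>2))"
    unfolding M_def second_moment_vec_sum n_def by (intro sum.cong refl) (simp add: power2_eq_square algebra_simps)
  also have "\<dots> = (real m)\<^sup>2 * H2 + 2 * real m * n * S + n\<^sup>2 * \<kappa>\<^sup>2"
    unfolding k2[symmetric] S_def H2_def by (simp add: sum.distrib sum_distrib_left)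
  also have "\<dots> \<le> (real m)\<^sup>2 * H2 + 2 * real m * n * (sqrt H2 * \<kappa>) + ((real m)\<^sup>2)\<^sup>2 * \<kappa>\<^sup>2"
    using quadratic_form_le n by (intro add_mono mult_left_mono mult_right_mono power_mono) (auto simp: S_def)
  also have "2 * real m * n * (sqrt H2 * \<kappa>) \<le> 2 * real m * (real m)\<^sup>2 * (sqrt H2 * \<kappa>)"
    using n kappa_nonneg H2_nonneg by (intro mult_right_mono mult_left_mono) auto
  finally have EU2: "E_pmf (samples m) (\<lambda>(zs, zs'). (ustat w C f zs zs')\<^sup>2) \<le>
      (real m)\<^sup>2 * H2 + 2 * real m ^ 3 * (sqrt H2 * \<kappa>) + ((real m)\<^sup>2 * \<kappa>)\<^sup>2"
    unfolding second by (simp add: power2_eq_square power3_eq_cube power_mult_distrib mult_ac)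
  have "E_pmf (samples m) (\<lambda>(zs, zs'). (ustat w C f zs zs' - (real m)\<^sup>2 * \<kappa>)\<^sup>2) =
    E_pmf (samples m) (\<lambda>z. (case z of (zs, zs') \<Rightarrow> (ustat w C f zs zs')\<^sup>2) +
      ((- 2 * ((real m)\<^sup>2 * \<kappa>)) * (case z of (zs, zs') \<Rightarrow> ustat w C f zs zs') + ((real m)\<^sup>2 * \<kappa>)\<^sup>2))"
    by (intro E_cong) (auto simp: power2_diff algebra_simps)
  also have "\<dots> = E_pmf (samples m) (\<lambda>(zs, zs'). (ustat w C f zs zs')\<^sup>2) - ((real m)\<^sup>2 * \<kappa>)\<^sup>2"
    by (simp only: E_add[OF finite_samples] integral_mult_right_zero mean_ustat lebesgue_integral_const
        measure_pmf.prob_space) (simp add: power2_eq_square)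
  finally show ?thesis using EU2 by simp
qed

text \<open>Chebyshev's inequality, as Markov's applied to the squared deviation.\<close>

lemma ustat_upper_tail:
  assumes "(real m)\<^sup>2 * \<kappa> < \<tau>"
  shows "measure_pmf.prob (samples m) {(zs, zs'). \<tau> \<le> ustat w C f zs zs'} \<le>
    ((real m)\<^sup>2 * H2 + 2 * real m ^ 3 * (sqrt H2 * \<kappa>)) / (\<tau> - (real m)\<^sup>2 * \<kappa>)\<^sup>2"
proof -
  let ?u = "\<lambda>(zs, zs'). (ustat w C f zs zs' - (real m)\<^sup>2 * \<kappa>)\<^sup>2"
  have "measure_pmf.prob (samples m) {(zs, zs'). \<tau> \<le> ustat w C f zs zs'} \<le>
      measure_pmf.prob (samples m) {z. (\<tau> - (real m)\<^sup>2 * \<kappa>)\<^sup>2 \<le> ?u z}"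
    using assms by (intro measure_pmf.finite_measure_mono) (auto intro!: power_mono)
  also have "\<dots> \<le> E_pmf (samples m) ?u / (\<tau> - (real m)\<^sup>2 * \<kappa>)\<^sup>2"
    using assms by (intro Markov_pmf finite_samples) auto
  also have "\<dots> \<le> ((real m)\<^sup>2 * H2 + 2 * real m ^ 3 * (sqrt H2 * \<kappa>)) / (\<tau> - (real m)\<^sup>2 * \<kappa>)\<^sup>2"
    by (intro divide_right_mono variance_ustat) auto
  finally show ?thesis .
qed

lemma ustat_lower_tail:
  assumes "\<tau> < (real m)\<^sup>2 * \<kappa>"
  shows "measure_pmf.prob (samples m) {(zs, zs'). ustat w C f zs zs' < \<tau>} \<le>
    ((real m)\<^sup>2 * H2 + 2 * real m ^ 3 * (sqrt H2 * \<kappa>)) / ((real m)\<^sup>2 * \<kappa> - \<tau>)\<^sup>2"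
proof -
  let ?u = "\<lambda>(zs, zs'). (ustat w C f zs zs' - (real m)\<^sup>2 * \<kappa>)\<^sup>2"
  have "measure_pmf.prob (samples m) {(zs, zs'). ustat w C f zs zs' < \<tau>} \<le>
      measure_pmf.prob (samples m) {z. ((real m)\<^sup>2 * \<kappa> - \<tau>)\<^sup>2 \<le> ?u z}"
    using assms
    by (intro measure_pmf.finite_measure_mono)
      (auto simp: power2_commute[of _ "(real m)\<^sup>2 * \<kappa>"] intro!: power_mono)
  also have "\<dots> \<le> E_pmf (samples m) ?u / ((real m)\<^sup>2 * \<kappa> - \<tau>)\<^sup>2"
    using assms by (intro Markov_pmf finite_samples) auto
  also have "\<dots> \<le> ((real m)\<^sup>2 * H2 + 2 * real m ^ 3 * (sqrt H2 * \<kappa>)) / ((real m)\<^sup>2 * \<kappa> - \<tau>)\<^sup>2"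
    by (intro divide_right_mono variance_ustat) auto
  finally show ?thesis .
qed

text \<open>Expanding the square identifies \<open>H2\<close> with the second moment of the inner
  product of two independent vectors. For spread samples this form is easier to bound than
  \<open>Q\<close>.\<close>

lemma H2_eq: "H2 = E_pmf Z (\<lambda>z. E_pmf Z (\<lambda>z'. (\<Sum>c\<in>C. w c * (f z c * f z' c))\<^sup>2))"
proof -
  have "E_pmf Z (\<lambda>z. E_pmf Z (\<lambda>z'. (\<Sum>c\<in>C. w c * (f z c * f z' c))\<^sup>2)) =
    E_pmf Z (\<lambda>z. E_pmf Z (\<lambda>z'. \<Sum>c\<in>C. \<Sum>c'\<in>C. w c * w c' * ((f z c * f z c') * (f z' c * f z' c'))))"
    by (simp add: power2_eq_square sum_product mult_ac)
  also have "\<dots> = H2" by (simp only: E_sum[OF fZ] E_E_mult H2_def Q_def power2_eq_square)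
  finally show ?thesis by simp
qed

end

section \<open>Probing a cell\<close>

text \<open>The invariant is that \<open>pt lo\<close> lies in the cell and
  \<open>pt (lo + w)\<close> does not.\<close>

primrec bisect_q :: "(real \<Rightarrow> point) \<Rightarrow> nat \<Rightarrow> real \<Rightarrow> real \<Rightarrow> real qtree" where
  "bisect_q pt 0 lo w = Answer lo"
| "bisect_q pt (Suc n) lo w = Ask (pt (lo + w / 2)) (\<lambda>b. bisect_q pt n (if b then lo + w / 2 else lo) (w / 2))"

lemma asks_bisect_q: "asks (bisect_q pt n lo w) n"
  by (induction n arbitrary: lo w) auto

lemma eval_bisect_q:
  assumes "P (pt lo)" "\<not> P (pt (lo + w))" "0 \<le> w"
  shows "P (pt (eval_q P (bisect_q pt n lo w))) \<and> \<not> P (pt (eval_q P (bisect_q pt n lo w) + w / 2 ^ n)) \<and>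
    lo \<le> eval_q P (bisect_q pt n lo w)"
  using assms
proof (induction n arbitrary: lo w)
  case (Suc n)
  show ?case
  proof (cases "P (pt (lo + w / 2))")
    case True
    have "lo + w / 2 + w / 2 = lo + w" by simp
    then show ?thesis using True Suc.IH[of "lo + w / 2" "w / 2", unfolded \<open>lo + w / 2 + w / 2 = lo + w\<close>] Suc.prems by simp
  next
    case False
    then show ?thesis using Suc.IH[of lo "w / 2"] Suc.prems by simp
  qed
qed simp

definition directions :: "nat \<Rightarrow> (nat \<times> bool) list" where
  "directions d = List.product [0..<d] [False, True]"

lemma set_directions: "set (directions d) = {..<d} \<times> UNIV"
  by (auto simp: directions_def)

lemma length_directions: "length (directions d) = 2 * d"
  by (simp add: directions_def)

text \<open>Bisection starts from the interval [0,2], because a move by 2 certainly leaves the unit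
  cube.\<close>

definition bisect_width :: "nat \<Rightarrow> real" where
  "bisect_width n = 2 / 2 ^ n"

lemma bisect_width_pos: "0 < bisect_width n" by (simp add: bisect_width_def)

definition axis_extent_q :: "nat \<Rightarrow> point \<Rightarrow> nat \<times> bool \<Rightarrow> real qtree" where
  "axis_extent_q n r = (\<lambda>(i, \<sigma>). bisect_q (\<lambda>t. axis_move r i (sgn_of \<sigma> * t)) n 0 2)"

definition corner :: "nat \<Rightarrow> point \<Rightarrow> (nat \<Rightarrow> bool \<Rightarrow> real) \<Rightarrow> (nat \<Rightarrow> bool) \<Rightarrow> point" where
  "corner d r e c = (\<lambda>k\<in>{..<d}. r k + sgn_of (c k) * e k (c k))"

text \<open>Pairs bound the extent of a cell with quadratically many queries. The 2^d corners
  additionally put the whole recorded box into \<open>star\<close>, as volumes require.\<close>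

definition check_points :: "bool \<Rightarrow> nat \<Rightarrow> point \<Rightarrow> (nat \<Rightarrow> bool \<Rightarrow> real) \<Rightarrow> point list" where
  "check_points full d r e =
     map (\<lambda>((i, \<sigma>), (j, \<tau>)). pair_point d r e i \<sigma> j \<tau>) (List.product (directions d) (directions d)) @
     (if full then map (\<lambda>cs. corner d r e (\<lambda>k. cs ! k)) (List.n_lists d [False, True]) else [])"

text \<open>
  The recorded extents are shortened by one bisection width, so that for a box all points to be
  checked lie in its interior.
\<close>

definition probe_q :: "bool \<Rightarrow> nat \<Rightarrow> nat \<Rightarrow> point \<Rightarrow> (nat \<Rightarrow> bool \<Rightarrow> real) option qtree" where
  "probe_q full n d r = bind_q (collect_q (axis_extent_q n r) (directions d)) (\<lambda>ts.
     let e = (\<lambda>i \<sigma>. the (map_of (zip (directions d) ts) (i, \<sigma>)) - bisect_width n) in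
     bind_q (collect_q (\<lambda>x. Ask x Answer) (check_points full d r e)) (\<lambda>bs.
       Answer (if list_all id bs then Some e else None)))"

definition probe_cost :: "bool \<Rightarrow> nat \<Rightarrow> nat \<Rightarrow> nat" where
  "probe_cost full n d = 2 * d * n + 4 * d\<^sup>2 + (if full then 2 ^ d else 0)"

lemma length_check_points: "length (check_points full d r e) = 4 * d\<^sup>2 + (if full then 2 ^ d else 0)"
  by (simp add: check_points_def length_directions length_n_lists power2_eq_square
      flip: numeral_2_eq_2)

lemma asks_probe_q: "asks (probe_q full n d r) (probe_cost full n d)"
proof -
  have ext: "asks (collect_q (axis_extent_q n r) (directions d)) (length (directions d) * n)"
    by (rule asks_collect_q) (auto simp: axis_extent_q_def asks_bisect_q split: prod.split)
  have check: "asks (bind_q (collect_q (\<lambda>x. Ask x Answer) (check_points full d r e)) (\<lambda>bs. Answer (g bs)))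
      (4 * d\<^sup>2 + (if full then 2 ^ d else 0))" for e and g :: "bool list \<Rightarrow> (nat \<Rightarrow> bool \<Rightarrow> real) option"
    using asks_bind_q[OF asks_collect_q[of "\<lambda>x. Ask x Answer" 1 "check_points full d r e"], of "\<lambda>bs. Answer (g bs)" 0]
    by (simp add: length_check_points)
  have "asks (probe_q full n d r) (length (directions d) * n + (4 * d\<^sup>2 + (if full then 2 ^ d else 0)))"
    unfolding probe_q_def Let_def by (rule asks_bind_q[OF ext check])
  then show ?thesis by (simp add: probe_cost_def length_directions add.assoc)
qed

text \<open>The value that \<open>probe_q\<close> records, shortening included, as a function of the
  cell alone.\<close>

definition extent :: "nat \<Rightarrow> point set \<Rightarrow> point \<Rightarrow> nat \<Rightarrow> bool \<Rightarrow> real" where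
  "extent n G r i \<sigma> = eval_q (\<lambda>x. x \<in> G) (axis_extent_q n r (i, \<sigma>)) - bisect_width n"

lemma corner_cong: "(\<And>k. k < d \<Longrightarrow> c k = c' k \<and> e k (c k) = e' k (c k)) \<Longrightarrow> corner d r e c = corner d r e' c'"
  unfolding corner_def
proof (intro restrict_ext)
  fix k assume *: "\<And>k. k < d \<Longrightarrow> c k = c' k \<and> e k (c k) = e' k (c k)" and "k \<in> {..<d}"
  then have "c k = c' k" "e k (c k) = e' k (c k)" using *[of k] by auto
  then show "r k + sgn_of (c k) * e k (c k) = r k + sgn_of (c' k) * e' k (c' k)" by simp
qed

lemma set_check_points:
  "set (check_points full d r e) \<subseteq> G \<longleftrightarrow>
    (\<forall>i<d. \<forall>\<sigma>. \<forall>j<d. \<forall>\<tau>. pair_point d r e i \<sigma> j \<tau> \<in> G) \<and> (full \<longrightarrow> (\<forall>c. corner d r e c \<in> G))"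
proof -
  have "(\<forall>cs. length cs = d \<longrightarrow> corner d r e (\<lambda>k. cs ! k) \<in> G) \<longleftrightarrow> (\<forall>c. corner d r e c \<in> G)"
  proof (intro iffI allI impI)
    fix c assume *: "\<forall>cs. length cs = d \<longrightarrow> corner d r e (\<lambda>k. cs ! k) \<in> G"
    have "corner d r e c = corner d r e (\<lambda>k. map c [0..<d] ! k)" by (rule corner_cong) simp
    then show "corner d r e c \<in> G" using * by simp
  qed simp
  moreover have "set (List.n_lists d [False, True]) = {cs. length cs = d}"
    by (auto simp: set_n_lists)
  ultimately show ?thesis
    by (auto simp: check_points_def set_directions image_subset_iff)
qed

text \<open>The odd value for \<open>i \<ge> d\<close> is a failed lookup in the list of recorded
  extents; later uses read only directions below \<open>d\<close>.\<close>

lemma eval_probe_q: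
  "eval_q (\<lambda>x. x \<in> G) (probe_q full n d r) =
    (if set (check_points full d r (extent n G r)) \<subseteq> G then Some (\<lambda>i \<sigma>. if i < d then extent n G r i \<sigma>
      else the None - bisect_width n) else None)"
proof -
  let ?ts = "map (\<lambda>x. eval_q (\<lambda>x. x \<in> G) (axis_extent_q n r x)) (directions d)"
  let ?e = "\<lambda>i \<sigma>. the (map_of (zip (directions d) ?ts) (i, \<sigma>)) - bisect_width n"
  have e: "?e = (\<lambda>i \<sigma>. if i < d then extent n G r i \<sigma> else the None - bisect_width n)"
    by (intro ext) (auto simp: map_of_zip_map set_directions extent_def)
  have "check_points full d r ?e = check_points full d r (extent n G r)"
    unfolding check_points_def e
    by (auto simp: pair_point_def set_directions intro!: corner_cong)
  moreover have "list_all id (map (\<lambda>x. x \<in> G) xs) \<longleftrightarrow> set xs \<subseteq> G" for xs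
    by (auto simp: list_all_iff)
  ultimately show ?thesis by (simp add: probe_q_def Let_def e comp_def)
qed

definition probe_ok :: "bool \<Rightarrow> nat \<Rightarrow> nat \<Rightarrow> point set \<Rightarrow> point \<Rightarrow> bool" where
  "probe_ok full n d G r \<longleftrightarrow> set (check_points full d r (extent n G r)) \<subseteq> G"

definition box_size :: "(nat \<Rightarrow> bool \<Rightarrow> real) \<Rightarrow> nat \<Rightarrow> real" where
  "box_size e k = e k True + e k False"

context convex_cell
begin

text \<open>One bisection width was subtracted, so the bracketing points sit one and two widths
  beyond the recorded extent. The lower bound holds because a point of the axis outside the cell has
  distance at least \<delta> from \<open>r\<close>.\<close>

lemma axis_extent:
  assumes i: "i < d"
  shows "axis_move r i (sgn_of \<sigma> * (extent n G r i \<sigma> + bisect_width n)) \<in> G"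
    and "axis_move r i (sgn_of \<sigma> * (extent n G r i \<sigma> + 2 * bisect_width n)) \<notin> G"
    and "\<delta> - 2 * bisect_width n \<le> extent n G r i \<sigma>"
    and "extent n G r i \<sigma> \<le> 1"
proof -
  let ?pt = "\<lambda>t. axis_move r i (sgn_of \<sigma> * t)"
  have ri: "0 \<le> r i" "r i \<le> 1" using rG Gcube i by (auto simp: cube_def PiE_iff)
  have cube: "\<bar>t\<bar> \<le> 1" if "?pt t \<in> G" for t
  proof -
    have "?pt t i \<in> {0..1}" using that Gcube i by (auto simp: cube_def PiE_iff)
    then show ?thesis using ri by (cases \<sigma>) (auto simp: axis_move_def)
  qed
  have "?pt 0 \<in> G" using rG by (simp add: axis_move_def)
  moreover have "?pt (0 + 2) \<notin> G" using cube[of 2] by auto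
  ultimately have *: "?pt (extent n G r i \<sigma> + bisect_width n) \<in> G"
    "?pt (extent n G r i \<sigma> + bisect_width n + bisect_width n) \<notin> G"
    using eval_bisect_q[of "\<lambda>x. x \<in> G" ?pt 0 2 n] unfolding extent_def axis_extent_q_def
    by (simp_all add: bisect_width_def)
  then show "?pt (extent n G r i \<sigma> + bisect_width n) \<in> G"
    and out: "?pt (extent n G r i \<sigma> + 2 * bisect_width n) \<notin> G" by (simp_all add: add.assoc)
  show "extent n G r i \<sigma> \<le> 1" using cube[OF *(1)] bisect_width_pos[of n] by linarith
  show "\<delta> - 2 * bisect_width n \<le> extent n G r i \<sigma>"
  proof (rule ccontr)
    assume "\<not> ?thesis"
    moreover have "0 \<le> eval_q (\<lambda>x. x \<in> G) (axis_extent_q n r (i, \<sigma>))"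
      using eval_bisect_q[of "\<lambda>x. x \<in> G" ?pt 0 2 n] \<open>?pt 0 \<in> G\<close> \<open>?pt (0 + 2) \<notin> G\<close>
      by (simp add: axis_extent_q_def)
    then have "- bisect_width n \<le> extent n G r i \<sigma>" by (simp add: extent_def)
    ultimately have "\<bar>sgn_of \<sigma> * (extent n G r i \<sigma> + 2 * bisect_width n)\<bar> < \<delta>"
      using bisect_width_pos[of n] by (simp add: abs_mult)
    then show False using ball_axis[OF i] out by blast
  qed
qed

text \<open>Halving \<delta> pays for the two widths by which a recorded extent can fall short of
  \<delta>.\<close>

lemma probed_cell:
  assumes ok: "probe_ok full n d G r" and w: "bisect_width n \<le> \<delta> / 4"
  shows "probed_cell d \<delta> G S r (extent n G r) (\<delta> / 2) (2 * bisect_width n)"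
proof
  show "0 < \<delta> / 2" using \<delta> by simp
  show "0 < 2 * bisect_width n" using bisect_width_pos by simp
  show "\<delta> / 2 \<le> extent n G r i \<sigma>" if "i < d" for i \<sigma> using axis_extent(3)[OF that, of n \<sigma>] w by simp
  show "pair_point d r (extent n G r) i \<sigma> j \<tau> \<in> G" if "i < d" "j < d" for i \<sigma> j \<tau>
    using ok that by (auto simp: probe_ok_def set_check_points)
  show "axis_move r i (sgn_of \<sigma> * (extent n G r i \<sigma> + 2 * bisect_width n)) \<notin> G" if "i < d" for i \<sigma>
    using axis_extent(2)[OF that] .
qed

text \<open>The error of \<open>cell_extent\<close> for \<open>\<delta>' = \<delta> / 2\<close> and
  \<open>w = 2 * bisect_width n\<close>, with the summand 1 estimated by d/\<delta>.\<close>

definition slack :: "nat \<Rightarrow> real" where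
  "slack n = 6 * bisect_width n * d / \<delta>"

lemma probe_extent:
  assumes ok: "probe_ok full n d G r" and w: "bisect_width n \<le> \<delta> / 4" and \<delta>1: "\<delta> \<le> 1"
    and x: "x \<in> G" and i: "i < d"
  shows "r i - extent n G r i False - slack n \<le> x i" "x i \<le> r i + extent n G r i True + slack n"
proof -
  interpret probed_cell d \<delta> G S r "extent n G r" "\<delta> / 2" "2 * bisect_width n"
    by (rule probed_cell[OF ok w])
  have "2 * bisect_width n * (1 + d / (\<delta> / 2)) \<le> slack n"
  proof -
    have "1 \<le> d / \<delta>" using d \<delta> \<delta>1 by (simp add: le_divide_eq)
    then have "2 * bisect_width n * (1 + d / (\<delta> / 2)) \<le> 2 * bisect_width n * (d / \<delta> + d / (\<delta> / 2))"
      using bisect_width_pos[of n] by (intro mult_left_mono) auto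
    also have "\<dots> = slack n" by (simp add: slack_def)
    finally show ?thesis .
  qed
  with cell_extent[OF x i, of True] cell_extent[OF x i, of False]
  show "r i - extent n G r i False - slack n \<le> x i" "x i \<le> r i + extent n G r i True + slack n" by simp_all
qed

text \<open>The precision \<delta>^2/(24 d) is chosen to bring the slack down to \<delta>/4, below
  every recorded extent.\<close>

lemma slack_le:
  assumes "bisect_width n \<le> \<delta>\<^sup>2 / (24 * d)" "i < d" and \<delta>1: "\<delta> \<le> 1"
  shows "bisect_width n \<le> \<delta> / 4" "slack n \<le> \<delta> / 4" "slack n \<le> extent n G r i \<sigma>"
proof -
  have "\<delta>\<^sup>2 / (24 * d) \<le> \<delta> / 24"
  proof -
    have "\<delta> * \<delta> \<le> \<delta> * d" using d \<delta> \<delta>1 by (intro mult_left_mono) auto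
    then show ?thesis using d by (simp add: power2_eq_square field_simps)
  qed
  then show w: "bisect_width n \<le> \<delta> / 4" using assms \<delta> by simp
  have "slack n \<le> 6 * (\<delta>\<^sup>2 / (24 * d)) * d / \<delta>" unfolding slack_def
    using assms \<delta> by (intro divide_right_mono mult_right_mono mult_left_mono) auto
  also have "\<dots> = \<delta> / 4" using d \<delta> by (simp add: power2_eq_square)
  finally show s: "slack n \<le> \<delta> / 4" .
  then show "slack n \<le> extent n G r i \<sigma>" using axis_extent(3)[OF assms(2), of n \<sigma>] w \<delta> by simp
qed

text \<open>The slack on either side is at most the recorded extent there, so the certified
  enclosure has at most twice the side lengths of the recorded box.\<close>

lemma probe_diameter:
  assumes ok: "probe_ok full n d G r" and w: "bisect_width n \<le> \<delta>\<^sup>2 / (24 * d)" and \<delta>1: "\<delta> \<le> 1" and p: "1 \<le> p"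
    and x: "x \<in> G" and y: "\<And>i. i < d \<Longrightarrow> r i - extent n G r i False - slack n \<le> y i \<and>
      y i \<le> r i + extent n G r i True + slack n"
  shows "lp_dist d p x y \<le> 2 * lp_dist d p (box_size (extent n G r)) (\<lambda>_. 0)"
proof (rule lp_dist_scale_mono[OF p])
  fix i assume i: "i < d"
  note s = slack_le[OF w i \<delta>1]
  have "\<bar>x i - y i\<bar> \<le> extent n G r i True + extent n G r i False + 2 * slack n"
    using probe_extent[OF ok s(1) \<delta>1 x i] y[OF i] by linarith
  also have "\<dots> \<le> 2 * \<bar>box_size (extent n G r) i - 0\<bar>"
    using s(3)[of True] s(3)[of False] by (simp add: box_size_def abs_if)
  finally show "\<bar>x i - y i\<bar> \<le> 2 * \<bar>box_size (extent n G r) i - 0\<bar>" .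
qed simp

text \<open>In a box, the axis points that bisection found inside lie one width beyond the recorded
  ones. This makes the coordinatewise inequalities strict, whatever part of the boundary belongs to
  the cell.\<close>

lemma box_probe:
  assumes box: "axis_aligned_box d G" and w: "bisect_width n \<le> \<delta> / 4"
    and y: "y \<in> extensional {..<d}" "\<And>k. k < d \<Longrightarrow> r k - extent n G r k False \<le> y k \<and> y k \<le> r k + extent n G r k True"
  shows "y \<in> G"
proof -
  obtain a b where ab: "euclidean_top d interior_of closed_box d a b \<subseteq> G" "G \<subseteq> closed_box d a b"
    using box by (auto simp: axis_aligned_box_def)
  show ?thesis
  proof (rule interior_of_box_in_cell[OF ab(1) y(1)])
    fix i assume i: "i < d"
    have "axis_move r i (sgn_of \<sigma> * (extent n G r i \<sigma> + bisect_width n)) i \<in> {a i..b i}" for \<sigma>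
      using axis_extent(1)[OF i, of \<sigma> n] ab(2) i by (auto simp: closed_box_def PiE_iff)
    from this[of True] this[of False] show "a i < y i \<and> y i < b i"
      using y(2)[OF i] bisect_width_pos[of n] by (auto simp: axis_move_def)
  qed
qed

lemma box_probe_ok:
  assumes box: "axis_aligned_box d G" and w: "bisect_width n \<le> \<delta> / 4"
  shows "probe_ok full n d G r"
proof -
  have pos: "0 \<le> extent n G r i \<sigma>" if "i < d" for i \<sigma> using axis_extent(3)[OF that, of n \<sigma>] w \<delta> by simp
  then have pos': "- extent n G r i False \<le> extent n G r i True" if "i < d" for i
    using pos[OF that, of True] pos[OF that, of False] that by linarith
  show ?thesis unfolding probe_ok_def set_check_points
  proof (intro conjI impI allI)
    show "pair_point d r (extent n G r) i \<sigma> j \<tau> \<in> G" if "i < d" "j < d" for i \<sigma> j \<tau>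
      by (rule box_probe[OF box w]) (use pos pos' in \<open>auto simp: pair_point_def sgn_of_def\<close>)
    show "corner d r (extent n G r) c \<in> G" for c
      by (rule box_probe[OF box w]) (use pos pos' in \<open>auto simp: corner_def sgn_of_def\<close>)
  qed
qed

text \<open>Two opposite recorded corners lie in the cell and differ by \<open>box_size\<close> in
  every coordinate. Hence a box of small diameter is never flagged as large.\<close>

lemma box_size_le_diam:
  assumes box: "axis_aligned_box d G" and w: "bisect_width n \<le> \<delta> / 4" and p: "1 \<le> p"
  shows "lp_dist d p (box_size (extent n G r)) (\<lambda>_. 0) \<le> lp_diam d p G"
proof -
  have pos: "0 \<le> extent n G r i \<sigma>" if "i < d" for i \<sigma> using axis_extent(3)[OF that, of n \<sigma>] w \<delta> by simp
  then have pos': "- extent n G r i False \<le> extent n G r i True" if "i < d" for i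
    using pos[OF that, of True] pos[OF that, of False] that by linarith
  let ?c = "\<lambda>b. corner d r (extent n G r) (\<lambda>_. b)"
  have c: "?c b \<in> G" for b
    by (rule box_probe[OF box w]) (use pos pos' in \<open>auto simp: corner_def sgn_of_def\<close>)
  have "lp_dist d p (box_size (extent n G r)) (\<lambda>_. 0) = lp_dist d p (?c True) (?c False)"
    by (simp add: lp_dist_def corner_def box_size_def)
  also have "\<dots> \<le> lp_diam d p G" unfolding lp_diam_def
  proof (rule cSUP_upper2)
    show "bdd_above ((\<lambda>(x, y). lp_dist d p x y) ` (G \<times> G))"
      using lp_dist_cube_le_1[OF p d] Gcube by (intro bdd_aboveI2[of _ _ 1]) auto
    show "(?c True, ?c False) \<in> G \<times> G" using c by simp
  qed simp
  finally show ?thesis .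
qed

end

lemma CV_convex_cell:
  assumes "K \<in> CV d \<delta>" "1 \<le> d" "0 < \<delta>" "i < num_cells K"
  shows "\<exists>S. convex_cell d \<delta> (cell K i) S (rep K i)"
proof -
  have K: "is_clustering d K" using assms by (simp add: CV_def)
  obtain S where "openin (euclidean_top d) S" "convex_d d S" "S \<subseteq> cell K i" "cell K i \<subseteq> euclidean_top d closure_of S"
    "eucl_ball d (rep K i) \<delta> \<subseteq> cell K i" using assms by (auto simp: CV_def)
  moreover have "rep K i \<in> cell K i" "cell K i \<subseteq> cube d"
    using K assms(4) by (auto simp: is_clustering_def)
  ultimately show ?thesis using assms by (auto intro!: exI[of _ S] convex_cell.intro)
qed

text \<open>A ball of radius \<delta> has to fit into the unit interval along coordinate 0. The name
  refers to the consequence that \<open>CV d \<delta>\<close> is empty for \<delta> > 1/2.\<close>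

lemma CV_empty:
  assumes K: "K \<in> CV d \<delta>" and d: "1 \<le> d" and \<delta>: "0 < \<delta>"
  shows "\<delta> \<le> 1 / 2"
proof -
  have "is_clustering d K" using K by (simp add: CV_def)
  moreover have "(\<lambda>i\<in>{..<d}. 0) \<in> cube d" by (auto simp: cube_def)
  ultimately obtain i where i: "i < num_cells K" unfolding is_clustering_def by blast
  obtain S where "convex_cell d \<delta> (cell K i) S (rep K i)" using CV_convex_cell[OF K d \<delta> i] by blast
  then interpret convex_cell d \<delta> "cell K i" S "rep K i" .
  have 0: "0 < d" using d by simp
  have "axis_move (rep K i) 0 t 0 \<in> {0..1}" if "\<bar>t\<bar> < \<delta>" for t
    using ball_axis[OF 0 that] Gcube 0 by (auto simp: cube_def PiE_iff)
  then have "\<bar>t\<bar> < \<delta> \<Longrightarrow> rep K i 0 + t \<in> {0..1}" for t by (simp add: axis_move_def)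
  \<comment> \<open>If \<delta> > 1/2, this offset is below \<delta> while twice the offset exceeds
    1.\<close>
  from this[of "(1 / 4 + \<delta> / 2)"] this[of "- (1 / 4 + \<delta> / 2)"] show ?thesis by (rule_tac ccontr) auto
qed

section \<open>Volumes and dyadic bins\<close>

lemma cube_sets: "cube d \<in> sets (\<Pi>\<^sub>M i\<in>{..<d}. lborel)"
  unfolding cube_def by (intro sets_PiM_I_finite) auto

lemma lebesgue_sets_PiM: "A \<in> sets (\<Pi>\<^sub>M i\<in>{..<d}. lborel) \<Longrightarrow> A \<in> sets (lebesgue_d d)"
  by (simp add: lebesgue_d_def)

lemma cube_lebesgue_d: "cube d \<in> sets (lebesgue_d d)"
  by (intro lebesgue_sets_PiM cube_sets)

lemma space_uniform_cube: "space (uniform_cube d) = cube d"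
  by (auto simp: uniform_cube_def space_restrict_space lebesgue_d_def space_PiM cube_def)

lemma sets_uniform_cube: "A \<in> sets (uniform_cube d) \<longleftrightarrow> A \<in> sets (lebesgue_d d) \<and> A \<subseteq> cube d"
proof -
  have "cube d \<inter> space (lebesgue_d d) = cube d"
    using sets.sets_into_space[OF cube_lebesgue_d] by auto
  then show ?thesis
    using cube_lebesgue_d unfolding uniform_cube_def by (subst sets_restrict_space_iff) auto
qed

lemma emeasure_uniform_cube:
  "A \<in> sets (lebesgue_d d) \<Longrightarrow> A \<subseteq> cube d \<Longrightarrow> emeasure (uniform_cube d) A = emeasure (lebesgue_d d) A"
  unfolding uniform_cube_def
  using cube_lebesgue_d sets.sets_into_space[OF cube_lebesgue_d]
  by (intro emeasure_restrict_space) (auto simp: Int_absorb2)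

lemma emeasure_uniform_cube_PiE:
  assumes A: "\<And>i. i < d \<Longrightarrow> A i \<in> sets borel" "\<And>i. i < d \<Longrightarrow> A i \<subseteq> {0..1}"
  shows "(\<Pi>\<^sub>E i\<in>{..<d}. A i) \<in> sets (uniform_cube d)"
    and "emeasure (uniform_cube d) (\<Pi>\<^sub>E i\<in>{..<d}. A i) = (\<Prod>i<d. emeasure lborel (A i))"
proof -
  interpret product_sigma_finite "\<lambda>_. lborel :: real measure" ..
  have m: "(\<Pi>\<^sub>E i\<in>{..<d}. A i) \<in> sets (\<Pi>\<^sub>M i\<in>{..<d}. lborel)"
    using A by (intro sets_PiM_I_finite) auto
  have sub: "(\<Pi>\<^sub>E i\<in>{..<d}. A i) \<subseteq> cube d" unfolding cube_def using A by (intro PiE_mono) auto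
  show "(\<Pi>\<^sub>E i\<in>{..<d}. A i) \<in> sets (uniform_cube d)"
    using m sub by (simp add: sets_uniform_cube lebesgue_sets_PiM)
  show "emeasure (uniform_cube d) (\<Pi>\<^sub>E i\<in>{..<d}. A i) = (\<Prod>i<d. emeasure lborel (A i))"
    using m sub A by (simp add: emeasure_uniform_cube lebesgue_sets_PiM lebesgue_d_def) (subst emeasure_PiM, auto)
qed

lemma measure_uniform_cube_PiE:
  assumes "\<And>i. i < d \<Longrightarrow> A i \<in> sets borel" "\<And>i. i < d \<Longrightarrow> A i \<subseteq> {0..1}"
    and "\<And>i. i < d \<Longrightarrow> 0 \<le> c i \<and> emeasure lborel (A i) = ennreal (c i)"
  shows "measure (uniform_cube d) (\<Pi>\<^sub>E i\<in>{..<d}. A i) = (\<Prod>i<d. c i)"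
proof -
  have "emeasure (uniform_cube d) (\<Pi>\<^sub>E i\<in>{..<d}. A i) = ennreal (\<Prod>i<d. c i)"
    using assms by (simp add: emeasure_uniform_cube_PiE) (subst prod_ennreal, auto)
  moreover have "0 \<le> (\<Prod>i<d. c i)" using assms(3) by (intro prod_nonneg) auto
  ultimately show ?thesis by (simp add: measure_def)
qed

lemma prob_space_uniform_cube: "prob_space (uniform_cube d)"
proof
  show "emeasure (uniform_cube d) (space (uniform_cube d)) = 1"
    unfolding space_uniform_cube cube_def by (subst emeasure_uniform_cube_PiE) auto
qed

lemma space_input_distribution: "input_distribution d \<mu> \<Longrightarrow> space \<mu> = cube d"
  using sets_eq_imp_space_eq[of \<mu> "uniform_cube d"] by (simp add: input_distribution_def space_uniform_cube)

lemma CV_clustered_source: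
  assumes K: "K \<in> CV d \<delta>" and mu: "input_distribution d \<mu>"
  shows "clustered_source d K \<mu>"
proof (rule clustered_source.intro)
  show K': "is_clustering d K" using K by (simp add: CV_def)
  show "prob_space \<mu>" using mu by (simp add: input_distribution_def)
  show "space \<mu> = cube d" by (rule space_input_distribution[OF mu])
  show "cell K i \<in> sets \<mu>" if "i < num_cells K" for i
  proof -
    have "cell K i \<subseteq> cube d" using K' that by (auto simp: is_clustering_def)
    moreover have "cell K i \<in> sets (lebesgue_d d)" using K that by (auto simp: CV_def)
    ultimately show ?thesis using mu by (simp add: input_distribution_def sets_uniform_cube)
  qed
qed

lemma clustered_source_uniform:
  assumes K: "K \<in> CV d \<delta>" shows "clustered_source d K (uniform_cube d)"
proof -
  have "input_distribution d (uniform_cube d)"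
    by (simp add: input_distribution_def prob_space_uniform_cube absolutely_continuous_def)
  then show ?thesis by (rule CV_clustered_source[OF K])
qed

section \<open>Dyadic bins and their tree\<close>

definition coord_bin :: "nat \<Rightarrow> real \<Rightarrow> nat" where
  "coord_bin L t = min (nat \<lfloor>2 ^ L * t\<rfloor>) (2 ^ L - 1)"

definition bin :: "nat \<Rightarrow> nat \<Rightarrow> point \<Rightarrow> nat \<Rightarrow> nat" where
  "bin d L x = (\<lambda>i\<in>{..<d}. coord_bin L (x i))"

definition bins :: "nat \<Rightarrow> nat \<Rightarrow> (nat \<Rightarrow> nat) set" where
  "bins d l = (\<Pi>\<^sub>E i\<in>{..<d}. {..<2 ^ l})"

text \<open>Dropping the last \<open>L - l\<close> binary digits of each coordinate leads from a
  finest bin to its ancestor of level \<open>l\<close>.\<close>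

definition anc :: "nat \<Rightarrow> nat \<Rightarrow> nat \<Rightarrow> (nat \<Rightarrow> nat) \<Rightarrow> nat \<Rightarrow> nat" where
  "anc d L l c = (\<lambda>i\<in>{..<d}. c i div 2 ^ (L - l))"

lemma coord_bin_less: "coord_bin L t < 2 ^ L"
  by (simp add: coord_bin_def min_less_iff_disj)

lemma coord_bin_bounds:
  assumes t: "t \<in> {0..1}"
  shows "real (coord_bin L t) / 2 ^ L \<le> t" "t \<le> (real (coord_bin L t) + 1) / 2 ^ L"
proof -
  have fl: "0 \<le> \<lfloor>2 ^ L * t\<rfloor>" using t by simp
  have "\<lfloor>2 ^ L * t\<rfloor> \<le> 2 ^ L * t" by (rule of_int_floor_le)
  moreover have "coord_bin L t \<le> nat \<lfloor>2 ^ L * t\<rfloor>" by (simp add: coord_bin_def)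
  then have "int (coord_bin L t) \<le> \<lfloor>2 ^ L * t\<rfloor>" using fl by linarith
  then have "real (coord_bin L t) \<le> of_int \<lfloor>2 ^ L * t\<rfloor>" by linarith
  ultimately have "real (coord_bin L t) \<le> 2 ^ L * t" by linarith
  then show "real (coord_bin L t) / 2 ^ L \<le> t" by (simp add: divide_le_eq mult.commute)
  have "2 ^ L * t \<le> real (coord_bin L t) + 1"
  proof (cases "nat \<lfloor>2 ^ L * t\<rfloor> \<le> 2 ^ L - 1")
    case True
    then have "real (coord_bin L t) = of_int \<lfloor>2 ^ L * t\<rfloor>" using fl by (simp add: coord_bin_def min_def)
    then show ?thesis using floor_correct[of "2 ^ L * t"] by linarith
  next
    case False
    then have "coord_bin L t = 2 ^ L - 1" by (simp add: coord_bin_def min_def)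
    then have "real (coord_bin L t) = 2 ^ L - 1" by (simp add: of_nat_diff)
    then show ?thesis using t by simp
  qed
  then show "t \<le> (real (coord_bin L t) + 1) / 2 ^ L" by (simp add: le_divide_eq mult.commute)
qed

text \<open>Bins are half-open except the last one, which the minimum in \<open>coord_bin\<close>
  closes at 1; hence the two shapes of interval.\<close>

lemma coord_bin_emeasure:
  assumes k: "k < 2 ^ L"
  shows "{t \<in> {0..1}. coord_bin L t = k} \<in> sets borel"
    and "emeasure lborel {t \<in> {0..1}. coord_bin L t = k} = ennreal (1 / 2 ^ L)"
proof -
  let ?A = "{t \<in> {0..1::real}. coord_bin L t = k}"
  let ?a = "real k / 2 ^ L" and ?b = "(real k + 1) / 2 ^ L"
  have kL: "real k + 1 \<le> 2 ^ L" using k by (metis Suc_leI add.commute of_nat_Suc of_nat_le_iff of_nat_numeral of_nat_power)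
  have "?A = {?a..<?b} \<or> ?A = {?a..?b}"
  proof (cases "Suc k = 2 ^ L")
    case True
    then have kr: "real k + 1 = 2 ^ L" by (metis add.commute of_nat_Suc of_nat_numeral of_nat_power)
    have "coord_bin L t = k" if t: "?a \<le> t" "t \<le> 1" for t
    proof -
      have "real k \<le> 2 ^ L * t" using t by (simp add: divide_le_eq mult.commute)
      then have "int k \<le> \<lfloor>2 ^ L * t\<rfloor>" by (simp add: le_floor_iff)
      then show ?thesis using True by (auto simp: coord_bin_def)
    qed
    note in_bin = this
    have ab: "0 \<le> ?a" "?b = 1" using kr by auto
    have "?A = {?a..?b}"
    proof (intro equalityI subsetI)
      fix t assume "t \<in> ?A"
      then show "t \<in> {?a..?b}" using coord_bin_bounds[of t L] by auto
    next
      fix t assume t: "t \<in> {?a..?b}"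
      then have "?a \<le> t" "t \<le> 1" using ab(2) by auto
      moreover from this(1) ab(1) have "0 \<le> t" by linarith
      ultimately show "t \<in> ?A" using in_bin[of t] by auto
    qed
    then show ?thesis by blast
  next
    case False
    then have kr: "real k + 1 \<le> 2 ^ L - 1" using k
      by (metis Suc_leI Suc_lessI add.commute le_diff_eq of_nat_Suc of_nat_le_iff of_nat_numeral of_nat_power)
    have iff: "coord_bin L t = k \<longleftrightarrow> ?a \<le> t \<and> t < ?b" if t: "t \<in> {0..1}" for t
    proof -
      have fl: "0 \<le> \<lfloor>2 ^ L * t\<rfloor>" using t by simp
      have "coord_bin L t = k \<longleftrightarrow> nat \<lfloor>2 ^ L * t\<rfloor> = k"
      proof -
        have "min a b = k \<longleftrightarrow> a = k" if "k < b" for a b :: nat using that by auto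
        moreover have "k < 2 ^ L - 1" using False k by linarith
        ultimately show ?thesis unfolding coord_bin_def by blast
      qed
      also have "\<dots> \<longleftrightarrow> \<lfloor>2 ^ L * t\<rfloor> = int k" using fl by auto
      also have "\<dots> \<longleftrightarrow> real k \<le> 2 ^ L * t \<and> 2 ^ L * t < real k + 1" by (simp add: floor_eq_iff)
      also have "\<dots> \<longleftrightarrow> ?a \<le> t \<and> t < ?b" by (simp add: divide_le_eq less_divide_eq mult.commute)
      finally show ?thesis .
    qed
    have ab: "?b \<le> 1" "0 \<le> ?a" using kr by (auto simp: divide_le_eq)
    have "?A = {?a..<?b}"
    proof (intro equalityI subsetI)
      fix t assume "t \<in> ?A"
      then show "t \<in> {?a..<?b}" using iff[of t] by auto
    next
      fix t assume t: "t \<in> {?a..<?b}"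
      then have "t \<in> {0..1}" using ab by (simp only: atLeastAtMost_iff atLeastLessThan_iff) linarith
      then show "t \<in> ?A" using iff[of t] t by auto
    qed
    then show ?thesis by blast
  qed
  moreover have "?a \<le> ?b" by (simp add: divide_right_mono)
  moreover have "?b - ?a = 1 / 2 ^ L" by (simp add: add_divide_distrib)
  ultimately show "?A \<in> sets borel" "emeasure lborel ?A = ennreal (1 / 2 ^ L)" by auto
qed

lemma finite_bins: "finite (bins d l)" by (auto simp: bins_def intro!: finite_PiE)

lemma card_bins: "card (bins d l) = 2 ^ (l * d)"
  by (simp add: bins_def card_PiE power_mult)

lemma bin_in_bins: "bin d L x \<in> bins d L"
  by (auto simp: bin_def bins_def coord_bin_less)

lemma anc_in_bins: "c \<in> bins d L \<Longrightarrow> l \<le> L \<Longrightarrow> anc d L l c \<in> bins d l"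
  by (auto simp: anc_def bins_def PiE_iff less_mult_imp_div_less simp flip: power_add)

lemma anc_refines:
  assumes "l' \<le> l" "l \<le> L" "anc d L l c = anc d L l c'"
  shows "anc d L l' c = anc d L l' c'"
proof -
  have *: "c i div 2 ^ (L - l') = c i div 2 ^ (L - l) div 2 ^ (l - l')" for c :: "nat \<Rightarrow> nat" and i
    using assms by (simp add: div_mult2_eq[symmetric] power_add[symmetric])
  have "c i div 2 ^ (L - l) = c' i div 2 ^ (L - l)" if "i < d" for i
    using fun_cong[OF assms(3), of i] that by (simp add: anc_def)
  then show ?thesis unfolding anc_def * by (intro restrict_ext) simp
qed

lemma anc_root: "c \<in> bins d L \<Longrightarrow> c' \<in> bins d L \<Longrightarrow> anc d L 0 c = anc d L 0 c'"
  unfolding anc_def by (intro restrict_ext) (auto simp: bins_def PiE_iff)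

lemma card_fiber_anc:
  assumes l: "l \<le> L" and b: "b \<in> bins d l"
  shows "card {c \<in> bins d L. anc d L l c = b} = 2 ^ ((L - l) * d)"
proof -
  have iff: "k < 2 ^ L \<and> k div 2 ^ (L - l) = j \<longleftrightarrow> k \<in> {j * 2 ^ (L - l)..<j * 2 ^ (L - l) + 2 ^ (L - l)}"
    if "j < 2 ^ l" for j k :: nat
  proof -
    have "j * 2 ^ (L - l) + 2 ^ (L - l) \<le> 2 ^ l * 2 ^ (L - l)"
      using mult_le_mono1[of "Suc j" "2 ^ l" "2 ^ (L - l)"] that by (simp add: Suc_leI)
    also have "\<dots> = (2 :: nat) ^ L" using l by (simp flip: power_add)
    finally have le: "j * 2 ^ (L - l) + 2 ^ (L - l) \<le> (2 :: nat) ^ L" .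
    have "k div 2 ^ (L - l) = j \<longleftrightarrow> j * 2 ^ (L - l) \<le> k \<and> k < j * 2 ^ (L - l) + 2 ^ (L - l)"
    proof
      assume "k div 2 ^ (L - l) = j"
      then show "j * 2 ^ (L - l) \<le> k \<and> k < j * 2 ^ (L - l) + 2 ^ (L - l)"
        using dividend_less_div_times[of "2 ^ (L - l)" k] by auto
    next
      assume "j * 2 ^ (L - l) \<le> k \<and> k < j * 2 ^ (L - l) + 2 ^ (L - l)"
      then show "k div 2 ^ (L - l) = j" by (intro div_nat_eqI) (auto simp: mult.commute)
    qed
    then show ?thesis using le by auto
  qed
  have "{c \<in> bins d L. anc d L l c = b} = (\<Pi>\<^sub>E i\<in>{..<d}. {b i * 2 ^ (L - l)..<b i * 2 ^ (L - l) + 2 ^ (L - l)})" (is "?A = ?B")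
  proof (rule set_eqI)
    fix c
    have bi: "b i < 2 ^ l" if "i < d" for i using b that by (auto simp: bins_def PiE_iff)
    have "c \<in> ?A \<longleftrightarrow> c \<in> extensional {..<d} \<and> (\<forall>i<d. c i < 2 ^ L) \<and> (\<forall>i<d. c i div 2 ^ (L - l) = b i)"
      using b by (auto simp: bins_def anc_def PiE_iff fun_eq_iff extensional_def)
    also have "\<dots> \<longleftrightarrow> c \<in> ?B" using iff[OF bi] by (auto simp: PiE_iff)
    finally show "c \<in> ?A \<longleftrightarrow> c \<in> ?B" .
  qed
  then show ?thesis by (simp add: card_PiE power_mult)
qed

lemma anc_image: "l \<le> L \<Longrightarrow> anc d L l ` bins d L = bins d l"
proof (intro equalityI subsetI)
  fix b assume l: "l \<le> L" and b: "b \<in> bins d l"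
  then have "{c \<in> bins d L. anc d L l c = b} \<noteq> {}" using card_fiber_anc[OF l b] by (metis card.empty power_not_zero zero_neq_numeral)
  then show "b \<in> anc d L l ` bins d L" by auto
qed (auto simp: anc_in_bins)

lemma bin_close:
  assumes l: "l \<le> L" and x: "x \<in> cube d" and y: "y \<in> cube d"
    and eq: "anc d L l (bin d L x) = anc d L l (bin d L y)" and i: "i < d"
  shows "\<bar>x i - y i\<bar> \<le> (1 / 2) ^ l"
proof -
  define e where "e = coord_bin L (x i) div 2 ^ (L - l)"
  have ey: "e = coord_bin L (y i) div 2 ^ (L - l)"
    using fun_cong[OF eq, of i] i by (simp add: anc_def bin_def e_def)
  have L: "(2::real) ^ L = 2 ^ l * 2 ^ (L - l)" using l by (simp flip: power_add)
  have *: "real e / 2 ^ l \<le> t \<and> t \<le> (real e + 1) / 2 ^ l"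
    if "t \<in> {0..1}" "e = coord_bin L t div 2 ^ (L - l)" for t
  proof -
    let ?k = "coord_bin L t"
    have "e * 2 ^ (L - l) \<le> ?k" "?k < Suc e * 2 ^ (L - l)"
      using that(2) dividend_less_div_times[of "2 ^ (L - l)" ?k] by (auto simp: algebra_simps)
    then have "real (e * 2 ^ (L - l)) \<le> real ?k" "real (Suc ?k) \<le> real (Suc e * 2 ^ (L - l))"
      by (simp_all only: of_nat_le_iff Suc_le_eq)
    then have k: "real e * 2 ^ (L - l) \<le> real ?k" "real ?k + 1 \<le> (real e + 1) * 2 ^ (L - l)"
      by (simp_all add: algebra_simps)
    have "real e / 2 ^ l = real e * 2 ^ (L - l) / 2 ^ L" by (simp add: L)
    also have "\<dots> \<le> real ?k / 2 ^ L" using k by (intro divide_right_mono) auto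
    also have "\<dots> \<le> t" by (rule coord_bin_bounds[OF that(1)])
    finally have 1: "real e / 2 ^ l \<le> t" .
    have "t \<le> (real ?k + 1) / 2 ^ L" by (rule coord_bin_bounds[OF that(1)])
    also have "\<dots> \<le> (real e + 1) * 2 ^ (L - l) / 2 ^ L" using k by (intro divide_right_mono) auto
    also have "\<dots> = (real e + 1) / 2 ^ l" by (simp add: L)
    finally show ?thesis using 1 by simp
  qed
  have "x i \<in> {0..1}" "y i \<in> {0..1}" using x y i by (auto simp: cube_def PiE_iff)
  with *[of "x i"] *[of "y i"] have "\<bar>x i - y i\<bar> \<le> (real e + 1) / 2 ^ l - real e / 2 ^ l"
    using e_def ey by (simp add: abs_le_iff)
  also have "\<dots> = (1 / 2) ^ l" by (simp add: add_divide_distrib power_one_over)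
  finally show ?thesis .
qed

text \<open>The side of the smallest dyadic cube containing both bins; the inserted 1 keeps the
  minimum defined for arbitrary arguments. The premise of \<open>EMD_le_tree\<close> that bounds
  \<open>D\<close> by (1/2)^l holds by construction.\<close>

definition bin_dist :: "nat \<Rightarrow> nat \<Rightarrow> (nat \<Rightarrow> nat) \<Rightarrow> (nat \<Rightarrow> nat) \<Rightarrow> real" where
  "bin_dist d L c c' = Min (insert 1 ((\<lambda>l. (1 / 2) ^ l) ` {l. l \<le> L \<and> anc d L l c = anc d L l c'}))"

lemma bin_dist_nonneg: "0 \<le> bin_dist d L c c'"
  unfolding bin_dist_def by (subst Min_ge_iff) auto

lemma bin_dist_le: "l \<le> L \<Longrightarrow> anc d L l c = anc d L l c' \<Longrightarrow> bin_dist d L c c' \<le> (1 / 2) ^ l"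
  unfolding bin_dist_def by (intro Min_le) auto

lemma lp_dist_le_bin_dist:
  assumes "1 \<le> p" "1 \<le> d" "x \<in> cube d" "y \<in> cube d"
  shows "lp_dist d p x y \<le> bin_dist d L (bin d L x) (bin d L y)"
  unfolding bin_dist_def using assms lp_dist_cube_le_1[OF assms]
  by (subst Min_ge_iff) (auto intro!: lp_dist_le_const bin_close)

definition bin_cell :: "nat \<Rightarrow> nat \<Rightarrow> (nat \<Rightarrow> nat) \<Rightarrow> point set" where
  "bin_cell d L c = {x \<in> cube d. bin d L x = c}"

lemma bin_cell_uniform:
  assumes c: "c \<in> bins d L"
  shows "bin_cell d L c \<in> sets (uniform_cube d)" "measure (uniform_cube d) (bin_cell d L c) = 1 / 2 ^ (L * d)"
proof -
  have ck: "c i < 2 ^ L" if "i < d" for i using c that by (auto simp: bins_def PiE_iff)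
  have eq: "bin_cell d L c = (\<Pi>\<^sub>E i\<in>{..<d}. {t \<in> {0..1}. coord_bin L t = c i})"
    using c by (auto simp: bin_cell_def bin_def cube_def PiE_iff fun_eq_iff extensional_def bins_def)
  show "bin_cell d L c \<in> sets (uniform_cube d)"
    unfolding eq using coord_bin_emeasure(1)[OF ck] by (intro emeasure_uniform_cube_PiE) auto
  show "measure (uniform_cube d) (bin_cell d L c) = 1 / 2 ^ (L * d)"
    unfolding eq using coord_bin_emeasure[OF ck]
    by (subst measure_uniform_cube_PiE[where c = "\<lambda>_. 1 / 2 ^ L"]) (auto simp: power_mult power_one_over)
qed

lemma sum_bin_cells:
  assumes mu: "prob_space \<mu>" "sets \<mu> = sets (uniform_cube d)" and B: "B \<in> sets \<mu>"
  shows "(\<Sum>c\<in>bins d L. measure \<mu> (B \<inter> bin_cell d L c)) = measure \<mu> B"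
proof -
  interpret prob_space \<mu> by fact
  have "measure \<mu> (\<Union>c\<in>bins d L. B \<inter> bin_cell d L c) = (\<Sum>c\<in>bins d L. measure \<mu> (B \<inter> bin_cell d L c))"
    using B bin_cell_uniform(1) mu(2)
    by (intro finite_measure_finite_Union finite_bins) (auto simp: disjoint_family_on_def bin_cell_def)
  moreover have "B \<subseteq> cube d"
    using sets.sets_into_space[OF B] sets_eq_imp_space_eq[OF mu(2)] by (simp add: space_uniform_cube)
  then have "(\<Union>c\<in>bins d L. B \<inter> bin_cell d L c) = B" using bin_in_bins by (auto simp: bin_cell_def)
  ultimately show ?thesis by simp
qed

lemma fiber_sum_uniform:
  assumes "l \<le> L" "b \<in> bins d l"
  shows "fiber_sum (bins d L) (anc d L l) (\<lambda>_. 1 / 2 ^ (L * d)) b = 1 / 2 ^ (l * d)"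
proof -
  have "(2::real) ^ (L * d) = 2 ^ ((L - l) * d) * 2 ^ (l * d)" using assms(1)
    by (simp flip: power_add add: diff_mult_distrib)
  then show ?thesis using card_fiber_anc[OF assms] by (simp add: fiber_sum_def)
qed

text \<open>The value on null sets makes this a probability vector for every \<open>B\<close>.\<close>

definition spread :: "nat \<Rightarrow> nat \<Rightarrow> point set \<Rightarrow> (nat \<Rightarrow> nat) \<Rightarrow> real" where
  "spread d L B c = (if measure (uniform_cube d) B = 0 then 1 / 2 ^ (L * d)
     else measure (uniform_cube d) (B \<inter> bin_cell d L c) / measure (uniform_cube d) B)"

lemma spread_nonneg: "0 \<le> spread d L B c"
  by (simp add: spread_def)

lemma sum_spread: "B \<in> sets (uniform_cube d) \<Longrightarrow> (\<Sum>c\<in>bins d L. spread d L B c) = 1"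
  using sum_bin_cells[OF prob_space_uniform_cube refl, of B d L]
  by (cases "measure (uniform_cube d) B = 0") (simp_all add: spread_def card_bins flip: sum_divide_distrib)

lemma spread_pos_bin:
  assumes "measure (uniform_cube d) B \<noteq> 0" "0 < spread d L B c"
  obtains z where "z \<in> B" "z \<in> cube d" "bin d L z = c"
proof -
  have "B \<inter> bin_cell d L c \<noteq> {}" using assms by (auto simp: spread_def)
  then show ?thesis using that by (auto simp: bin_cell_def)
qed

text \<open>In each bin both the spread mass and the true mass of \<open>G\<close> dominate the mass
  of \<open>B\<close>, so they differ by at most the sum of the two surpluses. Each surplus totals
  the volume of \<open>G\<close> minus that of \<open>B\<close>.\<close>

lemma spread_error:
  assumes G: "G \<in> sets (uniform_cube d)" and B: "B \<in> sets (uniform_cube d)" and sub: "B \<subseteq> G"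
    and pos: "0 < measure (uniform_cube d) B"
    and le: "measure (uniform_cube d) G - measure (uniform_cube d) B \<le> \<xi> * measure (uniform_cube d) G"
  shows "(\<Sum>c\<in>bins d L. \<bar>measure (uniform_cube d) G * spread d L B c - measure (uniform_cube d) (G \<inter> bin_cell d L c)\<bar>)
     \<le> 2 * \<xi> * measure (uniform_cube d) G"
proof -
  interpret prob_space "uniform_cube d" by (rule prob_space_uniform_cube)
  let ?m = "measure (uniform_cube d)"
  have GB: "?m B \<le> ?m G" using sub G by (intro finite_measure_mono)
  have "(\<Sum>c\<in>bins d L. \<bar>?m G * spread d L B c - ?m (G \<inter> bin_cell d L c)\<bar>) \<le>
    (\<Sum>c\<in>bins d L. (?m G * spread d L B c - ?m (B \<inter> bin_cell d L c)) + (?m (G \<inter> bin_cell d L c) - ?m (B \<inter> bin_cell d L c)))"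
  proof (rule sum_mono)
    fix c assume c: "c \<in> bins d L"
    have 1: "?m (B \<inter> bin_cell d L c) \<le> ?m (G \<inter> bin_cell d L c)"
      using sub G bin_cell_uniform(1)[OF c] by (intro finite_measure_mono) auto
    have "?m B * spread d L B c = ?m (B \<inter> bin_cell d L c)" using pos by (simp add: spread_def)
    then have "?m (B \<inter> bin_cell d L c) \<le> ?m G * spread d L B c"
      using GB spread_nonneg[of d L B c] by (metis mult_right_mono)
    with 1 show "\<bar>?m G * spread d L B c - ?m (G \<inter> bin_cell d L c)\<bar> \<le>
      (?m G * spread d L B c - ?m (B \<inter> bin_cell d L c)) + (?m (G \<inter> bin_cell d L c) - ?m (B \<inter> bin_cell d L c))" by simp
  qed
  also have "\<dots> = 2 * (?m G - ?m B)"
    using sum_spread[OF B, of L] sum_bin_cells[OF prob_space_uniform_cube refl, of B d L]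
      sum_bin_cells[OF prob_space_uniform_cube refl, of G d L] G B
    by (simp add: sum.distrib sum_subtractf flip: sum_distrib_left)
  also have "\<dots> \<le> 2 * \<xi> * ?m G" using le by simp
  finally show ?thesis .
qed

lemma spread_self:
  assumes "G \<in> sets (uniform_cube d)" "c \<in> bins d L"
  shows "measure (uniform_cube d) G * spread d L G c = measure (uniform_cube d) (G \<inter> bin_cell d L c)"
proof -
  interpret prob_space "uniform_cube d" by (rule prob_space_uniform_cube)
  have "measure (uniform_cube d) (G \<inter> bin_cell d L c) \<le> measure (uniform_cube d) G"
    using assms by (intro finite_measure_mono) auto
  then show ?thesis by (auto simp: spread_def measure_le_0_iff)
qed

text \<open>Shrinking the probed box slightly moves it off the boundary of the cell.\<close>

definition inner_box :: "nat \<Rightarrow> real \<Rightarrow> point \<Rightarrow> (nat \<Rightarrow> bool \<Rightarrow> real) \<Rightarrow> point set" where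
  "inner_box d h r e = (\<Pi>\<^sub>E k\<in>{..<d}. {r k - h * e k False..r k + h * e k True})"

context convex_cell
begin

text \<open>Dividing a displacement by \<open>h\<close> gives a displacement of the recorded box,
  which the corners put into \<open>star\<close>; scaling back by \<open>h < 1\<close> lands in the
  open core.\<close>

lemma inner_box_sub:
  assumes ok: "probe_ok True n d G r" and w: "bisect_width n \<le> \<delta> / 4" and h: "0 < h" "h < 1"
  shows "inner_box d h r (extent n G r) \<subseteq> G"
proof
  interpret probed_cell d \<delta> G S r "extent n G r" "\<delta> / 2" "2 * bisect_width n"
    by (rule probed_cell[OF ok w])
  fix y assume y: "y \<in> inner_box d h r (extent n G r)"
  define z where "z k = (y k - r k) / h" for k
  have "z \<in> star"
  proof (rule box_star)
    show "(\<lambda>k\<in>{..<d}. r k + sgn_of (c k) * extent n G r k (c k)) \<in> G" for c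
      using ok by (simp add: probe_ok_def set_check_points corner_def)
    fix k assume "k < d"
    then have "y k \<in> {r k - h * extent n G r k False..r k + h * extent n G r k True}"
      using y unfolding inner_box_def by (auto simp: PiE_iff)
    then show "- extent n G r k False \<le> z k \<and> z k \<le> extent n G r k True"
      using h by (auto simp: z_def divide_le_eq le_divide_eq algebra_simps)
  qed
  then have "(\<lambda>k\<in>{..<d}. r k + h * z k) \<in> S" using h by (intro star_in_S) auto
  also have "(\<lambda>k\<in>{..<d}. r k + h * z k) = y"
    using h y by (auto simp: z_def inner_box_def PiE_iff extensional_def fun_eq_iff)
  finally show "y \<in> G" using SG by blast
qed

text \<open>The cell is caught between two boxes whose sides agree up to a factor 1 - \<eta>; by
  Bernoulli's inequality the volumes then agree up to a factor 1 - d \<eta>.\<close>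

lemma inner_box_measure:
  assumes ok: "probe_ok True n d G r" and w: "bisect_width n \<le> \<delta>\<^sup>2 / (24 * d)" and \<delta>1: "\<delta> \<le> 1"
    and G: "G \<in> sets (uniform_cube d)"
  defines "B \<equiv> inner_box d (1 - bisect_width n) r (extent n G r)"
  shows "B \<in> sets (uniform_cube d)" "B \<subseteq> G" "0 < measure (uniform_cube d) B"
    and "measure (uniform_cube d) G - measure (uniform_cube d) B \<le> 18 * bisect_width n * (real d)\<^sup>2 / \<delta>\<^sup>2 * measure (uniform_cube d) G"
proof -
  interpret P: prob_space "uniform_cube d" by (rule prob_space_uniform_cube)
  have d0: "0 < d" using d by simp
  note w4 = slack_le(1)[OF w d0 \<delta>1]
  define e where "e = extent n G r"
  define h where "h = 1 - bisect_width n"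
  define s where "s = slack n"
  have h: "0 < h" "h < 1" using w4 bisect_width_pos[of n] \<delta>1 by (auto simp: h_def)
  have e: "\<delta> / 2 \<le> e k \<sigma>" if "k < d" for k \<sigma>
    using axis_extent(3)[OF that, of n \<sigma>] w4 by (simp add: e_def)
  have s0: "0 \<le> s" using \<delta> bisect_width_pos[of n] by (simp add: s_def slack_def)
  show sub: "B \<subseteq> G" unfolding B_def using inner_box_sub[OF ok w4] h by (simp add: h_def)
  have Beq: "B = (\<Pi>\<^sub>E k\<in>{..<d}. {r k - h * e k False..r k + h * e k True})"
    by (simp add: B_def inner_box_def h_def e_def)
  have le: "r k - h * e k False \<le> r k + h * e k True" if "k < d" for k
  proof -
    have "0 \<le> h * e k \<sigma>" for \<sigma> using e[OF that, of \<sigma>] h \<delta> by (intro mult_nonneg_nonneg) auto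
    from this[of True] this[of False] show ?thesis by simp
  qed
  have "B \<subseteq> (\<Pi>\<^sub>E k\<in>{..<d}. {0..1})" using sub Gcube unfolding cube_def by blast
  moreover have "B \<noteq> {}" unfolding Beq using le by (simp add: PiE_eq_empty_iff)
  \<comment> \<open>As \<open>B\<close> is nonempty, containment in the cube can be read off for
    each factor separately.\<close>
  ultimately have sub1: "{r k - h * e k False..r k + h * e k True} \<subseteq> {0..1}" if "k < d" for k
    using that unfolding Beq subset_PiE by blast
  show Bm: "B \<in> sets (uniform_cube d)" unfolding Beq using sub1 by (intro emeasure_uniform_cube_PiE) auto
  have mB: "measure (uniform_cube d) B = (\<Prod>k<d. h * box_size e k)"
    unfolding Beq using sub1 le
    by (subst measure_uniform_cube_PiE[where c = "\<lambda>k. h * box_size e k"]) (auto simp: box_size_def algebra_simps)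
  have bs: "\<delta> \<le> box_size e k" if "k < d" for k using e[OF that, of True] e[OF that, of False] by (simp add: box_size_def)
  show "0 < measure (uniform_cube d) B" unfolding mB using h bs \<delta>
    by (intro prod_pos) (force dest: less_le_trans)
  \<comment> \<open>Clipping to [0,1] keeps the outer box in the cube, where its uniform measure is
    the product of the side lengths.\<close>
  define lo hi where "lo k = max 0 (r k - e k False - s)" and "hi k = min 1 (r k + e k True + s)" for k
  have lohi: "x k \<in> {lo k..hi k}" if "x \<in> G" "k < d" for x k
  proof -
    have "x k \<in> {0..1}" using that Gcube by (auto simp: cube_def PiE_iff)
    then show ?thesis using probe_extent[OF ok w4 \<delta>1 that] by (simp add: lo_def hi_def e_def s_def)
  qed
  have GE: "G \<subseteq> (\<Pi>\<^sub>E k\<in>{..<d}. {lo k..hi k})"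
    using lohi Gcube by (auto simp: cube_def PiE_iff)
  have lh: "lo k \<le> hi k" if "k < d" for k using lohi[OF rG that] by simp
  have hisub: "{lo k..hi k} \<subseteq> {0..1}" for k by (auto simp: lo_def hi_def)
  have "measure (uniform_cube d) G \<le> measure (uniform_cube d) (\<Pi>\<^sub>E k\<in>{..<d}. {lo k..hi k})"
    using GE hisub by (intro P.finite_measure_mono emeasure_uniform_cube_PiE) auto
  also have "\<dots> = (\<Prod>k<d. hi k - lo k)"
    using lh hisub by (subst measure_uniform_cube_PiE[where c = "\<lambda>k. hi k - lo k"]) auto
  also have "\<dots> \<le> (\<Prod>k<d. box_size e k + 2 * s)"
    using lh by (intro prod_mono) (auto simp: lo_def hi_def box_size_def)
  finally have mG: "measure (uniform_cube d) G \<le> (\<Prod>k<d. box_size e k + 2 * s)" .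
  \<comment> \<open>Sides are at least \<delta>, so the slack at both ends costs 2 s/\<delta>;
    shrinking by \<open>bisect_width n\<close>, which is at most s/\<delta>, costs the third
    share.\<close>
  define \<eta> where "\<eta> = 3 * s / \<delta>"
  have \<eta>0: "0 \<le> \<eta>" using s0 \<delta> by (simp add: \<eta>_def)
  have \<eta>1: "\<eta> \<le> 1" using slack_le(2)[OF w d0 \<delta>1] \<delta> by (simp add: \<eta>_def s_def)
  have ws: "bisect_width n \<le> s / \<delta>"
  proof -
    have "1 * 1 \<le> 6 * real d * (1 / (\<delta> * \<delta>))" using d \<delta> \<delta>1
      by (intro mult_mono) (auto simp: le_divide_eq mult_le_one)
    then have "bisect_width n * 1 \<le> bisect_width n * (6 * real d * (1 / (\<delta> * \<delta>)))"
      using bisect_width_pos[of n] by (intro mult_left_mono) auto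
    then show ?thesis by (simp add: s_def slack_def mult_ac)
  qed
  have factor: "(1 - \<eta>) * (box_size e k + 2 * s) \<le> h * box_size e k" if k: "k < d" for k
  proof -
    define a where "a = s * box_size e k / \<delta>"
    have "\<eta> * (box_size e k + 2 * s) \<ge> \<eta> * box_size e k" using \<eta>0 s0 by (intro mult_left_mono) auto
    moreover have "s \<le> a" using bs[OF k] s0 \<delta> by (simp add: a_def le_divide_eq mult_left_mono)
    moreover have "\<eta> * box_size e k = 3 * a" by (simp add: \<eta>_def a_def)
    moreover have "bisect_width n * box_size e k \<le> s / \<delta> * box_size e k"
      using ws bs[OF k] \<delta> by (intro mult_right_mono) auto
    then have "bisect_width n * box_size e k \<le> a" by (simp add: a_def)
    ultimately have "2 * s + bisect_width n * box_size e k \<le> \<eta> * (box_size e k + 2 * s)" by argo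
    then show ?thesis by (simp add: h_def algebra_simps)
  qed
  have "(1 - real d * \<eta>) * measure (uniform_cube d) G \<le> (1 - \<eta>) ^ d * measure (uniform_cube d) G"
    using Bernoulli_inequality[of "- \<eta>" d] \<eta>1 by (intro mult_right_mono) auto
  also have "\<dots> \<le> (1 - \<eta>) ^ d * (\<Prod>k<d. box_size e k + 2 * s)"
    using mG \<eta>1 by (intro mult_left_mono) auto
  also have "\<dots> = (\<Prod>k<d. (1 - \<eta>) * (box_size e k + 2 * s))" by (simp add: prod.distrib)
  also have "\<dots> \<le> (\<Prod>k<d. h * box_size e k)"
    using factor \<eta>1 bs \<delta> s0 by (intro prod_mono conjI mult_nonneg_nonneg) (force dest: less_le_trans)+
  finally have "measure (uniform_cube d) G - measure (uniform_cube d) B \<le> real d * \<eta> * measure (uniform_cube d) G"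
    unfolding mB by (simp add: algebra_simps)
  also have "real d * \<eta> = 18 * bisect_width n * (real d)\<^sup>2 / \<delta>\<^sup>2"
    by (simp add: \<eta>_def s_def slack_def power2_eq_square)
  finally show "measure (uniform_cube d) G - measure (uniform_cube d) B \<le> 18 * bisect_width n * (real d)\<^sup>2 / \<delta>\<^sup>2 * measure (uniform_cube d) G" .
qed

end

section \<open>Closeness and uniformity statistics\<close>

definition pair_vec :: "('x \<Rightarrow> 'c) \<Rightarrow> 'x \<times> 'x \<Rightarrow> 'c \<Rightarrow> real" where
  "pair_vec b z c = of_bool (b (fst z) = c) - of_bool (b (snd z) = c)"

text \<open>Flattening splits a bin into equal pieces, one plus its scaled auxiliary count. For a
  quadratic statistic this amounts to dividing the bin's contribution by the number of pieces, and
  that number need not be an integer, so the rate \<open>lam\<close> can be tuned.\<close>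

definition flat_weight :: "('x \<Rightarrow> 'c) \<Rightarrow> real \<Rightarrow> ('x \<times> 'x) list \<Rightarrow> 'c \<Rightarrow> real" where
  "flat_weight b lam fs c = 1 / (1 + lam * (length (filter (\<lambda>z. b (fst z) = c) fs) + length (filter (\<lambda>z. b (snd z) = c) fs)))"

lemma sum_length_filter:
  assumes "finite C" "\<And>z. g z \<in> C"
  shows "(\<Sum>c\<in>C. real (length (filter (\<lambda>z. g z = c) zs))) = length zs"
proof (induction zs)
  case (Cons z zs)
  have "(\<Sum>c\<in>C. real (length (filter (\<lambda>z. g z = c) (z # zs)))) =
      (\<Sum>c\<in>C. (if c = g z then 1 else 0) + real (length (filter (\<lambda>z. g z = c) zs)))"
    by (intro sum.cong) auto
  also have "\<dots> = 1 + length zs" using assms Cons by (simp add: sum.distrib)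
  finally show ?case by simp
qed simp

lemma E_of_bool: "E_pmf P (\<lambda>x. of_bool (R x)) = measure_pmf.prob P {x. R x}"
proof -
  have "(\<lambda>x. of_bool (R x)) = (indicator {x. R x} :: 'a \<Rightarrow> real)" by (auto simp: indicator_def)
  then show ?thesis by simp
qed

locale pair_samples =
  fixes P Q :: "'x pmf" and b :: "'x \<Rightarrow> 'c" and C :: "'c set"
  assumes fP: "finite (set_pmf P)" and fQ: "finite (set_pmf Q)" and fC: "finite C" and bC: "\<And>x. b x \<in> C"
begin

definition p :: "'c \<Rightarrow> real" where "p c = measure_pmf.prob P {x. b x = c}"
definition q :: "'c \<Rightarrow> real" where "q c = measure_pmf.prob Q {x. b x = c}"

abbreviation Z :: "('x \<times> 'x) pmf" where "Z \<equiv> pair_pmf P Q"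

lemma fZ: "finite (set_pmf Z)" using fP fQ by simp

lemma p_nonneg: "0 \<le> p c" "0 \<le> q c" by (simp_all add: p_def q_def)

lemma sum_p: "sum p C = 1" "sum q C = 1"
proof -
  have "(\<Sum>c\<in>C. measure_pmf.prob R {x. b x = c}) = 1" for R :: "'x pmf"
  proof -
    have "(\<Sum>c\<in>C. measure_pmf.prob R {x. b x = c}) = measure_pmf.prob R (\<Union>c\<in>C. {x. b x = c})"
      using fC by (intro measure_pmf.finite_measure_finite_Union[symmetric]) (auto simp: disjoint_family_on_def)
    also have "(\<Union>c\<in>C. {x. b x = c}) = UNIV" using bC by auto
    finally show ?thesis by simp
  qed
  then show "sum p C = 1" "sum q C = 1" by (simp_all add: p_def[abs_def] q_def[abs_def])
qed

definition weighted_norm :: "('c \<Rightarrow> real) \<Rightarrow> real" where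
  "weighted_norm w = (\<Sum>c\<in>C. w c * ((p c)\<^sup>2 + (q c)\<^sup>2))"

lemma weighted_norm_nonneg: "(\<And>c. 0 \<le> w c) \<Longrightarrow> 0 \<le> weighted_norm w"
  unfolding weighted_norm_def by (intro sum_nonneg) auto

lemma flat_weight_range: "0 \<le> lam \<Longrightarrow> 0 < flat_weight b lam fs c" "0 \<le> lam \<Longrightarrow> flat_weight b lam fs c \<le> 1"
  by (auto simp: flat_weight_def add_pos_nonneg intro!: divide_le_eq_1_pos[THEN iffD2])

text \<open>A bin of probability p has weight about 1/(lam m p), so w p^2 is about p/(lam m), and
  these sum to a constant over lam m. \<open>expectation_inverse_count\<close> makes this precise;
  counting only first components serves \<open>p\<close>, only second components
  \<open>q\<close>.\<close>

lemma expected_weighted_norm: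
  assumes lam: "0 < lam" "lam \<le> 1"
  shows "E_pmf (replicate_pmf m Z) (\<lambda>fs. weighted_norm (flat_weight b lam fs)) \<le> 2 / (lam * (m + 1))"
proof -
  note fR = finite_set_replicate_pmf[OF fZ, of m]
  have w_le: "flat_weight b lam fs c \<le> 1 / lam * (1 / (1 + real (length (filter R fs))))"
    if "length (filter R fs) \<le> length (filter (\<lambda>z. b (fst z) = c) fs) + length (filter (\<lambda>z. b (snd z) = c) fs)" for R fs c
  proof -
    \<comment> \<open>Here \<open>lam \<le> 1\<close> enters: the leading 1 of the denominator
      dominates \<open>lam\<close>.\<close>
    have "lam * (1 + real (length (filter R fs))) \<le> 1 + lam * (length (filter (\<lambda>z. b (fst z) = c) fs) + length (filter (\<lambda>z. b (snd z) = c) fs))"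
      using lam that by (simp add: distrib_left add_mono mult_left_mono flip: of_nat_add)
    then have "flat_weight b lam fs c \<le> 1 / (lam * (1 + real (length (filter R fs))))"
      unfolding flat_weight_def using lam by (intro divide_left_mono) (auto intro!: mult_pos_pos add_pos_nonneg)
    then show ?thesis by simp
  qed
  have aux: "E_pmf (replicate_pmf m Z) (\<lambda>fs. flat_weight b lam fs c) * (measure_pmf.prob Z {z. R z})\<^sup>2 \<le>
      1 / (lam * (m + 1)) * measure_pmf.prob Z {z. R z}"
    if R: "\<And>fs. length (filter R fs) \<le> length (filter (\<lambda>z. b (fst z) = c) fs) + length (filter (\<lambda>z. b (snd z) = c) fs)" for R c
  proof -
    let ?r = "measure_pmf.prob Z {z. R z}"
    have "E_pmf (replicate_pmf m Z) (\<lambda>fs. flat_weight b lam fs c) \<le>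
        E_pmf (replicate_pmf m Z) (\<lambda>fs. 1 / lam * (1 / (1 + real (length (filter R fs)))))"
      by (rule E_mono[OF fR]) (rule w_le[OF R])
    also have "\<dots> = 1 / lam * E_pmf (replicate_pmf m Z) (\<lambda>fs. 1 / (1 + real (length (filter R fs))))"
      by (rule integral_mult_right_zero)
    finally have "?r * E_pmf (replicate_pmf m Z) (\<lambda>fs. flat_weight b lam fs c) \<le>
        ?r * (1 / lam * E_pmf (replicate_pmf m Z) (\<lambda>fs. 1 / (1 + real (length (filter R fs)))))"
      by (rule mult_left_mono) simp
    also have "\<dots> = 1 / lam * (?r * E_pmf (replicate_pmf m Z) (\<lambda>fs. 1 / (1 + real (length (filter R fs)))))"
      by (rule mult.left_commute)
    also have "\<dots> \<le> 1 / lam * (1 / (m + 1))"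
    proof (rule mult_left_mono)
      show "?r * E_pmf (replicate_pmf m Z) (\<lambda>fs. 1 / (1 + real (length (filter R fs)))) \<le> 1 / (m + 1)"
        using expectation_inverse_count[of Z R m] by (simp add: add.commute)
    qed (use lam in simp)
    finally have "?r * (?r * E_pmf (replicate_pmf m Z) (\<lambda>fs. flat_weight b lam fs c)) \<le> ?r * (1 / lam * (1 / (m + 1)))"
      by (intro mult_left_mono) auto
    then show ?thesis by (simp add: power2_eq_square mult_ac)
  qed
  have pZ: "p c = measure_pmf.prob Z {z. b (fst z) = c}" for c
  proof -
    have "p c = measure_pmf.prob (map_pmf fst Z) {x. b x = c}" by (simp add: p_def map_fst_pair_pmf)
    then show ?thesis by (simp add: vimage_def)
  qed
  have qZ: "q c = measure_pmf.prob Z {z. b (snd z) = c}" for c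
  proof -
    have "q c = measure_pmf.prob (map_pmf snd Z) {x. b x = c}" by (simp add: q_def map_snd_pair_pmf)
    then show ?thesis by (simp add: vimage_def)
  qed
  have "E_pmf (replicate_pmf m Z) (\<lambda>fs. weighted_norm (flat_weight b lam fs)) =
      (\<Sum>c\<in>C. E_pmf (replicate_pmf m Z) (\<lambda>fs. flat_weight b lam fs c) * ((p c)\<^sup>2 + (q c)\<^sup>2))"
    unfolding weighted_norm_def by (subst E_sum[OF fR]) simp
  also have "\<dots> \<le> (\<Sum>c\<in>C. 1 / (lam * (m + 1)) * p c + 1 / (lam * (m + 1)) * q c)"
  proof (rule sum_mono)
    fix c
    show "E_pmf (replicate_pmf m Z) (\<lambda>fs. flat_weight b lam fs c) * ((p c)\<^sup>2 + (q c)\<^sup>2) \<le>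
      1 / (lam * (m + 1)) * p c + 1 / (lam * (m + 1)) * q c"
      unfolding distrib_left pZ qZ by (intro add_mono aux) auto
  qed
  also have "\<dots> = 2 / (lam * (m + 1))"
    by (simp add: sum.distrib sum_p flip: sum_divide_distrib)
  finally show ?thesis .
qed

lemma prob_weighted_norm:
  assumes "0 < lam" "lam \<le> 1" "0 < \<rho>"
  shows "measure_pmf.prob (replicate_pmf m Z) {fs. \<rho> \<le> weighted_norm (flat_weight b lam fs)} \<le> 2 / (lam * (m + 1)) / \<rho>"
proof -
  have "0 \<le> weighted_norm (flat_weight b lam fs)" for fs
    using flat_weight_range(1)[of lam fs] assms by (intro weighted_norm_nonneg) (simp add: less_imp_le)
  then have "measure_pmf.prob (replicate_pmf m Z) {fs. \<rho> \<le> weighted_norm (flat_weight b lam fs)} \<le>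
     E_pmf (replicate_pmf m Z) (\<lambda>fs. weighted_norm (flat_weight b lam fs)) / \<rho>"
    using assms by (intro Markov_pmf finite_set_replicate_pmf fZ) auto
  also have "\<dots> \<le> 2 / (lam * (m + 1)) / \<rho>"
    using expected_weighted_norm[OF assms(1,2)] assms(3) by (intro divide_right_mono) auto
  finally show ?thesis .
qed

end

locale weighted_pair_samples = pair_samples P Q b C for P Q :: "'x pmf" and b :: "'x \<Rightarrow> 'c" and C +
  fixes w :: "'c \<Rightarrow> real"
  assumes w: "\<And>c. 0 < w c" "\<And>c. w c \<le> 1"
begin

sublocale sampled_vectors Z "pair_vec b" C w
  using fZ fC w(1) by unfold_locales (auto intro: less_imp_le)

lemma \<theta>_eq: "\<theta> c = p c - q c"
  unfolding \<theta>_def pair_vec_def using fP fQ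
  by (subst E_pair_pmf) (simp_all add: E_of_bool p_def q_def Bochner_Integration.integral_diff integrable_measure_pmf_finite)

lemma Q_eq: "sampled_vectors.Q Z (pair_vec b) c c' = (if c = c' then p c + q c else 0) - p c * q c' - q c * p c'"
proof -
  have [simp]: "integrable (measure_pmf P) f" "integrable (measure_pmf Q) f" for f :: "'x \<Rightarrow> real"
    using fP fQ by (auto intro: integrable_measure_pmf_finite)
  have diag: "of_bool (b x = c) * of_bool (b x = c') = (if c = c' then of_bool (b x = c) else (0::real))" for x by auto
  have "sampled_vectors.Q Z (pair_vec b) c c' = E_pmf P (\<lambda>x. E_pmf Q (\<lambda>y. of_bool (b x = c) * of_bool (b x = c')
      - of_bool (b x = c) * of_bool (b y = c') - of_bool (b x = c') * of_bool (b y = c) + of_bool (b y = c) * of_bool (b y = c')))"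
    unfolding Q_def pair_vec_def using fP fQ
    by (subst E_pair_pmf) (simp_all add: algebra_simps)
  also have "\<dots> = E_pmf P (\<lambda>x. of_bool (b x = c) * of_bool (b x = c') - of_bool (b x = c) * q c' - of_bool (b x = c') * q c
      + E_pmf Q (\<lambda>y. of_bool (b y = c) * of_bool (b y = c')))"
    by (simp add: E_of_bool q_def)
  also have "\<dots> = E_pmf P (\<lambda>x. of_bool (b x = c) * of_bool (b x = c')) - p c * q c' - p c' * q c
      + E_pmf Q (\<lambda>y. of_bool (b y = c) * of_bool (b y = c'))"
    by (simp add: E_of_bool p_def)
  also have "\<dots> = (if c = c' then p c + q c else 0) - p c * q c' - q c * p c'"
    unfolding diag by (simp add: E_of_bool p_def q_def)
  finally show ?thesis .
qed

text \<open>\<open>Q\<close> is the diagonal matrix of p + q minus two rank-one matrices. The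
  diagonal contributes at most 4 times the weighted norm, because w \<le> 1, and the rank-one parts
  at most 8 times, because the weighted sum of q^2 is at most 1.\<close>

lemma H2_le: "H2 \<le> 12 * weighted_norm w"
proof -
  let ?A = "\<Sum>c\<in>C. w c * (p c)\<^sup>2" and ?B = "\<Sum>c\<in>C. w c * (q c)\<^sup>2"
  have le1: "f c \<le> 1" if "sum f C = 1" "\<And>c. 0 \<le> f c" "c \<in> C" for f :: "'c \<Rightarrow> real" and c
    using member_le_sum[of c C f] that fC by auto
  have W0: "0 \<le> w c" for c using w(1)[of c] by simp
  have sq: "(a - x - y)\<^sup>2 \<le> 2 * a\<^sup>2 + 4 * x\<^sup>2 + 4 * y\<^sup>2" for a x y :: real
  proof -
    \<comment> \<open>Exactly the difference of the two sides of the claim.\<close>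
    have "0 \<le> (a + x + y)\<^sup>2 + 2 * (x - y)\<^sup>2" by simp
    then show ?thesis by (simp add: power2_eq_square algebra_simps)
  qed
  have "H2 \<le> (\<Sum>c\<in>C. \<Sum>c'\<in>C. w c * w c' * (2 * (if c = c' then p c + q c else 0)\<^sup>2 + 4 * (p c * q c')\<^sup>2 + 4 * (q c * p c')\<^sup>2))"
    unfolding H2_def Q_eq using W0 sq by (intro sum_mono mult_left_mono) auto
  also have "\<dots> = (\<Sum>c\<in>C. \<Sum>c'\<in>C. if c = c' then 2 * (w c)\<^sup>2 * (p c + q c)\<^sup>2 else 0) + 8 * (?A * ?B)"
  proof -
    have "(\<Sum>c\<in>C. \<Sum>c'\<in>C. w c * w c' * (2 * (if c = c' then p c + q c else 0)\<^sup>2 + 4 * (p c * q c')\<^sup>2 + 4 * (q c * p c')\<^sup>2)) =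
      (\<Sum>c\<in>C. \<Sum>c'\<in>C. (if c = c' then 2 * (w c)\<^sup>2 * (p c + q c)\<^sup>2 else 0) +
        4 * ((w c * (p c)\<^sup>2) * (w c' * (q c')\<^sup>2)) + 4 * ((w c * (q c)\<^sup>2) * (w c' * (p c')\<^sup>2)))"
      by (intro sum.cong refl) (auto simp: power2_eq_square algebra_simps)
    also have "\<dots> = (\<Sum>c\<in>C. \<Sum>c'\<in>C. if c = c' then 2 * (w c)\<^sup>2 * (p c + q c)\<^sup>2 else 0) + 4 * (?A * ?B) + 4 * (?B * ?A)"
    proof -
      have "(\<Sum>c\<in>C. \<Sum>c'\<in>C. 4 * (x c * y c')) = 4 * (sum x C * sum y C)" for x y :: "'c \<Rightarrow> real"
        by (subst sum_product) (simp only: sum_distrib_left)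
      then show ?thesis by (simp only: sum.distrib)
    qed
    finally show ?thesis by simp
  qed
  also have "(\<Sum>c\<in>C. \<Sum>c'\<in>C. if c = c' then 2 * (w c)\<^sup>2 * (p c + q c)\<^sup>2 else 0) = (\<Sum>c\<in>C. 2 * (w c)\<^sup>2 * (p c + q c)\<^sup>2)"
    using fC by (simp add: sum.delta)
  also have "\<dots> \<le> (\<Sum>c\<in>C. 4 * (w c * ((p c)\<^sup>2 + (q c)\<^sup>2)))"
  proof (rule sum_mono)
    fix c
    have 1: "2 * (p c + q c)\<^sup>2 \<le> 4 * ((p c)\<^sup>2 + (q c)\<^sup>2)"
      using zero_le_power2[of "p c - q c"] by (simp add: power2_eq_square algebra_simps)
    have 2: "(w c)\<^sup>2 \<le> w c"
      using W0[of c] w(2)[of c] by (simp add: power2_eq_square mult_left_le)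
    have "(w c)\<^sup>2 * (2 * (p c + q c)\<^sup>2) \<le> w c * (4 * ((p c)\<^sup>2 + (q c)\<^sup>2))"
      by (rule mult_mono[OF 2 1 W0]) simp
    then show "2 * (w c)\<^sup>2 * (p c + q c)\<^sup>2 \<le> 4 * (w c * ((p c)\<^sup>2 + (q c)\<^sup>2))" by (simp add: mult_ac)
  qed
  also have "\<dots> = 4 * weighted_norm w" by (simp add: weighted_norm_def sum_distrib_left)
  also have "?A * ?B \<le> weighted_norm w"
  proof -
    have "?B \<le> (\<Sum>c\<in>C. 1 * q c)"
    proof (intro sum_mono mult_mono)
      fix c assume "c \<in> C"
      then show "(q c)\<^sup>2 \<le> q c" using le1[OF sum_p(2)] p_nonneg[of c] p_nonneg by (simp add: power2_eq_square mult_left_le)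
    qed (use w p_nonneg in \<open>auto intro: less_imp_le\<close>)
    then have "?B \<le> 1" by (simp add: sum_p)
    moreover have "0 \<le> ?A" "0 \<le> ?B" using W0 by (auto intro!: sum_nonneg)
    moreover have "?A \<le> weighted_norm w" unfolding weighted_norm_def using W0 by (intro sum_mono mult_left_mono) auto
    ultimately show ?thesis using mult_left_le[of ?B ?A] by linarith
  qed
  finally show ?thesis by simp
qed

text \<open>Cauchy-Schwarz with weights w and 1/w; the sum of 1/w is the number of pieces after
  flattening.\<close>

lemma \<kappa>_ge:
  assumes W: "(\<Sum>c\<in>C. 1 / w c) \<le> W" "0 < W"
  shows "(\<Sum>c\<in>C. \<bar>p c - q c\<bar>)\<^sup>2 / W \<le> \<kappa>"
proof -
  have W0: "0 \<le> w c" for c using w(1)[of c] by simp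
  have "(\<Sum>c\<in>C. \<bar>p c - q c\<bar>) = (\<Sum>c\<in>C. \<bar>sqrt (w c) * \<theta> c\<bar> * \<bar>1 / sqrt (w c)\<bar>)"
    using w(1) by (intro sum.cong refl) (simp add: \<theta>_eq abs_mult less_imp_le less_imp_neq[symmetric])
  also have "\<dots> \<le> L2_set (\<lambda>c. sqrt (w c) * \<theta> c) C * L2_set (\<lambda>c. 1 / sqrt (w c)) C"
    by (rule L2_set_mult_ineq)
  also have "L2_set (\<lambda>c. sqrt (w c) * \<theta> c) C = sqrt \<kappa>"
    using W0 by (simp add: L2_set_def \<kappa>_def power_mult_distrib)
  also have "L2_set (\<lambda>c. 1 / sqrt (w c)) C = sqrt (\<Sum>c\<in>C. 1 / w c)"
    using W0 by (simp add: L2_set_def power_divide)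
  finally have "(\<Sum>c\<in>C. \<bar>p c - q c\<bar>)\<^sup>2 \<le> (sqrt \<kappa> * sqrt (\<Sum>c\<in>C. 1 / w c))\<^sup>2"
    by (intro power_mono sum_nonneg) auto
  also have "\<dots> = \<kappa> * (\<Sum>c\<in>C. 1 / w c)"
    using kappa_nonneg W0 by (simp add: power_mult_distrib sum_nonneg)
  also have "\<dots> \<le> \<kappa> * W" using W kappa_nonneg by (intro mult_left_mono)
  finally show ?thesis using W(2) by (simp add: divide_le_eq)
qed

end

context sampled_vectors
begin

text \<open>\<open>x\<close> bounds the ratio of sqrt H2 to m \<kappa>. Relative to the squared mean
  the variance is at most 3 x, and deviating by half the mean costs a factor 4.\<close>

lemma ustat_lower_tail_half:
  assumes m: "0 < m" and \<eta>: "0 < \<eta>" "\<eta> \<le> \<kappa>" and x: "0 \<le> x" "x \<le> 1" "H2 \<le> (x * (m * \<kappa>))\<^sup>2"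
  shows "measure_pmf.prob (samples m) {(zs, zs'). ustat w C f zs zs' < (real m)\<^sup>2 * \<eta> / 2} \<le> 12 * x"
proof -
  define M where "M = (real m)\<^sup>2 * \<kappa>"
  have M: "0 < M" using m \<eta> by (simp add: M_def)
  have \<tau>: "(real m)\<^sup>2 * \<eta> / 2 \<le> M / 2" unfolding M_def using \<eta> by (intro divide_right_mono mult_left_mono) auto
  have sH: "sqrt H2 \<le> x * (m * \<kappa>)" using x \<eta> by (intro real_le_lsqrt) auto
  have "measure_pmf.prob (samples m) {(zs, zs'). ustat w C f zs zs' < (real m)\<^sup>2 * \<eta> / 2} \<le>
    ((real m)\<^sup>2 * H2 + 2 * real m ^ 3 * (sqrt H2 * \<kappa>)) / (M - (real m)\<^sup>2 * \<eta> / 2)\<^sup>2"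
    using \<tau> M ustat_lower_tail[of "(real m)\<^sup>2 * \<eta> / 2" m] by (simp add: M_def)
  also have "\<dots> \<le> (3 * x * M\<^sup>2) / (M / 2)\<^sup>2"
  proof (rule frac_le)
    have "(real m)\<^sup>2 * H2 \<le> (real m)\<^sup>2 * (x * (m * \<kappa>))\<^sup>2" using x by (intro mult_left_mono) auto
    also have "\<dots> = x\<^sup>2 * M\<^sup>2" by (simp add: M_def power_mult_distrib power2_eq_square)
    also have "\<dots> \<le> x * M\<^sup>2" using x by (intro mult_right_mono) (auto simp: power2_eq_square mult_left_le)
    finally have 1: "(real m)\<^sup>2 * H2 \<le> x * M\<^sup>2" .
    have "2 * real m ^ 3 * (sqrt H2 * \<kappa>) \<le> 2 * real m ^ 3 * (x * (m * \<kappa>) * \<kappa>)"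
      using sH kappa_nonneg by (intro mult_left_mono mult_right_mono) auto
    also have "\<dots> = 2 * x * M\<^sup>2" by (simp add: M_def power2_eq_square power3_eq_cube)
    finally show "(real m)\<^sup>2 * H2 + 2 * real m ^ 3 * (sqrt H2 * \<kappa>) \<le> 3 * x * M\<^sup>2" using 1 by simp
    show "(M / 2)\<^sup>2 \<le> (M - (real m)\<^sup>2 * \<eta> / 2)\<^sup>2" using \<tau> M by (intro power_mono) auto
  qed (use M x in auto)
  also have "\<dots> = 12 * x" using M by (simp add: power_divide)
  finally show ?thesis .
qed

end

lemma prob_pair_pmf_le:
  assumes fin: "finite (set_pmf A)" and b: "0 \<le> b"
    and le: "\<And>x. x \<in> set_pmf A \<Longrightarrow> x \<notin> Bad \<Longrightarrow> measure_pmf.prob B {y. R x y} \<le> b"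
  shows "measure_pmf.prob (pair_pmf A B) {(x, y). R x y} \<le> measure_pmf.prob A Bad + b"
proof -
  have eq: "pair_pmf A B = bind_pmf A (\<lambda>x. map_pmf (Pair x) B)"
    by (simp add: pair_pmf_def map_pmf_def)
  show ?thesis unfolding eq
  proof (rule prob_bind_pmf_le[OF fin b])
    fix x assume "x \<in> set_pmf A" "x \<notin> Bad"
    then show "measure_pmf.prob (map_pmf (Pair x) B) {(x, y). R x y} \<le> b"
      using le[of x] by (simp add: vimage_def)
  qed
qed

context pair_samples
begin

lemma weighted_pair_samples_flat:
  assumes "0 < lam" shows "weighted_pair_samples P Q b C (flat_weight b lam fs)"
  by unfold_locales (use flat_weight_range[of lam] assms in \<open>simp_all add: less_imp_le\<close>)

text \<open>Half of the allowance goes to the auxiliary sample, whose weighted norm reaches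
  \<open>\<rho>\<close> rarely by Markov. Otherwise the statistic has mean 0, and Chebyshev with
  variance m^2 H2 accounts for the other half. \<open>\<Lambda>\<close> will be the number of
  levels, for the union bound.\<close>

lemma closeness_null:
  fixes lam \<eta> \<Lambda> :: real and m :: nat
  assumes eq: "P = Q" and lam: "0 < lam" "lam \<le> 1" and m: "0 < m" and \<Lambda>: "1 \<le> \<Lambda>" and \<eta>: "0 < \<eta>"
    and cond: "10^7 * \<Lambda>\<^sup>2 \<le> lam * real m ^ 3 * \<eta>\<^sup>2"
  shows "measure_pmf.prob (pair_pmf (replicate_pmf m Z) (pair_pmf (replicate_pmf m Z) (replicate_pmf m Z)))
    {(fs, z). (real m)\<^sup>2 * \<eta> / 2 \<le> (case z of (zs, zs') \<Rightarrow> ustat (flat_weight b lam fs) C (pair_vec b) zs zs')} \<le> 1 / (6 * \<Lambda>)"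
proof -
  define \<rho> where "\<rho> = 24 * \<Lambda> / (lam * m)"
  have \<rho>: "0 < \<rho>" using lam m \<Lambda> by (simp add: \<rho>_def)
  define Bad where "Bad = {fs. \<rho> \<le> weighted_norm (flat_weight b lam fs)}"
  have "measure_pmf.prob (replicate_pmf m Z) Bad \<le> 2 / (lam * (m + 1)) / \<rho>"
    unfolding Bad_def by (rule prob_weighted_norm[OF lam \<rho>])
  also have "\<dots> \<le> 2 / (lam * m) / \<rho>" using lam m \<rho>
    by (intro divide_right_mono divide_left_mono mult_left_mono mult_pos_pos) auto
  also have "\<dots> = 1 / (12 * \<Lambda>)" using lam m by (simp add: \<rho>_def)
  finally have bad: "measure_pmf.prob (replicate_pmf m Z) Bad \<le> 1 / (12 * \<Lambda>)" .
  have "measure_pmf.prob (pair_pmf (replicate_pmf m Z) (pair_pmf (replicate_pmf m Z) (replicate_pmf m Z)))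
    {(fs, z). (real m)\<^sup>2 * \<eta> / 2 \<le> (case z of (zs, zs') \<Rightarrow> ustat (flat_weight b lam fs) C (pair_vec b) zs zs')}
     \<le> measure_pmf.prob (replicate_pmf m Z) Bad + 1 / (12 * \<Lambda>)"
  proof (rule prob_pair_pmf_le)
    fix fs assume "fs \<notin> Bad"
    interpret weighted_pair_samples P Q b C "flat_weight b lam fs" by (rule weighted_pair_samples_flat[OF lam(1)])
    have "p c = q c" for c unfolding p_def q_def by (simp only: eq)
    then have \<kappa>: "\<kappa> = 0" unfolding \<kappa>_def \<theta>_eq by simp
    have H2: "H2 \<le> 12 * \<rho>" using H2_le \<open>fs \<notin> Bad\<close> by (simp add: Bad_def)
    have \<tau>: "0 < (real m)\<^sup>2 * \<eta> / 2" using m \<eta> by simp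
    have "measure_pmf.prob (samples m) {(zs, zs'). (real m)\<^sup>2 * \<eta> / 2 \<le> ustat (flat_weight b lam fs) C (pair_vec b) zs zs'}
        \<le> (real m)\<^sup>2 * H2 / ((real m)\<^sup>2 * \<eta> / 2)\<^sup>2"
      using ustat_upper_tail[of m "(real m)\<^sup>2 * \<eta> / 2"] \<kappa> \<tau> by simp
    also have "\<dots> \<le> (real m)\<^sup>2 * (12 * \<rho>) / ((real m)\<^sup>2 * \<eta> / 2)\<^sup>2"
      using H2 by (intro divide_right_mono mult_left_mono) auto
    \<comment> \<open>1152 = 12 * 24 * 4, the 4 coming from the threshold at half of m^2
      \<eta>.\<close>
    also have "\<dots> = 1152 * \<Lambda> / (lam * real m ^ 3 * \<eta>\<^sup>2)"
      using m lam \<eta> by (simp add: \<rho>_def divide_simps power2_eq_square power3_eq_cube)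
    also have "\<dots> \<le> 1152 * \<Lambda> / (10^7 * \<Lambda>\<^sup>2)" using cond \<Lambda> lam m \<eta> by (intro divide_left_mono mult_pos_pos) auto
    also have "\<dots> \<le> 1 / (12 * \<Lambda>)" using \<Lambda> by (simp add: divide_simps power2_eq_square)
    finally show "measure_pmf.prob (pair_pmf (replicate_pmf m Z) (replicate_pmf m Z))
      {y. (real m)\<^sup>2 * \<eta> / 2 \<le> (case y of (zs, zs') \<Rightarrow> ustat (flat_weight b lam fs) C (pair_vec b) zs zs')} \<le> 1 / (12 * \<Lambda>)"
      by (simp add: samples_def case_prod_unfold)
  qed (use \<Lambda> in \<open>auto intro: finite_set_replicate_pmf fZ\<close>)
  also have "\<dots> \<le> 1 / (12 * \<Lambda>) + 1 / (12 * \<Lambda>)" using bad by simp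
  also have "\<dots> = 1 / (6 * \<Lambda>)" using \<Lambda> by (simp add: field_simps)
  finally show ?thesis .
qed

text \<open>Flattening yields card C + 2 lam m pieces, so a large L1 distance still forces \<kappa>
  \<ge> \<eta>, and the mean is at least twice the threshold. The 1/6 is shared equally by the
  auxiliary sample and the statistic.\<close>

lemma closeness_alternative:
  fixes lam \<eta> \<Lambda> :: real and m :: nat
  assumes lam: "0 < lam" "lam \<le> 1" and m: "0 < m" and \<Lambda>: "1 \<le> \<Lambda>" and \<eta>: "0 < \<eta>"
    and far: "\<eta> * (card C + 2 * lam * m) \<le> (\<Sum>c\<in>C. \<bar>p c - q c\<bar>)\<^sup>2"
    and cond: "10^7 * \<Lambda>\<^sup>2 \<le> lam * real m ^ 3 * \<eta>\<^sup>2"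
  shows "measure_pmf.prob (pair_pmf (replicate_pmf m Z) (pair_pmf (replicate_pmf m Z) (replicate_pmf m Z)))
    {(fs, z). (case z of (zs, zs') \<Rightarrow> ustat (flat_weight b lam fs) C (pair_vec b) zs zs') < (real m)\<^sup>2 * \<eta> / 2} \<le> 1 / 6"
proof -
  define \<rho> where "\<rho> = 24 / (lam * m)"
  have \<rho>: "0 < \<rho>" using lam m by (simp add: \<rho>_def)
  define Bad where "Bad = {fs. \<rho> \<le> weighted_norm (flat_weight b lam fs)}"
  have "measure_pmf.prob (replicate_pmf m Z) Bad \<le> 2 / (lam * (m + 1)) / \<rho>"
    unfolding Bad_def by (rule prob_weighted_norm[OF lam \<rho>])
  also have "\<dots> \<le> 2 / (lam * m) / \<rho>" using lam m \<rho>
    by (intro divide_right_mono divide_left_mono mult_left_mono mult_pos_pos) auto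
  also have "\<dots> = 1 / 12" using lam m by (simp add: \<rho>_def)
  finally have bad: "measure_pmf.prob (replicate_pmf m Z) Bad \<le> 1 / 12" .
  have "measure_pmf.prob (pair_pmf (replicate_pmf m Z) (pair_pmf (replicate_pmf m Z) (replicate_pmf m Z)))
    {(fs, z). (case z of (zs, zs') \<Rightarrow> ustat (flat_weight b lam fs) C (pair_vec b) zs zs') < (real m)\<^sup>2 * \<eta> / 2}
     \<le> measure_pmf.prob (replicate_pmf m Z) Bad + 1 / 12"
  proof (rule prob_pair_pmf_le)
    fix fs assume fs: "fs \<in> set_pmf (replicate_pmf m Z)" "fs \<notin> Bad"
    interpret weighted_pair_samples P Q b C "flat_weight b lam fs" by (rule weighted_pair_samples_flat[OF lam(1)])
    have H2: "H2 \<le> 12 * \<rho>" using H2_le fs(2) by (simp add: Bad_def)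
    have len: "length fs = m" using fs(1) by (auto simp: set_replicate_pmf)
    have "(\<Sum>c\<in>C. 1 / flat_weight b lam fs c) = card C + lam * ((\<Sum>c\<in>C. real (length (filter (\<lambda>z. b (fst z) = c) fs)))
        + (\<Sum>c\<in>C. real (length (filter (\<lambda>z. b (snd z) = c) fs))))"
      by (simp add: flat_weight_def sum.distrib sum_distrib_left distrib_left)
    also have "\<dots> = card C + 2 * lam * m"
      using sum_length_filter[OF fC, of "\<lambda>z. b (fst z)" fs] sum_length_filter[OF fC, of "\<lambda>z. b (snd z)" fs] bC
      by (simp add: len)
    finally have W: "(\<Sum>c\<in>C. 1 / flat_weight b lam fs c) = card C + 2 * lam * m" .
    have Wpos: "0 < card C + 2 * lam * m" using lam m by (simp add: add_nonneg_pos)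
    have \<eta>\<kappa>: "\<eta> \<le> \<kappa>"
    proof -
      have "\<eta> \<le> (\<Sum>c\<in>C. \<bar>p c - q c\<bar>)\<^sup>2 / (card C + 2 * lam * m)" using far Wpos by (simp add: le_divide_eq)
      also have "\<dots> \<le> \<kappa>" using W Wpos by (intro \<kappa>_ge) auto
      finally show ?thesis .
    qed
    have "H2 \<le> (1 / 144 * (m * \<kappa>))\<^sup>2"
    proof -
      \<comment> \<open>The origin of 10^7: with x = 1/144 the tail bound 12 x is 1/12, and 12
        \<rho> \<le> (x m \<eta>)^2 asks for this product.\<close>
      have "(12 * 24 * 144\<^sup>2 :: real) \<le> 10 ^ 7 * \<Lambda>\<^sup>2" using one_le_power[OF \<Lambda>, of 2] by simp
      also note cond
      also have "lam * real m ^ 3 * \<eta>\<^sup>2 = (lam * m) * (m * \<eta>)\<^sup>2" by (simp add: power2_eq_square power3_eq_cube)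
      finally have "12 * \<rho> \<le> (1 / 144 * (m * \<eta>))\<^sup>2" using lam m
        by (simp add: \<rho>_def divide_simps power2_eq_square mult_ac)
      also have "\<dots> \<le> (1 / 144 * (m * \<kappa>))\<^sup>2"
        using \<eta>\<kappa> \<eta> by (intro power_mono mult_left_mono) auto
      finally show ?thesis using H2 by simp
    qed
    then have "measure_pmf.prob (samples m) {(zs, zs'). ustat (flat_weight b lam fs) C (pair_vec b) zs zs' < (real m)\<^sup>2 * \<eta> / 2} \<le> 12 * (1 / 144)"
      using m \<eta> \<eta>\<kappa> by (intro ustat_lower_tail_half) auto
    then show "measure_pmf.prob (pair_pmf (replicate_pmf m Z) (replicate_pmf m Z))
      {y. (case y of (zs, zs') \<Rightarrow> ustat (flat_weight b lam fs) C (pair_vec b) zs zs') < (real m)\<^sup>2 * \<eta> / 2} \<le> 1 / 12"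
      by (simp add: samples_def case_prod_unfold)
  qed (auto intro: finite_set_replicate_pmf fZ)
  also have "\<dots> \<le> 1 / 6" using bad by simp
  finally show ?thesis .
qed

end

section \<open>Distance of spread samples from uniform\<close>

locale spread_samples =
  fixes Z :: "'z pmf" and v :: "'z \<Rightarrow> 'c \<Rightarrow> real" and C :: "'c set"
  assumes fZ: "finite (set_pmf Z)" and fC: "finite C" and neC: "C \<noteq> {}"
    and v: "\<And>z c. 0 \<le> v z c" "\<And>z. z \<in> set_pmf Z \<Longrightarrow> (\<Sum>c\<in>C. v z c) = 1"
begin

definition N :: real where "N = card C"

definition dev :: "'z \<Rightarrow> 'c \<Rightarrow> real" where "dev z c = v z c - 1 / N"

lemma N_ge_1: "1 \<le> N"
  using fC neC by (simp add: N_def Suc_le_eq card_gt_0_iff)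

sublocale sampled_vectors Z dev C "\<lambda>_. 1"
  using fZ fC by unfold_locales auto

lemma \<theta>_eq: "\<theta> c = E_pmf Z (\<lambda>z. v z c) - 1 / N"
  unfolding \<theta>_def dev_def using fZ
  by (subst Bochner_Integration.integral_diff) (auto intro: integrable_measure_pmf_finite)

lemma sum_\<theta>: "(\<Sum>c\<in>C. \<theta> c) = 0"
proof -
  have "(\<Sum>c\<in>C. E_pmf Z (\<lambda>z. v z c)) = E_pmf Z (\<lambda>z. \<Sum>c\<in>C. v z c)" by (rule E_sum[OF fZ, symmetric])
  also have "\<dots> = E_pmf Z (\<lambda>_. 1)" by (rule E_cong) (rule v(2))
  also have "\<dots> = 1" by simp
  finally show ?thesis using N_ge_1 by (simp add: \<theta>_eq sum_subtractf N_def)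
qed

lemma v_le_1: "z \<in> set_pmf Z \<Longrightarrow> c \<in> C \<Longrightarrow> v z c \<le> 1"
  using member_le_sum[of c C "v z"] v fC by auto

text \<open>For two samples the kernel is the overlap a of their vectors minus 1/N, and 0 \<le> a
  \<le> 1 allows a^2 to be replaced by a. The expected overlap is the squared norm of the mean
  vector, which is \<kappa> + 1/N.\<close>

lemma H2_le: "H2 \<le> \<kappa> + 2 / N"
proof -
  have inner: "(\<Sum>c\<in>C. dev z c * dev z' c) = (\<Sum>c\<in>C. v z c * v z' c) - 1 / N"
    if "z \<in> set_pmf Z" "z' \<in> set_pmf Z" for z z'
  proof -
    have "(\<Sum>c\<in>C. dev z c * dev z' c) = (\<Sum>c\<in>C. v z c * v z' c) - (\<Sum>c\<in>C. v z c) / N - (\<Sum>c\<in>C. v z' c) / N + N * (1 / N * (1 / N))"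
      by (simp add: dev_def algebra_simps sum.distrib sum_subtractf sum_divide_distrib N_def)
    then show ?thesis using v(2)[OF that(1)] v(2)[OF that(2)] N_ge_1 by simp
  qed
  have sq: "(\<Sum>c\<in>C. dev z c * dev z' c)\<^sup>2 \<le> (\<Sum>c\<in>C. v z c * v z' c) + 1 / N\<^sup>2"
    if z: "z \<in> set_pmf Z" "z' \<in> set_pmf Z" for z z'
  proof -
    define a where "a = (\<Sum>c\<in>C. v z c * v z' c)"
    have "0 \<le> a" unfolding a_def using v(1) by (intro sum_nonneg mult_nonneg_nonneg) auto
    have "a \<le> (\<Sum>c\<in>C. v z c * 1)" unfolding a_def using v(1) v_le_1[OF z(2)] by (intro sum_mono mult_left_mono) auto
    then have "a \<le> 1" using v(2)[OF z(1)] by simp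
    have "(a - 1 / N)\<^sup>2 = a\<^sup>2 - 2 * a / N + 1 / N\<^sup>2" by (simp add: power2_diff power_divide)
    also have "\<dots> \<le> a\<^sup>2 + 1 / N\<^sup>2" using \<open>0 \<le> a\<close> N_ge_1 by simp
    also have "a\<^sup>2 \<le> a" using \<open>0 \<le> a\<close> \<open>a \<le> 1\<close> by (simp add: power2_eq_square mult_left_le)
    finally show ?thesis unfolding inner[OF z] a_def by simp
  qed
  have "H2 = E_pmf Z (\<lambda>z. E_pmf Z (\<lambda>z'. (\<Sum>c\<in>C. dev z c * dev z' c)\<^sup>2))" unfolding H2_eq by simp
  also have "\<dots> \<le> E_pmf Z (\<lambda>z. E_pmf Z (\<lambda>z'. (\<Sum>c\<in>C. v z c * v z' c) + 1 / N\<^sup>2))"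
    using sq by (intro E_mono fZ)
  also have "\<dots> = (\<Sum>c\<in>C. (E_pmf Z (\<lambda>z. v z c))\<^sup>2) + 1 / N\<^sup>2"
    by (simp add: E_add[OF fZ] E_sum[OF fZ] power2_eq_square)
  also have "(\<Sum>c\<in>C. (E_pmf Z (\<lambda>z. v z c))\<^sup>2) = (\<Sum>c\<in>C. (\<theta> c)\<^sup>2 + 2 / N * \<theta> c + 1 / N\<^sup>2)"
  proof (intro sum.cong refl)
    fix c
    have "E_pmf Z (\<lambda>z. v z c) = \<theta> c + 1 / N" by (simp add: \<theta>_eq)
    then show "(E_pmf Z (\<lambda>z. v z c))\<^sup>2 = (\<theta> c)\<^sup>2 + 2 / N * \<theta> c + 1 / N\<^sup>2"
      by (simp add: power2_sum power_divide)
  qed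
  also have "\<dots> = \<kappa> + 1 / N"
  proof -
    have "(\<Sum>c\<in>C. 2 / N * \<theta> c) = 0" using sum_\<theta> by (metis mult_zero_right sum_distrib_left)
    moreover have "(\<Sum>c\<in>C. 1 / N\<^sup>2) = 1 / N" using N_ge_1 by (simp add: power2_eq_square flip: N_def)
    ultimately show ?thesis by (simp add: sum.distrib \<kappa>_def)
  qed
  also have "1 / N\<^sup>2 \<le> 1 / N" using N_ge_1 by (simp add: power2_eq_square divide_simps)
  finally show ?thesis by simp
qed

lemma \<kappa>_ge: "(\<Sum>c\<in>C. \<bar>E_pmf Z (\<lambda>z. v z c) - 1 / N\<bar>)\<^sup>2 / N \<le> \<kappa>"
proof -
  have "(\<Sum>c\<in>C. \<bar>\<theta> c\<bar>) = (\<Sum>c\<in>C. \<bar>\<theta> c\<bar> * \<bar>1\<bar>)" by simp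
  also have "\<dots> \<le> L2_set \<theta> C * L2_set (\<lambda>_. 1) C" by (rule L2_set_mult_ineq)
  also have "\<dots> = sqrt \<kappa> * sqrt N" by (simp add: L2_set_def \<kappa>_def N_def)
  finally have "(\<Sum>c\<in>C. \<bar>\<theta> c\<bar>)\<^sup>2 \<le> (sqrt \<kappa> * sqrt N)\<^sup>2" by (intro power_mono sum_nonneg) auto
  then show ?thesis using kappa_nonneg N_ge_1 by (simp add: power_mult_distrib \<theta>_eq divide_le_eq)
qed

text \<open>Probing leaves the mean vector slightly off uniform. With an L1 error of 1/m the mean
  m^2 \<kappa> of the statistic is at most 1, negligible against a threshold of at least
  10^4.\<close>

lemma uniformity_null:
  fixes \<eta> \<Lambda> :: real and m :: nat
  assumes m: "0 < m" and \<Lambda>: "1 \<le> \<Lambda>" and \<eta>: "0 < \<eta>"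
    and close: "(\<Sum>c\<in>C. \<bar>E_pmf Z (\<lambda>z. v z c) - 1 / N\<bar>) \<le> 1 / m"
    and cond: "20000 * \<Lambda> \<le> (real m)\<^sup>2 * \<eta>" "30000 * \<Lambda> \<le> N * (real m)\<^sup>2 * \<eta>\<^sup>2"
  shows "measure_pmf.prob (pair_pmf (replicate_pmf m Z) (replicate_pmf m Z))
    {(zs, zs'). (real m)\<^sup>2 * \<eta> / 2 \<le> ustat (\<lambda>_. 1) C dev zs zs'} \<le> 1 / (6 * \<Lambda>)"
proof -
  have "\<kappa> = (\<Sum>c\<in>C. \<bar>\<theta> c\<bar>\<^sup>2)" by (simp add: \<kappa>_def)
  also have "\<dots> \<le> (\<Sum>c\<in>C. \<bar>\<theta> c\<bar>)\<^sup>2"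
  proof -
    have "(\<Sum>c\<in>C. \<bar>\<theta> c\<bar>\<^sup>2) \<le> (\<Sum>c\<in>C. \<bar>\<theta> c\<bar> * (\<Sum>c\<in>C. \<bar>\<theta> c\<bar>))"
      unfolding power2_eq_square using fC by (intro sum_mono mult_left_mono member_le_sum) auto
    then show ?thesis by (simp add: power2_eq_square sum_distrib_right)
  qed
  also have "\<dots> \<le> (1 / m)\<^sup>2" using close by (intro power_mono sum_nonneg) (auto simp: \<theta>_eq)
  finally have \<kappa>: "(real m)\<^sup>2 * \<kappa> \<le> 1" using m by (simp add: power_divide divide_simps mult.commute)
  define T where "T = (real m)\<^sup>2 * \<eta>"
  have T: "20000 \<le> T" using cond(1) \<Lambda> by (simp add: T_def)
  have mH: "(real m)\<^sup>2 * H2 \<le> 1 + 2 * (real m)\<^sup>2 / N"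
  proof -
    have "(real m)\<^sup>2 * H2 \<le> (real m)\<^sup>2 * (\<kappa> + 2 / N)" using H2_le by (intro mult_left_mono) auto
    also have "\<dots> = (real m)\<^sup>2 * \<kappa> + 2 * (real m)\<^sup>2 / N" by (simp add: distrib_left)
    finally show ?thesis using \<kappa> by linarith
  qed
  \<comment> \<open>The bound m^2 \<kappa> \<le> 1 and 2 a \<le> a^2 + 1 reduce the mixed term to
    the first one.\<close>
  have "2 * real m ^ 3 * (sqrt H2 * \<kappa>) = 2 * (m * sqrt H2) * ((real m)\<^sup>2 * \<kappa>)"
    by (simp add: power2_eq_square power3_eq_cube)
  also have "\<dots> \<le> 2 * (m * sqrt H2) * 1" using \<kappa> H2_nonneg by (intro mult_left_mono) auto
  also have "\<dots> \<le> (m * sqrt H2)\<^sup>2 + 1"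
    using zero_le_power2[of "m * sqrt H2 - 1"] by (simp add: power2_diff)
  also have "\<dots> = (real m)\<^sup>2 * H2 + 1" using H2_nonneg by (simp add: power_mult_distrib)
  finally have num: "(real m)\<^sup>2 * H2 + 2 * real m ^ 3 * (sqrt H2 * \<kappa>) \<le> 3 + 4 * ((real m)\<^sup>2 / N)" using mH by simp
  have "measure_pmf.prob (samples m) {(zs, zs'). T / 2 \<le> ustat (\<lambda>_. 1) C dev zs zs'} \<le>
    ((real m)\<^sup>2 * H2 + 2 * real m ^ 3 * (sqrt H2 * \<kappa>)) / (T / 2 - (real m)\<^sup>2 * \<kappa>)\<^sup>2"
    using \<kappa> T by (intro ustat_upper_tail) simp
  also have "\<dots> \<le> (3 + 4 * ((real m)\<^sup>2 / N)) / (T / 4)\<^sup>2"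
    using num \<kappa> T N_ge_1 by (intro frac_le power_mono) auto
  also have "\<dots> \<le> 1 / (6 * \<Lambda>)"
  proof -
    have "20000 * (20000 * \<Lambda>) \<le> T * T" using T cond(1) \<Lambda> by (intro mult_mono) (auto simp: T_def)
    moreover have "30000 * \<Lambda> * ((real m)\<^sup>2 / N) \<le> N * (real m)\<^sup>2 * \<eta>\<^sup>2 * ((real m)\<^sup>2 / N)"
      using cond(2) N_ge_1 by (intro mult_right_mono) auto
    then have "30000 * \<Lambda> * ((real m)\<^sup>2 / N) \<le> T * T"
      using N_ge_1 by (simp add: T_def power2_eq_square mult_ac)
    ultimately have "6 * \<Lambda> * (3 + 4 * ((real m)\<^sup>2 / N)) * 16 \<le> T\<^sup>2"
      using \<Lambda> by (simp add: power2_eq_square algebra_simps)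
    moreover have "0 < T" using T by simp
    ultimately show ?thesis using \<Lambda> by (simp add: power_divide divide_simps mult_ac)
  qed
  finally show ?thesis by (simp add: T_def samples_def)
qed

text \<open>In H2 \<le> \<kappa> + 2/N the two conditions on \<open>m\<close> bound the two summands
  by small multiples of (m \<kappa>)^2. The ratio 1/72 is what \<open>ustat_lower_tail_half\<close>
  needs for 1/6.\<close>

lemma uniformity_alternative:
  fixes \<eta> \<Lambda> :: real and m :: nat
  assumes m: "0 < m" and \<Lambda>: "1 \<le> \<Lambda>" and \<eta>: "0 < \<eta>"
    and far: "\<eta> * N \<le> (\<Sum>c\<in>C. \<bar>E_pmf Z (\<lambda>z. v z c) - 1 / N\<bar>)\<^sup>2"
    and cond: "20000 * \<Lambda> \<le> (real m)\<^sup>2 * \<eta>" "30000 * \<Lambda> \<le> N * (real m)\<^sup>2 * \<eta>\<^sup>2"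
  shows "measure_pmf.prob (pair_pmf (replicate_pmf m Z) (replicate_pmf m Z))
    {(zs, zs'). ustat (\<lambda>_. 1) C dev zs zs' < (real m)\<^sup>2 * \<eta> / 2} \<le> 1 / 6"
proof -
  have \<eta>\<kappa>: "\<eta> \<le> \<kappa>"
  proof -
    have "\<eta> \<le> (\<Sum>c\<in>C. \<bar>E_pmf Z (\<lambda>z. v z c) - 1 / N\<bar>)\<^sup>2 / N" using far N_ge_1 by (simp add: le_divide_eq)
    also note \<kappa>_ge
    finally show ?thesis .
  qed
  then have \<kappa>: "0 < \<kappa>" using \<eta> by simp
  have "H2 \<le> \<kappa> + 2 / N" by (rule H2_le)
  also have "\<dots> \<le> (1 / 72 * (m * \<kappa>))\<^sup>2"
  proof -
    have "20000 \<le> (real m)\<^sup>2 * \<eta>" using cond(1) \<Lambda> by simp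
    also have "\<dots> \<le> (real m)\<^sup>2 * \<kappa>" using \<eta>\<kappa> by (intro mult_left_mono) auto
    finally have "20000 * \<kappa> \<le> (real m)\<^sup>2 * \<kappa> * \<kappa>" using \<kappa> by (intro mult_right_mono) auto
    moreover have "30000 \<le> N * (real m)\<^sup>2 * \<eta>\<^sup>2" using cond(2) \<Lambda> by simp
    then have "30000 \<le> N * ((real m)\<^sup>2 * \<kappa>\<^sup>2)"
    proof (rule order_trans)
      show "N * (real m)\<^sup>2 * \<eta>\<^sup>2 \<le> N * ((real m)\<^sup>2 * \<kappa>\<^sup>2)"
        unfolding mult.assoc using \<eta>\<kappa> \<eta> N_ge_1 by (intro mult_left_mono power_mono) auto
    qed
    then have "30000 / N \<le> (real m)\<^sup>2 * \<kappa>\<^sup>2" using N_ge_1 by (simp add: divide_le_eq mult.commute)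
    moreover have "(real m)\<^sup>2 * \<kappa> * \<kappa> = (real m)\<^sup>2 * \<kappa>\<^sup>2" by (simp add: power2_eq_square)
    moreover have "2 / N = (30000 / N) / 15000" by simp
    moreover have "0 \<le> (real m)\<^sup>2 * \<kappa>\<^sup>2" by simp
    ultimately have "\<kappa> + 2 / N \<le> (real m)\<^sup>2 * \<kappa>\<^sup>2 / 5184" by linarith
    then show ?thesis by (simp add: power_mult_distrib power_divide)
  qed
  finally have "H2 \<le> (1 / 72 * (m * \<kappa>))\<^sup>2" .
  then have "measure_pmf.prob (samples m) {(zs, zs'). ustat (\<lambda>_. 1) C dev zs zs' < (real m)\<^sup>2 * \<eta> / 2} \<le> 12 * (1 / 72)"
    using m \<eta> \<eta>\<kappa> by (intro ustat_lower_tail_half) auto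
  then show ?thesis by (simp add: samples_def)
qed

end

section \<open>Repeated independent trials\<close>

lemma prob_replicate_all:
  "measure_pmf.prob (replicate_pmf n D) {zs. \<forall>z\<in>set zs. z \<in> A} = measure_pmf.prob D A ^ n"
proof (induction n)
  case (Suc n)
  have "measure_pmf.prob (replicate_pmf (Suc n) D) {zs. \<forall>z\<in>set zs. z \<in> A} =
      E_pmf D (\<lambda>z. indicator A z * measure_pmf.prob (replicate_pmf n D) {zs. \<forall>z\<in>set zs. z \<in> A})"
  proof -
    have "replicate_pmf (Suc n) D = bind_pmf D (\<lambda>z. map_pmf (Cons z) (replicate_pmf n D))"
      by (simp add: map_pmf_def)
    moreover have "measure_pmf.prob (map_pmf (Cons z) (replicate_pmf n D)) {zs. \<forall>z\<in>set zs. z \<in> A} =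
        indicator A z * measure_pmf.prob (replicate_pmf n D) {zs. \<forall>z\<in>set zs. z \<in> A}" for z
      by (cases "z \<in> A") (auto simp: vimage_def)
    ultimately show ?thesis by (simp only: prob_bind_pmf)
  qed
  then show ?case by (simp add: Suc)
qed simp

lemma prob_replicate_ex:
  "measure_pmf.prob (replicate_pmf n D) {zs. \<exists>z\<in>set zs. z \<in> B} \<le> n * measure_pmf.prob D B"
proof -
  let ?b = "measure_pmf.prob D B"
  have "measure_pmf.prob (replicate_pmf n D) {zs. \<exists>z\<in>set zs. z \<in> B} =
      1 - measure_pmf.prob (replicate_pmf n D) {zs. \<forall>z\<in>set zs. z \<in> - B}"
  proof -
    have "{zs. \<exists>z\<in>set zs. z \<in> B} = UNIV - {zs. \<forall>z\<in>set zs. z \<in> - B}" by auto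
    then show ?thesis using measure_pmf.prob_compl[of "{zs. \<forall>z\<in>set zs. z \<in> - B}" "replicate_pmf n D"] by simp
  qed
  also have "\<dots> = 1 - (1 - ?b) ^ n"
    using measure_pmf.prob_compl[of B D] by (simp only: prob_replicate_all) (simp add: Compl_eq_Diff_UNIV)
  also have "\<dots> \<le> n * ?b" using Bernoulli_inequality[of "- ?b" n] by simp
  finally show ?thesis .
qed

lemma prob_replicate_none:
  assumes "b \<le> measure_pmf.prob D B"
  shows "measure_pmf.prob (replicate_pmf n D) {zs. \<forall>z\<in>set zs. z \<notin> B} \<le> exp (- b * n)"
proof -
  let ?b = "measure_pmf.prob D B"
  have "measure_pmf.prob (replicate_pmf n D) {zs. \<forall>z\<in>set zs. z \<notin> B} = (1 - ?b) ^ n"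
    using prob_replicate_all[of n D "- B"] measure_pmf.prob_compl[of B D] by (simp add: Compl_eq_Diff_UNIV)
  also have "\<dots> \<le> exp (- b) ^ n"
    using exp_ge_add_one_self[of "- b"] assms by (intro power_mono) auto
  also have "\<dots> = exp (- b * n)" by (simp add: exp_of_nat_mult[symmetric] mult.commute)
  finally show ?thesis .
qed

section \<open>The equivalence tester\<close>

lemma exp_minus_2_le: "exp (- 2 :: real) \<le> 1 / 6"
proof -
  \<comment> \<open>A rational lower bound for e^2: (9/8)^16 exceeds 6.\<close>
  have "(1 + 1 / 8 :: real) ^ 16 \<le> exp (1 / 8) ^ 16"
    using exp_ge_add_one_self[of "1 / 8 :: real"] by (intro power_mono) auto
  also have "exp (1 / 8 :: real) ^ 16 = exp 2" by (simp flip: exp_of_nat_mult)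
  finally have "6 \<le> exp (2 :: real)" by (simp add: power_divide)
  then show ?thesis by (simp add: exp_minus divide_simps)
qed

text \<open>From ln 24 \<ge> 3 and 384 * 3 = 1152.\<close>

lemma guard_const_le: "guard_const \<le> 1 / 1152" "0 \<le> guard_const"
proof -
  have "exp (3::real) = exp 1 ^ 3" by (simp flip: exp_of_nat_mult)
  also have "\<dots> \<le> (272 / 100) ^ 3" using e_less_272 by (intro power_mono) auto
  also have "\<dots> \<le> 24" by (simp add: power3_eq_cube)
  finally have "3 \<le> ln (24::real)" by (subst ln_ge_iff) auto
  then show "guard_const \<le> 1 / 1152" "0 \<le> guard_const" by (auto simp: guard_const_def divide_simps)
qed

text \<open>The cell addressed by the label that the algorithm sees, instead of by its
  index.\<close>

definition cell_of :: "nat \<Rightarrow> clustering \<Rightarrow> point \<Rightarrow> point set" where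
  "cell_of d K r = {x \<in> cube d. label K x = r}"

lemma cell_of_rep: "is_clustering d K \<Longrightarrow> i < num_cells K \<Longrightarrow> cell_of d K (rep K i) = cell K i"
  using label_eq_rep_iff[of d K i] by (auto simp: cell_of_def is_clustering_def)

lemma verdict_probes_labels:
  assumes K: "is_clustering d K" and "set rs \<subseteq> rep K ` {..<num_cells K}"
  shows "verdict_pmf K P (probes d g rs k) = verdict_pmf K P (k (map (\<lambda>r. eval_q (\<lambda>x. x \<in> cell_of d K r) (g r)) rs))"
  using assms(2)
proof (induction rs arbitrary: k)
  case (Cons r rs)
  then obtain i where "i < num_cells K" "r = rep K i" by auto
  then show ?case using Cons by (simp add: verdict_compile_q[OF K] cell_of_rep[OF K])
qed simp

lemma (in clustered_source) set_label_pmf: "set_pmf (label_pmf K \<mu>) \<subseteq> rep K ` {..<num_cells K}"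
  using set_cell_pmf by (auto simp: label_pmf_def)

lemma (in clustered_source) prob_label_pmf:
  "measure_pmf.prob (label_pmf K \<mu>) {r. R r} = (\<Sum>i<num_cells K. measure \<mu> (cell K i) * of_bool (R (rep K i)))"
  using expectation_label_pmf[of "\<lambda>r. of_bool (R r)"] by (simp add: E_of_bool)

text \<open>The distance of the vector of side lengths from 0 is the diameter of the recorded box.
  \<open>small\<close> is the test applied to a probe result, \<open>good\<close> the same property
  stated for the cell.\<close>

definition small :: "nat \<Rightarrow> real \<Rightarrow> real \<Rightarrow> (nat \<Rightarrow> bool \<Rightarrow> real) option \<Rightarrow> bool" where
  "small d p \<Delta> res = (case res of None \<Rightarrow> False | Some e \<Rightarrow> lp_dist d p (box_size e) (\<lambda>_. 0) \<le> \<Delta>)"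

definition good :: "bool \<Rightarrow> nat \<Rightarrow> nat \<Rightarrow> real \<Rightarrow> real \<Rightarrow> point set \<Rightarrow> point \<Rightarrow> bool" where
  "good full n d p \<Delta> G r \<longleftrightarrow> probe_ok full n d G r \<and> lp_dist d p (box_size (extent n G r)) (\<lambda>_. 0) \<le> \<Delta>"

lemma lp_dist_cong: "(\<And>i. i < d \<Longrightarrow> x i = x' i) \<Longrightarrow> lp_dist d p x y = lp_dist d p x' y"
  by (simp add: lp_dist_def)

lemma small_probe: "small d p \<Delta> (eval_q (\<lambda>x. x \<in> G) (probe_q full n d r)) \<longleftrightarrow> good full n d p \<Delta> G r"
proof -
  have "lp_dist d p (box_size (\<lambda>i \<sigma>. if i < d then extent n G r i \<sigma> else z)) (\<lambda>_. 0) =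
    lp_dist d p (box_size (extent n G r)) (\<lambda>_. 0)" for z
    by (rule lp_dist_cong) (simp add: box_size_def)
  then show ?thesis by (simp add: small_def good_def eval_probe_q probe_ok_def)
qed

lemma good_diameter:
  assumes K: "K \<in> CV d \<delta>" and d: "1 \<le> d" and \<delta>: "0 < \<delta>" and p: "1 \<le> p" and w: "bisect_width n \<le> \<delta>\<^sup>2 / (24 * d)"
    and i: "i < num_cells K" and good: "good full n d p \<Delta> (cell K i) (rep K i)" and xy: "x \<in> cell K i" "y \<in> cell K i"
  shows "lp_dist d p x y \<le> 2 * \<Delta>"
proof -
  obtain S where "convex_cell d \<delta> (cell K i) S (rep K i)" using CV_convex_cell[OF K d \<delta> i] by blast
  then interpret convex_cell d \<delta> "cell K i" S "rep K i" .
  have \<delta>1: "\<delta> \<le> 1" using CV_empty[OF K d \<delta>] by simp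
  have d0: "0 < d" using d by simp
  have ok: "probe_ok full n d (cell K i) (rep K i)" using good by (simp add: good_def)
  have "lp_dist d p x y \<le> 2 * lp_dist d p (box_size (extent n (cell K i) (rep K i))) (\<lambda>_. 0)"
    using probe_extent[OF ok slack_le(1)[OF w d0 \<delta>1] \<delta>1 xy(2)]
    by (intro probe_diameter[OF ok w \<delta>1 p xy(1)]) auto
  then show ?thesis using good by (simp add: good_def)
qed

text \<open>On boxes every probe passes and the recorded corners lie in the cell, so a cell that is
  not good really has diameter above \<Delta>; the diameter condition bounds the mass of such
  cells.\<close>

lemma bad_mass_le:
  assumes KB: "K \<in> Boxes d \<delta>" and d: "1 \<le> d" and \<delta>: "0 < \<delta>" and p: "1 \<le> p" and w: "bisect_width n \<le> \<delta>\<^sup>2 / (24 * d)"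
    and mu: "input_distribution d \<mu>" and diam: "diameter_condition d p \<epsilon> \<Delta> K \<mu>"
  shows "measure_pmf.prob (label_pmf K \<mu>) {r. \<not> good full n d p \<Delta> (cell_of d K r) r} \<le> guard_const * \<epsilon>"
proof -
  have CV: "K \<in> CV d \<delta>" using KB by (simp add: Boxes_def)
  have Kc: "is_clustering d K" using CV by (simp add: CV_def)
  interpret clustered_source d K \<mu> by (rule CV_clustered_source[OF CV mu])
  have \<delta>1: "\<delta> \<le> 1" using CV_empty[OF CV d \<delta>] by simp
  have d0: "0 < d" using d by simp
  have small: "lp_diam d p (cell K i) > \<Delta>" if i: "i < num_cells K" and bad: "\<not> good full n d p \<Delta> (cell K i) (rep K i)" for i
  proof -
    obtain S where "convex_cell d \<delta> (cell K i) S (rep K i)" using CV_convex_cell[OF CV d \<delta> i] by blast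
    then interpret convex_cell d \<delta> "cell K i" S "rep K i" .
    have box: "axis_aligned_box d (cell K i)" using KB i by (simp add: Boxes_def)
    note w4 = slack_le(1)[OF w d0 \<delta>1]
    show ?thesis using bad box_probe_ok[OF box w4] box_size_le_diam[OF box w4 p] by (auto simp: good_def)
  qed
  have eq: "{x \<in> space \<mu>. lp_diam d p (cell K (cell_index K x)) > \<Delta>} =
      (\<Union>i\<in>{i \<in> {..<num_cells K}. lp_diam d p (cell K i) > \<Delta>}. cell K i)" (is "?L = ?R")
  proof (intro equalityI subsetI)
    fix x assume x: "x \<in> ?L"
    then obtain i where i: "i < num_cells K" "x \<in> cell K i" using Kc by (auto simp: space is_clustering_def)
    then show "x \<in> ?R" using x is_clustering_cell_index[OF Kc i] by auto
  next
    fix x assume "x \<in> ?R"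
    then obtain i where i: "i < num_cells K" "x \<in> cell K i" "lp_diam d p (cell K i) > \<Delta>" by auto
    moreover have "x \<in> space \<mu>" using i Kc by (auto simp: space is_clustering_def)
    ultimately show "x \<in> ?L" using is_clustering_cell_index[OF Kc i(1,2)] by auto
  qed
  have "measure_pmf.prob (label_pmf K \<mu>) {r. \<not> good full n d p \<Delta> (cell_of d K r) r} \<le>
      (\<Sum>i<num_cells K. if lp_diam d p (cell K i) > \<Delta> then measure \<mu> (cell K i) else 0)"
    unfolding prob_label_pmf using small cell_of_rep[OF Kc] by (intro sum_mono) auto
  also have "\<dots> = (\<Sum>i\<in>{i \<in> {..<num_cells K}. lp_diam d p (cell K i) > \<Delta>}. measure \<mu> (cell K i))"
    by (rule sum.inter_filter[symmetric]) simp
  also have "\<dots> = measure \<mu> {x \<in> space \<mu>. lp_diam d p (cell K (cell_index K x)) > \<Delta>}"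
    unfolding eq using cells Kc
    by (intro finite_measure_finite_Union[symmetric]) (auto simp: is_clustering_def disjoint_family_on_def)
  also have "\<dots> \<le> guard_const * \<epsilon>" using diam by (simp add: diameter_condition_def)
  finally show ?thesis .
qed

definition level_bin :: "nat \<Rightarrow> nat \<Rightarrow> nat \<Rightarrow> point \<Rightarrow> nat \<Rightarrow> nat" where
  "level_bin d L l x = anc d L l (bin d L x)"

lemma (in clustered_source) fiber_sum_label:
  "fiber_sum A \<phi> (\<lambda>c. \<Sum>i<num_cells K. measure \<mu> (cell K i) * v (rep K i) c) b =
     E_pmf (label_pmf K \<mu>) (\<lambda>r. fiber_sum A \<phi> (v r) b)"
  unfolding expectation_label_pmf fiber_sum_def
  by (subst sum.swap) (simp add: sum_distrib_left)

lemma fiber_sum_point: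
  assumes "finite A" "c0 \<in> A"
  shows "fiber_sum A \<phi> (\<lambda>c. of_bool (c0 = c)) b = of_bool (\<phi> c0 = b)"
proof -
  have "fiber_sum A \<phi> (\<lambda>c. of_bool (c0 = c)) b = (\<Sum>c | c \<in> A \<and> \<phi> c = b. if c0 = c then 1 else 0)"
    unfolding fiber_sum_def by (intro sum.cong) auto
  also have "\<dots> = of_bool (\<phi> c0 = b)" using assms by (subst sum.delta') auto
  finally show ?thesis .
qed

text \<open>Bad cells are charged 1, the diameter of the whole cube.\<close>

lemma sum_guarded_cost:
  assumes "clustered_source d K \<mu>" and c: "0 \<le> c"
    and bad: "measure_pmf.prob (label_pmf K \<mu>) {r. \<not> R r} \<le> \<beta>"
  shows "(\<Sum>i<num_cells K. measure \<mu> (cell K i) * (if R (rep K i) then c else 1)) \<le> c + \<beta>"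
proof -
  interpret clustered_source d K \<mu> by fact
  have "(\<Sum>i<num_cells K. measure \<mu> (cell K i) * (if R (rep K i) then c else 1)) \<le>
    (\<Sum>i<num_cells K. c * measure \<mu> (cell K i) + measure \<mu> (cell K i) * of_bool (\<not> R (rep K i)))"
    using c by (intro sum_mono) auto
  also have "\<dots> = c + measure_pmf.prob (label_pmf K \<mu>) {r. \<not> R r}"
    by (simp add: sum.distrib sum_cells_1 prob_label_pmf flip: sum_distrib_left)
  finally show ?thesis using bad by simp
qed

text \<open>The instance of \<open>EMD_le_tree\<close> in which each cell sends its whole mass to
  the leaf of its representative. Reaching the representative costs at most the certified diameter 2
  \<Delta>, or 1 in a bad cell.\<close>

lemma EMD_le_labels:
  assumes K: "K \<in> CV d \<delta>" and d: "1 \<le> d" and \<delta>: "0 < \<delta>" and p: "1 \<le> p" and w: "bisect_width n \<le> \<delta>\<^sup>2 / (24 * d)"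
    and mu: "input_distribution d \<mu>" and nu: "input_distribution d \<nu>" and \<Delta>: "0 \<le> \<Delta>"
    and bad: "measure_pmf.prob (label_pmf K \<mu>) {r. \<not> good full n d p \<Delta> (cell_of d K r) r} \<le> \<beta>"
      "measure_pmf.prob (label_pmf K \<nu>) {r. \<not> good full n d p \<Delta> (cell_of d K r) r} \<le> \<beta>"
  shows "EMD d p \<mu> \<nu> \<le> 2 * (2 * \<Delta> + \<beta>) + (1 / 2) ^ L + (\<Sum>l=1..L. (1 / 2) ^ l * (\<Sum>b\<in>bins d l.
    \<bar>measure_pmf.prob (label_pmf K \<mu>) {r. level_bin d L l r = b} - measure_pmf.prob (label_pmf K \<nu>) {r. level_bin d L l r = b}\<bar>))"
proof -
  interpret mu: clustered_source d K \<mu> by (rule CV_clustered_source[OF K mu])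
  interpret nu: clustered_source d K \<nu> by (rule CV_clustered_source[OF K nu])
  have Kc: "is_clustering d K" using K by (simp add: CV_def)
  define R where "R r = good full n d p \<Delta> (cell_of d K r) r" for r
  define \<rho> where "\<rho> i = (if R (rep K i) then 2 * \<Delta> else 1)" for i
  define v :: "nat \<Rightarrow> (nat \<Rightarrow> nat) \<Rightarrow> real" where "v i c = of_bool (bin d L (rep K i) = c)" for i c
  have cellcube: "x \<in> cube d" if "i < num_cells K" "x \<in> cell K i" for i x
    using that Kc by (auto simp: is_clustering_def)
  have repcell: "rep K i \<in> cell K i" if "i < num_cells K" for i using that Kc by (simp add: is_clustering_def)
  have near: "lp_dist d p x (rep K i) \<le> \<rho> i" if i: "i < num_cells K" and x: "x \<in> cell K i" for i x
  proof (cases "R (rep K i)")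
    case True
    then show ?thesis using good_diameter[OF K d \<delta> p w i _ x repcell[OF i]]
      by (auto simp: R_def \<rho>_def cell_of_rep[OF Kc i])
  next
    case False
    then show ?thesis using lp_dist_cube_le_1[OF p d cellcube[OF i x] cellcube[OF i repcell[OF i]]] by (simp add: \<rho>_def)
  qed
  have sumv: "(\<Sum>c\<in>bins d L. v i c) = 1" for i
    using bin_in_bins[of d L "rep K i"] finite_bins[of d L] by (simp add: v_def of_bool_def sum.delta')
  have "EMD d p \<mu> \<nu> \<le> (\<Sum>i<num_cells K. measure \<mu> (cell K i) * \<rho> i) + (\<Sum>j<num_cells K. measure \<nu> (cell K j) * \<rho> j) + (1 / 2) ^ L +
    (\<Sum>l=1..L. (1 / 2) ^ l * (\<Sum>b\<in>anc d L l ` bins d L.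
      \<bar>fiber_sum (bins d L) (anc d L l) (\<lambda>c. \<Sum>i<num_cells K. measure \<mu> (cell K i) * v i c) b -
       fiber_sum (bins d L) (anc d L l) (\<lambda>c. \<Sum>j<num_cells K. measure \<nu> (cell K j) * v j c) b\<bar>))"
  proof (rule EMD_le_tree[where D = "bin_dist d L"])
    show "prob_space \<mu>" "prob_space \<nu>" using mu nu by (simp_all add: input_distribution_def)
    show "disjoint_family_on (cell K) {..<num_cells K}" "disjoint_family_on (cell K) {..<num_cells K}"
      using Kc by (simp_all add: is_clustering_def)
    show "(\<Union>i<num_cells K. cell K i) = space \<mu>" "(\<Union>i<num_cells K. cell K i) = space \<nu>"
      using Kc mu.space nu.space by (simp_all add: is_clustering_def)
    fix i j x y c c'
    assume ij: "i \<in> {..<num_cells K}" "j \<in> {..<num_cells K}" and xy: "x \<in> cell K i" "y \<in> cell K j"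
      and "0 < v i c" "0 < v j c'"
    then have c: "c = bin d L (rep K i)" "c' = bin d L (rep K j)" by (auto simp: v_def split: if_splits)
    have "lp_dist d p x y \<le> lp_dist d p x (rep K i) + (lp_dist d p (rep K i) (rep K j) + lp_dist d p (rep K j) y)"
      using lp_dist_triangle[OF p, of d x y "rep K i"] lp_dist_triangle[OF p, of d "rep K i" y "rep K j"] by simp
    moreover have "lp_dist d p (rep K i) (rep K j) \<le> bin_dist d L c c'"
      unfolding c using ij cellcube repcell by (intro lp_dist_le_bin_dist[OF p d]) auto
    moreover have "lp_dist d p x (rep K i) \<le> \<rho> i" "lp_dist d p (rep K j) y \<le> \<rho> j"
      using near ij xy by (auto simp: lp_dist_commute[of d p "rep K j"])
    ultimately show "lp_dist d p x y \<le> \<rho> i + \<rho> j + bin_dist d L c c'" by linarith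
  qed (use \<Delta> mu.cells nu.cells sumv in \<open>auto simp: finite_bins v_def \<rho>_def bin_dist_nonneg intro: anc_root anc_refines bin_dist_le\<close>)
  also have "(\<Sum>i<num_cells K. measure \<mu> (cell K i) * \<rho> i) \<le> 2 * \<Delta> + \<beta>"
    unfolding \<rho>_def using \<Delta> bad by (intro sum_guarded_cost[OF mu.clustered_source_axioms]) (auto simp: R_def)
  also have "(\<Sum>i<num_cells K. measure \<nu> (cell K i) * \<rho> i) \<le> 2 * \<Delta> + \<beta>"
    unfolding \<rho>_def using \<Delta> bad by (intro sum_guarded_cost[OF nu.clustered_source_axioms]) (auto simp: R_def)
  also have "(\<Sum>l=1..L. (1 / 2) ^ l * (\<Sum>b\<in>anc d L l ` bins d L.
      \<bar>fiber_sum (bins d L) (anc d L l) (\<lambda>c. \<Sum>i<num_cells K. measure \<mu> (cell K i) * v i c) b -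
       fiber_sum (bins d L) (anc d L l) (\<lambda>c. \<Sum>j<num_cells K. measure \<nu> (cell K j) * v j c) b\<bar>)) =
    (\<Sum>l=1..L. (1 / 2) ^ l * (\<Sum>b\<in>bins d l.
    \<bar>measure_pmf.prob (label_pmf K \<mu>) {r. level_bin d L l r = b} - measure_pmf.prob (label_pmf K \<nu>) {r. level_bin d L l r = b}\<bar>))"
    unfolding v_def mu.fiber_sum_label[of _ _ "\<lambda>r c. of_bool (bin d L r = c)"] nu.fiber_sum_label[of _ _ "\<lambda>r c. of_bool (bin d L r = c)"]
    by (intro sum.cong refl) (simp add: anc_image fiber_sum_point finite_bins bin_in_bins E_of_bool level_bin_def)
  finally show ?thesis by simp
qed

text \<open>The continuation after the guard uses fresh samples, so the two stages are independent
  and probabilities multiply.\<close>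

lemma prob_guarded:
  fixes A :: "'a pmf"
  shows "measure_pmf.prob (bind_pmf A (\<lambda>s. if ok s then B else return_pmf ClusterReject)) {v} =
    measure_pmf.prob A {s. ok s} * measure_pmf.prob B {v} + of_bool (v = ClusterReject) * measure_pmf.prob A {s. \<not> ok s}"
proof -
  have [simp]: "integrable (measure_pmf A) (indicator S :: 'a \<Rightarrow> real)" for S
    by (rule measure_pmf.integrable_const_bound[where B = 1]) (auto simp: indicator_def)
  have "measure_pmf.prob (bind_pmf A (\<lambda>s. if ok s then B else return_pmf ClusterReject)) {v} =
    E_pmf A (\<lambda>s. measure_pmf.prob B {v} * indicator {s. ok s} s + of_bool (v = ClusterReject) * indicator {s. \<not> ok s} s)"
    unfolding prob_bind_pmf by (intro Bochner_Integration.integral_cong) (auto simp: indicator_def)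
  also have "\<dots> = E_pmf A (\<lambda>s. measure_pmf.prob B {v} * indicator {s. ok s} s) +
      E_pmf A (\<lambda>s. of_bool (v = ClusterReject) * indicator {s. \<not> ok s} s)"
    by (intro Bochner_Integration.integral_add) auto
  finally show ?thesis by (simp add: mult.commute)
qed

lemma verdict_complement:
  fixes V :: "verdict pmf"
  shows "measure_pmf.prob V {Accept, ClusterReject} = 1 - measure_pmf.prob V {Reject}"
    and "measure_pmf.prob V {Reject, ClusterReject} = 1 - measure_pmf.prob V {Accept}"
proof -
  have "UNIV - {Reject} = {Accept, ClusterReject}" "UNIV - {Accept} = {Reject, ClusterReject}"
    using verdict.exhaust by auto
  then show "measure_pmf.prob V {Accept, ClusterReject} = 1 - measure_pmf.prob V {Reject}"
    "measure_pmf.prob V {Reject, ClusterReject} = 1 - measure_pmf.prob V {Accept}"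
    using measure_pmf.prob_compl[of "{Reject}" V] measure_pmf.prob_compl[of "{Accept}" V] by simp_all
qed

section \<open>The strategy for equivalence\<close>

definition draw_pair :: "(point \<times> point \<Rightarrow> bool strategy) \<Rightarrow> bool strategy" where
  "draw_pair k = Draw True (\<lambda>x. Draw False (\<lambda>y. k (x, y)))"

lemma verdict_draw_pair:
  "verdict_pmf K P (draw_pair k) = bind_pmf (pair_pmf (P True) (P False)) (\<lambda>z. verdict_pmf K P (k z))"
  by (simp add: draw_pair_def pair_pmf_def bind_assoc_pmf bind_return_pmf)

lemma uses_draw_pair:
  "(\<And>z. z \<in> cube d \<times> cube d \<Longrightarrow> uses_at_most d m q (k z)) \<Longrightarrow> uses_at_most d (2 + m) q (draw_pair k)"
  unfolding draw_pair_def by (simp add: numeral_2_eq_2) (intro uses_at_most.intros, auto)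

text \<open>The accuracy in total variation that level \<open>l\<close> needs for its share of the transport cost.\<close>

definition level_accuracy :: "real \<Rightarrow> nat \<Rightarrow> nat \<Rightarrow> real" where
  "level_accuracy \<epsilon> L l = 2 ^ l * \<epsilon> / (4 * L)"

lemma sum_level_accuracy: "1 \<le> L \<Longrightarrow> (\<Sum>l=1..L. (1 / 2) ^ l * level_accuracy \<epsilon> L l) = \<epsilon> / 4"
  by (simp add: level_accuracy_def power_one_over)

text \<open>The lower bound on \<kappa> when level \<open>l\<close> exceeds its accuracy: 2^(l d)
  bins, and at most twice as many pieces added by flattening, give the factor 3.\<close>

definition equiv_eta :: "nat \<Rightarrow> real \<Rightarrow> nat \<Rightarrow> nat \<Rightarrow> real" where
  "equiv_eta d \<epsilon> L l = (level_accuracy \<epsilon> L l)\<^sup>2 / (3 * 2 ^ (l * d))"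

text \<open>On levels with fewer bins than samples the rate is lowered, so that flattening adds at
  most twice the number of bins.\<close>

definition flat_rate :: "nat \<Rightarrow> nat \<Rightarrow> nat \<Rightarrow> real" where
  "flat_rate d m l = min 1 (2 ^ (l * d) / m)"

definition equiv_stat :: "nat \<Rightarrow> nat \<Rightarrow> nat \<Rightarrow> nat \<Rightarrow> (point \<times> point) list \<Rightarrow> (point \<times> point) list \<Rightarrow> (point \<times> point) list \<Rightarrow> real" where
  "equiv_stat d L m l fs zs zs' =
     ustat (flat_weight (level_bin d L l) (flat_rate d m l) fs) (bins d l) (pair_vec (level_bin d L l)) zs zs'"

text \<open>All levels reuse the same three samples; the union bound over the levels asks for no
  independence.\<close>

definition equiv_decision :: "nat \<Rightarrow> real \<Rightarrow> nat \<Rightarrow> nat \<Rightarrow> (point \<times> point) list \<Rightarrow> (point \<times> point) list \<Rightarrow> (point \<times> point) list \<Rightarrow> verdict" where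
  "equiv_decision d \<epsilon> L m fs zs zs' =
     (if \<exists>l\<in>{1..L}. (real m)\<^sup>2 * equiv_eta d \<epsilon> L l / 2 \<le> equiv_stat d L m l fs zs zs' then Reject else Accept)"

text \<open>Only the \<open>2 * k\<close> samples of the guard are probed. The statistic works on
  labels alone, so the number of queries does not depend on \<open>m\<close>.\<close>

definition equiv_tree :: "nat \<Rightarrow> real \<Rightarrow> real \<Rightarrow> nat \<Rightarrow> nat \<Rightarrow> nat \<Rightarrow> nat \<Rightarrow> bool strategy" where
  "equiv_tree d p \<epsilon> n L k m =
     draws draw_pair k (\<lambda>ss. probes d (probe_q False n d) (map fst ss @ map snd ss) (\<lambda>res.
       if list_all (small d p (\<epsilon> / 16)) res then
         draws draw_pair m (\<lambda>fs. draws draw_pair m (\<lambda>zs. draws draw_pair m (\<lambda>zs'.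
           Output (equiv_decision d \<epsilon> L m fs zs zs'))))
       else Output ClusterReject))"

lemma uses_equiv_tree:
  "uses_at_most d (k * 2 + m * 6) (2 * k * probe_cost False n d) (equiv_tree d p \<epsilon> n L k m)"
proof -
  note dr = uses_draws[of "cube d \<times> cube d" d 2 draw_pair, OF uses_draw_pair]
  have "uses_at_most d (m * 2 + (m * 2 + (m * 2 + 0))) 0 (draws draw_pair m (\<lambda>fs. draws draw_pair m (\<lambda>zs.
      draws draw_pair m (\<lambda>zs'. Output (equiv_decision d \<epsilon> L m fs zs zs')))))"
    by (intro dr) (auto intro: uses_at_most.intros)
  then have B: "uses_at_most d (m * 6) 0 (if list_all (small d p (\<epsilon> / 16)) res then
         draws draw_pair m (\<lambda>fs. draws draw_pair m (\<lambda>zs. draws draw_pair m (\<lambda>zs'.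
           Output (equiv_decision d \<epsilon> L m fs zs zs'))))
       else Output ClusterReject)" for res
    by (auto intro: uses_at_most.intros simp: mult.commute[of 6])
  show ?thesis unfolding equiv_tree_def
  proof (rule dr)
    fix ss :: "(point \<times> point) list" assume "length ss = k"
    then show "uses_at_most d (m * 6) (2 * k * probe_cost False n d) (probes d (probe_q False n d) (map fst ss @ map snd ss) (\<lambda>res.
       if list_all (small d p (\<epsilon> / 16)) res then
         draws draw_pair m (\<lambda>fs. draws draw_pair m (\<lambda>zs. draws draw_pair m (\<lambda>zs'.
           Output (equiv_decision d \<epsilon> L m fs zs zs'))))
       else Output ClusterReject))"
      using uses_probes[of "probe_q False n d" "probe_cost False n d" d "m * 6" 0 _ "map fst ss @ map snd ss", OF asks_probe_q B]
      by (simp add: mult_2 mult_2_right)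
  qed auto
qed

lemma verdict_equiv_tree:
  fixes \<mu> \<nu> :: "point measure"
  assumes K: "is_clustering d K" and P: "set_pmf (P True) \<subseteq> rep K ` {..<num_cells K}" "set_pmf (P False) \<subseteq> rep K ` {..<num_cells K}"
  defines "Z \<equiv> pair_pmf (P True) (P False)"
  shows "verdict_pmf K P (equiv_tree d p \<epsilon> n L k m) =
    bind_pmf (replicate_pmf k Z) (\<lambda>ss. if \<forall>z\<in>set ss. good False n d p (\<epsilon> / 16) (cell_of d K (fst z)) (fst z) \<and>
        good False n d p (\<epsilon> / 16) (cell_of d K (snd z)) (snd z)
      then map_pmf (\<lambda>(fs, zs, zs'). equiv_decision d \<epsilon> L m fs zs zs')
        (pair_pmf (replicate_pmf m Z) (pair_pmf (replicate_pmf m Z) (replicate_pmf m Z)))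
      else return_pmf ClusterReject)"
proof -
  note vd = verdict_draws[of K P draw_pair Z, OF verdict_draw_pair[of K P, folded Z_def]]
  show ?thesis unfolding equiv_tree_def vd
  proof (rule bind_pmf_cong[OF refl])
    fix ss assume "ss \<in> set_pmf (replicate_pmf k Z)"
    then have "set (map fst ss @ map snd ss) \<subseteq> rep K ` {..<num_cells K}"
      using P by (force simp: set_replicate_pmf Z_def)
    note probes = verdict_probes_labels[OF K this]
    have check: "list_all (small d p (\<epsilon> / 16)) (map (\<lambda>r. eval_q (\<lambda>x. x \<in> cell_of d K r) (probe_q False n d r)) (map fst ss @ map snd ss))
      \<longleftrightarrow> (\<forall>z\<in>set ss. good False n d p (\<epsilon> / 16) (cell_of d K (fst z)) (fst z) \<and>
        good False n d p (\<epsilon> / 16) (cell_of d K (snd z)) (snd z))"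
      unfolding list.pred_map comp_def small_probe by (auto simp: list_all_iff)
    show "verdict_pmf K P (probes d (probe_q False n d) (map fst ss @ map snd ss) (\<lambda>res.
       if list_all (small d p (\<epsilon> / 16)) res then
         draws draw_pair m (\<lambda>fs. draws draw_pair m (\<lambda>zs. draws draw_pair m (\<lambda>zs'.
           Output (equiv_decision d \<epsilon> L m fs zs zs'))))
       else Output ClusterReject)) =
      (if \<forall>z\<in>set ss. good False n d p (\<epsilon> / 16) (cell_of d K (fst z)) (fst z) \<and>
        good False n d p (\<epsilon> / 16) (cell_of d K (snd z)) (snd z)
      then map_pmf (\<lambda>(fs, zs, zs'). equiv_decision d \<epsilon> L m fs zs zs')
        (pair_pmf (replicate_pmf m Z) (pair_pmf (replicate_pmf m Z) (replicate_pmf m Z)))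
      else return_pmf ClusterReject)"
      unfolding probes check
      by (simp add: vd pair_pmf_def map_pmf_def bind_assoc_pmf bind_return_pmf)
  qed
qed

theorem equiv_tree_tester:
  assumes d: "1 \<le> d" and p: "1 \<le> p" and \<epsilon>: "0 < \<epsilon>" "\<epsilon> < 1" and \<delta>: "0 < \<delta>"
    and w: "bisect_width n \<le> \<delta>\<^sup>2 / (24 * d)" and k: "40 / \<epsilon> \<le> k" "k \<le> 41 / \<epsilon>"
    and L: "1 \<le> L" "8 / \<epsilon> \<le> 2 ^ L" and m: "0 < m"
    and cond: "\<And>l. 1 \<le> l \<Longrightarrow> l \<le> L \<Longrightarrow> 10 ^ 7 * (real L)\<^sup>2 \<le> flat_rate d m l * real m ^ 3 * (equiv_eta d \<epsilon> L l)\<^sup>2"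
  shows "equivalence_tester d p \<epsilon> (CV d \<delta>) (Boxes d \<delta>) (\<epsilon> / 16) (\<lambda>_. equiv_tree d p \<epsilon> n L k m)"
  unfolding equivalence_tester_def Let_def
proof (intro ballI allI impI)
  fix K \<mu> \<nu>
  assume K: "K \<in> CV d \<delta>" and mu: "input_distribution d \<mu>" and nu: "input_distribution d \<nu>"
  have w': "bisect_width n \<le> \<delta>\<^sup>2 / real (24 * d)" using w by simp
  define src where "src = (\<lambda>s. if s then \<mu> else \<nu>)"
  interpret mu: clustered_source d K \<mu> by (rule CV_clustered_source[OF K mu])
  interpret nu: clustered_source d K \<nu> by (rule CV_clustered_source[OF K nu])
  have cs: "clustered_source d K (src s)" for s
    using mu.clustered_source_axioms nu.clustered_source_axioms by (simp add: src_def)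
  have Kc: "is_clustering d K" using K by (simp add: CV_def)
  let ?T = "\<lambda>_. equiv_tree d p \<epsilon> n L k m"
  define Z where "Z = pair_pmf (label_pmf K \<mu>) (label_pmf K \<nu>)"
  define R where "R r = good False n d p (\<epsilon> / 16) (cell_of d K r) r" for r
  define ok where "ok ss = (\<forall>z\<in>set ss. R (fst z) \<and> R (snd z))" for ss
  define J where "J = pair_pmf (replicate_pmf m Z) (pair_pmf (replicate_pmf m Z) (replicate_pmf m Z))"
  define B where "B = map_pmf (\<lambda>(fs, zs, zs'). equiv_decision d \<epsilon> L m fs zs zs') J"
  define V where "V = bind_pmf (replicate_pmf k Z) (\<lambda>ss. if ok ss then B else return_pmf ClusterReject)"
  have fZ: "finite (set_pmf Z)" using mu.finite_label_pmf nu.finite_label_pmf by (simp add: Z_def)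
  have V: "verdict_pmf K (\<lambda>s. label_pmf K (src s)) (equiv_tree d p \<epsilon> n L k m) = V"
  proof -
    have src: "src True = \<mu>" "src False = \<nu>" by (simp_all add: src_def)
    have "set_pmf (label_pmf K (src True)) \<subseteq> rep K ` {..<num_cells K}" "set_pmf (label_pmf K (src False)) \<subseteq> rep K ` {..<num_cells K}"
      unfolding src by (rule mu.set_label_pmf nu.set_label_pmf)+
    from verdict_equiv_tree[of d K "\<lambda>s. label_pmf K (src s)", OF Kc this] show ?thesis
      by (simp only: V_def B_def J_def Z_def ok_def R_def src)
  qed
  have out: "outcome_prob ?T K src W = measure_pmf.prob V W" for W
    using outcome_deterministic(2)[of d K src, OF cs] by (simp add: V)
  have meas: "outcome ?T K \<in> run_space src \<rightarrow>\<^sub>M count_space UNIV"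
    by (rule outcome_deterministic(1)[of d K src, OF cs])
  have VP: "measure_pmf.prob V {v} = measure_pmf.prob (replicate_pmf k Z) {s. ok s} * measure_pmf.prob B {v} +
      of_bool (v = ClusterReject) * measure_pmf.prob (replicate_pmf k Z) {s. \<not> ok s}" for v
    unfolding V_def by (rule prob_guarded)
  have B_CR: "measure_pmf.prob B {ClusterReject} = 0"
  proof -
    have "(\<lambda>(fs, zs, zs'). equiv_decision d \<epsilon> L m fs zs zs') -` {ClusterReject} = {}"
      by (auto simp: equiv_decision_def split: if_splits)
    then show ?thesis by (simp add: B_def)
  qed
  have fst_Z: "measure_pmf.prob Z {z. \<not> R (fst z)} = measure_pmf.prob (label_pmf K \<mu>) {r. \<not> R r}"
  proof -
    have "measure_pmf.prob (map_pmf fst Z) {r. \<not> R r} = measure_pmf.prob (label_pmf K \<mu>) {r. \<not> R r}"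
      by (simp add: Z_def map_fst_pair_pmf)
    then show ?thesis by (simp add: vimage_def)
  qed
  have snd_Z: "measure_pmf.prob Z {z. \<not> R (snd z)} = measure_pmf.prob (label_pmf K \<nu>) {r. \<not> R r}"
  proof -
    have "measure_pmf.prob (map_pmf snd Z) {r. \<not> R r} = measure_pmf.prob (label_pmf K \<nu>) {r. \<not> R r}"
      by (simp add: Z_def map_snd_pair_pmf)
    then show ?thesis by (simp add: vimage_def)
  qed
  have pairs: "pair_samples (label_pmf K \<mu>) (label_pmf K \<nu>) (level_bin d L l) (bins d l)" if "l \<le> L" for l
    using that by unfold_locales (auto simp: mu.finite_label_pmf nu.finite_label_pmf finite_bins level_bin_def intro: anc_in_bins bin_in_bins)
  have rate: "0 < flat_rate d m l" "flat_rate d m l \<le> 1" "flat_rate d m l * m \<le> 2 ^ (l * d)" for l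
  proof -
    show "0 < flat_rate d m l" "flat_rate d m l \<le> 1" using m by (auto simp: flat_rate_def)
    have "flat_rate d m l * m \<le> (2 ^ (l * d) / m) * m" by (intro mult_right_mono) (auto simp: flat_rate_def)
    then show "flat_rate d m l * m \<le> 2 ^ (l * d)" using m by simp
  qed
  have acc: "0 < level_accuracy \<epsilon> L l" "0 < equiv_eta d \<epsilon> L l" for l
    using \<epsilon> L by (auto simp: level_accuracy_def equiv_eta_def)
  have L1: "1 \<le> real L" using L by simp
  have "measure_pmf.prob V {ClusterReject} \<le> 1 / 6"
    if "K \<in> Boxes d \<delta>" "diameter_condition d p \<epsilon> (\<epsilon> / 16) K \<mu>" "diameter_condition d p \<epsilon> (\<epsilon> / 16) K \<nu>"
  proof -
    have "measure_pmf.prob V {ClusterReject} = measure_pmf.prob (replicate_pmf k Z) {s. \<not> ok s}"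
      by (simp add: VP B_CR)
    also have "{s. \<not> ok s} = {s. \<exists>z\<in>set s. z \<in> {z. \<not> R (fst z)} \<union> {z. \<not> R (snd z)}}" by (auto simp: ok_def)
    also have "measure_pmf.prob (replicate_pmf k Z) \<dots> \<le> k * measure_pmf.prob Z ({z. \<not> R (fst z)} \<union> {z. \<not> R (snd z)})"
      by (rule prob_replicate_ex)
    also have "measure_pmf.prob Z ({z. \<not> R (fst z)} \<union> {z. \<not> R (snd z)}) \<le> guard_const * \<epsilon> + guard_const * \<epsilon>"
      using measure_Un_le[of "{z. \<not> R (fst z)}" Z "{z. \<not> R (snd z)}"]
        bad_mass_le[OF that(1) d \<delta> p w' mu that(2), of False] bad_mass_le[OF that(1) d \<delta> p w' nu that(3), of False]
        fst_Z snd_Z by (simp add: R_def)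
    \<comment> \<open>Two distributions and at most 41/\<epsilon> pairs: 82/1152 is well below
      1/6.\<close>
    also have "k * (guard_const * \<epsilon> + guard_const * \<epsilon>) \<le> 41 / \<epsilon> * (1 / 1152 * \<epsilon> + 1 / 1152 * \<epsilon>)"
      using k guard_const_le \<epsilon> by (intro mult_mono add_mono) auto
    also have "\<dots> \<le> 1 / 6" using \<epsilon> by simp
    finally show ?thesis by (simp add: mult_left_mono)
  qed
  moreover have "measure_pmf.prob V {Accept, ClusterReject} \<ge> 5 / 6" if eq: "\<mu> = \<nu>"
  proof -
    \<comment> \<open>A failing guard never outputs REJECT, so no control of the cells is required
      here: the two label distributions coincide, and the statistic sees nothing else.\<close>
    have "measure_pmf.prob V {Reject} \<le> measure_pmf.prob B {Reject}"
      by (simp add: VP mult_left_le_one_le)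
    also have "\<dots> \<le> measure_pmf.prob J (\<Union>l\<in>{1..L}. {(fs, z). (real m)\<^sup>2 * equiv_eta d \<epsilon> L l / 2 \<le> (case z of (zs, zs') \<Rightarrow> equiv_stat d L m l fs zs zs')})"
      unfolding B_def measure_map_pmf
      by (intro measure_pmf.finite_measure_mono) (auto simp: equiv_decision_def split: if_splits)
    also have "\<dots> \<le> (\<Sum>l\<in>{1..L}. measure_pmf.prob J {(fs, z). (real m)\<^sup>2 * equiv_eta d \<epsilon> L l / 2 \<le> (case z of (zs, zs') \<Rightarrow> equiv_stat d L m l fs zs zs')})"
      by (intro measure_UNION_le) auto
    also have "\<dots> \<le> (\<Sum>l\<in>{1..L}. 1 / (6 * real L))"
    proof (rule sum_mono)
      fix l assume l: "l \<in> {1..L}"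
      show "measure_pmf.prob J {(fs, z). (real m)\<^sup>2 * equiv_eta d \<epsilon> L l / 2 \<le> (case z of (zs, zs') \<Rightarrow> equiv_stat d L m l fs zs zs')} \<le> 1 / (6 * real L)"
        unfolding J_def Z_def equiv_stat_def
        using l eq by (intro pair_samples.closeness_null[OF pairs] rate m L1 acc cond) auto
    qed
    also have "\<dots> = 1 / 6" using L by simp
    finally show ?thesis by (simp add: verdict_complement)
  qed
  moreover have "measure_pmf.prob V {Reject, ClusterReject} \<ge> 5 / 6" if far: "EMD d p \<mu> \<nu> > \<epsilon>"
  proof -
    have "measure_pmf.prob V {Accept} \<le> 1 / 6"
    \<comment> \<open>Either bad cells carry enough mass for the guard to notice, or they are rare
      and the large EMD must show at some level.\<close>
    proof (cases "\<epsilon> / 20 < measure_pmf.prob (label_pmf K \<mu>) {r. \<not> R r} \<or> \<epsilon> / 20 < measure_pmf.prob (label_pmf K \<nu>) {r. \<not> R r}")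
      case True
      have detect: "measure_pmf.prob (replicate_pmf k Z) {s. ok s} \<le> 1 / 6"
        if E: "\<epsilon> / 20 < measure_pmf.prob Z E" "\<And>z. z \<in> E \<Longrightarrow> \<not> (R (fst z) \<and> R (snd z))" for E
      proof -
        have "measure_pmf.prob (replicate_pmf k Z) {s. ok s} \<le> measure_pmf.prob (replicate_pmf k Z) {s. \<forall>z\<in>set s. z \<notin> E}"
          using E(2) by (intro measure_pmf.finite_measure_mono) (auto simp: ok_def)
        also have "\<dots> \<le> exp (- (\<epsilon> / 20) * k)" using E(1) by (intro prob_replicate_none) simp
        \<comment> \<open>At least 40/\<epsilon> probes against mass \<epsilon>/20 give the exponent
          2.\<close>
        also have "\<dots> \<le> exp (- 2)" using k(1) \<epsilon> by (simp add: field_simps)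
        also have "\<dots> \<le> 1 / 6" by (rule exp_minus_2_le)
        finally show ?thesis .
      qed
      from True have "measure_pmf.prob (replicate_pmf k Z) {s. ok s} \<le> 1 / 6"
        using detect[of "{z. \<not> R (fst z)}"] detect[of "{z. \<not> R (snd z)}"] by (auto simp: fst_Z snd_Z)
      then show ?thesis
        using mult_left_le[of "measure_pmf.prob B {Accept}" "measure_pmf.prob (replicate_pmf k Z) {s. ok s}"] by (simp add: VP)
    next
      case False
      let ?D = "\<lambda>l. \<Sum>b\<in>bins d l. \<bar>measure_pmf.prob (label_pmf K \<mu>) {r. level_bin d L l r = b} - measure_pmf.prob (label_pmf K \<nu>) {r. level_bin d L l r = b}\<bar>"
      have "\<exists>l\<in>{1..L}. level_accuracy \<epsilon> L l < ?D l"
      proof (rule ccontr)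
        assume "\<not> ?thesis"
        then have le: "?D l \<le> level_accuracy \<epsilon> L l" if "l \<in> {1..L}" for l using that by force
        have "EMD d p \<mu> \<nu> \<le> 2 * (2 * (\<epsilon> / 16) + \<epsilon> / 20) + (1 / 2) ^ L + (\<Sum>l=1..L. (1 / 2) ^ l * ?D l)"
          using False \<epsilon> by (intro EMD_le_labels[OF K d \<delta> p w' mu nu, of _ False]) (auto simp: R_def)
        \<comment> \<open>The terms add up to 0.725 \<epsilon>.\<close>
        also have "\<dots> \<le> 2 * (2 * (\<epsilon> / 16) + \<epsilon> / 20) + \<epsilon> / 8 + (\<Sum>l=1..L. (1 / 2) ^ l * level_accuracy \<epsilon> L l)"
        proof (intro add_mono sum_mono mult_left_mono le)
          have "8 \<le> \<epsilon> * 2 ^ L" using L(2) \<epsilon> by (simp add: divide_le_eq mult.commute)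
          then show "(1 / 2) ^ L \<le> \<epsilon> / 8" by (simp add: power_one_over divide_simps)
        qed auto
        also have "\<dots> \<le> \<epsilon>" using \<epsilon> unfolding sum_level_accuracy[OF L(1)] by simp
        finally show False using far by simp
      qed
      then obtain l where l: "l \<in> {1..L}" "level_accuracy \<epsilon> L l < ?D l" by blast
      have lL: "l \<le> L" using l by simp
      have "measure_pmf.prob V {Accept} \<le> measure_pmf.prob B {Accept}"
        by (simp add: VP mult_left_le_one_le)
      also have "\<dots> \<le> measure_pmf.prob J {(fs, z). (case z of (zs, zs') \<Rightarrow> equiv_stat d L m l fs zs zs') < (real m)\<^sup>2 * equiv_eta d \<epsilon> L l / 2}"
        unfolding B_def measure_map_pmf using l(1)
        by (intro measure_pmf.finite_measure_mono) (auto simp: equiv_decision_def not_le split: if_splits)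
      also have "\<dots> \<le> 1 / 6" unfolding J_def Z_def equiv_stat_def
      proof (rule pair_samples.closeness_alternative[OF pairs[OF lL] rate(1,2) m L1 acc(2)])
        have "equiv_eta d \<epsilon> L l * (card (bins d l) + 2 * flat_rate d m l * m) \<le> equiv_eta d \<epsilon> L l * (3 * 2 ^ (l * d))"
          using rate(3)[of l] acc(2)[of l] by (intro mult_left_mono) (auto simp: card_bins)
        also have "\<dots> = (level_accuracy \<epsilon> L l)\<^sup>2" by (simp add: equiv_eta_def)
        also have "\<dots> \<le> (?D l)\<^sup>2" using l(2) acc(1)[of l] by (intro power_mono) auto
        finally show "equiv_eta d \<epsilon> L l * (card (bins d l) + 2 * flat_rate d m l * m) \<le> (\<Sum>c\<in>bins d l.
            \<bar>pair_samples.p (label_pmf K \<mu>) (level_bin d L l) c - pair_samples.q (label_pmf K \<nu>) (level_bin d L l) c\<bar>)\<^sup>2"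
          by (simp add: pair_samples.p_def[OF pairs[OF lL]] pair_samples.q_def[OF pairs[OF lL]])
        show "10 ^ 7 * (real L)\<^sup>2 \<le> flat_rate d m l * real m ^ 3 * (equiv_eta d \<epsilon> L l)\<^sup>2" using cond l by simp
      qed
      finally show ?thesis .
    qed
    then show ?thesis by (simp add: verdict_complement)
  qed
  ultimately show "outcome ?T K \<in> run_space (\<lambda>s. if s then \<mu> else \<nu>) \<rightarrow>\<^sub>M count_space UNIV \<and>
    (K \<in> Boxes d \<delta> \<and> diameter_condition d p \<epsilon> (\<epsilon> / 16) K \<mu> \<and> diameter_condition d p \<epsilon> (\<epsilon> / 16) K \<nu> \<longrightarrow>
      outcome_prob ?T K (\<lambda>s. if s then \<mu> else \<nu>) {ClusterReject} \<le> 1 / 6) \<and>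
    (\<mu> = \<nu> \<longrightarrow> 5 / 6 \<le> outcome_prob ?T K (\<lambda>s. if s then \<mu> else \<nu>) {Accept, ClusterReject}) \<and>
    (\<epsilon> < EMD d p \<mu> \<nu> \<longrightarrow> 5 / 6 \<le> outcome_prob ?T K (\<lambda>s. if s then \<mu> else \<nu>) {Reject, ClusterReject})"
    unfolding src_def[symmetric] out using meas by blast
qed

section \<open>The uniformity tester\<close>

definition draw_one :: "(point \<Rightarrow> unit strategy) \<Rightarrow> unit strategy" where
  "draw_one k = Draw () k"

lemma verdict_draw_one: "verdict_pmf K P (draw_one k) = bind_pmf (P ()) (\<lambda>z. verdict_pmf K P (k z))"
  by (simp add: draw_one_def)

lemma uses_draw_one:
  "(\<And>z. z \<in> cube d \<Longrightarrow> uses_at_most d m q (k z)) \<Longrightarrow> uses_at_most d (1 + m) q (draw_one k)"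
  unfolding draw_one_def by (simp add: uses_at_most.intros)

definition unif_eta :: "nat \<Rightarrow> real \<Rightarrow> nat \<Rightarrow> nat \<Rightarrow> real" where
  "unif_eta d \<epsilon> L l = (level_accuracy \<epsilon> L l)\<^sup>2 / 2 ^ (l * d)"

definition level_spread :: "nat \<Rightarrow> nat \<Rightarrow> nat \<Rightarrow> point set \<Rightarrow> (nat \<Rightarrow> nat) \<Rightarrow> real" where
  "level_spread d L l B = fiber_sum (bins d L) (anc d L l) (spread d L B)"

text \<open>What the algorithm can compute from a sample and its probe: the spread of the probed box
  on level \<open>l\<close>, centred at the uniform distribution.\<close>

definition box_vec :: "nat \<Rightarrow> nat \<Rightarrow> nat \<Rightarrow> nat \<Rightarrow> point \<times> (nat \<Rightarrow> bool \<Rightarrow> real) option \<Rightarrow> (nat \<Rightarrow> nat) \<Rightarrow> real" where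
  "box_vec d n L l z b = level_spread d L l (inner_box d (1 - bisect_width n) (fst z) (the (snd z))) b - 1 / 2 ^ (l * d)"

definition unif_decision :: "nat \<Rightarrow> real \<Rightarrow> nat \<Rightarrow> nat \<Rightarrow> nat \<Rightarrow> (point \<times> (nat \<Rightarrow> bool \<Rightarrow> real) option) list \<Rightarrow>
    (point \<times> (nat \<Rightarrow> bool \<Rightarrow> real) option) list \<Rightarrow> verdict" where
  "unif_decision d \<epsilon> n L m zs zs' =
     (if list_all (\<lambda>z. snd z \<noteq> None) (zs @ zs') then
       if \<exists>l\<in>{1..L}. (real m)\<^sup>2 * unif_eta d \<epsilon> L l / 2 \<le> ustat (\<lambda>_. 1) (bins d l) (box_vec d n L l) zs zs'
       then Reject else Accept
      else ClusterReject)"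

text \<open>Unlike for equivalence, every sample is probed, since its box is needed for spreading;
  this is why the query bound has the size of the sample bound.\<close>

definition unif_tree :: "nat \<Rightarrow> real \<Rightarrow> real \<Rightarrow> nat \<Rightarrow> nat \<Rightarrow> nat \<Rightarrow> nat \<Rightarrow> unit strategy" where
  "unif_tree d p \<epsilon> n L k m =
     draws draw_one k (\<lambda>ss. probes d (probe_q True n d) ss (\<lambda>res.
       if list_all (small d p (\<epsilon> / 16)) res then
         draws draw_one m (\<lambda>zs. draws draw_one m (\<lambda>zs'.
           probes d (probe_q True n d) zs (\<lambda>as. probes d (probe_q True n d) zs' (\<lambda>as'.
             Output (unif_decision d \<epsilon> n L m (zip zs as) (zip zs' as'))))))
       else Output ClusterReject))"

lemma uses_unif_tree:
  "uses_at_most d (k + 2 * m) ((k + 2 * m) * probe_cost True n d) (unif_tree d p \<epsilon> n L k m)"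
proof -
  let ?c = "probe_cost True n d"
  note dr = uses_draws[of "cube d" d 1 draw_one, OF uses_draw_one]
  note pr = uses_probes[of "probe_q True n d" ?c d, OF asks_probe_q]
  have inner: "uses_at_most d 0 (m * ?c + (m * ?c + 0)) (probes d (probe_q True n d) zs (\<lambda>as. probes d (probe_q True n d) zs' (\<lambda>as'.
             Output (unif_decision d \<epsilon> n L m (zip zs as) (zip zs' as')))))"
    if "length zs = m" "length zs' = m" for zs zs'
  proof -
    have "uses_at_most d 0 (length zs' * ?c + 0) (probes d (probe_q True n d) zs' (\<lambda>as'.
             Output (unif_decision d \<epsilon> n L m (zip zs as) (zip zs' as'))))" for as
      by (rule pr) (rule uses_at_most.intros)
    then have "uses_at_most d 0 (length zs * ?c + (length zs' * ?c + 0)) (probes d (probe_q True n d) zs (\<lambda>as. probes d (probe_q True n d) zs' (\<lambda>as'.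
             Output (unif_decision d \<epsilon> n L m (zip zs as) (zip zs' as')))))"
      by (rule pr)
    then show ?thesis using that by simp
  qed
  have "uses_at_most d (m * 1 + (m * 1 + 0)) (m * ?c + (m * ?c + 0)) (draws draw_one m (\<lambda>zs. draws draw_one m (\<lambda>zs'.
           probes d (probe_q True n d) zs (\<lambda>as. probes d (probe_q True n d) zs' (\<lambda>as'.
             Output (unif_decision d \<epsilon> n L m (zip zs as) (zip zs' as')))))))"
    by (rule dr, assumption, rule dr, assumption, rule inner)
  then have B: "uses_at_most d (2 * m) (2 * m * ?c) (if list_all (small d p (\<epsilon> / 16)) res then
         draws draw_one m (\<lambda>zs. draws draw_one m (\<lambda>zs'.
           probes d (probe_q True n d) zs (\<lambda>as. probes d (probe_q True n d) zs' (\<lambda>as'.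
             Output (unif_decision d \<epsilon> n L m (zip zs as) (zip zs' as'))))))
       else Output ClusterReject)" for res
    by (auto intro: uses_at_most.intros simp: mult_2 distrib_right)
  have "uses_at_most d (k * 1 + 2 * m) (k * ?c + 2 * m * ?c) (unif_tree d p \<epsilon> n L k m)"
    unfolding unif_tree_def
  proof (rule dr)
    fix ss :: "point list" assume "length ss = k"
    then show "uses_at_most d (2 * m) (k * ?c + 2 * m * ?c) (probes d (probe_q True n d) ss (\<lambda>res.
       if list_all (small d p (\<epsilon> / 16)) res then
         draws draw_one m (\<lambda>zs. draws draw_one m (\<lambda>zs'.
           probes d (probe_q True n d) zs (\<lambda>as. probes d (probe_q True n d) zs' (\<lambda>as'.
             Output (unif_decision d \<epsilon> n L m (zip zs as) (zip zs' as'))))))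
       else Output ClusterReject))"
      using pr[OF B, where rs = ss] by simp
  qed assumption
  then show ?thesis by (simp add: distrib_right)
qed

text \<open>The set in which the algorithm spreads a sample; it is the cell itself where the probe fails.\<close>

definition region :: "nat \<Rightarrow> nat \<Rightarrow> point set \<Rightarrow> point \<Rightarrow> point set" where
  "region d n G r = (if probe_ok True n d G r then inner_box d (1 - bisect_width n) r (extent n G r) else G)"

definition region_spread :: "nat \<Rightarrow> clustering \<Rightarrow> nat \<Rightarrow> nat \<Rightarrow> nat \<Rightarrow> point \<Rightarrow> (nat \<Rightarrow> nat) \<Rightarrow> real" where
  "region_spread d K n L l r = level_spread d L l (region d n (cell_of d K r) r)"

text \<open>The decision as a function of the labels alone. Where a probe fails,
  \<open>region\<close> supplies a harmless value that the algorithm could not compute; this lets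
  \<open>spread_samples\<close> apply to all labels, and such samples end in CLUSTER-REJECT
  anyway.\<close>

definition region_decision :: "nat \<Rightarrow> clustering \<Rightarrow> real \<Rightarrow> nat \<Rightarrow> nat \<Rightarrow> nat \<Rightarrow> point list \<Rightarrow> point list \<Rightarrow> verdict" where
  "region_decision d K \<epsilon> n L m zs zs' =
     (if \<forall>r\<in>set (zs @ zs'). probe_ok True n d (cell_of d K r) r then
       if \<exists>l\<in>{1..L}. (real m)\<^sup>2 * unif_eta d \<epsilon> L l / 2 \<le>
         ustat (\<lambda>_. 1) (bins d l) (spread_samples.dev (region_spread d K n L l) (bins d l)) zs zs'
       then Reject else Accept
      else ClusterReject)"

lemma vec_sum_map_cong:
  "(\<And>z. z \<in> set zs \<Longrightarrow> F (h z) c = f z c) \<Longrightarrow> vec_sum F (map h zs) c = vec_sum f zs c"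
  by (induction zs) (auto simp: vec_sum_def)

lemma unif_decision_region:
  fixes K :: clustering and d n :: nat
  defines "probe_res \<equiv> \<lambda>r. eval_q (\<lambda>x. x \<in> cell_of d K r) (probe_q True n d r)"
  assumes dev: "\<And>l z c. l \<le> L \<Longrightarrow> spread_samples.dev (region_spread d K n L l) (bins d l) z c = region_spread d K n L l z c - 1 / 2 ^ (l * d)"
  shows "unif_decision d \<epsilon> n L m (zip zs (map probe_res zs)) (zip zs' (map probe_res zs')) = region_decision d K \<epsilon> n L m zs zs'"
proof -
  have z: "zip zs (map probe_res zs) = map (\<lambda>r. (r, probe_res r)) zs" for zs
    by (induction zs) auto
  have None: "probe_res r \<noteq> None \<longleftrightarrow> probe_ok True n d (cell_of d K r) r" for r
    by (simp add: probe_res_def eval_probe_q probe_ok_def)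
  have vec: "box_vec d n L l (r, probe_res r) c = spread_samples.dev (region_spread d K n L l) (bins d l) r c"
    if "probe_ok True n d (cell_of d K r) r" and l: "l \<le> L" for r l c
  proof -
    have "inner_box d (1 - bisect_width n) r (the (probe_res r)) = region d n (cell_of d K r) r"
      using that by (auto simp: probe_res_def eval_probe_q probe_ok_def region_def inner_box_def intro!: PiE_cong)
    then show ?thesis by (simp add: box_vec_def dev[OF l] region_spread_def)
  qed
  have vs: "vec_sum (box_vec d n L l) (map (\<lambda>r. (r, probe_res r)) zs) c =
      vec_sum (spread_samples.dev (region_spread d K n L l) (bins d l)) zs c"
    if "\<forall>r\<in>set zs. probe_ok True n d (cell_of d K r) r" "l \<le> L" for zs l c
    using that vec by (intro vec_sum_map_cong) auto
  have stat: "ustat (\<lambda>_. 1) (bins d l) (box_vec d n L l) (map (\<lambda>r. (r, probe_res r)) zs) (map (\<lambda>r. (r, probe_res r)) zs') =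
    ustat (\<lambda>_. 1) (bins d l) (spread_samples.dev (region_spread d K n L l) (bins d l)) zs zs'"
    if "\<forall>r\<in>set (zs @ zs'). probe_ok True n d (cell_of d K r) r" "l \<in> {1..L}" for l
    using that vs by (simp add: ustat_def)
  have all: "list_all (\<lambda>z. snd z \<noteq> None) (map (\<lambda>r. (r, probe_res r)) zs @ map (\<lambda>r. (r, probe_res r)) zs') \<longleftrightarrow>
    (\<forall>r\<in>set (zs @ zs'). probe_ok True n d (cell_of d K r) r)"
    by (simp only: list_all_append list.pred_map comp_def snd_conv None) (auto simp: list_all_iff)
  show ?thesis unfolding unif_decision_def region_decision_def z all
    by (intro if_cong refl bex_cong) (simp add: stat)
qed

lemma verdict_unif_tree:
  assumes K: "is_clustering d K" and P: "set_pmf (P ()) \<subseteq> rep K ` {..<num_cells K}"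
    and dev: "\<And>l z c. l \<le> L \<Longrightarrow> spread_samples.dev (region_spread d K n L l) (bins d l) z c = region_spread d K n L l z c - 1 / 2 ^ (l * d)"
  shows "verdict_pmf K P (unif_tree d p \<epsilon> n L k m) =
    bind_pmf (replicate_pmf k (P ())) (\<lambda>ss. if \<forall>r\<in>set ss. good True n d p (\<epsilon> / 16) (cell_of d K r) r
      then map_pmf (\<lambda>(zs, zs'). region_decision d K \<epsilon> n L m zs zs')
        (pair_pmf (replicate_pmf m (P ())) (replicate_pmf m (P ())))
      else return_pmf ClusterReject)"
proof -
  note vd = verdict_draws[of K P draw_one "P ()", OF verdict_draw_one]
  have sub: "set ss \<subseteq> rep K ` {..<num_cells K}" if "ss \<in> set_pmf (replicate_pmf j (P ()))" for ss j
    using that P by (auto simp: set_replicate_pmf)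
  have second: "verdict_pmf K P (draws draw_one m (\<lambda>zs. draws draw_one m (\<lambda>zs'.
           probes d (probe_q True n d) zs (\<lambda>as. probes d (probe_q True n d) zs' (\<lambda>as'.
             Output (unif_decision d \<epsilon> n L m (zip zs as) (zip zs' as'))))))) =
    map_pmf (\<lambda>(zs, zs'). region_decision d K \<epsilon> n L m zs zs') (pair_pmf (replicate_pmf m (P ())) (replicate_pmf m (P ())))"
    unfolding vd pair_pmf_def map_bind_pmf map_return_pmf prod.case
    by (intro bind_pmf_cong refl) (simp add: verdict_probes_labels[OF K sub] unif_decision_region[OF dev])
  show ?thesis unfolding unif_tree_def vd[of k]
  proof (rule bind_pmf_cong[OF refl])
    fix ss assume "ss \<in> set_pmf (replicate_pmf k (P ()))"
    note probes = verdict_probes_labels[OF K sub[OF this]]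
    have check: "list_all (small d p (\<epsilon> / 16)) (map (\<lambda>r. eval_q (\<lambda>x. x \<in> cell_of d K r) (probe_q True n d r)) ss)
      \<longleftrightarrow> (\<forall>r\<in>set ss. good True n d p (\<epsilon> / 16) (cell_of d K r) r)"
      unfolding list.pred_map comp_def small_probe by (simp add: list_all_iff)
    show "verdict_pmf K P (probes d (probe_q True n d) ss (\<lambda>res.
       if list_all (small d p (\<epsilon> / 16)) res then
         draws draw_one m (\<lambda>zs. draws draw_one m (\<lambda>zs'.
           probes d (probe_q True n d) zs (\<lambda>as. probes d (probe_q True n d) zs' (\<lambda>as'.
             Output (unif_decision d \<epsilon> n L m (zip zs as) (zip zs' as'))))))
       else Output ClusterReject)) =
      (if \<forall>r\<in>set ss. good True n d p (\<epsilon> / 16) (cell_of d K r) r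
      then map_pmf (\<lambda>(zs, zs'). region_decision d K \<epsilon> n L m zs zs')
        (pair_pmf (replicate_pmf m (P ())) (replicate_pmf m (P ())))
      else return_pmf ClusterReject)"
      unfolding probes check using second by simp
  qed
qed

lemma fiber_sum_diff_le:
  assumes "finite A"
  shows "(\<Sum>b\<in>\<phi> ` A. \<bar>fiber_sum A \<phi> P b - fiber_sum A \<phi> Q b\<bar>) \<le> (\<Sum>c\<in>A. \<bar>P c - Q c\<bar>)"
proof -
  have "(\<Sum>b\<in>\<phi> ` A. \<bar>fiber_sum A \<phi> P b - fiber_sum A \<phi> Q b\<bar>) \<le> (\<Sum>b\<in>\<phi> ` A. fiber_sum A \<phi> (\<lambda>c. \<bar>P c - Q c\<bar>) b)"
    by (intro sum_mono) (simp add: fiber_sum_def sum_abs flip: sum_subtractf)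
  then show ?thesis by (simp add: sum_fiber_sum[OF assms])
qed

lemma sum_level_spread:
  assumes "B \<in> sets (uniform_cube d)" "l \<le> L"
  shows "(\<Sum>b\<in>bins d l. level_spread d L l B b) = 1"
  using sum_fiber_sum[OF finite_bins[of d L], where \<phi> = "anc d L l" and p = "spread d L B"] sum_spread[OF assms(1), of L]
  by (simp add: level_spread_def anc_image[OF assms(2)])

text \<open>A cell whose probe fails is its own region and is spread without error. For the others,
  \<open>spread_error\<close> applies with the volume bound of
  \<open>inner_box_measure\<close>.\<close>

lemma region_properties:
  assumes K: "K \<in> CV d \<delta>" and d: "1 \<le> d" and \<delta>: "0 < \<delta>" and w: "bisect_width n \<le> \<delta>\<^sup>2 / real (24 * d)" and i: "i < num_cells K"
  defines "B \<equiv> region d n (cell K i) (rep K i)"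
  shows "B \<in> sets (uniform_cube d)" "B \<subseteq> cell K i"
    and "probe_ok True n d (cell K i) (rep K i) \<Longrightarrow> 0 < measure (uniform_cube d) B"
    and "(\<Sum>c\<in>bins d L. \<bar>measure (uniform_cube d) (cell K i) * spread d L B c - measure (uniform_cube d) (cell K i \<inter> bin_cell d L c)\<bar>)
      \<le> 2 * (18 * bisect_width n * (real d)\<^sup>2 / \<delta>\<^sup>2) * measure (uniform_cube d) (cell K i)"
proof -
  interpret U: clustered_source d K "uniform_cube d" by (rule clustered_source_uniform[OF K])
  obtain S where "convex_cell d \<delta> (cell K i) S (rep K i)" using CV_convex_cell[OF K d \<delta> i] by blast
  then interpret convex_cell d \<delta> "cell K i" S "rep K i" .
  have \<delta>1: "\<delta> \<le> 1" using CV_empty[OF K d \<delta>] by simp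
  note G = U.cells[OF i]
  have w': "bisect_width n \<le> \<delta>\<^sup>2 / (24 * d)" using w by simp
  show B: "B \<in> sets (uniform_cube d)" "B \<subseteq> cell K i"
    using G inner_box_measure(1,2)[OF _ w' \<delta>1 G] by (auto simp: B_def region_def)
  show pos: "0 < measure (uniform_cube d) B" if "probe_ok True n d (cell K i) (rep K i)"
    using inner_box_measure(3)[OF that w' \<delta>1 G] that by (simp add: B_def region_def)
  show "(\<Sum>c\<in>bins d L. \<bar>measure (uniform_cube d) (cell K i) * spread d L B c - measure (uniform_cube d) (cell K i \<inter> bin_cell d L c)\<bar>)
      \<le> 2 * (18 * bisect_width n * (real d)\<^sup>2 / \<delta>\<^sup>2) * measure (uniform_cube d) (cell K i)"
  proof (cases "probe_ok True n d (cell K i) (rep K i)")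
    case True
    show ?thesis using inner_box_measure(4)[OF True w' \<delta>1 G] True
      by (intro spread_error[OF G B pos[OF True]]) (simp add: B_def region_def)
  next
    case False
    then have "(\<Sum>c\<in>bins d L. \<bar>measure (uniform_cube d) (cell K i) * spread d L B c - measure (uniform_cube d) (cell K i \<inter> bin_cell d L c)\<bar>) = 0"
      by (intro sum.neutral) (simp add: B_def region_def spread_self[OF G])
    then show ?thesis using bisect_width_pos[of n] by simp
  qed
qed

lemma spread_samples_region:
  assumes K: "K \<in> CV d \<delta>" and d: "1 \<le> d" and \<delta>: "0 < \<delta>" and w: "bisect_width n \<le> \<delta>\<^sup>2 / real (24 * d)"
    and mu: "input_distribution d \<mu>" and l: "l \<le> L"
  shows "spread_samples (label_pmf K \<mu>) (region_spread d K n L l) (bins d l)"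
proof
  interpret mu: clustered_source d K \<mu> by (rule CV_clustered_source[OF K mu])
  have Kc: "is_clustering d K" using K by (simp add: CV_def)
  show "finite (set_pmf (label_pmf K \<mu>))" by (rule mu.finite_label_pmf)
  show "finite (bins d l)" by (rule finite_bins)
  show "bins d l \<noteq> {}" using bin_in_bins by blast
  show "0 \<le> region_spread d K n L l z c" for z c
    by (simp add: region_spread_def level_spread_def fiber_sum_nonneg spread_nonneg)
  show "(\<Sum>c\<in>bins d l. region_spread d K n L l z c) = 1" if z: "z \<in> set_pmf (label_pmf K \<mu>)" for z
  proof -
    obtain i where i: "i < num_cells K" "z = rep K i" using z mu.set_label_pmf by auto
    show ?thesis unfolding region_spread_def i(2) cell_of_rep[OF Kc i(1)]
      by (rule sum_level_spread[OF region_properties(1)[OF K d \<delta> w i(1)] l])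
  qed
qed

text \<open>Under the uniform distribution, spreading each cell over itself would reproduce the bins
  exactly. The error is thus the relative volume error of the probes averaged over the cells, and
  merging bins to a coarser level does not increase it.\<close>

lemma region_spread_uniform:
  assumes K: "K \<in> CV d \<delta>" and d: "1 \<le> d" and \<delta>: "0 < \<delta>" and w: "bisect_width n \<le> \<delta>\<^sup>2 / real (24 * d)" and l: "l \<le> L"
  shows "(\<Sum>b\<in>bins d l. \<bar>E_pmf (label_pmf K (uniform_cube d)) (\<lambda>r. region_spread d K n L l r b) - 1 / 2 ^ (l * d)\<bar>)
    \<le> 36 * bisect_width n * (real d)\<^sup>2 / \<delta>\<^sup>2"
proof -
  interpret U: clustered_source d K "uniform_cube d" by (rule clustered_source_uniform[OF K])
  have Kc: "is_clustering d K" using K by (simp add: CV_def)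
  let ?m = "measure (uniform_cube d)"
  define B where "B r = region d n (cell_of d K r) r" for r
  define P where "P c = (\<Sum>i<num_cells K. ?m (cell K i) * spread d L (B (rep K i)) c)" for c
  have E: "E_pmf (label_pmf K (uniform_cube d)) (\<lambda>r. region_spread d K n L l r b) = fiber_sum (bins d L) (anc d L l) P b" for b
    using U.fiber_sum_label[of "bins d L" "anc d L l" "\<lambda>r. spread d L (B r)" b]
    by (simp add: region_spread_def level_spread_def P_def[abs_def] B_def)
  have "(\<Sum>b\<in>bins d l. \<bar>E_pmf (label_pmf K (uniform_cube d)) (\<lambda>r. region_spread d K n L l r b) - 1 / 2 ^ (l * d)\<bar>) =
    (\<Sum>b\<in>anc d L l ` bins d L. \<bar>fiber_sum (bins d L) (anc d L l) P b - fiber_sum (bins d L) (anc d L l) (\<lambda>_. 1 / 2 ^ (L * d)) b\<bar>)"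
    unfolding anc_image[OF l] by (intro sum.cong refl) (simp add: E fiber_sum_uniform[OF l])
  also have "\<dots> \<le> (\<Sum>c\<in>bins d L. \<bar>P c - 1 / 2 ^ (L * d)\<bar>)" by (rule fiber_sum_diff_le[OF finite_bins])
  also have "\<dots> \<le> (\<Sum>c\<in>bins d L. \<Sum>i<num_cells K. \<bar>?m (cell K i) * spread d L (B (rep K i)) c - ?m (cell K i \<inter> bin_cell d L c)\<bar>)"
  proof (rule sum_mono)
    fix c assume c: "c \<in> bins d L"
    have "1 / 2 ^ (L * d) = (\<Sum>i<num_cells K. ?m (cell K i \<inter> bin_cell d L c))"
      using U.sum_cells[OF bin_cell_uniform(1)[OF c]] bin_cell_uniform(2)[OF c] by (simp add: Int_commute)
    then show "\<bar>P c - 1 / 2 ^ (L * d)\<bar> \<le> (\<Sum>i<num_cells K. \<bar>?m (cell K i) * spread d L (B (rep K i)) c - ?m (cell K i \<inter> bin_cell d L c)\<bar>)"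
      unfolding P_def by (simp add: sum_abs flip: sum_subtractf)
  qed
  also have "\<dots> = (\<Sum>i<num_cells K. \<Sum>c\<in>bins d L. \<bar>?m (cell K i) * spread d L (B (rep K i)) c - ?m (cell K i \<inter> bin_cell d L c)\<bar>)"
    by (rule sum.swap)
  also have "\<dots> \<le> (\<Sum>i<num_cells K. 2 * (18 * bisect_width n * (real d)\<^sup>2 / \<delta>\<^sup>2) * ?m (cell K i))"
    using region_properties(4)[OF K d \<delta> w] by (intro sum_mono) (simp add: B_def cell_of_rep[OF Kc])
  also have "\<dots> = 2 * (18 * bisect_width n * (real d)\<^sup>2 / \<delta>\<^sup>2) * (\<Sum>i<num_cells K. ?m (cell K i))"
    by (rule sum_distrib_left[symmetric])
  finally show ?thesis by (simp add: U.sum_cells_1)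
qed

text \<open>The uniform distribution is partitioned by the finest bins themselves, each sent to its
  own leaf at no cost, so cell diameters enter only once.\<close>

lemma EMD_uniform_le:
  assumes K: "K \<in> CV d \<delta>" and d: "1 \<le> d" and \<delta>: "0 < \<delta>" and p: "1 \<le> p" and w: "bisect_width n \<le> \<delta>\<^sup>2 / real (24 * d)"
    and mu: "input_distribution d \<mu>" and \<Delta>: "0 \<le> \<Delta>"
    and bad: "measure_pmf.prob (label_pmf K \<mu>) {r. \<not> good True n d p \<Delta> (cell_of d K r) r} \<le> \<beta>"
  shows "EMD d p \<mu> (uniform_cube d) \<le> (2 * \<Delta> + \<beta>) + (1 / 2) ^ L + (\<Sum>l=1..L. (1 / 2) ^ l * (\<Sum>b\<in>bins d l.
    \<bar>E_pmf (label_pmf K \<mu>) (\<lambda>r. region_spread d K n L l r b) - 1 / 2 ^ (l * d)\<bar>))"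
proof -
  interpret mu: clustered_source d K \<mu> by (rule CV_clustered_source[OF K mu])
  have Kc: "is_clustering d K" using K by (simp add: CV_def)
  define R where "R r = good True n d p \<Delta> (cell_of d K r) r" for r
  define \<rho> where "\<rho> i = (if R (rep K i) then 2 * \<Delta> else 1)" for i
  define B where "B r = region d n (cell_of d K r) r" for r
  define v where "v i = spread d L (B (rep K i))" for i
  define v' :: "(nat \<Rightarrow> nat) \<Rightarrow> (nat \<Rightarrow> nat) \<Rightarrow> real" where "v' c c' = of_bool (c = c')" for c c'
  have Bi: "B (rep K i) = region d n (cell K i) (rep K i)" if "i < num_cells K" for i
    by (simp add: B_def cell_of_rep[OF Kc that])
  have cellcube: "x \<in> cube d" if "i < num_cells K" "x \<in> cell K i" for i x
    using that Kc by (auto simp: is_clustering_def)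
  have "EMD d p \<mu> (uniform_cube d) \<le> (\<Sum>i<num_cells K. measure \<mu> (cell K i) * \<rho> i) +
    (\<Sum>c\<in>bins d L. measure (uniform_cube d) (bin_cell d L c) * 0) + (1 / 2) ^ L +
    (\<Sum>l=1..L. (1 / 2) ^ l * (\<Sum>b\<in>anc d L l ` bins d L.
      \<bar>fiber_sum (bins d L) (anc d L l) (\<lambda>c. \<Sum>i<num_cells K. measure \<mu> (cell K i) * v i c) b -
       fiber_sum (bins d L) (anc d L l) (\<lambda>c. \<Sum>c0\<in>bins d L. measure (uniform_cube d) (bin_cell d L c0) * v' c0 c) b\<bar>))"
  proof (rule EMD_le_tree[where D = "bin_dist d L"])
    show "prob_space \<mu>" using mu by (simp add: input_distribution_def)
    show "prob_space (uniform_cube d)" by (rule prob_space_uniform_cube)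
    show "disjoint_family_on (cell K) {..<num_cells K}" using Kc by (simp add: is_clustering_def)
    show "(\<Union>i<num_cells K. cell K i) = space \<mu>" using Kc mu.space by (simp add: is_clustering_def)
    show "disjoint_family_on (bin_cell d L) (bins d L)" by (auto simp: disjoint_family_on_def bin_cell_def)
    show "(\<Union>c\<in>bins d L. bin_cell d L c) = space (uniform_cube d)"
      using bin_in_bins by (auto simp: bin_cell_def space_uniform_cube)
    show "(\<Sum>c\<in>bins d L. v i c) = 1" if "i \<in> {..<num_cells K}" for i
      using that unfolding v_def by (intro sum_spread) (simp add: Bi region_properties(1)[OF K d \<delta> w])
    show "(\<Sum>c\<in>bins d L. v' c0 c) = 1" if "c0 \<in> bins d L" for c0
      using that by (simp add: v'_def of_bool_def sum.delta' finite_bins)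
    fix i c0 x y c c'
    assume i: "i \<in> {..<num_cells K}" and xy: "x \<in> cell K i" "y \<in> bin_cell d L c0" and v: "0 < v i c" "0 < v' c0 c'"
    have c': "c' = bin d L y" "y \<in> cube d" using xy(2) v(2) by (auto simp: v'_def bin_cell_def split: if_splits)
    have xc: "x \<in> cube d" using cellcube xy(1) i by simp
    show "lp_dist d p x y \<le> \<rho> i + 0 + bin_dist d L c c'"
    proof (cases "R (rep K i)")
      case True
      then have g: "good True n d p \<Delta> (cell K i) (rep K i)" using i by (simp add: R_def cell_of_rep[OF Kc])
      then have "probe_ok True n d (cell K i) (rep K i)" by (simp add: good_def)
      then have "measure (uniform_cube d) (B (rep K i)) \<noteq> 0"
        using region_properties(3)[OF K d \<delta> w] i Bi by fastforce
      \<comment> \<open>A bin of positive spread meets the region, so a point of the cell itself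
        lies in that bin and serves as an intermediate stop between \<open>x\<close> and
        \<open>y\<close>.\<close>
      then obtain z where z: "z \<in> B (rep K i)" "z \<in> cube d" "bin d L z = c"
        using spread_pos_bin v(1) unfolding v_def by blast
      then have "z \<in> cell K i" using region_properties(2)[OF K d \<delta> w] i Bi by auto
      then have "lp_dist d p x z \<le> \<rho> i"
        using good_diameter[OF K d \<delta> p w _ g xy(1)] i True by (simp add: \<rho>_def)
      moreover have "lp_dist d p z y \<le> bin_dist d L c c'"
        using lp_dist_le_bin_dist[OF p d z(2) c'(2), of L] z c' by simp
      ultimately show ?thesis using lp_dist_triangle[OF p, of d x y z] by simp
    next
      case False
      then show ?thesis using lp_dist_cube_le_1[OF p d xc c'(2)] bin_dist_nonneg[of d L c c'] by (simp add: \<rho>_def)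
    qed
  qed (use \<Delta> mu.cells in \<open>auto simp: finite_bins v_def v'_def \<rho>_def spread_nonneg bin_dist_nonneg bin_cell_uniform
      intro: anc_root anc_refines bin_dist_le\<close>)
  also have "(\<Sum>i<num_cells K. measure \<mu> (cell K i) * \<rho> i) \<le> 2 * \<Delta> + \<beta>"
    unfolding \<rho>_def using \<Delta> bad by (intro sum_guarded_cost[OF mu.clustered_source_axioms]) (auto simp: R_def)
  also have "(\<Sum>l=1..L. (1 / 2) ^ l * (\<Sum>b\<in>anc d L l ` bins d L.
      \<bar>fiber_sum (bins d L) (anc d L l) (\<lambda>c. \<Sum>i<num_cells K. measure \<mu> (cell K i) * v i c) b -
       fiber_sum (bins d L) (anc d L l) (\<lambda>c. \<Sum>c0\<in>bins d L. measure (uniform_cube d) (bin_cell d L c0) * v' c0 c) b\<bar>)) =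
    (\<Sum>l=1..L. (1 / 2) ^ l * (\<Sum>b\<in>bins d l. \<bar>E_pmf (label_pmf K \<mu>) (\<lambda>r. region_spread d K n L l r b) - 1 / 2 ^ (l * d)\<bar>))"
  proof (intro sum.cong refl)
    fix l assume "l \<in> {1..L}"
    then have l: "l \<le> L" by simp
    have "fiber_sum (bins d L) (anc d L l) (\<lambda>c. \<Sum>c0\<in>bins d L. measure (uniform_cube d) (bin_cell d L c0) * v' c0 c) b =
        fiber_sum (bins d L) (anc d L l) (\<lambda>_. 1 / 2 ^ (L * d)) b" for b
      unfolding fiber_sum_def
    proof (intro sum.cong refl)
      fix c assume "c \<in> {c \<in> bins d L. anc d L l c = b}"
      then have "(\<Sum>c0\<in>bins d L. measure (uniform_cube d) (bin_cell d L c0) * v' c0 c) =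
          (\<Sum>c0\<in>bins d L. if c0 = c then 1 / 2 ^ (L * d) else 0)"
        by (intro sum.cong) (auto simp: v'_def bin_cell_uniform)
      then show "(\<Sum>c0\<in>bins d L. measure (uniform_cube d) (bin_cell d L c0) * v' c0 c) = 1 / 2 ^ (L * d)"
        using \<open>c \<in> {c \<in> bins d L. anc d L l c = b}\<close> by (simp add: sum.delta finite_bins)
    qed
    moreover have "fiber_sum (bins d L) (anc d L l) (\<lambda>c. \<Sum>i<num_cells K. measure \<mu> (cell K i) * v i c) b =
        E_pmf (label_pmf K \<mu>) (\<lambda>r. region_spread d K n L l r b)" for b
      using mu.fiber_sum_label[of "bins d L" "anc d L l" "\<lambda>r. spread d L (B r)" b]
      by (simp add: region_spread_def level_spread_def v_def B_def)
    ultimately show "(1 / 2) ^ l * (\<Sum>b\<in>anc d L l ` bins d L.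
      \<bar>fiber_sum (bins d L) (anc d L l) (\<lambda>c. \<Sum>i<num_cells K. measure \<mu> (cell K i) * v i c) b -
       fiber_sum (bins d L) (anc d L l) (\<lambda>c. \<Sum>c0\<in>bins d L. measure (uniform_cube d) (bin_cell d L c0) * v' c0 c) b\<bar>) =
      (1 / 2) ^ l * (\<Sum>b\<in>bins d l. \<bar>E_pmf (label_pmf K \<mu>) (\<lambda>r. region_spread d K n L l r b) - 1 / 2 ^ (l * d)\<bar>)"
      unfolding anc_image[OF l] using fiber_sum_uniform[OF l] by simp
  qed
  finally show ?thesis by simp
qed

theorem unif_tree_tester:
  fixes \<epsilon> \<delta> p :: real and d n L k m :: nat
  assumes d: "1 \<le> d" and p: "1 \<le> p" and \<epsilon>: "0 < \<epsilon>" "\<epsilon> < 1" and \<delta>: "0 < \<delta>"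
    and w: "bisect_width n \<le> \<delta>\<^sup>2 / real (24 * d)" and k: "40 / \<epsilon> \<le> k" "k \<le> 41 / \<epsilon>"
    and L: "1 \<le> L" "8 / \<epsilon> \<le> 2 ^ L" and m: "0 < m"
    and w2: "36 * bisect_width n * (real d)\<^sup>2 / \<delta>\<^sup>2 \<le> 1 / m"
    and cond: "\<And>l. 1 \<le> l \<Longrightarrow> l \<le> L \<Longrightarrow> 20000 * real L \<le> (real m)\<^sup>2 * unif_eta d \<epsilon> L l"
      "\<And>l. 1 \<le> l \<Longrightarrow> l \<le> L \<Longrightarrow> 30000 * real L \<le> 2 ^ (l * d) * (real m)\<^sup>2 * (unif_eta d \<epsilon> L l)\<^sup>2"
  shows "uniformity_tester d p \<epsilon> (CV d \<delta>) (Boxes d \<delta>) (\<epsilon> / 16) (\<lambda>_. unif_tree d p \<epsilon> n L k m)"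
  unfolding uniformity_tester_def Let_def
proof (intro ballI allI impI)
  fix K \<mu>
  assume K: "K \<in> CV d \<delta>" and mu: "input_distribution d \<mu>"
  define src where "src = (\<lambda>_::unit. \<mu>)"
  interpret mu: clustered_source d K \<mu> by (rule CV_clustered_source[OF K mu])
  have cs: "clustered_source d K (src s)" for s
    using mu.clustered_source_axioms by (simp add: src_def)
  have Kc: "is_clustering d K" using K by (simp add: CV_def)
  let ?T = "\<lambda>_. unif_tree d p \<epsilon> n L k m"
  define Z where "Z = label_pmf K \<mu>"
  define R where "R r = good True n d p (\<epsilon> / 16) (cell_of d K r) r" for r
  define ok where "ok ss = (\<forall>r\<in>set ss. R r)" for ss
  define J where "J = pair_pmf (replicate_pmf m Z) (replicate_pmf m Z)"
  define B where "B = map_pmf (\<lambda>(zs, zs'). region_decision d K \<epsilon> n L m zs zs') J"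
  define V where "V = bind_pmf (replicate_pmf k Z) (\<lambda>ss. if ok ss then B else return_pmf ClusterReject)"
  have spread: "spread_samples Z (region_spread d K n L l) (bins d l)" if "l \<le> L" for l
    unfolding Z_def by (rule spread_samples_region[OF K d \<delta> w mu that])
  have N: "spread_samples.N (bins d l) = 2 ^ (l * d)" if "l \<le> L" for l
    by (simp add: spread_samples.N_def[OF spread[OF that]] card_bins)
  have dev: "spread_samples.dev (region_spread d K n L l) (bins d l) z c = region_spread d K n L l z c - 1 / 2 ^ (l * d)"
    if "l \<le> L" for l z c
    by (simp add: spread_samples.dev_def[OF spread[OF that]] N[OF that])
  have V: "verdict_pmf K (\<lambda>s. label_pmf K (src s)) (unif_tree d p \<epsilon> n L k m) = V"
  proof -
    have "set_pmf (label_pmf K (src ())) \<subseteq> rep K ` {..<num_cells K}"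
      unfolding src_def by (rule mu.set_label_pmf)
    from verdict_unif_tree[of d K "\<lambda>s. label_pmf K (src s)", OF Kc this dev] show ?thesis
      by (simp only: V_def B_def J_def Z_def ok_def R_def src_def)
  qed
  have out: "outcome_prob ?T K src W = measure_pmf.prob V W" for W
    unfolding V[symmetric] by (rule outcome_deterministic(2)[of d K src, OF cs])
  have meas: "outcome ?T K \<in> run_space src \<rightarrow>\<^sub>M count_space UNIV"
    by (rule outcome_deterministic(1)[of d K src, OF cs])
  have VP: "measure_pmf.prob V {v} = measure_pmf.prob (replicate_pmf k Z) {s. ok s} * measure_pmf.prob B {v} +
      of_bool (v = ClusterReject) * measure_pmf.prob (replicate_pmf k Z) {s. \<not> ok s}" for v
    unfolding V_def by (rule prob_guarded)
  have acc: "0 < level_accuracy \<epsilon> L l" "0 < unif_eta d \<epsilon> L l" for l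
    using \<epsilon> L by (auto simp: level_accuracy_def unif_eta_def)
  have L1: "1 \<le> real L" using L by simp
  let ?stat = "\<lambda>l. ustat (\<lambda>_. 1) (bins d l) (spread_samples.dev (region_spread d K n L l) (bins d l))"
  have "measure_pmf.prob V {ClusterReject} \<le> 1 / 6"
    if box: "K \<in> Boxes d \<delta>" and diam: "diameter_condition d p \<epsilon> (\<epsilon> / 16) K \<mu>"
  proof -
    \<comment> \<open>The second stage can output CLUSTER-REJECT as well, namely when a probe fails;
      on boxes no probe fails.\<close>
    have ok_all: "probe_ok True n d (cell_of d K r) r" if r: "r \<in> set_pmf Z" for r
    proof -
      obtain i where i: "i < num_cells K" "r = rep K i" using r mu.set_label_pmf by (auto simp: Z_def)
      obtain S where "convex_cell d \<delta> (cell K i) S (rep K i)" using CV_convex_cell[OF K d \<delta> i(1)] by blast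
      then interpret convex_cell d \<delta> "cell K i" S "rep K i" .
      have "bisect_width n \<le> \<delta>\<^sup>2 / (24 * d)" using w by simp
      then have "bisect_width n \<le> \<delta> / 4" using d CV_empty[OF K d \<delta>] by (intro slack_le(1)[of n 0]) auto
      moreover have "axis_aligned_box d (cell K i)" using box i by (simp add: Boxes_def)
      ultimately show ?thesis using box_probe_ok by (simp add: i cell_of_rep[OF Kc])
    qed
    have "measure_pmf.prob B {ClusterReject} = 0"
    proof -
      have "set_pmf J \<inter> (\<lambda>(zs, zs'). region_decision d K \<epsilon> n L m zs zs') -` {ClusterReject} = {}"
      proof -
        have "region_decision d K \<epsilon> n L m zs zs' \<noteq> ClusterReject" if "(zs, zs') \<in> set_pmf J" for zs zs'
        proof -
          have "\<forall>r\<in>set (zs @ zs'). probe_ok True n d (cell_of d K r) r"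
            using that ok_all by (auto simp: J_def set_replicate_pmf)
          then show ?thesis by (simp add: region_decision_def)
        qed
        then show ?thesis by auto
      qed
      then show ?thesis by (auto simp: B_def measure_pmf_zero_iff)
    qed
    then have "measure_pmf.prob V {ClusterReject} = measure_pmf.prob (replicate_pmf k Z) {s. \<not> ok s}"
      by (simp add: VP)
    also have "{s. \<not> ok s} = {s. \<exists>r\<in>set s. r \<in> {r. \<not> R r}}" by (auto simp: ok_def)
    also have "measure_pmf.prob (replicate_pmf k Z) \<dots> \<le> k * measure_pmf.prob Z {r. \<not> R r}"
      by (rule prob_replicate_ex)
    also have "measure_pmf.prob Z {r. \<not> R r} \<le> guard_const * \<epsilon>"
      unfolding Z_def R_def by (rule bad_mass_le[OF box d \<delta> p w mu diam])
    also have "k * (guard_const * \<epsilon>) \<le> 41 / \<epsilon> * (1 / 1152 * \<epsilon>)"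
      using k guard_const_le \<epsilon> by (intro mult_mono) auto
    also have "\<dots> \<le> 1 / 6" using \<epsilon> by simp
    finally show ?thesis by (simp add: mult_left_mono)
  qed
  moreover have "measure_pmf.prob V {Accept, ClusterReject} \<ge> 5 / 6" if unif: "\<mu> = uniform_cube d"
  proof -
    have "measure_pmf.prob V {Reject} \<le> measure_pmf.prob B {Reject}"
      by (simp add: VP mult_left_le_one_le)
    \<comment> \<open>Failing probes only remove outcomes from the event REJECT; the statistic in
      the larger event is defined for all labels.\<close>
    also have "\<dots> \<le> measure_pmf.prob J (\<Union>l\<in>{1..L}. {(zs, zs'). (real m)\<^sup>2 * unif_eta d \<epsilon> L l / 2 \<le> ?stat l zs zs'})"
      unfolding B_def measure_map_pmf
      by (intro measure_pmf.finite_measure_mono) (auto simp: region_decision_def split: if_splits)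
    also have "\<dots> \<le> (\<Sum>l\<in>{1..L}. measure_pmf.prob J {(zs, zs'). (real m)\<^sup>2 * unif_eta d \<epsilon> L l / 2 \<le> ?stat l zs zs'})"
      by (intro measure_UNION_le) auto
    also have "\<dots> \<le> (\<Sum>l\<in>{1..L}. 1 / (6 * real L))"
    proof (rule sum_mono)
      fix l assume "l \<in> {1..L}"
      then have l: "1 \<le> l" "l \<le> L" by auto
      \<comment> \<open>The bisection precision in \<open>w2\<close> was chosen to make the
        spreading error at most 1/m.\<close>
      have "(\<Sum>b\<in>bins d l. \<bar>E_pmf Z (\<lambda>r. region_spread d K n L l r b) - 1 / spread_samples.N (bins d l)\<bar>) \<le> 1 / m"
        using region_spread_uniform[OF K d \<delta> w l(2)] w2 unfolding N[OF l(2)] Z_def unif by (rule order_trans)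
      then show "measure_pmf.prob J {(zs, zs'). (real m)\<^sup>2 * unif_eta d \<epsilon> L l / 2 \<le> ?stat l zs zs'} \<le> 1 / (6 * real L)"
        unfolding J_def using cond[OF l]
        by (intro spread_samples.uniformity_null[OF spread[OF l(2)] m L1 acc(2)]) (simp_all add: N[OF l(2)])
    qed
    also have "\<dots> = 1 / 6" using L by simp
    finally show ?thesis by (simp add: verdict_complement)
  qed
  moreover have "measure_pmf.prob V {Reject, ClusterReject} \<ge> 5 / 6" if far: "EMD d p \<mu> (uniform_cube d) > \<epsilon>"
  proof -
    have "measure_pmf.prob V {Accept} \<le> 1 / 6"
    proof (cases "\<epsilon> / 20 < measure_pmf.prob Z {r. \<not> R r}")
      case True
      have "measure_pmf.prob (replicate_pmf k Z) {s. ok s} \<le> measure_pmf.prob (replicate_pmf k Z) {s. \<forall>r\<in>set s. r \<notin> {r. \<not> R r}}"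
        by (intro measure_pmf.finite_measure_mono) (auto simp: ok_def)
      also have "\<dots> \<le> exp (- (\<epsilon> / 20) * k)" using True by (intro prob_replicate_none) simp
      also have "\<dots> \<le> exp (- 2)" using k(1) \<epsilon> by (simp add: field_simps)
      also have "\<dots> \<le> 1 / 6" by (rule exp_minus_2_le)
      finally show ?thesis
        using mult_left_le[of "measure_pmf.prob B {Accept}" "measure_pmf.prob (replicate_pmf k Z) {s. ok s}"] by (simp add: VP)
    next
      case False
      let ?D = "\<lambda>l. \<Sum>b\<in>bins d l. \<bar>E_pmf Z (\<lambda>r. region_spread d K n L l r b) - 1 / 2 ^ (l * d)\<bar>"
      have "\<exists>l\<in>{1..L}. level_accuracy \<epsilon> L l < ?D l"
      proof (rule ccontr)
        assume "\<not> ?thesis"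
        then have le: "?D l \<le> level_accuracy \<epsilon> L l" if "l \<in> {1..L}" for l using that by force
        have "EMD d p \<mu> (uniform_cube d) \<le> (2 * (\<epsilon> / 16) + \<epsilon> / 20) + (1 / 2) ^ L + (\<Sum>l=1..L. (1 / 2) ^ l * ?D l)"
          using False \<epsilon> unfolding Z_def by (intro EMD_uniform_le[OF K d \<delta> p w mu]) (auto simp: R_def)
        also have "\<dots> \<le> (2 * (\<epsilon> / 16) + \<epsilon> / 20) + \<epsilon> / 8 + (\<Sum>l=1..L. (1 / 2) ^ l * level_accuracy \<epsilon> L l)"
        proof (intro add_mono sum_mono mult_left_mono le)
          have "8 \<le> \<epsilon> * 2 ^ L" using L(2) \<epsilon> by (simp add: divide_le_eq mult.commute)
          then show "(1 / 2) ^ L \<le> \<epsilon> / 8" by (simp add: power_one_over divide_simps)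
        qed auto
        also have "\<dots> \<le> \<epsilon>" using \<epsilon> unfolding sum_level_accuracy[OF L(1)] by simp
        finally show False using far by simp
      qed
      then obtain l where l: "1 \<le> l" "l \<le> L" "level_accuracy \<epsilon> L l < ?D l" by auto
      have "measure_pmf.prob V {Accept} \<le> measure_pmf.prob B {Accept}"
        by (simp add: VP mult_left_le_one_le)
      also have "\<dots> \<le> measure_pmf.prob J {(zs, zs'). ?stat l zs zs' < (real m)\<^sup>2 * unif_eta d \<epsilon> L l / 2}"
        unfolding B_def measure_map_pmf using l(1,2)
        by (intro measure_pmf.finite_measure_mono) (auto simp: region_decision_def not_le split: if_splits)
      also have "\<dots> \<le> 1 / 6" unfolding J_def
      proof (rule spread_samples.uniformity_alternative[OF spread[OF l(2)] m L1 acc(2)])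
        have "unif_eta d \<epsilon> L l * 2 ^ (l * d) = (level_accuracy \<epsilon> L l)\<^sup>2" by (simp add: unif_eta_def)
        also have "\<dots> \<le> (?D l)\<^sup>2" using l(3) acc(1)[of l] by (intro power_mono) auto
        finally show "unif_eta d \<epsilon> L l * spread_samples.N (bins d l) \<le>
          (\<Sum>c\<in>bins d l. \<bar>E_pmf Z (\<lambda>z. region_spread d K n L l z c) - 1 / spread_samples.N (bins d l)\<bar>)\<^sup>2"
          by (simp add: N[OF l(2)])
      qed (use cond[OF l(1,2)] in \<open>simp_all add: N[OF l(2)]\<close>)
      finally show ?thesis .
    qed
    then show ?thesis by (simp add: verdict_complement)
  qed
  ultimately show "outcome ?T K \<in> run_space (\<lambda>_. \<mu>) \<rightarrow>\<^sub>M count_space UNIV \<and>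
    (K \<in> Boxes d \<delta> \<and> diameter_condition d p \<epsilon> (\<epsilon> / 16) K \<mu> \<longrightarrow> outcome_prob ?T K (\<lambda>_. \<mu>) {ClusterReject} \<le> 1 / 6) \<and>
    (\<mu> = uniform_cube d \<longrightarrow> 5 / 6 \<le> outcome_prob ?T K (\<lambda>_. \<mu>) {Accept, ClusterReject}) \<and>
    (\<epsilon> < EMD d p \<mu> (uniform_cube d) \<longrightarrow> 5 / 6 \<le> outcome_prob ?T K (\<lambda>_. \<mu>) {Reject, ClusterReject})"
    unfolding src_def[symmetric] out using meas by blast
qed

section \<open>Parameters\<close>

lemma ln_two_bounds: "1 / 2 \<le> ln (2::real)" "ln (2::real) \<le> 1"
proof -
  have "exp (1 / 2 :: real) ^ 2 = exp 1" by (simp flip: exp_of_nat_mult)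
  also have "\<dots> \<le> 2 ^ 2" using exp_le by simp
  finally have "exp (1 / 2 :: real) \<le> 2" by (rule power2_le_imp_le) simp
  then show "1 / 2 \<le> ln (2::real)" by (subst ln_ge_iff) auto
  show "ln (2::real) \<le> 1" using ln_le_minus_one[of 2] by simp
qed

text \<open>It yields both the finest level and the number of bisection steps; the bound on
  \<open>n\<close> keeps both logarithmic.\<close>

lemma power_of_two_between:
  fixes x :: real
  assumes "1 \<le> x"
  obtains n :: nat where "x \<le> 2 ^ n" "2 ^ n \<le> 2 * x" "real n \<le> 2 * ln (2 * x)"
proof -
  define n where "n = nat \<lceil>log 2 x\<rceil>"
  have l0: "0 \<le> log 2 x" using assms by simp
  then have n: "log 2 x \<le> real n" "real n \<le> log 2 x + 1"
    unfolding n_def by linarith+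
  have "x = 2 powr (log 2 x)" using assms by simp
  also have "\<dots> \<le> 2 powr (real n)" using n by simp
  finally have 1: "x \<le> 2 ^ n" by (simp add: powr_realpow)
  have "2 powr (real n) \<le> 2 powr (log 2 x + 1)" using n by simp
  also have "\<dots> = 2 * x" using assms by (simp add: powr_add)
  finally have 2: "2 ^ n \<le> 2 * x" by (simp add: powr_realpow)
  have "real n * (1 / 2) \<le> real n * ln 2" using ln_two_bounds by (intro mult_left_mono) auto
  also have "\<dots> = ln (2 ^ n)" by (simp add: ln_realpow)
  also have "\<dots> \<le> ln (2 * x)" using 2 assms by (intro ln_mono) auto
  finally show ?thesis using that 1 2 by simp
qed

text \<open>The sample-size condition of one level with t = 2^l and u = 1/\<epsilon>, cleared of
  denominators; j = 1 belongs to uniformity, j = 2 to equivalence. If j d \<le> 4 the coarse levels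
  are the hardest and e \<ge> 2 suffices; otherwise the finest level, with t up to 16 u, is the
  hardest and e \<ge> j d/(j+1) suffices. This is the origin of the maximum in the
  exponents.\<close>

lemma level_power_bound:
  fixes u t E e :: real and d :: nat
  assumes u: "1 \<le> u" and t: "1 \<le> t" "t \<le> 16 * u" and j: "1 \<le> j" and e: "max 2 (real (j * d) / (j + 1)) \<le> e"
  defines "E \<equiv> u powr e"
  shows "t ^ (j * d) * u ^ 4 \<le> 16 ^ ((j + 1) * d) * E ^ (j + 1) * t ^ 4"
proof (cases "j * d \<le> 4")
  case True
  have "u ^ 2 = u powr 2" using u by (simp add: powr_numeral)
  also have "\<dots> \<le> E" unfolding E_def using u e by (intro powr_mono) auto
  finally have E: "u ^ 2 \<le> E" .
  have E1: "1 \<le> E" using E u one_le_power[OF u, of 2] by linarith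
  have "u ^ 4 = (u ^ 2) ^ 2" by simp
  also have "\<dots> \<le> E ^ 2" using E by (intro power_mono) auto
  also have "\<dots> \<le> E ^ (j + 1)" using E1 j by (intro power_increasing) auto
  finally have "t ^ (j * d) * u ^ 4 \<le> t ^ 4 * (1 * E ^ (j + 1))"
    using True t u by (intro mult_mono power_increasing) auto
  also have "\<dots> \<le> t ^ 4 * (16 ^ ((j + 1) * d) * E ^ (j + 1))"
    using t E1 by (intro mult_left_mono mult_right_mono) auto
  finally show ?thesis by (simp add: mult_ac)
next
  case False
  have E: "u ^ (j * d) \<le> E ^ (j + 1)"
  proof -
    have "u ^ (j * d) = u powr (real (j * d))" using u by (intro powr_realpow[symmetric]) simp
    also have "\<dots> = u powr (real (j * d) / (j + 1) * (j + 1))" by simp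
    also have "\<dots> \<le> u powr (e * (j + 1))" using u e by (intro powr_mono mult_right_mono) auto
    also have "\<dots> = E ^ (j + 1)"
      unfolding E_def using u by (subst powr_realpow[symmetric]) (auto simp: powr_powr)
    finally show ?thesis .
  qed
  have split: "j * d = 4 + (j * d - 4)" using False by simp
  have "t ^ (j * d) * u ^ 4 = t ^ 4 * (t ^ (j * d - 4) * u ^ 4)"
    by (subst split) (simp only: power_add mult_ac)
  also have "\<dots> \<le> t ^ 4 * ((16 * u) ^ (j * d - 4) * u ^ 4)"
    using t u by (intro mult_left_mono mult_right_mono power_mono) auto
  also have "(16 * u) ^ (j * d - 4) * u ^ 4 = 16 ^ (j * d - 4) * u ^ (j * d)"
    by (subst (2) split) (simp only: power_add power_mult_distrib mult_ac)
  also have "t ^ 4 * (16 ^ (j * d - 4) * u ^ (j * d)) \<le> t ^ 4 * (16 ^ ((j + 1) * d) * E ^ (j + 1))"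
    using E t u by (intro mult_left_mono mult_mono power_increasing) auto
  finally show ?thesis by (simp add: mult_ac)
qed

text \<open>The factor \<open>16 ^ d\<close> pays for the number \<open>2 ^ (L * d) \<le> (16 / \<epsilon>) ^ d\<close> of bins.\<close>

definition sample_scale :: "nat \<Rightarrow> real \<Rightarrow> nat \<Rightarrow> real \<Rightarrow> real" where
  "sample_scale d \<epsilon> L e = 10 ^ 6 * real L ^ 3 * 16 ^ d * (1 / \<epsilon>) powr e"

lemma level_condition:
  fixes m :: nat
  assumes \<epsilon>: "0 < \<epsilon>" "\<epsilon> < 1" and L: "1 \<le> L" "2 ^ L \<le> 16 / \<epsilon>" and l: "l \<le> L" and j: "1 \<le> j"
    and e: "max 2 (real (j * d) / (j + 1)) \<le> e" and m: "sample_scale d \<epsilon> L e \<le> m"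
  shows "(10 ^ 6) ^ (j + 1) * real L ^ 2 / 256 \<le> real m ^ (j + 1) * (level_accuracy \<epsilon> L l) ^ 4 / (2 ^ (l * d)) ^ j"
proof -
  define u t where "u = 1 / \<epsilon>" and "t = (2::real) ^ l"
  have u: "1 \<le> u" using \<epsilon> by (simp add: u_def)
  have t: "1 \<le> t" "t \<le> 16 * u"
  proof -
    have "t \<le> 2 ^ L" using l by (simp add: t_def power_increasing)
    then show "t \<le> 16 * u" using L by (simp add: u_def)
  qed (simp add: t_def)
  have L1: "1 \<le> real L" using L by simp
  have "(10 ^ 6 * real L ^ 3) ^ (j + 1) * (t ^ (j * d) * u ^ 4) \<le>
      (10 ^ 6 * real L ^ 3) ^ (j + 1) * (16 ^ ((j + 1) * d) * (u powr e) ^ (j + 1) * t ^ 4)"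
    by (intro mult_left_mono level_power_bound[OF u t j e]) auto
  also have "\<dots> = sample_scale d \<epsilon> L e ^ (j + 1) * t ^ 4"
  proof -
    have "(16::real) ^ ((j + 1) * d) = (16 ^ d) ^ (j + 1)" by (simp only: power_mult[symmetric] mult.commute)
    then show ?thesis unfolding sample_scale_def u_def power_mult_distrib by (simp only: mult_ac)
  qed
  also have "\<dots> \<le> real m ^ (j + 1) * t ^ 4"
    using m t by (intro mult_right_mono power_mono) (auto simp: sample_scale_def)
  finally have main: "(10 ^ 6 * real L ^ 3) ^ (j + 1) * (t ^ (j * d) * u ^ 4) \<le> real m ^ (j + 1) * t ^ 4" .
  \<comment> \<open>Six factors \<open>L\<close> are wanted, four for the fourth power of
    \<open>level_accuracy\<close> and two for the failure probability per level. As j + 1 \<ge> 2,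
    the cube in \<open>sample_scale\<close> provides them.\<close>
  have "real L ^ 6 \<le> (real L ^ 3) ^ (j + 1)"
    unfolding power_mult[symmetric] using L1 j by (intro power_increasing) auto
  then have "(10 ^ 6) ^ (j + 1) * real L ^ 6 * (t ^ (j * d) * u ^ 4) \<le> (10 ^ 6 * real L ^ 3) ^ (j + 1) * (t ^ (j * d) * u ^ 4)"
    unfolding power_mult_distrib using t u by (intro mult_right_mono mult_left_mono) auto
  from order_trans[OF this main]
  have "(10 ^ 6) ^ (j + 1) * real L ^ 6 * (t ^ (j * d) * u ^ 4) \<le> real m ^ (j + 1) * t ^ 4" .
  then have A: "(10 ^ 6) ^ (j + 1) * real L ^ 6 * (t ^ (j * d) * u ^ 4) / (256 * real L ^ 4 * u ^ 4 * t ^ (j * d)) \<le>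
      real m ^ (j + 1) * t ^ 4 / (256 * real L ^ 4 * u ^ 4 * t ^ (j * d))"
    using t u by (intro divide_right_mono) auto
  have B: "(10 ^ 6) ^ (j + 1) * real L ^ 6 * (t ^ (j * d) * u ^ 4) / (256 * real L ^ 4 * u ^ 4 * t ^ (j * d)) =
      (10 ^ 6) ^ (j + 1) * real L ^ 2 / 256"
  proof -
    have "real L ^ 6 = real L ^ 4 * real L ^ 2" by (simp flip: power_add)
    then show ?thesis using t u L1 by (simp add: divide_simps)
  qed
  have C: "real m ^ (j + 1) * t ^ 4 / (256 * real L ^ 4 * u ^ 4 * t ^ (j * d)) =
      real m ^ (j + 1) * (level_accuracy \<epsilon> L l) ^ 4 / (2 ^ (l * d)) ^ j"
  proof -
    have "level_accuracy \<epsilon> L l = t / (4 * L * u)" by (simp add: level_accuracy_def t_def u_def)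
    then have "(level_accuracy \<epsilon> L l) ^ 4 = t ^ 4 / (256 * real L ^ 4 * u ^ 4)"
      by (simp add: power_divide power_mult_distrib)
    moreover have "((2::real) ^ (l * d)) ^ j = t ^ (j * d)" by (simp add: t_def mult_ac flip: power_mult)
    ultimately show ?thesis by simp
  qed
  show ?thesis using A unfolding B C .
qed

lemma unif_conditions:
  fixes m :: nat
  assumes \<epsilon>: "0 < \<epsilon>" "\<epsilon> < 1" and L: "1 \<le> L" "2 ^ L \<le> 16 / \<epsilon>" and l: "l \<le> L"
    and e: "max 2 (real d / 2) \<le> e" and m: "sample_scale d \<epsilon> L e \<le> m"
  shows "20000 * real L \<le> (real m)\<^sup>2 * unif_eta d \<epsilon> L l"
    and "30000 * real L \<le> 2 ^ (l * d) * (real m)\<^sup>2 * (unif_eta d \<epsilon> L l)\<^sup>2"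
proof -
  define a where "a = level_accuracy \<epsilon> L l"
  define N where "N = (2::real) ^ (l * d)"
  have N: "0 < N" by (simp add: N_def)
  have L1: "1 \<le> real L" using L by simp
  \<comment> \<open>Accuracies never exceed 4, so a lower bound involving their fourth power also
    gives one involving their square; both conditions follow from the same inequality.\<close>
  have "(2::real) ^ l \<le> 2 ^ L" using l by (intro power_increasing) auto
  then have "2 ^ l * \<epsilon> \<le> 2 ^ L * \<epsilon>" using \<epsilon> by (intro mult_right_mono) auto
  also have "\<dots> \<le> 16" using L \<epsilon> by (simp add: le_divide_eq)
  finally have "2 ^ l * \<epsilon> \<le> 16" .
  also have "16 \<le> 16 * real L" using L1 by simp
  finally have a: "0 < a" "a \<le> 4" using \<epsilon> L1 by (auto simp: a_def level_accuracy_def divide_le_eq)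
  have "(10 ^ 6) ^ 2 * real L ^ 2 / 256 \<le> (real m)\<^sup>2 * a ^ 4 / N"
    using level_condition[OF \<epsilon> L l, of 1 d e m] e m by (simp add: a_def N_def numeral_2_eq_2)
  moreover have "10 ^ 9 * real L \<le> (10 ^ 6) ^ 2 * real L ^ 2 / 256"
  proof -
    have "10 ^ 9 * real L * 1 \<le> 10 ^ 9 * real L * real L" using L1 by (intro mult_left_mono) auto
    also have "\<dots> \<le> (10 ^ 6) ^ 2 / 256 * (real L * real L)" unfolding mult.assoc by (intro mult_right_mono) auto
    finally show ?thesis by (simp add: power2_eq_square)
  qed
  ultimately have big: "10 ^ 9 * real L \<le> (real m)\<^sup>2 * a ^ 4 / N" by (rule order_trans[rotated])
  have "N * (real m)\<^sup>2 * (a\<^sup>2 / N)\<^sup>2 = (real m)\<^sup>2 * a ^ 4 / N" using N by (simp add: power2_eq_square power4_eq_xxxx)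
  then show "30000 * real L \<le> 2 ^ (l * d) * (real m)\<^sup>2 * (unif_eta d \<epsilon> L l)\<^sup>2"
    using big L1 by (simp add: unif_eta_def a_def[symmetric] N_def[symmetric])
  have "a ^ 4 = a\<^sup>2 * a\<^sup>2" by (simp flip: power_add)
  also have "\<dots> \<le> a\<^sup>2 * 4\<^sup>2" using a by (intro mult_left_mono power_mono) auto
  finally have "(real m)\<^sup>2 * a ^ 4 / N \<le> (real m)\<^sup>2 * (a\<^sup>2 * 4\<^sup>2) / N"
    using N by (intro divide_right_mono mult_left_mono) auto
  also have "\<dots> = 16 * ((real m)\<^sup>2 * (a\<^sup>2 / N))" by simp
  finally have "10 ^ 9 * real L \<le> 16 * ((real m)\<^sup>2 * (a\<^sup>2 / N))" by (rule order_trans[OF big])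
  then have "10 ^ 9 / 16 * real L \<le> (real m)\<^sup>2 * (a\<^sup>2 / N)" by simp
  moreover have "20000 * real L \<le> 10 ^ 9 / 16 * real L" by (intro mult_right_mono) auto
  ultimately show "20000 * real L \<le> (real m)\<^sup>2 * unif_eta d \<epsilon> L l"
    unfolding unif_eta_def a_def[symmetric] N_def[symmetric] by (rule order_trans[rotated])
qed

text \<open>Where the flattening rate is 1, this is the case j = 2 of
  \<open>level_condition\<close>. Where the rate is 2^(l d)/m, one power of m/2^(l d) cancels and
  the case j = 1 remains, whose exponent d/2 is below 2d/3.\<close>

lemma equiv_condition:
  fixes m :: nat
  assumes \<epsilon>: "0 < \<epsilon>" "\<epsilon> < 1" and L: "1 \<le> L" "2 ^ L \<le> 16 / \<epsilon>" and l: "l \<le> L"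
    and e: "max 2 (2 * real d / 3) \<le> e" and m: "sample_scale d \<epsilon> L e \<le> m" "0 < m"
  shows "10 ^ 7 * (real L)\<^sup>2 \<le> flat_rate d m l * real m ^ 3 * (equiv_eta d \<epsilon> L l)\<^sup>2"
proof -
  define a where "a = level_accuracy \<epsilon> L l"
  define N where "N = (2::real) ^ (l * d)"
  have N: "0 < N" by (simp add: N_def)
  have eta: "(equiv_eta d \<epsilon> L l)\<^sup>2 = a ^ 4 / (9 * N\<^sup>2)"
    by (simp add: equiv_eta_def a_def[symmetric] N_def[symmetric] power_divide power_mult_distrib flip: power_mult)
  have L2: "0 \<le> (real L)\<^sup>2" by simp
  have "flat_rate d m l = 1 \<or> flat_rate d m l = N / m" by (simp add: flat_rate_def min_def N_def)
  then consider "flat_rate d m l = 1" | "flat_rate d m l = N / m" by blast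
  then show ?thesis
  proof cases
    case 1
    have "10 ^ 18 / 256 * (real L)\<^sup>2 \<le> real m ^ 3 * a ^ 4 / N ^ 2"
      using level_condition[OF \<epsilon> L l, of 2 d e m] e m(1) by (simp add: a_def N_def numeral_3_eq_3)
    then have "10 ^ 18 / 256 * (real L)\<^sup>2 / 9 \<le> real m ^ 3 * a ^ 4 / N\<^sup>2 / 9" by (rule divide_right_mono) simp
    moreover have "10 ^ 7 * (real L)\<^sup>2 \<le> 10 ^ 18 / 256 * (real L)\<^sup>2 / 9" using L2 by simp
    moreover have "flat_rate d m l * real m ^ 3 * (equiv_eta d \<epsilon> L l)\<^sup>2 = real m ^ 3 * a ^ 4 / N\<^sup>2 / 9"
      unfolding 1 eta by simp
    ultimately show ?thesis by (simp only: order_trans)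
  next
    case 2
    have "max 2 (real (1 * d) / (1 + 1)) \<le> e" using e by auto
    then have "10 ^ 12 / 256 * (real L)\<^sup>2 \<le> (real m)\<^sup>2 * a ^ 4 / N"
      using level_condition[OF \<epsilon> L l, of 1 d e m] m(1) by (simp add: a_def N_def numeral_2_eq_2)
    then have "10 ^ 12 / 256 * (real L)\<^sup>2 / 9 \<le> (real m)\<^sup>2 * a ^ 4 / N / 9" by (rule divide_right_mono) simp
    moreover have "10 ^ 7 * (real L)\<^sup>2 \<le> 10 ^ 12 / 256 * (real L)\<^sup>2 / 9" using L2 by simp
    moreover have "flat_rate d m l * real m ^ 3 * (equiv_eta d \<epsilon> L l)\<^sup>2 = (real m)\<^sup>2 * a ^ 4 / N / 9"
      unfolding 2 eta using N m(2) by (simp add: power2_eq_square power3_eq_cube)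
    ultimately show ?thesis by (simp only: order_trans)
  qed
qed

lemma parameters:
  fixes \<epsilon> e :: real and d :: nat
  assumes \<epsilon>: "0 < \<epsilon>" "\<epsilon> < 1" and e: "2 \<le> e"
  obtains L k m :: nat where "1 \<le> L" "8 / \<epsilon> \<le> 2 ^ L" "2 ^ L \<le> 16 / \<epsilon>" "40 / \<epsilon> \<le> k" "k \<le> 41 / \<epsilon>"
    "0 < m" "sample_scale d \<epsilon> L e \<le> m"
    "real m \<le> 2 ^ 30 * (16 ^ d * ((1 / \<epsilon>) powr e * log1 (1 / \<epsilon>) ^ 3))"
    "real k \<le> 41 * (16 ^ d * ((1 / \<epsilon>) powr e * log1 (1 / \<epsilon>) ^ 3))"
proof -
  have "1 \<le> 8 / \<epsilon>" using \<epsilon> by simp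
  then obtain L where L: "8 / \<epsilon> \<le> 2 ^ L" "2 ^ L \<le> 2 * (8 / \<epsilon>)" "real L \<le> 2 * ln (2 * (8 / \<epsilon>))"
    using power_of_two_between by blast
  define u where "u = 1 / \<epsilon>"
  have u: "1 \<le> u" using \<epsilon> by (simp add: u_def)
  have lg: "1 \<le> log1 u" using u by (simp add: log1_def)
  have L1: "1 \<le> L"
  proof (rule ccontr)
    assume "\<not> 1 \<le> L"
    then have "L = 0" by simp
    then have "8 / \<epsilon> \<le> 1" using L(1) by simp
    then show False using \<epsilon> by (simp add: divide_le_eq)
  qed
  have "ln (2 * (8 / \<epsilon>)) = ln 16 + ln u" using u \<epsilon> by (simp add: u_def ln_mult ln_div)
  also have "ln (16::real) = 4 * ln 2" using ln_realpow[of 2 4] by simp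
  finally have "real L \<le> 2 * (4 * ln 2 + ln u)" using L(3) by simp
  also have "\<dots> \<le> 2 * (4 * 1 + 4 * ln u)"
    using ln_two_bounds(2) u by (intro mult_left_mono add_mono) auto
  finally have Lb: "real L \<le> 8 * log1 u" by (simp add: log1_def)
  define E where "E = u powr e"
  have "u powr 1 \<le> E" unfolding E_def using u e by (intro powr_mono) auto
  then have E: "u \<le> E" "1 \<le> E" using u by auto
  define X where "X = sample_scale d \<epsilon> L e"
  have X: "1 \<le> X"
  proof -
    have "1 * 1 * 1 * 1 \<le> 10 ^ 6 * real L ^ 3 * 16 ^ d * E"
      using L1 E by (intro mult_mono one_le_power) auto
    then show ?thesis by (simp add: X_def sample_scale_def E_def u_def)
  qed
  define m where "m = nat \<lceil>X\<rceil>"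
  have m: "X \<le> m" "m \<le> 2 * X" "0 < m" using X by (auto simp: m_def) linarith+
  define k where "k = nat \<lceil>40 * u\<rceil>"
  have k: "40 * u \<le> k" "k \<le> 41 * u" using u unfolding k_def by linarith+
  have "real m \<le> 2 * (10 ^ 6 * (8 * log1 u) ^ 3 * 16 ^ d * E)"
  proof -
    have "X \<le> 10 ^ 6 * (8 * log1 u) ^ 3 * 16 ^ d * E"
      unfolding X_def sample_scale_def E_def[symmetric] u_def[symmetric]
      using Lb E by (intro mult_right_mono mult_left_mono power_mono) auto
    then show ?thesis using m(2) by linarith
  qed
  also have "\<dots> = (2 * 10 ^ 6 * 512) * (16 ^ d * (E * log1 u ^ 3))" by (simp add: power_mult_distrib)
  also have "\<dots> \<le> 2 ^ 30 * (16 ^ d * (E * log1 u ^ 3))"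
    using E lg by (intro mult_right_mono) auto
  finally have mb: "real m \<le> 2 ^ 30 * (16 ^ d * (E * log1 u ^ 3))" .
  have "1 * u * 1 \<le> 16 ^ d * E * log1 u ^ 3" using u E lg by (intro mult_mono one_le_power) auto
  then have kb: "real k \<le> 41 * (16 ^ d * (E * log1 u ^ 3))" using k(2) by (simp add: mult.assoc)
  show ?thesis
    by (rule that[of L k m]) (use L L1 k m mb kb in \<open>simp_all add: X_def E_def u_def\<close>)
qed

text \<open>Since d \<ge> 1, absolute constants are absorbed into a power 2^O(d).\<close>

lemma const_le_powr: "(2::real) ^ j * 2 ^ (i * d) \<le> 2 powr ((j + i) * real d)" if "1 \<le> d"
proof -
  have "(2::real) ^ j * 2 ^ (i * d) \<le> 2 ^ (j * d) * 2 ^ (i * d)"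
    using that by (intro mult_right_mono power_increasing) auto
  also have "\<dots> = 2 ^ ((j + i) * d)" by (simp add: distrib_right power_add)
  finally show ?thesis by (simp add: powr_realpow[symmetric])
qed

lemma equiv_queries:
  fixes d :: nat and \<epsilon> \<delta> :: real
  assumes d: "1 \<le> d" and \<epsilon>: "0 < \<epsilon>" "\<epsilon> < 1" and \<delta>: "0 < \<delta>" "\<delta> \<le> 1 / 2" and k: "real k \<le> 41 / \<epsilon>"
  obtains n where "bisect_width n \<le> \<delta>\<^sup>2 / real (24 * d)"
    "real (2 * k * probe_cost False n d) \<le> 12000 * (1 / \<epsilon> * real d ^ 3 * (ln (real d / \<delta>))\<^sup>2 * log1 (real d / \<epsilon>))"
proof -
  have d1: "1 \<le> real d" using d by simp
  have \<delta>2: "\<delta>\<^sup>2 \<le> 1" using \<delta> by (simp add: power_le_one)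
  \<comment> \<open>Twice 24 d/\<delta>^2, because bisection starts from width 2.\<close>
  define x where "x = 48 * real d / \<delta>\<^sup>2"
  have "1 \<le> x" using d1 \<delta> \<delta>2 by (simp add: x_def le_divide_eq)
  then obtain n where n: "x \<le> 2 ^ n" "2 ^ n \<le> 2 * x" "real n \<le> 2 * ln (2 * x)" using power_of_two_between by blast
  define \<Lambda> where "\<Lambda> = ln (real d / \<delta>)"
  have "2 \<le> real d / \<delta>" using d1 \<delta> by (simp add: le_divide_eq)
  \<comment> \<open>As \<delta> \<le> 1/2, the logarithm is bounded away from 0, so additive
    constants can be absorbed into it.\<close>
  then have "ln 2 \<le> \<Lambda>" unfolding \<Lambda>_def by (intro ln_mono) auto
  then have \<Lambda>: "1 / 2 \<le> \<Lambda>" using ln_two_bounds by linarith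
  have w: "bisect_width n \<le> \<delta>\<^sup>2 / real (24 * d)"
  proof -
    have "2 / 2 ^ n \<le> 2 / x" using n(1) \<open>1 \<le> x\<close> by (intro divide_left_mono) auto
    then show ?thesis using d1 by (simp add: bisect_width_def x_def)
  qed
  have "ln (2 * x) \<le> ln (128 * (real d / \<delta>)\<^sup>2)"
  proof (rule ln_mono)
    have "96 * real d \<le> 128 * (real d)\<^sup>2" using d1 by (simp add: power2_eq_square mult_mono)
    then show "2 * x \<le> 128 * (real d / \<delta>)\<^sup>2" using \<delta> by (simp add: x_def power_divide divide_right_mono)
    show "0 < 2 * x" using \<open>1 \<le> x\<close> by simp
  qed
  also have "\<dots> = ln 128 + 2 * \<Lambda>" using d1 \<delta> by (simp add: ln_mult ln_realpow \<Lambda>_def)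
  also have "ln (128::real) = 7 * ln 2" using ln_realpow[of 2 7] by simp
  finally have "real n \<le> 14 + 4 * \<Lambda>" using n(3) ln_two_bounds(2) by linarith
  then have nb: "real n \<le> 32 * \<Lambda>" using \<Lambda> by linarith
  have \<Lambda>2: "\<Lambda> \<le> 2 * \<Lambda>\<^sup>2" "1 \<le> 4 * \<Lambda>\<^sup>2"
  proof -
    have "1 / 2 * \<Lambda> \<le> \<Lambda> * \<Lambda>" using \<Lambda> by (intro mult_right_mono) auto
    then show "\<Lambda> \<le> 2 * \<Lambda>\<^sup>2" by (simp add: power2_eq_square)
    then show "1 \<le> 4 * \<Lambda>\<^sup>2" using \<Lambda> by linarith
  qed
  have dd: "real d \<le> real d ^ 3" "(real d)\<^sup>2 \<le> real d ^ 3"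
    using d1 power_increasing[of 1 3 "real d"] power_increasing[of 2 3 "real d"] by auto
  have "real (probe_cost False n d) = 2 * (real d * real n) + 4 * (real d)\<^sup>2" by (simp add: probe_cost_def)
  also have "\<dots> \<le> 2 * (real d ^ 3 * (64 * \<Lambda>\<^sup>2)) + 4 * (real d ^ 3 * (4 * \<Lambda>\<^sup>2))"
  proof (intro add_mono mult_left_mono)
    show "real d * real n \<le> real d ^ 3 * (64 * \<Lambda>\<^sup>2)"
      using dd nb \<Lambda>2 by (intro mult_mono) auto
    have "(real d)\<^sup>2 * 1 \<le> real d ^ 3 * (4 * \<Lambda>\<^sup>2)" using dd \<Lambda>2 by (intro mult_mono) auto
    then show "(real d)\<^sup>2 \<le> real d ^ 3 * (4 * \<Lambda>\<^sup>2)" by simp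
  qed auto
  finally have cost: "real (probe_cost False n d) \<le> 144 * (real d ^ 3 * \<Lambda>\<^sup>2)" by (simp add: mult.commute)
  have "1 \<le> real d / \<epsilon>" using d1 \<epsilon> by (simp add: le_divide_eq)
  then have lg: "1 \<le> log1 (real d / \<epsilon>)" by (simp add: log1_def)
  have "real (2 * k * probe_cost False n d) = 2 * real k * real (probe_cost False n d)" by simp
  also have "\<dots> \<le> 2 * (41 / \<epsilon>) * (144 * (real d ^ 3 * \<Lambda>\<^sup>2))"
    using k cost \<epsilon> by (intro mult_mono) auto
  also have "\<dots> = 11808 * (1 / \<epsilon> * real d ^ 3 * \<Lambda>\<^sup>2 * 1)" by simp
  also have "\<dots> \<le> 12000 * (1 / \<epsilon> * real d ^ 3 * \<Lambda>\<^sup>2 * log1 (real d / \<epsilon>))"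
    using \<epsilon> lg by (intro mult_mono mult_left_mono) auto
  finally show ?thesis using w that by (simp add: \<Lambda>_def)
qed

text \<open>The spreading error has to be at most 1/m, so ln m enters the number of bisection steps.
  It is at most of order d (1 + ln (1/\<epsilon>)); the powers of d go into 4^d, and one factor
  \<open>log1 (1 / \<epsilon>)\<close> is paid besides the logarithms of 1/\<delta>.\<close>

lemma unif_queries:
  fixes d m :: nat and \<epsilon> \<delta> F :: real
  assumes d: "1 \<le> d" and \<epsilon>: "0 < \<epsilon>" "\<epsilon> < 1" and \<delta>: "0 < \<delta>" "\<delta> \<le> 1 / 2" and m: "0 < m"
    and mb: "real m \<le> 2 ^ 30 * (16 ^ d * ((1 / \<epsilon>) powr (max 2 (real d / 2)) * log1 (1 / \<epsilon>) ^ 3))"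
  obtains n where "bisect_width n \<le> \<delta>\<^sup>2 / real (24 * d)" "36 * bisect_width n * (real d)\<^sup>2 / \<delta>\<^sup>2 \<le> 1 / m"
    "real (probe_cost True n d) \<le> 2 ^ 11 * 4 ^ d * (log1 (1 / \<epsilon>) * (ln (1 / \<delta>))\<^sup>2)"
proof -
  have d1: "1 \<le> real d" using d by simp
  have m1: "1 \<le> real m" using m by simp
  have \<delta>2: "\<delta>\<^sup>2 \<le> 1" "0 < \<delta>\<^sup>2" using \<delta> by (auto simp: power_le_one)
  have dm: "1 \<le> (real d)\<^sup>2 * m" using d1 m1 mult_mono[of 1 "(real d)\<^sup>2" 1 "real m"] by simp
  \<comment> \<open>Twice the reciprocal of the width at which the spreading error equals 1/m; this
    width is finer than the precision that the diameter needs.\<close>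
  define x where "x = 72 * ((real d)\<^sup>2 * m) / \<delta>\<^sup>2"
  have x1: "1 \<le> x" using dm \<delta>2 by (simp add: x_def le_divide_eq)
  then obtain n where n: "x \<le> 2 ^ n" "2 ^ n \<le> 2 * x" "real n \<le> 2 * ln (2 * x)" using power_of_two_between by blast
  have "2 / 2 ^ n \<le> 2 / x" using n(1) x1 by (intro divide_left_mono) auto
  then have w: "bisect_width n \<le> \<delta>\<^sup>2 / (36 * ((real d)\<^sup>2 * m))" by (simp add: bisect_width_def x_def mult.commute[of _ "real m"])
  also have "\<dots> \<le> \<delta>\<^sup>2 / real (24 * d)"
  proof (rule divide_left_mono)
    have "24 * (real d * 1) \<le> 36 * ((real d)\<^sup>2 * m)"
      using d1 m1 by (intro mult_mono) (auto simp: power2_eq_square)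
    then show "real (24 * d) \<le> 36 * ((real d)\<^sup>2 * m)" by simp
    show "0 < 36 * ((real d)\<^sup>2 * m) * real (24 * d)" using d m by simp
  qed simp
  finally have w1: "bisect_width n \<le> \<delta>\<^sup>2 / real (24 * d)" .
  have "36 * bisect_width n * (real d)\<^sup>2 / \<delta>\<^sup>2 \<le> 36 * (\<delta>\<^sup>2 / (36 * ((real d)\<^sup>2 * m))) * (real d)\<^sup>2 / \<delta>\<^sup>2"
    using w \<delta>2 by (intro divide_right_mono mult_right_mono mult_left_mono) auto
  also have "\<dots> = 1 / m" using \<delta>2 d1 m1 by (simp add: divide_simps)
  finally have w2: "36 * bisect_width n * (real d)\<^sup>2 / \<delta>\<^sup>2 \<le> 1 / m" .
  define u g lam where "u = 1 / \<epsilon>" and "g = log1 u" and "lam = ln (1 / \<delta>)"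
  have u: "1 \<le> u" using \<epsilon> by (simp add: u_def)
  have lu: "0 \<le> ln u" using u by simp
  have g: "1 \<le> g" "ln u \<le> g" using lu by (auto simp: g_def log1_def)
  have "ln 2 \<le> lam" unfolding lam_def using \<delta> by (intro ln_mono) (auto simp: le_divide_eq)
  then have lam: "1 / 2 \<le> lam" using ln_two_bounds by linarith
  have ln16: "ln (16::real) \<le> 4" using ln_realpow[of 2 4] ln_two_bounds by simp
  have lnm: "ln (real m) \<le> 40 * (real d * g)"
  proof -
    have "ln (real m) \<le> ln (2 ^ 30 * (16 ^ d * (u powr (max 2 (real d / 2)) * g ^ 3)))"
      using mb m unfolding u_def g_def by (intro ln_mono) simp_all
    also have "\<dots> = 30 * ln 2 + (d * ln 16 + (max 2 (real d / 2) * ln u + 3 * ln g))"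
      using u g ln_realpow[of 2 30] by (simp add: ln_mult ln_realpow ln_powr del: power_numeral)
    also have "\<dots> \<le> 30 * 1 + (d * 4 + ((1 + d) * g + 3 * g))"
    proof (intro add_mono mult_left_mono mult_mono)
      show "ln g \<le> g" using ln_le_minus_one[of g] g by linarith
    qed (use d1 lu g ln16 ln_two_bounds in auto)
    also have "\<dots> \<le> 30 * (real d * g) + (4 * (real d * g) + (2 * (real d * g) + 3 * (real d * g)))"
    proof -
      have "1 \<le> real d * g" "real d \<le> real d * g" "g \<le> real d * g"
        using d1 g mult_mono[of 1 "real d" 1 g] by auto
      then show ?thesis by (simp add: algebra_simps)
    qed
    finally have "ln (real m) \<le> 39 * (real d * g)" by (simp add: mult_ac)
    moreover have "0 \<le> real d * g" using g by simp
    ultimately show ?thesis by linarith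
  qed
  have "2 * x = 144 * ((real d)\<^sup>2 * m) * (1 / \<delta>)\<^sup>2" by (simp add: x_def power_divide)
  also have "ln \<dots> = ln 144 + (2 * ln d + ln m) + 2 * lam"
    using d1 m1 \<delta> by (simp add: ln_mult ln_realpow lam_def)
  also have "\<dots> \<le> 8 * (real d * g) + (2 * (real d * g) + 40 * (real d * g)) + 2 * (lam * (real d * g))"
  proof (intro add_mono mult_left_mono lnm)
    have dg: "1 \<le> real d * g" "real d \<le> real d * g" using d1 g mult_mono[of 1 "real d" 1 g] by auto
    have "ln (144::real) \<le> ln 256" by (intro ln_mono) auto
    also have "\<dots> = 8 * ln 2" using ln_realpow[of 2 8] by simp
    finally show "ln 144 \<le> 8 * (real d * g)" using ln_two_bounds dg by linarith
    show "ln (real d) \<le> real d * g" using ln_le_minus_one[of "real d"] d1 dg by linarith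
    show "lam \<le> lam * (real d * g)" using dg lam by simp
  qed auto
  also have "\<dots> = (50 + 2 * lam) * (real d * g)" by (simp add: algebra_simps)
  also have "\<dots> \<le> (102 * lam) * (real d * g)" using lam d1 g by (intro mult_right_mono) auto
  finally have nb: "real n \<le> 204 * (lam * (real d * g))" using n(3) by simp
  have lam2: "lam \<le> 2 * lam\<^sup>2" "1 \<le> 4 * lam\<^sup>2"
  proof -
    have "1 / 2 * lam \<le> lam * lam" using lam by (intro mult_right_mono) auto
    then show "lam \<le> 2 * lam\<^sup>2" by (simp add: power2_eq_square)
    then show "1 \<le> 4 * lam\<^sup>2" using lam by linarith
  qed
  have d2: "(real d)\<^sup>2 \<le> 4 ^ d"
  proof -
    have "real d \<le> 2 ^ d" by (simp add: less_imp_le)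
    then have "(real d)\<^sup>2 \<le> (2 ^ d)\<^sup>2" by (intro power_mono) auto
    then show ?thesis by (simp add: power_mult[symmetric] mult.commute[of d]) (simp add: power_mult)
  qed
  define W where "W = g * lam\<^sup>2"
  have W: "1 \<le> 4 * W" using mult_mono[of 1 g 1 "4 * lam\<^sup>2"] lam2 g by (simp add: W_def mult_ac)
  have "real (probe_cost True n d) = 2 * (real d * real n) + 4 * (real d)\<^sup>2 + 2 ^ d" by (simp add: probe_cost_def)
  also have "\<dots> \<le> 2 * (408 * (4 ^ d * W)) + 4 * (4 ^ d * (4 * W)) + 4 ^ d * (4 * W)"
  proof (intro add_mono mult_left_mono)
    have "real d * real n \<le> real d * (204 * (lam * (real d * g)))" using nb by (intro mult_left_mono) auto
    also have "\<dots> = 204 * ((real d)\<^sup>2 * (lam * g))" by (simp add: power2_eq_square)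
    also have "\<dots> \<le> 204 * (4 ^ d * (2 * lam\<^sup>2 * g))"
      using d2 lam2 lam g by (intro mult_mono) auto
    finally show "real d * real n \<le> 408 * (4 ^ d * W)" by (simp add: W_def mult_ac)
    have "(real d)\<^sup>2 * 1 \<le> 4 ^ d * (4 * W)" using d2 W by (intro mult_mono) auto
    then show "(real d)\<^sup>2 \<le> 4 ^ d * (4 * W)" by simp
    have "(2::real) ^ d * 1 \<le> 4 ^ d * (4 * W)" using W by (intro mult_mono power_mono) auto
    then show "(2::real) ^ d \<le> 4 ^ d * (4 * W)" by simp
  qed auto
  also have "\<dots> = 836 * (4 ^ d * W)" by simp
  also have "\<dots> \<le> 2 ^ 11 * (4 ^ d * W)" using W by (intro mult_right_mono) auto
  finally show ?thesis using that[OF w1 w2] by (simp add: W_def g_def u_def lam_def mult_ac)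
qed

lemma uniformity_parameters:
  fixes d :: nat and \<epsilon> \<delta> :: real
  assumes d: "1 \<le> d" and \<epsilon>: "0 < \<epsilon>" "\<epsilon> < 1" and \<delta>: "0 < \<delta>" "\<delta> \<le> 1 / 2"
  obtains L k m n :: nat where "1 \<le> L" "8 / \<epsilon> \<le> 2 ^ L" "40 / \<epsilon> \<le> k" "k \<le> 41 / \<epsilon>" "0 < m"
    "bisect_width n \<le> \<delta>\<^sup>2 / real (24 * d)" "36 * bisect_width n * (real d)\<^sup>2 / \<delta>\<^sup>2 \<le> 1 / m"
    "\<And>l. l \<le> L \<Longrightarrow> 20000 * real L \<le> (real m)\<^sup>2 * unif_eta d \<epsilon> L l"
    "\<And>l. l \<le> L \<Longrightarrow> 30000 * real L \<le> 2 ^ (l * d) * (real m)\<^sup>2 * (unif_eta d \<epsilon> L l)\<^sup>2"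
    "real (k + 2 * m) \<le> 2 powr (49 * real d) * ((1 / \<epsilon>) powr (max 2 (real d / 2)) * log1 (1 / \<epsilon>) ^ 4)"
    "real ((k + 2 * m) * probe_cost True n d) \<le>
       2 powr (49 * real d) * ((1 / \<epsilon>) powr (max 2 (real d / 2)) * (ln (1 / \<delta>))\<^sup>2 * log1 (1 / \<epsilon>) ^ 4)"
proof -
  define E g where "E = (1 / \<epsilon>) powr (max 2 (real d / 2))" and "g = log1 (1 / \<epsilon>)"
  have E: "0 \<le> E" by (simp add: E_def)
  have g: "1 \<le> g" using \<epsilon> by (simp add: g_def log1_def)
  obtain L k m :: nat where P: "1 \<le> L" "8 / \<epsilon> \<le> 2 ^ L" "2 ^ L \<le> 16 / \<epsilon>" "40 / \<epsilon> \<le> k" "k \<le> 41 / \<epsilon>"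
    "0 < m" "sample_scale d \<epsilon> L (max 2 (real d / 2)) \<le> m"
    and mb: "real m \<le> 2 ^ 30 * (16 ^ d * (E * g ^ 3))" and kb: "real k \<le> 41 * (16 ^ d * (E * g ^ 3))"
    using parameters[OF \<epsilon>, of "max 2 (real d / 2)" d] unfolding E_def g_def by auto
  obtain n where n: "bisect_width n \<le> \<delta>\<^sup>2 / real (24 * d)" "36 * bisect_width n * (real d)\<^sup>2 / \<delta>\<^sup>2 \<le> 1 / m"
    and cost: "real (probe_cost True n d) \<le> 2 ^ 11 * 4 ^ d * (g * (ln (1 / \<delta>))\<^sup>2)"
    using unif_queries[OF d \<epsilon> \<delta> P(6)] mb unfolding E_def g_def by blast
  \<comment> \<open>2^43 collects 2^32 for the samples and 2^11 for the cost of a probe, and 64 = 16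
    * 4 the corresponding exponentials in d; 43 + 6 = 49.\<close>
  have C: "2 ^ 43 * 64 ^ d \<le> 2 powr (49 * real d)" using const_le_powr[OF d, of 43 6] by (simp add: power_mult)
  have km: "real (k + 2 * m) \<le> 2 ^ 32 * (16 ^ d * (E * g ^ 3))" using mb kb E g by simp
  also have "\<dots> \<le> 2 ^ 43 * (64 ^ d * (E * g ^ 4))"
    using E g by (intro mult_mono power_mono power_increasing) auto
  also have "\<dots> = 2 ^ 43 * 64 ^ d * (E * g ^ 4)" by (simp only: mult.assoc)
  also have "\<dots> \<le> 2 powr (49 * real d) * (E * g ^ 4)" using C E g by (intro mult_right_mono) auto
  finally have mfin: "real (k + 2 * m) \<le> 2 powr (49 * real d) * (E * g ^ 4)" .
  have "real ((k + 2 * m) * probe_cost True n d) \<le>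
      (2 ^ 32 * (16 ^ d * (E * g ^ 3))) * (2 ^ 11 * 4 ^ d * (g * (ln (1 / \<delta>))\<^sup>2))"
    unfolding of_nat_mult using km cost E g by (intro mult_mono) auto
  also have "\<dots> = (2 ^ 32 * 2 ^ 11) * (16 ^ d * 4 ^ d) * (E * (ln (1 / \<delta>))\<^sup>2 * (g ^ 3 * g))"
    by (simp only: mult_ac)
  also have "\<dots> = 2 ^ 43 * 64 ^ d * (E * (ln (1 / \<delta>))\<^sup>2 * g ^ 4)"
    by (simp add: power_mult_distrib[symmetric] flip: power_Suc2)
  also have "\<dots> \<le> 2 powr (49 * real d) * (E * (ln (1 / \<delta>))\<^sup>2 * g ^ 4)"
    using C E g by (intro mult_right_mono) auto
  finally have qfin: "real ((k + 2 * m) * probe_cost True n d) \<le> 2 powr (49 * real d) * (E * (ln (1 / \<delta>))\<^sup>2 * g ^ 4)" .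
  show ?thesis
    using that[OF P(1,2,4,5,6) n unif_conditions[OF \<epsilon> P(1,3) _ order_refl P(7)]] mfin qfin
    unfolding E_def g_def by blast
qed

lemma equivalence_parameters:
  fixes d :: nat and \<epsilon> \<delta> :: real
  assumes d: "1 \<le> d" and \<epsilon>: "0 < \<epsilon>" "\<epsilon> < 1" and \<delta>: "0 < \<delta>" "\<delta> \<le> 1 / 2"
  obtains L k m n :: nat where "1 \<le> L" "8 / \<epsilon> \<le> 2 ^ L" "40 / \<epsilon> \<le> k" "k \<le> 41 / \<epsilon>" "0 < m"
    "bisect_width n \<le> \<delta>\<^sup>2 / (24 * real d)"
    "\<And>l. l \<le> L \<Longrightarrow> 10 ^ 7 * (real L)\<^sup>2 \<le> flat_rate d m l * real m ^ 3 * (equiv_eta d \<epsilon> L l)\<^sup>2"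
    "real (k * 2 + m * 6) \<le> 2 powr (12000 * real d) * ((1 / \<epsilon>) powr (max 2 (2 * real d / 3)) * log1 (1 / \<epsilon>) ^ 3)"
    "real (2 * k * probe_cost False n d) \<le> 12000 * (1 / \<epsilon> * real d ^ 3 * (ln (real d / \<delta>))\<^sup>2 * log1 (real d / \<epsilon>))"
proof -
  define E g where "E = (1 / \<epsilon>) powr (max 2 (2 * real d / 3))" and "g = log1 (1 / \<epsilon>)"
  have E: "0 \<le> E" by (simp add: E_def)
  have g: "1 \<le> g" using \<epsilon> by (simp add: g_def log1_def)
  obtain L k m :: nat where P: "1 \<le> L" "8 / \<epsilon> \<le> 2 ^ L" "2 ^ L \<le> 16 / \<epsilon>" "40 / \<epsilon> \<le> k" "k \<le> 41 / \<epsilon>"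
    "0 < m" "sample_scale d \<epsilon> L (max 2 (2 * real d / 3)) \<le> m"
    and mb: "real m \<le> 2 ^ 30 * (16 ^ d * (E * g ^ 3))" and kb: "real k \<le> 41 * (16 ^ d * (E * g ^ 3))"
    using parameters[OF \<epsilon>, of "max 2 (2 * real d / 3)" d] unfolding E_def g_def by auto
  obtain n where n: "bisect_width n \<le> \<delta>\<^sup>2 / real (24 * d)"
    "real (2 * k * probe_cost False n d) \<le> 12000 * (1 / \<epsilon> * real d ^ 3 * (ln (real d / \<delta>))\<^sup>2 * log1 (real d / \<epsilon>))"
    using equiv_queries[OF d \<epsilon> \<delta> P(5)] by blast
  have n': "bisect_width n \<le> \<delta>\<^sup>2 / (24 * real d)" using n(1) by simp
  have "2 ^ 33 * 16 ^ d \<le> 2 powr (37 * real d)" using const_le_powr[OF d, of 33 4] by (simp add: power_mult)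
  \<comment> \<open>Both bounds for equivalence share one constant, and the query bound already uses
    12000 as a factor.\<close>
  also have "\<dots> \<le> 2 powr (12000 * real d)" by simp
  finally have C: "2 ^ 33 * 16 ^ d \<le> 2 powr (12000 * real d)" .
  have "real (k * 2 + m * 6) \<le> 2 ^ 33 * (16 ^ d * (E * g ^ 3))" using mb kb E g by simp
  also have "\<dots> = 2 ^ 33 * 16 ^ d * (E * g ^ 3)" by (simp only: mult.assoc)
  also have "\<dots> \<le> 2 powr (12000 * real d) * (E * g ^ 3)" using C E g by (intro mult_right_mono) auto
  finally have mfin: "real (k * 2 + m * 6) \<le> 2 powr (12000 * real d) * (E * g ^ 3)" .
  show ?thesis
    using that[OF P(1,2,4,5,6) n' equiv_condition[OF \<epsilon> P(1,3) _ order_refl P(7,6)] mfin[unfolded E_def g_def] n(2)] .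
qed

text \<open>For \<delta> > 1/2 there is no clustering to test. The case is separated because ln
  (1/\<delta>) tends to 0 as \<delta> tends to 1, so the query bound for uniformity can drop below
  1.\<close>

lemma vacuous_testers:
  assumes "1 \<le> d" "1 / 2 < \<delta>"
  shows "uniformity_tester d p \<epsilon> (CV d \<delta>) G \<Delta> T" "equivalence_tester d p \<epsilon> (CV d \<delta>) G \<Delta> T'"
proof -
  have "CV d \<delta> = {}" using assms CV_empty[of _ d \<delta>] by fastforce
  then show "uniformity_tester d p \<epsilon> (CV d \<delta>) G \<Delta> T" "equivalence_tester d p \<epsilon> (CV d \<delta>) G \<Delta> T'"
    by (simp_all add: uniformity_tester_def equivalence_tester_def)
qed

theorem theorem3p26:
  shows
    "(\<exists>(C::real) (a::nat). \<forall>(d::nat) (p::real) (\<epsilon>::real) (\<delta>::real).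
        1 \<le> d \<longrightarrow> 1 \<le> p \<longrightarrow> 0 < \<epsilon> \<longrightarrow> \<epsilon> < 1 \<longrightarrow> 0 < \<delta> \<longrightarrow> \<delta> < 1 \<longrightarrow>
        (\<exists>(m::nat) (q::nat) (T::unit algorithm).
           real m \<le> 2 powr (C * real d) *
             ((1 / \<epsilon>) powr (max 2 (real d / 2)) * log1 (1 / \<epsilon>) ^ a) \<and>
           real q \<le> 2 powr (C * real d) *
             ((1 / \<epsilon>) powr (max 2 (real d / 2)) * (ln (1 / \<delta>))\<^sup>2 * log1 (1 / \<epsilon>) ^ a) \<and>
           (\<forall>\<omega>. uses_at_most d m q (T \<omega>)) \<and>
           uniformity_tester d p \<epsilon> (CV d \<delta>) (Boxes d \<delta>) (\<epsilon> / 16) T))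
     \<and>
     (\<exists>(C::real) (a::nat). \<forall>(d::nat) (p::real) (\<epsilon>::real) (\<delta>::real).
        1 \<le> d \<longrightarrow> 1 \<le> p \<longrightarrow> 0 < \<epsilon> \<longrightarrow> \<epsilon> < 1 \<longrightarrow> 0 < \<delta> \<longrightarrow> \<delta> < 1 \<longrightarrow>
        (\<exists>(m::nat) (q::nat) (T::bool algorithm).
           real m \<le> 2 powr (C * real d) *
             ((1 / \<epsilon>) powr (max 2 (2 * real d / 3)) * log1 (1 / \<epsilon>) ^ a) \<and>
           real q \<le> C * (1 / \<epsilon> * real d ^ 3 * (ln (real d / \<delta>))\<^sup>2 * log1 (real d / \<epsilon>)) \<and>
           (\<forall>\<omega>. uses_at_most d m q (T \<omega>)) \<and>
           equivalence_tester d p \<epsilon> (CV d \<delta>) (Boxes d \<delta>) (\<epsilon> / 16) T))"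
proof (rule conjI)
  show "\<exists>(C::real) (a::nat). \<forall>(d::nat) (p::real) (\<epsilon>::real) (\<delta>::real).
        1 \<le> d \<longrightarrow> 1 \<le> p \<longrightarrow> 0 < \<epsilon> \<longrightarrow> \<epsilon> < 1 \<longrightarrow> 0 < \<delta> \<longrightarrow> \<delta> < 1 \<longrightarrow>
        (\<exists>(m::nat) (q::nat) (T::unit algorithm).
           real m \<le> 2 powr (C * real d) *
             ((1 / \<epsilon>) powr (max 2 (real d / 2)) * log1 (1 / \<epsilon>) ^ a) \<and>
           real q \<le> 2 powr (C * real d) *
             ((1 / \<epsilon>) powr (max 2 (real d / 2)) * (ln (1 / \<delta>))\<^sup>2 * log1 (1 / \<epsilon>) ^ a) \<and>
           (\<forall>\<omega>. uses_at_most d m q (T \<omega>)) \<and>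
           uniformity_tester d p \<epsilon> (CV d \<delta>) (Boxes d \<delta>) (\<epsilon> / 16) T)"
  proof (rule exI[of _ 49], rule exI[of _ 4], intro allI impI)
    fix d :: nat and p \<epsilon> \<delta> :: real
    assume A: "1 \<le> d" "1 \<le> p" "0 < \<epsilon>" "\<epsilon> < 1" "0 < \<delta>" "\<delta> < 1"
    show "\<exists>m q (T::unit algorithm).
       real m \<le> 2 powr (49 * real d) * ((1 / \<epsilon>) powr (max 2 (real d / 2)) * log1 (1 / \<epsilon>) ^ 4) \<and>
       real q \<le> 2 powr (49 * real d) * ((1 / \<epsilon>) powr (max 2 (real d / 2)) * (ln (1 / \<delta>))\<^sup>2 * log1 (1 / \<epsilon>) ^ 4) \<and>
       (\<forall>\<omega>. uses_at_most d m q (T \<omega>)) \<and> uniformity_tester d p \<epsilon> (CV d \<delta>) (Boxes d \<delta>) (\<epsilon> / 16) T"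
    proof (cases "\<delta> \<le> 1 / 2")
      case True
      obtain L k m n :: nat where L: "1 \<le> L" "8 / \<epsilon> \<le> 2 ^ L" and k: "40 / \<epsilon> \<le> k" "k \<le> 41 / \<epsilon>" and m: "0 < m"
        and n: "bisect_width n \<le> \<delta>\<^sup>2 / real (24 * d)" "36 * bisect_width n * (real d)\<^sup>2 / \<delta>\<^sup>2 \<le> 1 / m"
        and cond: "\<And>l. l \<le> L \<Longrightarrow> 20000 * real L \<le> (real m)\<^sup>2 * unif_eta d \<epsilon> L l"
          "\<And>l. l \<le> L \<Longrightarrow> 30000 * real L \<le> 2 ^ (l * d) * (real m)\<^sup>2 * (unif_eta d \<epsilon> L l)\<^sup>2"
        and bounds:
          "real (k + 2 * m) \<le> 2 powr (49 * real d) * ((1 / \<epsilon>) powr (max 2 (real d / 2)) * log1 (1 / \<epsilon>) ^ 4)"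
          "real ((k + 2 * m) * probe_cost True n d) \<le>
            2 powr (49 * real d) * ((1 / \<epsilon>) powr (max 2 (real d / 2)) * (ln (1 / \<delta>))\<^sup>2 * log1 (1 / \<epsilon>) ^ 4)"
        using uniformity_parameters[OF A(1,3,4,5) True] by blast
      have "uniformity_tester d p \<epsilon> (CV d \<delta>) (Boxes d \<delta>) (\<epsilon> / 16) (\<lambda>_. unif_tree d p \<epsilon> n L k m)"
        by (rule unif_tree_tester[OF A(1-5) n(1) k L m n(2) cond])
      then show ?thesis
        by - (rule exI, rule exI, rule exI[of _ "\<lambda>_. unif_tree d p \<epsilon> n L k m"],
          intro conjI allI, rule bounds(1), rule bounds(2), rule uses_unif_tree, assumption)
    next
      case False
      then show ?thesis using A
        by (intro exI[of _ 0] exI[of _ "\<lambda>_. Output Accept"])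
          (auto intro: uses_at_most.intros vacuous_testers simp: log1_def)
    qed
  qed
next
  show "\<exists>(C::real) (a::nat). \<forall>(d::nat) (p::real) (\<epsilon>::real) (\<delta>::real).
        1 \<le> d \<longrightarrow> 1 \<le> p \<longrightarrow> 0 < \<epsilon> \<longrightarrow> \<epsilon> < 1 \<longrightarrow> 0 < \<delta> \<longrightarrow> \<delta> < 1 \<longrightarrow>
        (\<exists>(m::nat) (q::nat) (T::bool algorithm).
           real m \<le> 2 powr (C * real d) *
             ((1 / \<epsilon>) powr (max 2 (2 * real d / 3)) * log1 (1 / \<epsilon>) ^ a) \<and>
           real q \<le> C * (1 / \<epsilon> * real d ^ 3 * (ln (real d / \<delta>))\<^sup>2 * log1 (real d / \<epsilon>)) \<and>
           (\<forall>\<omega>. uses_at_most d m q (T \<omega>)) \<and>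
           equivalence_tester d p \<epsilon> (CV d \<delta>) (Boxes d \<delta>) (\<epsilon> / 16) T)"
  proof (rule exI[of _ 12000], rule exI[of _ 3], intro allI impI)
    fix d :: nat and p \<epsilon> \<delta> :: real
    assume A: "1 \<le> d" "1 \<le> p" "0 < \<epsilon>" "\<epsilon> < 1" "0 < \<delta>" "\<delta> < 1"
    show "\<exists>m q (T::bool algorithm).
       real m \<le> 2 powr (12000 * real d) * ((1 / \<epsilon>) powr (max 2 (2 * real d / 3)) * log1 (1 / \<epsilon>) ^ 3) \<and>
       real q \<le> 12000 * (1 / \<epsilon> * real d ^ 3 * (ln (real d / \<delta>))\<^sup>2 * log1 (real d / \<epsilon>)) \<and>
       (\<forall>\<omega>. uses_at_most d m q (T \<omega>)) \<and> equivalence_tester d p \<epsilon> (CV d \<delta>) (Boxes d \<delta>) (\<epsilon> / 16) T"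
    proof (cases "\<delta> \<le> 1 / 2")
      case True
      obtain L k m n :: nat where L: "1 \<le> L" "8 / \<epsilon> \<le> 2 ^ L" and k: "40 / \<epsilon> \<le> k" "k \<le> 41 / \<epsilon>" and m: "0 < m"
        and n: "bisect_width n \<le> \<delta>\<^sup>2 / (24 * real d)"
        and cond: "\<And>l. l \<le> L \<Longrightarrow> 10 ^ 7 * (real L)\<^sup>2 \<le> flat_rate d m l * real m ^ 3 * (equiv_eta d \<epsilon> L l)\<^sup>2"
        and bounds:
          "real (k * 2 + m * 6) \<le> 2 powr (12000 * real d) * ((1 / \<epsilon>) powr (max 2 (2 * real d / 3)) * log1 (1 / \<epsilon>) ^ 3)"
          "real (2 * k * probe_cost False n d) \<le> 12000 * (1 / \<epsilon> * real d ^ 3 * (ln (real d / \<delta>))\<^sup>2 * log1 (real d / \<epsilon>))"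
        using equivalence_parameters[OF A(1,3,4,5) True] by blast
      have "equivalence_tester d p \<epsilon> (CV d \<delta>) (Boxes d \<delta>) (\<epsilon> / 16) (\<lambda>_. equiv_tree d p \<epsilon> n L k m)"
        by (rule equiv_tree_tester[OF A(1-5) n k L m cond])
      then show ?thesis
        by - (rule exI, rule exI, rule exI[of _ "\<lambda>_. equiv_tree d p \<epsilon> n L k m"],
          intro conjI allI, rule bounds(1), rule bounds(2), rule uses_equiv_tree, assumption)
    next
      case False
      have "1 \<le> real d / \<epsilon>" using A by (simp add: le_divide_eq)
      then have "0 \<le> log1 (real d / \<epsilon>)" by (simp add: log1_def)
      with False show ?thesis using A
        by (intro exI[of _ 0] exI[of _ "\<lambda>_. Output Accept"])
          (auto intro: uses_at_most.intros vacuous_testers simp: log1_def)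
    qed
  qed
qed

end
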